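(* Let $(X_n)_{n\in\mathbb{N}}$ be a strictly stationary sequence with extremal index $\theta\in(0,1]$ and let $(u_r)_{r\in\mathbb{N}}$ be a (deterministic) sequence of thresholds such that $r\bar F(u_r)\to\tau\in(0,\infty)$ as $r\to\infty$. Let $(r_n)$ and $(l_n)$ be positive integer sequences such that, as $n\to\infty$, $$l_n=o(r_n),\qquad r_n=o(n),\qquad \sum_{l=l_n}^{n}\rho_{n,l}(u_{r_n})=o(r_n),\qquad \sum_{l=1}^{n}\rho_{n,l}(u_{r_n})=o(r_n^{1/2}).$$ Suppose there exist a positive integer sequence $(s_n)_{n\in\mathbb{N}}$ and a probability distribution $(\pi_j)_{j\in\mathbb{N}}$ on the positive integers such that, as $n\to\infty$, $$l_n=o(s_n),\qquad s_n=o(r_n),\qquad \rho_{n,l_n}(u_{r_n})=o(s_n/n),$$ $$\Pr\{N_{s_n}(u_{r_n})=j\mid M_{s_n}>u_{r_n}\}\to\pi_j\quad\text{for all }j\in\mathbb{N},$$ $$\mathrm{E}[N_{s_n}^2(u_{r_n})\mid M_{s_n}>u_{r_n}]\to\sum_{j=1}^{\infty}j^2\pi_j<\infty.$$ Suppose also that there exists a constant $p>1$ such that $\mathrm{E}[N_{r_n}^{2p}(u_{r_n})]=O(1)$ as $n\to\infty$, and that, with $k_n=\lfloor n/r_n\rfloor$, $$\theta_{r_n}(u_{r_n})-\theta=o\bigl(1/\sqrt{k_n}\bigr),\qquad n\to\infty.$$ Then, as $n\to\infty$, $$\sqrt{k_n}\begin{pmatrix}\hat\theta^{\mathrm{dj}}_{n,r_n}(u_{r_n})-\theta\\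 \hat\theta^{\mathrm{sl}}_{n,r_n}(u_{r_n})-\theta\end{pmatrix}\xrightarrow{d}N(\mathbf 0,\mathbf V)$$ where $\mathbf V=(v_{ij})_{i,j=1}^2$ is symmetric and, writing $\alpha=\tau\theta$, $$v_{11}=\frac{\theta^2}{\alpha^2}(e^{\alpha}-1-\alpha)+\frac{\theta^2c^2}{\alpha},\qquad v_{22}=v_{12}=2\frac{\theta^2}{\alpha^3}\Bigl(e^{\alpha}-1-\alpha-\frac{\alpha^2}{2}\Bigr)+\frac{\theta^2c^2}{\alpha}.$$
   Context: $(X_n)_{n\in\mathbb{N}}$, $\mathbb{N}=\{1,2,\dots\}$, is a strictly stationary sequence of real random variables with marginal distribution function $F$, and $\bar F=1-F$. $\xrightarrow{d}$ denotes convergence in distribution. Extremal index: the sequence has extremal index $\theta\in(0,1]$ if for each $\tau>0$ there exists a sequence of levels $(u_n(\tau))_{n\in\mathbb{N}}$ such that $\lim_{n\to\infty}n\bar F(u_n(\tau))=\tau$ and $\lim_{n\to\infty}\Pr(M_n\le u_n(\tau))=e^{-\theta\tau}$, where $M_n=\max\{X_1,\dots,X_n\}$. For a positive integer $r$ and a threshold $u$: $F_r(u)=\Pr(M_r\le u)$, $\tau_r(u)=r\bar F(u)$, $\theta_r(u)=-\log F_r(u)/\tau_r(u)$, $N_r(u)=\sum_{i=1}^{r}I(X_i>u)$. For integers $0\le s<r$, $M_{s,r}=\max_{s<i\le r}X_i$. For integers $1\le r\le n$, with $k=\lfloor n/r\rfloor$, $$\hat F^{\mathrm{dj}}_{n,r}(u)=\frac1k\sum_{i=1}^{k}I(M_{(i-1)r,ir}\le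 u),\quad \hat F^{\mathrm{sl}}_{n,r}(u)=\frac1{n-r+1}\sum_{i=0}^{n-r}I(M_{i,i+r}\le u),\quad \hat\tau_{n,r}(u)=\frac1k\sum_{i=1}^{rk}I(X_i>u).$$ The disjoint and sliding blocks estimators of the extremal index are $$\hat\theta^{\mathrm{dj}}_{n,r}(u)=-\frac{\log\hat F^{\mathrm{dj}}_{n,r}(u)}{\hat\tau_{n,r}(u)},\qquad \hat\theta^{\mathrm{sl}}_{n,r}(u)=-\frac{\log\hat F^{\mathrm{sl}}_{n,r}(u)}{\hat\tau_{n,r}(u)},$$ with an arbitrary fixed value assigned on the event where the expression is undefined. With $m_p=\sum_{j\ge1}j^p\pi_j$ for $p\in\{1,2\}$, the squared coefficient of variation of $(\pi_j)$ is $c^2=(m_2-m_1^2)/m_1^2$. Maximal correlation coefficients relative to the threshold $u$: $$\rho_{n,l}(u)=\max_{t=1,\dots,n-l}\ \sup\bigl\{|\operatorname{corr}(\xi,\eta)|:\ \xi\in L_2(\mathcal F_{1,t}(u)),\ \eta\in L_2(\mathcal F_{t+l,n}(u))\bigr\},$$ where $\mathcal F_{a,b}(u)$ is the $\sigma$-field generated by the events $\{X_i\le u\}$, $i\in\{a,\dots,b\}$, $L_2(\mathcal F)$ is the space of $\mathcal F$-measurable square-integrable random variables, and $\xi,\eta$ are required to have positive variance. A maximum or supremum over an empty set is $0$ (in particular $\rho_{n,n}(u)=0$). *)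

theory Defs
  imports "HOL-Probability.Probability" "HOL-Library.Landau_Symbols"
begin

text \<open>
  A sequence of random variables \<open>X\<^sub>1, X\<^sub>2, \<dots>\<close> on a probability space \<open>M\<close> is a function
  \<open>X :: nat \<Rightarrow> 'a \<Rightarrow> real\<close> of which only the values at indices \<open>i \<ge> 1\<close> are ever used;
  \<open>X 0\<close> is unconstrained.
\<close>

definition strictly_stationary :: "'a measure \<Rightarrow> (nat \<Rightarrow> 'a \<Rightarrow> real) \<Rightarrow> bool" where
  "strictly_stationary M X \<longleftrightarrow>
     (\<forall>m h. distr M (\<Pi>\<^sub>M i\<in>{1..m}. borel) (\<lambda>\<omega>. \<lambda>i\<in>{1..m}. X (i + h) \<omega>)
          = distr M (\<Pi>\<^sub>M i\<in>{1..m}. borel) (\<lambda>\<omega>. \<lambda>i\<in>{1..m}. X i \<omega>))"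

definition tail :: "'a measure \<Rightarrow> (nat \<Rightarrow> 'a \<Rightarrow> real) \<Rightarrow> real \<Rightarrow> real" where
  "tail M X u = 1 - cdf (distr M borel (X 1)) u"

definition block_max :: "(nat \<Rightarrow> 'a \<Rightarrow> real) \<Rightarrow> nat \<Rightarrow> nat \<Rightarrow> 'a \<Rightarrow> real" where
  "block_max X s r \<omega> = Max ((\<lambda>i. X i \<omega>) ` {s<..r})"

definition cdf_max :: "'a measure \<Rightarrow> (nat \<Rightarrow> 'a \<Rightarrow> real) \<Rightarrow> nat \<Rightarrow> real \<Rightarrow> real" where
  "cdf_max M X r u = \<P>(\<omega> in M. block_max X 0 r \<omega> \<le> u)"

definition has_extremal_index :: "'a measure \<Rightarrow> (nat \<Rightarrow> 'a \<Rightarrow> real) \<Rightarrow> real \<Rightarrow> bool" where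
  "has_extremal_index M X \<theta> \<longleftrightarrow> 0 < \<theta> \<and> \<theta> \<le> 1 \<and>
     (\<forall>\<tau>>0. \<exists>u :: nat \<Rightarrow> real.
        (\<lambda>n. real n * tail M X (u n)) \<longlonglongrightarrow> \<tau> \<and>
        (\<lambda>n. cdf_max M X n (u n)) \<longlonglongrightarrow> exp (- \<theta> * \<tau>))"

definition tau_block :: "'a measure \<Rightarrow> (nat \<Rightarrow> 'a \<Rightarrow> real) \<Rightarrow> nat \<Rightarrow> real \<Rightarrow> real" where
  "tau_block M X r u = real r * tail M X u"

definition theta_block :: "'a measure \<Rightarrow> (nat \<Rightarrow> 'a \<Rightarrow> real) \<Rightarrow> nat \<Rightarrow> real \<Rightarrow> real" where
  "theta_block M X r u = - ln (cdf_max M X r u) / tau_block M X r u"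

definition exceedances :: "(nat \<Rightarrow> 'a \<Rightarrow> real) \<Rightarrow> nat \<Rightarrow> real \<Rightarrow> 'a \<Rightarrow> nat" where
  "exceedances X r u \<omega> = (\<Sum>i=1..r. of_bool (X i \<omega> > u))"

definition cond_expect :: "'a measure \<Rightarrow> ('a \<Rightarrow> real) \<Rightarrow> ('a \<Rightarrow> bool) \<Rightarrow> real" where
  "cond_expect M f A = (\<integral>\<omega>. f \<omega> \<partial>uniform_measure M {\<omega> \<in> space M. A \<omega>})"


definition F_dj :: "(nat \<Rightarrow> 'a \<Rightarrow> real) \<Rightarrow> nat \<Rightarrow> nat \<Rightarrow> real \<Rightarrow> 'a \<Rightarrow> real" where
  "F_dj X n r u \<omega> =
     (\<Sum>i=1..n div r. of_bool (block_max X ((i - 1) * r) (i * r) \<omega> \<le> u)) / real (n div r)"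

definition F_sl :: "(nat \<Rightarrow> 'a \<Rightarrow> real) \<Rightarrow> nat \<Rightarrow> nat \<Rightarrow> real \<Rightarrow> 'a \<Rightarrow> real" where
  "F_sl X n r u \<omega> =
     (\<Sum>i=0..n - r. of_bool (block_max X i (i + r) \<omega> \<le> u)) / real (n - r + 1)"

definition tau_hat :: "(nat \<Rightarrow> 'a \<Rightarrow> real) \<Rightarrow> nat \<Rightarrow> nat \<Rightarrow> real \<Rightarrow> 'a \<Rightarrow> real" where
  "tau_hat X n r u \<omega> =
     (\<Sum>i=1..r * (n div r). of_bool (X i \<omega> > u)) / real (n div r)"

text \<open>
  The expression \<open>- log F / \<tau>\<close> is undefined iff \<open>F = 0\<close> or \<open>\<tau> = 0\<close>; the parameter \<open>d\<close> is the
  arbitrary fixed value that the estimators take in that case.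
\<close>

definition theta_dj :: "real \<Rightarrow> (nat \<Rightarrow> 'a \<Rightarrow> real) \<Rightarrow> nat \<Rightarrow> nat \<Rightarrow> real \<Rightarrow> 'a \<Rightarrow> real" where
  "theta_dj d X n r u \<omega> =
     (if F_dj X n r u \<omega> = 0 \<or> tau_hat X n r u \<omega> = 0 then d
      else - ln (F_dj X n r u \<omega>) / tau_hat X n r u \<omega>)"

definition theta_sl :: "real \<Rightarrow> (nat \<Rightarrow> 'a \<Rightarrow> real) \<Rightarrow> nat \<Rightarrow> nat \<Rightarrow> real \<Rightarrow> 'a \<Rightarrow> real" where
  "theta_sl d X n r u \<omega> =
     (if F_sl X n r u \<omega> = 0 \<or> tau_hat X n r u \<omega> = 0 then d
      else - ln (F_sl X n r u \<omega>) / tau_hat X n r u \<omega>)"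


definition var :: "'a measure \<Rightarrow> ('a \<Rightarrow> real) \<Rightarrow> real" where
  "var M \<xi> = (\<integral>\<omega>. (\<xi> \<omega> - (\<integral>x. \<xi> x \<partial>M))\<^sup>2 \<partial>M)"

definition corr :: "'a measure \<Rightarrow> ('a \<Rightarrow> real) \<Rightarrow> ('a \<Rightarrow> real) \<Rightarrow> real" where
  "corr M \<xi> \<eta> =
     (\<integral>\<omega>. (\<xi> \<omega> - (\<integral>x. \<xi> x \<partial>M)) * (\<eta> \<omega> - (\<integral>x. \<eta> x \<partial>M)) \<partial>M) / sqrt (var M \<xi> * var M \<eta>)"

definition threshold_field ::
    "'a measure \<Rightarrow> (nat \<Rightarrow> 'a \<Rightarrow> real) \<Rightarrow> real \<Rightarrow> nat \<Rightarrow> nat \<Rightarrow> 'a measure" where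
  "threshold_field M X u a b = sigma (space M) ((\<lambda>i. {\<omega> \<in> space M. X i \<omega> \<le> u}) ` {a..b})"

definition L2 :: "'a measure \<Rightarrow> 'a measure \<Rightarrow> ('a \<Rightarrow> real) set" where
  "L2 M G = {\<xi> \<in> borel_measurable G. integrable M (\<lambda>\<omega>. (\<xi> \<omega>)\<^sup>2)}"

text \<open>
  Inserting \<open>0\<close> implements the convention that a maximum or supremum over the empty set is \<open>0\<close>;
  it has no effect on a nonempty set of numbers \<open>\<bar>corr M \<xi> \<eta>\<bar> \<in> {0..1}\<close>. For \<open>l \<ge> n\<close> the
  truncated difference \<open>n - l\<close> is \<open>0\<close> and the range of \<open>t\<close> is empty.
\<close>

definition max_corr ::
    "'a measure \<Rightarrow> (nat \<Rightarrow> 'a \<Rightarrow> real) \<Rightarrow> nat \<Rightarrow> nat \<Rightarrow> real \<Rightarrow> real" where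
  "max_corr M X n l u =
     Max (insert 0 ((\<lambda>t. Sup (insert 0
       {\<bar>corr M \<xi> \<eta>\<bar> | \<xi> \<eta>.
          \<xi> \<in> L2 M (threshold_field M X u 1 t) \<and> \<eta> \<in> L2 M (threshold_field M X u (t + l) n) \<and>
          var M \<xi> > 0 \<and> var M \<eta> > 0})) ` {1..n - l}))"


definition pmf_moment :: "nat pmf \<Rightarrow> nat \<Rightarrow> real" where
  "pmf_moment \<pi> p = (\<Sum>\<^sub>\<infinity>j\<in>{1..}. real j ^ p * pmf \<pi> j)"

definition sq_coeff_var :: "nat pmf \<Rightarrow> real" where
  "sq_coeff_var \<pi> = (pmf_moment \<pi> 2 - (pmf_moment \<pi> 1)\<^sup>2) / (pmf_moment \<pi> 1)\<^sup>2"


text \<open>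
  The library only has weak convergence of measures on the real line. In a general space we use
  the definition by bounded continuous test functions.
\<close>

definition converges_in_distribution ::
    "'a measure \<Rightarrow> (nat \<Rightarrow> 'a \<Rightarrow> 'b :: topological_space) \<Rightarrow> 'b measure \<Rightarrow> bool" where
  "converges_in_distribution M Y \<nu> \<longleftrightarrow>
     (\<forall>f :: 'b \<Rightarrow> real. continuous_on UNIV f \<and> bounded (range f) \<longrightarrow>
        (\<lambda>n. \<integral>x. f x \<partial>distr M borel (Y n)) \<longlonglongrightarrow> (\<integral>x. f x \<partial>\<nu>))"

text \<open>
  The normal distribution on \<open>real ^ 'n\<close> with mean vector \<open>\<mu>\<close> and positive definite covariance
  matrix \<open>S\<close>, by its Lebesgue density. The definition is not meaningful for singular \<open>S\<close>.
\<close>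

definition multi_normal_density :: "real ^ 'n \<Rightarrow> real ^ 'n ^ 'n \<Rightarrow> real ^ 'n \<Rightarrow> real" where
  "multi_normal_density \<mu> S x =
     exp (- ((x - \<mu>) \<bullet> (matrix_inv S *v (x - \<mu>))) / 2) / sqrt ((2 * pi) ^ CARD('n) * det S)"

definition multi_normal :: "real ^ 'n \<Rightarrow> real ^ 'n ^ 'n \<Rightarrow> (real ^ 'n) measure" where
  "multi_normal \<mu> S = density lborel (\<lambda>x. ennreal (multi_normal_density \<mu> S x))"

text \<open>
  The asymptotic covariance matrix as a function of \<open>\<theta>\<close>, \<open>\<alpha>\<close> and \<open>c2 = c\<^sup>2\<close>. For \<open>\<theta>, \<alpha> > 0\<close> and
  \<open>c2 \<ge> 0\<close> it is positive definite, because \<open>v\<^sub>1\<^sub>1 > v\<^sub>1\<^sub>2 = v\<^sub>2\<^sub>2 > 0\<close>: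
  \<open>v\<^sub>1\<^sub>1 - v\<^sub>2\<^sub>2 = \<theta>\<^sup>2 / \<alpha>\<^sup>3 * (\<Sum>j\<ge>3. (j - 2) * \<alpha>^j / j!)\<close>.
\<close>

definition asymp_cov :: "real \<Rightarrow> real \<Rightarrow> real \<Rightarrow> real ^ 2 ^ 2" where
  "asymp_cov \<theta> \<alpha> c2 =
     (let v11 = \<theta>\<^sup>2 / \<alpha>\<^sup>2 * (exp \<alpha> - 1 - \<alpha>) + \<theta>\<^sup>2 * c2 / \<alpha>;
          v22 = 2 * (\<theta>\<^sup>2 / \<alpha> ^ 3) * (exp \<alpha> - 1 - \<alpha> - \<alpha>\<^sup>2 / 2) + \<theta>\<^sup>2 * c2 / \<alpha>;
          v12 = v22
      in vector [vector [v11, v12], vector [v12, v22]])"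

end

theory Submission
  imports Defs
begin

text \<open>
  Everything depends on the sequence only through the indicators of the exceedances \<open>X\<^sub>i > u\<close>. Write
  \<open>J\<^sub>a\<close> for the indicator that the window \<open>{a+1..a+r}\<close> contains no exceedance, \<open>N\<close> for the number
  of exceedances in a stretch of indices, \<open>\<alpha> = \<tau>\<theta>\<close> and \<open>F = exp (-\<alpha>)\<close>. The two empirical distribution
  functions average \<open>J\<^sub>a\<close>, over the disjoint windows and over all windows.
  
  Probabilities. The bound \<open>\<rho>\<^sub>n\<^sub>,\<^sub>l = o(s/n)\<close> is small even after multiplication by the number \<open>n/s\<close>
  of short blocks of length \<open>s\<close>. So short blocks that are separated by gaps of length \<open>l\<close> may be
  decoupled one after the other, and \<open>P(M\<^sub>L \<le> u)\<close> is close to \<open>P(M\<^sub>s \<le> u)\<close> to the power \<open>L/s\<close>. The case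
  \<open>L = r\<close> fixes the rate, and \<open>P(M\<^sub>L \<le> u) \<approx> exp (-\<alpha>L/r)\<close> results for all \<open>L \<le> 2r\<close> (lemma \<open>Q_lim\<close>).
  A short block therefore contains an exceedance with probability about \<open>\<alpha>s/r\<close>, while it contains
  \<open>\<tau>s/r\<close> exceedances on average. Hence the mean of \<open>\<pi>\<close> is \<open>1/\<theta>\<close> (lemma \<open>m1_eq\<close>), \<open>c\<^sup>2 = \<theta>\<^sup>2m\<^sub>2 - 1\<close>, and
  the number of exceedances in \<open>K\<close> consecutive blocks of length \<open>r\<close> has variance about \<open>K\<alpha>m\<^sub>2\<close>
  (lemma \<open>var_TN_lim\<close>).
  
  Covariances. For \<open>d \<le> r\<close> the product of \<open>J\<^sub>a\<close> and \<open>J\<^sub>a\<^sub>+\<^sub>d\<close> is the indicator of no exceedance in a window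
  of length \<open>r + d\<close>, so their covariance is about \<open>exp (-\<alpha>(1 + d/r)) - exp (-2\<alpha>)\<close>; windows further apart
  are nearly uncorrelated. The sum over all windows \<open>b\<close> of the covariance of \<open>J\<^sub>a\<close> and \<open>J\<^sub>b\<close> is then about
  \<open>2rg\<close> with \<open>g\<close> the integral of \<open>exp (-\<alpha>(1 + x)) - exp (-2\<alpha>)\<close> over the unit interval, for every \<open>a\<close>
  away from the ends of the sample.
  This is the reason for \<open>v\<^sub>1\<^sub>2 = v\<^sub>2\<^sub>2\<close>: averaging over the disjoint \<open>a\<close> or over all \<open>a\<close> makes no difference
  when the other factor is the sliding average. Finally \<open>J\<^sub>a\<close> vanishes wherever its window has an
  exceedance, so its covariance with the total number of exceedances is about \<open>-F\<tau>\<close>.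
  
  Central limit theorem. A linear combination of the disjoint windows, the sliding windows and the
  exceedance counts is a sum of \<open>k - 1\<close> block variables that have bounded moments of an order above 2.
  A block variable involves two adjacent blocks, so variables with two others left out between them
  depend on indices more than \<open>l\<close> apart. The sum of large groups of blocks, each without its last two,
  therefore has an almost multiplicative characteristic function,
  and the blocks left out are negligible in the end (theorem \<open>mixing_blocks_clt\<close>).
  
  Transfer. The estimators are the function \<open>-ln f / t\<close> of these averages up to terms of smaller order,
  so they are asymptotically linear, with the bias removed by the rate assumed for \<open>\<theta>\<^sub>r - \<theta>\<close>
  (lemma \<open>estimator_linearization\<close>). With \<open>w = v\<^sub>1\<^sub>2 = v\<^sub>2\<^sub>2\<close> and \<open>d = v\<^sub>1\<^sub>1 - w\<close>, the limiting variance of the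
  combination with coefficients \<open>t\<^sub>1, t\<^sub>2\<close> is \<open>d t\<^sub>1\<^sup>2 + w (t\<^sub>1 + t\<^sub>2)\<^sup>2\<close> (lemma \<open>asymp_variance_algebra\<close>), which
  is that of the pair \<open>(D + B, B)\<close> for independent centred normal \<open>D\<close>, \<open>B\<close> with variances \<open>d\<close>, \<open>w\<close>.
  The same shear identifies the bivariate normal density, and convergence of characteristic functions
  together with tightness yields convergence in distribution (theorem \<open>converges_in_distribution_charI\<close>).
\<close>

section \<open>Characteristic functions and convergence in distribution\<close>

inductive trig_poly :: "('b::real_inner \<Rightarrow> real) \<Rightarrow> bool" where
  cos: "trig_poly (\<lambda>x. cos (t \<bullet> x))"
| sin: "trig_poly (\<lambda>x. sin (t \<bullet> x))"
| add: "trig_poly f \<Longrightarrow> trig_poly g \<Longrightarrow> trig_poly (\<lambda>x. f x + g x)"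
| scale: "trig_poly f \<Longrightarrow> trig_poly (\<lambda>x. c * f x)"

lemma trig_poly_const: "trig_poly (\<lambda>x. c)"
  using trig_poly.scale[OF trig_poly.cos[of 0], of c] by simp

lemma trig_poly_sum: "finite I \<Longrightarrow> (\<And>i. i \<in> I \<Longrightarrow> trig_poly (f i)) \<Longrightarrow> trig_poly (\<lambda>x. \<Sum>i\<in>I. f i x)"
  by (induction I rule: finite_induct) (auto intro: trig_poly_const trig_poly.add)

lemma trig_poly_mult_cos:
  assumes "trig_poly f" shows "trig_poly (\<lambda>x. cos (t \<bullet> x) * f x)"
  using assms
proof induction
  case (cos s)
  have "(\<lambda>x. cos (t \<bullet> x) * cos (s \<bullet> x)) = (\<lambda>x. 1/2 * cos ((t - s) \<bullet> x) + 1/2 * cos ((t + s) \<bullet> x))"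
    by (auto simp: inner_left_distrib inner_diff_left cos_times_cos)
  then show ?case by (simp only:) (intro trig_poly.intros)
next
  case (sin s)
  have "(\<lambda>x. cos (t \<bullet> x) * sin (s \<bullet> x)) = (\<lambda>x. 1/2 * sin ((t + s) \<bullet> x) + (-1/2) * sin ((t - s) \<bullet> x))"
    by (auto simp: inner_left_distrib inner_diff_left cos_times_sin field_simps)
  then show ?case by (simp only:) (intro trig_poly.intros)
next
  case (add f g) then show ?case by (simp add: distrib_left trig_poly.add)
next
  case (scale f c)
  then have "trig_poly (\<lambda>x. c * (cos (t \<bullet> x) * f x))" by (intro trig_poly.scale)
  then show ?case by (simp add: ac_simps)
qed

lemma trig_poly_mult_sin:
  assumes "trig_poly f" shows "trig_poly (\<lambda>x. sin (t \<bullet> x) * f x)"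
  using assms
proof induction
  case (cos s)
  show ?case using trig_poly_mult_cos[OF trig_poly.sin[of t], of s] by (simp add: mult.commute)
next
  case (sin s)
  have "(\<lambda>x. sin (t \<bullet> x) * sin (s \<bullet> x)) = (\<lambda>x. 1/2 * cos ((t - s) \<bullet> x) + (-1/2) * cos ((t + s) \<bullet> x))"
    by (auto simp: inner_left_distrib inner_diff_left sin_times_sin)
  then show ?case by (simp only:) (intro trig_poly.intros)
next
  case (add f g) then show ?case by (simp add: distrib_left trig_poly.add)
next
  case (scale f c)
  then have "trig_poly (\<lambda>x. c * (sin (t \<bullet> x) * f x))" by (intro trig_poly.scale)
  then show ?case by (simp add: ac_simps)
qed

lemma trig_poly_mult:
  assumes "trig_poly f" "trig_poly g" shows "trig_poly (\<lambda>x. f x * g x)"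
  using assms(1)
proof induction
  case (cos t) show ?case by (rule trig_poly_mult_cos[OF assms(2)])
next
  case (sin t) show ?case by (rule trig_poly_mult_sin[OF assms(2)])
next
  case (add f g) then show ?case by (simp add: distrib_right trig_poly.add)
next
  case (scale f c)
  then show ?case using trig_poly.scale[OF scale.IH, of c] by (simp add: ac_simps)
qed

text \<open>
  Polynomials of the map that sends each coordinate to its sine are trigonometric polynomials. On a
  cube on which this map is injective, the theorem of Stone and Weierstrass makes such functions
  dense, and they are bounded everywhere.
\<close>
lemma trig_poly_polynomial_of_sines:
  fixes h :: "'b::euclidean_space \<Rightarrow> real"
  assumes "real_polynomial_function h"
  shows "trig_poly (\<lambda>x. h (\<Sum>b\<in>Basis. sin (c * (x \<bullet> b)) *\<^sub>R b))"
  using assms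
proof induction
  case (linear h)
  have "trig_poly (\<lambda>x::'b. \<Sum>b\<in>Basis. h b * sin ((c *\<^sub>R b) \<bullet> x))"
    by (intro trig_poly_sum trig_poly.scale trig_poly.sin) auto
  moreover have "h (\<Sum>b\<in>Basis. sin (c * (x \<bullet> b)) *\<^sub>R b) = (\<Sum>b\<in>Basis. h b * sin ((c *\<^sub>R b) \<bullet> x))" for x
    using linear by (simp add: bounded_linear.linear linear_sum linear_scale inner_commute mult.commute)
  ultimately show ?case by simp
next
  case (const c) show ?case by (rule trig_poly_const)
next
  case (add f g) then show ?case by (simp add: trig_poly.add)
next
  case (mult f g) then show ?case by (simp add: trig_poly_mult)
qed

lemma trig_poly_continuous_bounded:
  assumes "trig_poly f"
  shows "continuous_on UNIV f \<and> (\<exists>B. \<forall>x. \<bar>f x\<bar> \<le> B)"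
  using assms
proof induction
  case (cos t) then show ?case by (auto intro!: continuous_intros exI[of _ 1])
next
  case (sin t) then show ?case by (auto intro!: continuous_intros exI[of _ 1])
next
  case (add f g)
  then obtain B C where "\<forall>x. \<bar>f x\<bar> \<le> B" "\<forall>x. \<bar>g x\<bar> \<le> C" by auto
  then have "\<forall>x. \<bar>f x + g x\<bar> \<le> B + C" by (meson abs_triangle_ineq add_mono order_trans)
  with add show ?case by (auto intro!: continuous_intros)
next
  case (scale f c)
  then obtain B where "\<forall>x. \<bar>f x\<bar> \<le> B" by auto
  then have "\<forall>x. \<bar>c * f x\<bar> \<le> \<bar>c\<bar> * B" by (simp add: abs_mult mult_left_mono)
  with scale show ?case by (auto intro!: continuous_intros)
qed

lemma (in prob_space) trig_poly_integrable:
  fixes f :: "'b::euclidean_space \<Rightarrow> real"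
  assumes "trig_poly f" "Y \<in> borel_measurable M"
  shows "integrable M (\<lambda>\<omega>. f (Y \<omega>))"
proof -
  obtain B where B: "\<forall>x. \<bar>f x\<bar> \<le> B" and "continuous_on UNIV f"
    using trig_poly_continuous_bounded[OF assms(1)] by auto
  then have [measurable]: "f \<in> borel_measurable borel"
    by (simp add: borel_measurable_continuous_onI)
  show ?thesis
    by (rule integrable_const_bound[where B=B]) (use B assms in auto)
qed

lemma (in prob_space) integral_iexp:
  fixes f :: "'a \<Rightarrow> real"
  assumes "f \<in> borel_measurable M"
  shows "(\<integral>\<omega>. iexp (f \<omega>) \<partial>M) = Complex (\<integral>\<omega>. cos (f \<omega>) \<partial>M) (\<integral>\<omega>. sin (f \<omega>) \<partial>M)"
proof -
  have i: "integrable M (\<lambda>\<omega>. iexp (f \<omega>))" by (rule integrable_const_bound[where B=1]) (use assms in auto)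
  have "(\<integral>\<omega>. Re (iexp (f \<omega>)) \<partial>M) = Re (\<integral>\<omega>. iexp (f \<omega>) \<partial>M)"
       "(\<integral>\<omega>. Im (iexp (f \<omega>)) \<partial>M) = Im (\<integral>\<omega>. iexp (f \<omega>) \<partial>M)"
    by (rule integral_Re[OF i], rule integral_Im[OF i])
  then show ?thesis by (simp add: complex_eq_iff Re_exp Im_exp)
qed

lemma trig_poly_expectation_tendsto:
  fixes Y :: "nat \<Rightarrow> 'a \<Rightarrow> 'b::euclidean_space"
  assumes "prob_space M" "prob_space \<nu>" and [simp]: "sets \<nu> = sets borel"
    and Y: "\<And>n. Y n \<in> borel_measurable M"
    and char: "\<And>t. (\<lambda>n. \<integral>\<omega>. iexp (t \<bullet> Y n \<omega>) \<partial>M) \<longlonglongrightarrow> (\<integral>x. iexp (t \<bullet> x) \<partial>\<nu>)"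
    and f: "trig_poly f"
  shows "(\<lambda>n. \<integral>\<omega>. f (Y n \<omega>) \<partial>M) \<longlonglongrightarrow> (\<integral>x. f x \<partial>\<nu>)"
proof -
  interpret M: prob_space M by fact
  interpret N: prob_space \<nu> by fact
  note [measurable] = Y
  have id: "(\<lambda>x. x) \<in> borel_measurable \<nu>" by (simp add: measurable_def sets_eq_imp_space_eq[OF assms(3)])
  have [measurable]: "(\<lambda>x. t \<bullet> x) \<in> borel_measurable \<nu>" for t using id by measurable
  from f show ?thesis
  proof induction
    case (cos t)
    show ?case using tendsto_Re[OF char[of t]] by (simp add: M.integral_iexp N.integral_iexp)
  next
    case (sin t)
    show ?case using tendsto_Im[OF char[of t]] by (simp add: M.integral_iexp N.integral_iexp)
  next
    case (add f g)
    then show ?case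
      by (simp add: M.trig_poly_integrable[OF _ Y] N.trig_poly_integrable[OF _ id] tendsto_add)
  next
    case (scale f c)
    then show ?case by (simp add: tendsto_mult_left)
  qed
qed

text \<open>
  Tightness confines all laws, up to a small probability, to the ball of radius \<open>L\<close>. There the
  sine of each rescaled coordinate is invertible, so a bounded continuous \<open>f\<close> is a continuous function of the
  sines and hence uniformly close to a trigonometric polynomial \<open>g\<close>. Outside the ball, \<open>g\<close> stays
  within the bound of \<open>f\<close> up to a small error, because it is close to a value of \<open>f\<close> everywhere.
  Expectations of \<open>g\<close> are linear combinations of characteristic functions.
\<close>
theorem converges_in_distribution_charI:
  fixes Y :: "nat \<Rightarrow> 'a \<Rightarrow> 'b::euclidean_space"
  assumes M: "prob_space M" and N: "prob_space \<nu>" and sets[simp]: "sets \<nu> = sets borel"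
    and Y: "\<And>n. Y n \<in> borel_measurable M"
    and tight: "\<And>\<epsilon>::real. \<epsilon> > 0 \<Longrightarrow> \<exists>L. \<forall>\<^sub>F n in sequentially. \<P>(\<omega> in M. norm (Y n \<omega>) > L) < \<epsilon>"
    and char: "\<And>t. (\<lambda>n. \<integral>\<omega>. iexp (t \<bullet> Y n \<omega>) \<partial>M) \<longlonglongrightarrow> (\<integral>x. iexp (t \<bullet> x) \<partial>\<nu>)"
  shows "converges_in_distribution M Y \<nu>"
  unfolding converges_in_distribution_def
proof (intro allI impI, elim conjE)
  fix f :: "'b \<Rightarrow> real"
  assume f: "continuous_on UNIV f" and "bounded (range f)"
  then obtain B0 where "\<forall>x. \<bar>f x\<bar> \<le> B0" by (auto simp: bounded_iff)
  then obtain B where B: "\<And>x. \<bar>f x\<bar> \<le> B" and B0: "B > 0"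
    by (metis abs_ge_zero add_pos_nonneg add.commute less_add_one order_less_imp_le order_trans zero_less_one)
  interpret M: prob_space M by fact
  interpret N: prob_space \<nu> by fact
  note [measurable] = Y
  have [measurable]: "f \<in> borel_measurable borel" by (simp add: borel_measurable_continuous_onI f)
  have id[measurable]: "(\<lambda>x. x) \<in> \<nu> \<rightarrow>\<^sub>M borel"
    by (simp add: measurable_def sets_eq_imp_space_eq[OF sets])
  have spN: "space \<nu> = UNIV" using sets_eq_imp_space_eq[OF sets] by simp
  have key: "\<forall>\<^sub>F n in sequentially. \<bar>(\<integral>\<omega>. f (Y n \<omega>) \<partial>M) - (\<integral>x. f x \<partial>\<nu>)\<bar> < \<epsilon>"
    if e: "\<epsilon> > 0" for \<epsilon>
  proof -
    define \<delta> where "\<delta> = \<epsilon> / (8 * B)"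
    have d: "\<delta> > 0" using e B0 by (simp add: \<delta>_def)
    obtain L1 where L1: "\<forall>\<^sub>F n in sequentially. \<P>(\<omega> in M. norm (Y n \<omega>) > L1) < \<delta>"
      using tight[OF d] by auto
    obtain L2 where L2: "measure \<nu> {x. norm x > L2} < \<delta>"
    proof -
      have "(\<lambda>n. measure \<nu> {x. norm x > real n}) \<longlonglongrightarrow> measure \<nu> (\<Inter>n. {x. norm x > real n})"
        by (intro N.finite_Lim_measure_decseq) (auto simp: decseq_def spN intro!: borel_open open_Collect_less continuous_intros)
      moreover have "(\<Inter>n. {x::'b. norm x > real n}) = {}"
        by (simp add: set_eq_iff not_less real_arch_simple)
      ultimately have "(\<lambda>n. measure \<nu> {x. norm x > real n}) \<longlonglongrightarrow> 0" by simp
      from order_tendstoD(2)[OF this d] obtain n where "measure \<nu> {x. norm x > real n} < \<delta>"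
        by (auto simp: eventually_sequentially)
      then show ?thesis by (rule that)
    qed
    define L where "L = max 1 (max L1 L2)"
    have L: "L > 0" by (simp add: L_def)
    (* With this scale the arguments of the sines stay within half a period on the ball of radius L. *)
    define c where "c = pi / (2 * L)"
    have c: "c > 0" using L by (simp add: c_def)
    (* S maps everything into the cube C, and A inverts S on the ball. *)
    define S where "S x = (\<Sum>b\<in>Basis. sin (c * (x \<bullet> b)) *\<^sub>R b)" for x :: 'b
    define A where "A y = (\<Sum>b\<in>Basis. (arcsin (y \<bullet> b) / c) *\<^sub>R b)" for y :: 'b
    define C where "C = cbox (- (\<Sum>b\<in>Basis. b)) (\<Sum>b\<in>Basis. b :: 'b)"
    have C: "y \<in> C \<longleftrightarrow> (\<forall>b\<in>Basis. -1 \<le> y \<bullet> b \<and> y \<bullet> b \<le> 1)" for y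
      by (auto simp: C_def mem_box inner_sum_left inner_Basis if_distrib cong: if_cong)
    have SC: "S x \<in> C" for x by (simp add: C S_def)
    have AS: "A (S x) = x" if "norm x \<le> L" for x
    proof (rule euclidean_eqI)
      fix b :: 'b assume b: "b \<in> Basis"
      have xb: "\<bar>x \<bullet> b\<bar> \<le> L" using Basis_le_norm[OF b, of x] that by simp
      then have "c * \<bar>x \<bullet> b\<bar> \<le> pi / 2" using c L by (simp add: c_def field_simps)
      then have "\<bar>c * (x \<bullet> b)\<bar> \<le> pi / 2" using c by (simp add: abs_mult)
      then have "arcsin (sin (c * (x \<bullet> b))) = c * (x \<bullet> b)" by (intro arcsin_sin) (auto simp: abs_le_iff)
      then show "A (S x) \<bullet> b = x \<bullet> b" using b c by (simp add: A_def S_def)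
    qed
    have "continuous_on C (\<lambda>y. f (A y))"
    proof (rule continuous_on_compose2[OF f])
      show "continuous_on C A" unfolding A_def using c
        by (intro continuous_intros) (auto simp: C)
    qed auto
    moreover have "compact C" by (simp add: C_def)
    ultimately obtain h where h: "polynomial_function h" and hC: "\<And>y. y \<in> C \<Longrightarrow> norm (f (A y) - h y) < \<epsilon> / 8"
      using Stone_Weierstrass_polynomial_function[of C "\<lambda>y. f (A y)" "\<epsilon> / 8"] e by auto
    have hr: "real_polynomial_function h" using h by (simp add: real_polynomial_function_eq)
    define g where "g x = h (S x)" for x
    have g: "trig_poly g" unfolding g_def S_def by (rule trig_poly_polynomial_of_sines[OF hr])
    have gm[measurable]: "g \<in> borel_measurable borel"
      using trig_poly_continuous_bounded[OF g] by (simp add: borel_measurable_continuous_onI)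
    have gf: "\<bar>f x - g x\<bar> \<le> \<epsilon> / 8 + 2 * B * indicator {x. norm x > L} x" for x
    proof (cases "norm x > L")
      case False then show ?thesis using hC[OF SC, of x] AS[of x] by (simp add: g_def)
    next
      case True
      have "\<bar>f (A (S x)) - h (S x)\<bar> < \<epsilon> / 8" using hC[OF SC, of x] by simp
      with B[of x] B[of "A (S x)"] have "\<bar>f x - h (S x)\<bar> \<le> \<epsilon> / 8 + 2 * B" by linarith
      then show ?thesis using True by (simp add: g_def)
    qed
    have close: "\<bar>(\<integral>\<omega>. f (Z \<omega>) \<partial>P) - (\<integral>\<omega>. g (Z \<omega>) \<partial>P)\<bar> \<le> \<epsilon> / 8 + 2 * B * \<P>(\<omega> in P. norm (Z \<omega>) > L)"
      if P: "prob_space P" and Z[measurable]: "Z \<in> borel_measurable P" for P :: "'c measure" and Z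
    proof -
      interpret P: prob_space P by fact
      have i1: "integrable P (\<lambda>\<omega>. f (Z \<omega>))" by (rule P.integrable_const_bound[where B=B]) (use B in auto)
      have i2: "integrable P (\<lambda>\<omega>. g (Z \<omega>))" by (rule P.trig_poly_integrable[OF g Z])
      have i3: "integrable P (indicator {\<omega>\<in>space P. norm (Z \<omega>) > L} :: _ \<Rightarrow> real)"
        by (rule integrable_real_indicator) (auto simp: P.emeasure_eq_measure)
      have "\<bar>(\<integral>\<omega>. f (Z \<omega>) \<partial>P) - (\<integral>\<omega>. g (Z \<omega>) \<partial>P)\<bar> = \<bar>\<integral>\<omega>. f (Z \<omega>) - g (Z \<omega>) \<partial>P\<bar>"
        using i1 i2 by simp
      also have "\<dots> \<le> (\<integral>\<omega>. \<bar>f (Z \<omega>) - g (Z \<omega>)\<bar> \<partial>P)" by (rule integral_abs_bound)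
      also have "\<dots> \<le> (\<integral>\<omega>. \<epsilon> / 8 + 2 * B * indicator {\<omega>\<in>space P. norm (Z \<omega>) > L} \<omega> \<partial>P)"
      proof (rule integral_mono)
        show "integrable P (\<lambda>\<omega>. \<bar>f (Z \<omega>) - g (Z \<omega>)\<bar>)" using i1 i2 by auto
        show "integrable P (\<lambda>\<omega>. \<epsilon> / 8 + 2 * B * indicator {\<omega>\<in>space P. norm (Z \<omega>) > L} \<omega>)" using i3 by auto
      qed (use gf in \<open>auto simp: indicator_def split: if_splits\<close>)
      also have "\<dots> = \<epsilon> / 8 + 2 * B * \<P>(\<omega> in P. norm (Z \<omega>) > L)"
        using i3 by (simp add: P.prob_space)
      finally show ?thesis .
    qed
    have small: "2 * B * q \<le> \<epsilon> / 4" if "q < \<delta>" for q using that B0 by (simp add: \<delta>_def field_simps)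
    have c1: "\<bar>(\<integral>x. f x \<partial>\<nu>) - (\<integral>x. g x \<partial>\<nu>)\<bar> \<le> \<epsilon> / 8 + \<epsilon> / 4"
    proof -
      have "measure \<nu> {x. norm x > L} \<le> measure \<nu> {x. norm x > L2}"
        by (intro N.finite_measure_mono) (auto simp: L_def intro!: borel_open open_Collect_less continuous_intros)
      with L2 have "measure \<nu> {x. norm x > L} < \<delta>" by simp
      from small[OF this] show ?thesis using close[OF N id] by (simp add: spN)
    qed
    have c2: "\<forall>\<^sub>F n in sequentially. \<bar>(\<integral>\<omega>. f (Y n \<omega>) \<partial>M) - (\<integral>\<omega>. g (Y n \<omega>) \<partial>M)\<bar> \<le> \<epsilon> / 8 + \<epsilon> / 4"
      using L1
    proof eventually_elim
      case (elim n)
      have "\<P>(\<omega> in M. norm (Y n \<omega>) > L) \<le> \<P>(\<omega> in M. norm (Y n \<omega>) > L1)"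
        by (intro M.finite_measure_mono) (auto simp: L_def)
      with elim have "\<P>(\<omega> in M. norm (Y n \<omega>) > L) < \<delta>" by simp
      from small[OF this] show ?case using close[OF M Y, of n] by simp
    qed
    have "(\<lambda>n. \<integral>\<omega>. g (Y n \<omega>) \<partial>M) \<longlonglongrightarrow> (\<integral>x. g x \<partial>\<nu>)"
      by (rule trig_poly_expectation_tendsto[OF M N sets Y char g])
    then have "\<forall>\<^sub>F n in sequentially. dist (\<integral>\<omega>. g (Y n \<omega>) \<partial>M) (\<integral>x. g x \<partial>\<nu>) < \<epsilon> / 4"
      by (rule tendstoD) (use e in simp)
    with c2 show ?thesis
    proof eventually_elim
      case (elim n) with c1 show ?case unfolding dist_real_def by arith
    qed
  qed
  have "(\<lambda>n. \<integral>\<omega>. f (Y n \<omega>) \<partial>M) \<longlonglongrightarrow> (\<integral>x. f x \<partial>\<nu>)"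
    by (rule tendstoI) (use key in \<open>auto simp: dist_real_def\<close>)
  then show "(\<lambda>n. \<integral>x. f x \<partial>distr M borel (Y n)) \<longlonglongrightarrow> (\<integral>x. f x \<partial>\<nu>)"
    by (simp add: integral_distr)
qed

section \<open>The bivariate normal law as a sheared product\<close>

definition shear :: "real \<times> real \<Rightarrow> real ^ 2" where
  "shear z = vector [fst z + snd z, snd z]"

lemma inner_2: "(x :: real ^ 2) \<bullet> y = x $ 1 * y $ 1 + x $ 2 * y $ 2"
  by (simp add: inner_vec_def sum_2)

lemma shear_nth [simp]: "shear z $ 1 = fst z + snd z" "shear z $ 2 = snd z"
  by (simp_all add: shear_def)

lemma measurable_vector_2 [measurable (raw)]:
  assumes "f \<in> borel_measurable M" "g \<in> borel_measurable M"
  shows "(\<lambda>x. vector [f x, g x] :: real ^ 2) \<in> borel_measurable M"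
proof -
  have "(\<lambda>x. f x *\<^sub>R axis 1 1 + g x *\<^sub>R axis 2 1 :: real ^ 2) \<in> borel_measurable M"
    using assms by measurable
  also have "(\<lambda>x. f x *\<^sub>R axis 1 1 + g x *\<^sub>R axis 2 1 :: real ^ 2) = (\<lambda>x. vector [f x, g x])"
    by (auto simp: vec_eq_iff forall_2 axis_def)
  finally show ?thesis .
qed

lemma measurable_shear [measurable]: "shear \<in> borel_measurable (borel \<Otimes>\<^sub>M borel)"
  unfolding shear_def[abs_def] by measurable

text \<open>
  The shear has determinant 1: the fibre of the preimage of a box over the second coordinate is a
  translated interval of unchanged length.
\<close>
lemma lborel_eq_distr_shear: "lborel = distr (lborel \<Otimes>\<^sub>M lborel) borel shear"
proof (rule lborel_eqI)
  fix l v :: "real ^ 2"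
  assume le: "\<And>b. b \<in> Basis \<Longrightarrow> l \<bullet> b \<le> v \<bullet> b"
  have le1: "l $ 1 \<le> v $ 1" and le2: "l $ 2 \<le> v $ 2"
    using le[of "axis 1 1"] le[of "axis 2 1"] by (auto simp: inner_axis)
  have sh: "shear \<in> borel_measurable (lborel \<Otimes>\<^sub>M lborel)"
    using measurable_shear by (simp add: measurable_def space_pair_measure sets_pair_measure)
  define A where "A = shear -` box l v \<inter> space (lborel \<Otimes>\<^sub>M lborel)"
  have A[measurable]: "A \<in> sets (lborel \<Otimes>\<^sub>M lborel)"
    unfolding A_def by (rule measurable_sets[OF sh]) simp
  have fib: "(\<lambda>x. (x, y)) -` A = (if y \<in> {l $ 2<..<v $ 2} then {l $ 1 - y<..<v $ 1 - y} else {})" for y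
    by (auto simp: A_def mem_box_cart forall_2 space_pair_measure)
  have "emeasure (distr (lborel \<Otimes>\<^sub>M lborel) borel shear) (box l v) = emeasure (lborel \<Otimes>\<^sub>M lborel) A"
    by (subst emeasure_distr[OF sh]) (auto simp: A_def)
  also have "\<dots> = (\<integral>\<^sup>+ y. emeasure lborel ((\<lambda>x. (x, y)) -` A) \<partial>lborel)"
    by (rule lborel_pair.emeasure_pair_measure_alt2) (rule A)
  also have "\<dots> = (\<integral>\<^sup>+ y. ennreal (v $ 1 - l $ 1) * indicator {l $ 2<..<v $ 2} y \<partial>lborel)"
    by (rule nn_integral_cong) (use le1 in \<open>auto simp: fib indicator_def\<close>)
  also have "\<dots> = ennreal (v $ 1 - l $ 1) * ennreal (v $ 2 - l $ 2)"
    using le2 by (simp add: nn_integral_cmult_indicator)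
  also have "\<dots> = ennreal (prod ((\<bullet>) (v - l)) Basis)"
  proof -
    have "(Basis :: (real ^ 2) set) = {axis 1 1, axis 2 1}"
      by (auto simp: Basis_vec_def UNIV_2)
    moreover have "axis 1 1 \<noteq> (axis 2 1 :: real ^ 2)" by (simp add: axis_eq_axis)
    ultimately have "prod ((\<bullet>) (v - l)) Basis = ((v - l) \<bullet> axis 1 1) * ((v - l) \<bullet> axis 2 1)"
      by (metis (no_types, lifting) finite.emptyI finite_insert insert_absorb insert_not_empty prod.empty prod.insert mult.right_neutral singletonD)
    then have "prod ((\<bullet>) (v - l)) Basis = (v $ 1 - l $ 1) * (v $ 2 - l $ 2)"
      by (simp add: inner_axis)
    then show ?thesis using le1 le2 by (simp add: ennreal_mult)
  qed
  finally show "emeasure (distr (lborel \<Otimes>\<^sub>M lborel) borel shear) (box l v) = ennreal (prod ((\<bullet>) (v - l)) Basis)" .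
qed simp

definition normal_measure :: "real \<Rightarrow> real measure" where
  "normal_measure \<sigma> = density lborel (\<lambda>x. ennreal (normal_density 0 \<sigma> x))"

lemma prob_space_normal_measure: "\<sigma> > 0 \<Longrightarrow> prob_space (normal_measure \<sigma>)"
  unfolding normal_measure_def by (rule prob_space_normal_density)

lemma char_normal_measure:
  assumes "\<sigma> > 0"
  shows "char (normal_measure \<sigma>) t = exp (- (\<sigma> * t)\<^sup>2 / 2)"
proof -
  interpret prob_space std_normal_distribution by (rule prob_space_normal_density) simp
  have "distributed std_normal_distribution lborel (\<lambda>x. x) std_normal_density"
    unfolding distributed_def by (auto simp: distr_id2)
  from normal_density_affine[OF this, of \<sigma> 0] assms
  have "distr std_normal_distribution lborel (\<lambda>x. \<sigma> * x) = normal_measure \<sigma>"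
    by (simp add: distributed_def normal_measure_def)
  then have "normal_measure \<sigma> = distr std_normal_distribution lborel (\<lambda>x. \<sigma> * x)" ..
  then have "char (normal_measure \<sigma>) t = char std_normal_distribution (\<sigma> * t)"
    unfolding char_def by (simp add: integral_distr ac_simps)
  then show ?thesis by (simp add: char_std_normal_distribution)
qed

lemma matrix_inv_eqI:
  fixes A B :: "real ^ 'n ^ 'n"
  assumes "A ** B = mat 1" "B ** A = mat 1"
  shows "matrix_inv A = B"
proof -
  have "A ** matrix_inv A = mat 1 \<and> matrix_inv A ** A = mat 1"
    unfolding matrix_inv_def by (rule someI[of _ B]) (use assms in auto)
  then have "matrix_inv A ** (A ** B) = B" by (simp add: matrix_mul_assoc)
  then show ?thesis by (simp add: assms)
qed

text \<open>
  The matrix is the covariance of \<open>(D + B, B)\<close> for independent \<open>D\<close>, \<open>B\<close> with variances \<open>d\<close>, \<open>w\<close>. In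
  the coordinates of \<open>(D, B)\<close> its quadratic form is diagonal, so the density factorizes.
\<close>
lemma multi_normal_density_shear:
  fixes d w :: real
  assumes "d > 0" "w > 0"
  defines "S \<equiv> vector [vector [d + w, w], vector [w, w]] :: real ^ 2 ^ 2"
  shows "multi_normal_density 0 S (shear z) = normal_density 0 (sqrt d) (fst z) * normal_density 0 (sqrt w) (snd z)"
proof -
  have det: "det S = d * w" by (simp add: S_def det_2 algebra_simps)
  have "matrix_inv S = vector [vector [1/d, -1/d], vector [-1/d, 1/d + 1/w]]"
    using assms(1,2)
    by (intro matrix_inv_eqI)
       (auto simp: S_def vec_eq_iff forall_2 matrix_matrix_mult_def sum_2 mat_def field_simps)
  then have "shear z \<bullet> (matrix_inv S *v shear z) = (fst z)\<^sup>2 / d + (snd z)\<^sup>2 / w"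
    using assms(1,2)
    by (simp add: inner_2 matrix_vector_mult_def sum_2 power2_eq_square field_simps)
  moreover have "sqrt ((2 * pi)\<^sup>2 * (d * w)) = sqrt (2 * pi * d) * sqrt (2 * pi * w)"
    by (simp add: real_sqrt_mult[symmetric] power2_eq_square ac_simps)
  moreover have "exp (- ((fst z)\<^sup>2 / d + (snd z)\<^sup>2 / w) / 2) = exp (- (fst z)\<^sup>2 / (2 * d)) * exp (- (snd z)\<^sup>2 / (2 * w))"
    by (simp add: exp_add[symmetric] field_simps)
  ultimately show ?thesis using assms(1,2)
    by (simp add: multi_normal_density_def normal_density_def det)
qed

lemma multi_normal_eq_distr_shear:
  fixes d w :: real
  assumes "d > 0" "w > 0"
  shows "multi_normal 0 (vector [vector [d + w, w], vector [w, w]] :: real ^ 2 ^ 2) =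
         distr (normal_measure (sqrt d) \<Otimes>\<^sub>M normal_measure (sqrt w)) borel shear"
proof -
  let ?S = "vector [vector [d + w, w], vector [w, w]] :: real ^ 2 ^ 2"
  let ?g = "\<lambda>x. ennreal (multi_normal_density 0 ?S x)"
  have sh[measurable]: "shear \<in> borel_measurable (lborel \<Otimes>\<^sub>M lborel)"
    using measurable_shear by (simp add: measurable_def space_pair_measure sets_pair_measure)
  have lin: "(\<lambda>x. x \<bullet> (A *v x)) \<in> borel_measurable borel" for A :: "real ^ 2 ^ 2"
    by (intro borel_measurable_continuous_onI continuous_intros matrix_vector_mult_linear_continuous_on)
  have g: "?g \<in> borel_measurable borel"
    unfolding multi_normal_density_def using lin by simp
  interpret N1: prob_space "normal_measure (sqrt d)" using assms by (intro prob_space_normal_measure) simp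
  interpret N2: prob_space "normal_measure (sqrt w)" using assms by (intro prob_space_normal_measure) simp
  have "normal_measure (sqrt d) \<Otimes>\<^sub>M normal_measure (sqrt w) =
     density (lborel \<Otimes>\<^sub>M lborel) (\<lambda>(x, y). ennreal (normal_density 0 (sqrt d) x) * ennreal (normal_density 0 (sqrt w) y))"
    unfolding normal_measure_def
    by (rule pair_measure_density)
       (use N2.sigma_finite_measure_axioms in \<open>auto simp: normal_measure_def lborel.sigma_finite_measure_axioms\<close>)
  also have "\<dots> = density (lborel \<Otimes>\<^sub>M lborel) (\<lambda>z. ?g (shear z))"
    by (rule density_cong)
       (use g assms in \<open>auto simp: multi_normal_density_shear ennreal_mult\<close>)
  finally have "distr (normal_measure (sqrt d) \<Otimes>\<^sub>M normal_measure (sqrt w)) borel shear =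
     distr (density (lborel \<Otimes>\<^sub>M lborel) (\<lambda>z. ?g (shear z))) borel shear" by simp
  also have "\<dots> = density (distr (lborel \<Otimes>\<^sub>M lborel) borel shear) ?g"
    by (rule density_distr[symmetric]) (use g in auto)
  also have "\<dots> = multi_normal 0 ?S"
    unfolding multi_normal_def by (simp add: lborel_eq_distr_shear[symmetric])
  finally show ?thesis ..
qed

lemma prob_space_multi_normal_shear:
  assumes "d > 0" "w > 0"
  shows "prob_space (multi_normal 0 (vector [vector [d + w, w], vector [w, w]] :: real ^ 2 ^ 2))"
proof -
  interpret N1: prob_space "normal_measure (sqrt d)" using assms by (intro prob_space_normal_measure) simp
  interpret N2: prob_space "normal_measure (sqrt w)" using assms by (intro prob_space_normal_measure) simp
  interpret pair_prob_space "normal_measure (sqrt d)" "normal_measure (sqrt w)" ..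
  show ?thesis unfolding multi_normal_eq_distr_shear[OF assms]
    by (rule P.prob_space_distr)
       (use measurable_shear in \<open>simp add: normal_measure_def measurable_def space_pair_measure sets_pair_measure\<close>)
qed

lemma char_multi_normal_shear:
  fixes t :: "real ^ 2"
  assumes "d > 0" "w > 0"
  shows "(\<integral>x. iexp (t \<bullet> x) \<partial>multi_normal 0 (vector [vector [d + w, w], vector [w, w]] :: real ^ 2 ^ 2)) =
         exp (- (d * (t $ 1)\<^sup>2 + w * (t $ 1 + t $ 2)\<^sup>2) / 2)"
proof -
  interpret N1: prob_space "normal_measure (sqrt d)" using assms by (intro prob_space_normal_measure) simp
  interpret N2: prob_space "normal_measure (sqrt w)" using assms by (intro prob_space_normal_measure) simp
  interpret P: pair_prob_space "normal_measure (sqrt d)" "normal_measure (sqrt w)" ..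
  have s[simp, measurable_cong]: "sets (normal_measure \<sigma>) = sets borel" for \<sigma> by (simp add: normal_measure_def)
  have sh: "shear \<in> borel_measurable (normal_measure (sqrt d) \<Otimes>\<^sub>M normal_measure (sqrt w))"
    by measurable
  have m: "(\<lambda>x. iexp (t \<bullet> x)) \<in> borel_measurable borel"
    by (intro borel_measurable_continuous_onI continuous_intros)
  have "(\<integral>x. iexp (t \<bullet> x) \<partial>multi_normal 0 (vector [vector [d + w, w], vector [w, w]] :: real ^ 2 ^ 2)) =
     (\<integral>z. iexp (t \<bullet> shear z) \<partial>(normal_measure (sqrt d) \<Otimes>\<^sub>M normal_measure (sqrt w)))"
    unfolding multi_normal_eq_distr_shear[OF assms] by (rule integral_distr[OF sh m])
  also have "\<dots> = (\<integral>z. (case z of (x, y) \<Rightarrow> iexp (t $ 1 * x) * iexp ((t $ 1 + t $ 2) * y)) \<partial>(normal_measure (sqrt d) \<Otimes>\<^sub>M normal_measure (sqrt w)))"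
    by (intro Bochner_Integration.integral_cong refl)
       (auto simp: inner_2 exp_add[symmetric] algebra_simps)
  also have "\<dots> = (\<integral>x. \<integral>y. iexp (t $ 1 * x) * iexp ((t $ 1 + t $ 2) * y) \<partial>normal_measure (sqrt w) \<partial>normal_measure (sqrt d))"
    by (rule P.integral_fst[symmetric], rule P.P.integrable_const_bound[where B=1]) (auto simp: norm_mult)
  also have "\<dots> = char (normal_measure (sqrt d)) (t $ 1) * char (normal_measure (sqrt w)) (t $ 1 + t $ 2)"
    by (simp add: char_def)
  also have "\<dots> = exp (- (d * (t $ 1)\<^sup>2 + w * (t $ 1 + t $ 2)\<^sup>2) / 2)"
    using assms by (simp add: char_normal_measure power_mult_distrib exp_add[symmetric] of_real_mult[symmetric] add_divide_distrib del: of_real_mult)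
  finally show ?thesis .
qed

section \<open>Covariances of bounded random variables\<close>

definition cov :: "'a measure \<Rightarrow> ('a \<Rightarrow> real) \<Rightarrow> ('a \<Rightarrow> real) \<Rightarrow> real" where
  "cov M f g = (\<integral>\<omega>. (f \<omega> - (\<integral>x. f x \<partial>M)) * (g \<omega> - (\<integral>x. g x \<partial>M)) \<partial>M)"

definition sd :: "'a measure \<Rightarrow> ('a \<Rightarrow> real) \<Rightarrow> real" where
  "sd M f = sqrt (cov M f f)"

text \<open>
  The indicators and counts below are bounded for fixed \<open>n\<close>. Restricting to bounded variables makes
  every integrability side condition automatic. The bound itself never enters an estimate, so it may
  grow with \<open>n\<close>.
\<close>
definition bdd_rv :: "'a measure \<Rightarrow> ('a \<Rightarrow> real) \<Rightarrow> bool" where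
  "bdd_rv M f \<longleftrightarrow> f \<in> borel_measurable M \<and> (\<exists>B. \<forall>\<omega>\<in>space M. \<bar>f \<omega>\<bar> \<le> B)"

lemma bdd_rvI: "f \<in> borel_measurable M \<Longrightarrow> (\<And>\<omega>. \<omega> \<in> space M \<Longrightarrow> \<bar>f \<omega>\<bar> \<le> B) \<Longrightarrow> bdd_rv M f"
  by (auto simp: bdd_rv_def)

lemma bdd_rv_measurable [measurable_dest]: "bdd_rv M f \<Longrightarrow> f \<in> borel_measurable M"
  by (simp add: bdd_rv_def)

lemma bdd_rv_const [simp]: "bdd_rv M (\<lambda>_. c)"
  by (rule bdd_rvI[where B="\<bar>c\<bar>"]) auto

lemma bdd_rv_add [intro]:
  assumes "bdd_rv M f" "bdd_rv M g" shows "bdd_rv M (\<lambda>\<omega>. f \<omega> + g \<omega>)"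
proof -
  obtain A B where "\<forall>\<omega>\<in>space M. \<bar>f \<omega>\<bar> \<le> A" "\<forall>\<omega>\<in>space M. \<bar>g \<omega>\<bar> \<le> B"
    using assms by (auto simp: bdd_rv_def)
  then have "\<bar>f \<omega> + g \<omega>\<bar> \<le> A + B" if "\<omega> \<in> space M" for \<omega>
    using that abs_triangle_ineq[of "f \<omega>" "g \<omega>"] by fastforce
  then show ?thesis using assms by (intro bdd_rvI[where B="A + B"]) (auto dest: bdd_rv_measurable)
qed

lemma bdd_rv_mult [intro]:
  assumes "bdd_rv M f" "bdd_rv M g" shows "bdd_rv M (\<lambda>\<omega>. f \<omega> * g \<omega>)"
proof -
  obtain A B where "\<forall>\<omega>\<in>space M. \<bar>f \<omega>\<bar> \<le> A" "\<forall>\<omega>\<in>space M. \<bar>g \<omega>\<bar> \<le> B"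
    using assms by (auto simp: bdd_rv_def)
  then have "\<bar>f \<omega> * g \<omega>\<bar> \<le> A * B" if "\<omega> \<in> space M" for \<omega>
    using that unfolding abs_mult by (intro mult_mono) (auto intro: order_trans[OF abs_ge_zero])
  then show ?thesis using assms by (intro bdd_rvI[where B="A * B"]) (auto dest: bdd_rv_measurable)
qed

lemma bdd_rv_scale [intro]: "bdd_rv M f \<Longrightarrow> bdd_rv M (\<lambda>\<omega>. c * f \<omega>)"
  by (intro bdd_rv_mult bdd_rv_const)

lemma bdd_rv_diff [intro]:
  assumes "bdd_rv M f" "bdd_rv M g" shows "bdd_rv M (\<lambda>\<omega>. f \<omega> - g \<omega>)"
  using bdd_rv_add[OF assms(1) bdd_rv_scale[OF assms(2), of "-1"]] by simp

lemma bdd_rv_divide [intro]: "bdd_rv M f \<Longrightarrow> bdd_rv M (\<lambda>\<omega>. f \<omega> / c)"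
  using bdd_rv_scale[of M f "1 / c"] by simp

lemma bdd_rv_sum [intro]:
  assumes "\<And>i. i \<in> I \<Longrightarrow> bdd_rv M (f i)" shows "bdd_rv M (\<lambda>\<omega>. \<Sum>i\<in>I. f i \<omega>)"
  using assms by (induction I rule: infinite_finite_induct) auto

lemma bdd_rv_abs [intro]: "bdd_rv M f \<Longrightarrow> bdd_rv M (\<lambda>\<omega>. \<bar>f \<omega>\<bar>)"
  by (auto simp: bdd_rv_def)

lemma bdd_rv_power [intro]: "bdd_rv M f \<Longrightarrow> bdd_rv M (\<lambda>\<omega>. f \<omega> ^ n)"
  by (induction n) auto

lemma bdd_rv_powr:
  assumes "bdd_rv M f" "p \<ge> 0" shows "bdd_rv M (\<lambda>\<omega>. \<bar>f \<omega>\<bar> powr p)"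
proof -
  obtain A where "\<forall>\<omega>\<in>space M. \<bar>f \<omega>\<bar> \<le> A" using assms by (auto simp: bdd_rv_def)
  then show ?thesis using assms
    by (intro bdd_rvI[where B="A powr p"]) (auto intro!: powr_mono2 dest: bdd_rv_measurable)
qed

lemma cov_commute: "cov M f g = cov M g f"
  by (simp add: cov_def mult.commute)

context prob_space
begin

lemma bdd_rv_integrable [intro]:
  assumes "bdd_rv M f" shows "integrable M f"
proof -
  obtain B where "f \<in> borel_measurable M" "\<forall>\<omega>\<in>space M. \<bar>f \<omega>\<bar> \<le> B" using assms by (auto simp: bdd_rv_def)
  then show ?thesis by (intro integrable_const_bound[where B=B]) auto
qed

lemma cov_eq:
  assumes f: "bdd_rv M f" and g: "bdd_rv M g"
  shows "cov M f g = expectation (\<lambda>\<omega>. f \<omega> * g \<omega>) - expectation f * expectation g"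
proof -
  note [simp] = bdd_rv_integrable[OF f] bdd_rv_integrable[OF g] bdd_rv_integrable[OF bdd_rv_mult[OF f g]]
  have "cov M f g = (\<integral>\<omega>. f \<omega> * g \<omega> - expectation f * g \<omega> - expectation g * f \<omega> + expectation f * expectation g \<partial>M)"
    unfolding cov_def by (intro Bochner_Integration.integral_cong refl) (simp add: algebra_simps)
  then show ?thesis by (simp add: prob_space)
qed

lemma cov_add_left:
  assumes "bdd_rv M f" "bdd_rv M g" "bdd_rv M h"
  shows "cov M (\<lambda>\<omega>. f \<omega> + g \<omega>) h = cov M f h + cov M g h"
  using assms
  by (simp add: cov_eq bdd_rv_add bdd_rv_mult bdd_rv_integrable distrib_right)

lemma cov_scale_left:
  assumes "bdd_rv M f" "bdd_rv M h"
  shows "cov M (\<lambda>\<omega>. c * f \<omega>) h = c * cov M f h"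
  using assms by (simp add: cov_eq bdd_rv_scale mult.assoc algebra_simps)

lemma cov_const_left [simp]: "cov M (\<lambda>_. c) h = 0"
  by (simp add: cov_def prob_space)

lemma cov_const_right [simp]: "cov M h (\<lambda>_. c) = 0"
  by (simp add: cov_def prob_space)

lemma cov_sum_left:
  assumes "\<And>i. i \<in> I \<Longrightarrow> bdd_rv M (f i)" "bdd_rv M h"
  shows "cov M (\<lambda>\<omega>. \<Sum>i\<in>I. f i \<omega>) h = (\<Sum>i\<in>I. cov M (f i) h)"
  using assms
proof (induction I rule: infinite_finite_induct)
  case (insert i I)
  then show ?case by (simp add: cov_add_left bdd_rv_sum)
qed auto

lemma cov_add_right:
  assumes "bdd_rv M f" "bdd_rv M g" "bdd_rv M h"
  shows "cov M h (\<lambda>\<omega>. f \<omega> + g \<omega>) = cov M h f + cov M h g"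
  using cov_add_left[OF assms] by (simp add: cov_commute)

lemma cov_scale_right:
  assumes "bdd_rv M f" "bdd_rv M h"
  shows "cov M h (\<lambda>\<omega>. c * f \<omega>) = c * cov M h f"
  using cov_scale_left[OF assms] by (simp add: cov_commute)

lemma cov_sum_right:
  assumes "\<And>i. i \<in> I \<Longrightarrow> bdd_rv M (f i)" "bdd_rv M h"
  shows "cov M h (\<lambda>\<omega>. \<Sum>i\<in>I. f i \<omega>) = (\<Sum>i\<in>I. cov M h (f i))"
  using cov_sum_left[OF assms] by (simp add: cov_commute)

lemma cov_diff_const_left:
  assumes "bdd_rv M f" "bdd_rv M h"
  shows "cov M (\<lambda>\<omega>. f \<omega> - c) h = cov M f h"
  using cov_add_left[OF assms(1) bdd_rv_const assms(2), of "- c"] by simp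

lemma cov_diff_const_right:
  assumes "bdd_rv M f" "bdd_rv M h"
  shows "cov M h (\<lambda>\<omega>. f \<omega> - c) = cov M h f"
  using cov_diff_const_left[OF assms] by (simp add: cov_commute)

lemma var_nonneg: "cov M f f \<ge> 0"
  unfolding cov_def by (rule integral_nonneg_AE) auto

lemma sd_nonneg [simp]: "sd M f \<ge> 0"
  by (simp add: sd_def var_nonneg)

lemma sd_sq: "(sd M f)\<^sup>2 = cov M f f"
  by (simp add: sd_def var_nonneg)

lemma var_le_square: "bdd_rv M f \<Longrightarrow> cov M f f \<le> expectation (\<lambda>\<omega>. (f \<omega>)\<^sup>2)"
  by (simp add: cov_eq power2_eq_square)

lemma var_add_scale:
  assumes f: "bdd_rv M f" and g: "bdd_rv M g"
  shows "cov M (\<lambda>\<omega>. f \<omega> + c * g \<omega>) (\<lambda>\<omega>. f \<omega> + c * g \<omega>) = cov M f f + 2 * c * cov M f g + c\<^sup>2 * cov M g g"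
proof -
  note b = f g bdd_rv_scale[OF g, of c] bdd_rv_add[OF f bdd_rv_scale[OF g, of c]]
  have "cov M (\<lambda>\<omega>. f \<omega> + c * g \<omega>) (\<lambda>\<omega>. f \<omega> + c * g \<omega>)
    = cov M f f + c * cov M f g + (c * cov M g f + c * (c * cov M g g))"
    using b by (simp add: cov_add_left cov_add_right cov_scale_left cov_scale_right distrib_left)
  then show ?thesis by (simp add: cov_commute[of M g f] power2_eq_square)
qed

lemma cov_le_sd:
  assumes f: "bdd_rv M f" and g: "bdd_rv M g"
  shows "\<bar>cov M f g\<bar> \<le> sd M f * sd M g"
proof -
  have nn: "0 \<le> cov M f f + 2 * c * cov M f g + c\<^sup>2 * cov M g g" for c
    using var_nonneg[of "\<lambda>\<omega>. f \<omega> + c * g \<omega>"] var_add_scale[OF f g, of c] by simp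
  have "(cov M f g)\<^sup>2 \<le> cov M f f * cov M g g"
  proof (cases "cov M g g = 0")
    case True
    have "cov M f g = 0"
    proof (rule ccontr)
      assume "cov M f g \<noteq> 0"
      with nn[of "- (cov M f f + 1) / (2 * cov M f g)"] True show False by (simp add: field_simps)
    qed
    then show ?thesis by (simp add: True)
  next
    case False
    then have "cov M g g > 0" using var_nonneg[of g] by simp
    with nn[of "- cov M f g / cov M g g"] show ?thesis by (simp add: field_simps power2_eq_square)
  qed
  then have "(cov M f g)\<^sup>2 \<le> (sd M f * sd M g)\<^sup>2" by (simp add: power_mult_distrib sd_sq)
  then show ?thesis by (metis abs_le_square_iff abs_of_nonneg mult_nonneg_nonneg sd_nonneg)
qed

lemma sd_add_le:
  assumes f: "bdd_rv M f" and g: "bdd_rv M g"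
  shows "sd M (\<lambda>\<omega>. f \<omega> + g \<omega>) \<le> sd M f + sd M g"
proof (rule power2_le_imp_le)
  have "(sd M (\<lambda>\<omega>. f \<omega> + g \<omega>))\<^sup>2 = cov M f f + 2 * cov M f g + cov M g g"
    using var_add_scale[OF f g, of 1] by (simp add: sd_sq)
  also have "\<dots> \<le> (sd M f + sd M g)\<^sup>2"
    using cov_le_sd[OF f g] by (simp add: power2_sum sd_sq)
  finally show "(sd M (\<lambda>\<omega>. f \<omega> + g \<omega>))\<^sup>2 \<le> (sd M f + sd M g)\<^sup>2" .
qed simp

lemma sd_scale: "bdd_rv M f \<Longrightarrow> sd M (\<lambda>\<omega>. c * f \<omega>) = \<bar>c\<bar> * sd M f"
  by (simp add: sd_def cov_scale_left cov_scale_right bdd_rv_scale real_sqrt_mult mult.assoc[symmetric])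

lemma sd_diff_le:
  assumes f: "bdd_rv M f" and g: "bdd_rv M g"
  shows "\<bar>sd M f - sd M g\<bar> \<le> sd M (\<lambda>\<omega>. f \<omega> - g \<omega>)"
proof -
  have d: "bdd_rv M (\<lambda>\<omega>. f \<omega> - g \<omega>)" and d': "bdd_rv M (\<lambda>\<omega>. (-1) * (f \<omega> - g \<omega>))"
    by (rule bdd_rv_diff[OF f g], rule bdd_rv_scale, rule bdd_rv_diff[OF f g])
  show ?thesis
    using sd_add_le[OF g d] sd_add_le[OF f d'] sd_scale[OF d, of "-1"] by simp
qed

lemma sd_diff_const:
  assumes "bdd_rv M f" shows "sd M (\<lambda>\<omega>. f \<omega> - c) = sd M f"
  using assms by (simp add: sd_def cov_diff_const_left cov_diff_const_right bdd_rv_diff)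

lemma sd_le_1:
  assumes "f \<in> borel_measurable M" "\<And>\<omega>. \<omega> \<in> space M \<Longrightarrow> \<bar>f \<omega>\<bar> \<le> 1"
  shows "sd M f \<le> 1"
proof -
  have f: "bdd_rv M f" using assms by (rule bdd_rvI)
  have "cov M f f \<le> expectation (\<lambda>\<omega>. (f \<omega>)\<^sup>2)" by (rule var_le_square[OF f])
  also have "\<dots> \<le> expectation (\<lambda>_. 1)"
    by (intro integral_mono) (use f assms in \<open>auto intro!: bdd_rv_integrable simp: abs_square_le_1\<close>)
  finally show ?thesis by (simp add: sd_def prob_space)
qed

lemma expectation_abs_le_sd:
  assumes f: "bdd_rv M f" and "expectation f = 0"
  shows "expectation (\<lambda>\<omega>. \<bar>f \<omega>\<bar>) \<le> sd M f"
proof (rule power2_le_imp_le)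
  have a: "bdd_rv M (\<lambda>\<omega>. \<bar>f \<omega>\<bar>)" using f by auto
  have "0 \<le> cov M (\<lambda>\<omega>. \<bar>f \<omega>\<bar>) (\<lambda>\<omega>. \<bar>f \<omega>\<bar>)" by (rule var_nonneg)
  then show "(expectation (\<lambda>\<omega>. \<bar>f \<omega>\<bar>))\<^sup>2 \<le> (sd M f)\<^sup>2"
    using assms by (simp add: cov_eq[OF a a] cov_eq[OF f f] sd_sq[unfolded power2_eq_square] power2_eq_square)
qed simp

lemma iexp_expectation_dist:
  fixes f g :: "'a \<Rightarrow> real"
  assumes f: "bdd_rv M f" and g: "bdd_rv M g"
  shows "cmod (expectation (\<lambda>\<omega>. iexp (f \<omega>)) - expectation (\<lambda>\<omega>. iexp (g \<omega>))) \<le> expectation (\<lambda>\<omega>. \<bar>f \<omega> - g \<omega>\<bar>)"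
proof -
  have i: "integrable M (\<lambda>\<omega>. iexp (h \<omega>))" if "bdd_rv M h" for h
    using that by (intro integrable_const_bound[where B=1]) (auto dest: bdd_rv_measurable)
  have "cmod (expectation (\<lambda>\<omega>. iexp (f \<omega>)) - expectation (\<lambda>\<omega>. iexp (g \<omega>))) =
    cmod (expectation (\<lambda>\<omega>. iexp (f \<omega>) - iexp (g \<omega>)))" using i[OF f] i[OF g] by simp
  also have "\<dots> \<le> expectation (\<lambda>\<omega>. cmod (iexp (f \<omega>) - iexp (g \<omega>)))" by (rule integral_norm_bound)
  also have "\<dots> \<le> expectation (\<lambda>\<omega>. \<bar>f \<omega> - g \<omega>\<bar>)"
  proof (rule integral_mono)
    show "integrable M (\<lambda>\<omega>. cmod (iexp (f \<omega>) - iexp (g \<omega>)))" using i[OF f] i[OF g] by auto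
    show "integrable M (\<lambda>\<omega>. \<bar>f \<omega> - g \<omega>\<bar>)" by (intro bdd_rv_integrable bdd_rv_abs bdd_rv_diff f g)
    fix \<omega>
    have "iexp (f \<omega>) - iexp (g \<omega>) = iexp (g \<omega>) * (iexp (f \<omega> - g \<omega>) - 1)"
      by (simp add: algebra_simps exp_add[symmetric])
    then have "cmod (iexp (f \<omega>) - iexp (g \<omega>)) = cmod (iexp (f \<omega> - g \<omega>) - 1)" by (simp add: norm_mult)
    also have "\<dots> \<le> \<bar>f \<omega> - g \<omega>\<bar>" using iexp_approx1[of "f \<omega> - g \<omega>" 0] by simp
    finally show "cmod (iexp (f \<omega>) - iexp (g \<omega>)) \<le> \<bar>f \<omega> - g \<omega>\<bar>" .
  qed
  finally show ?thesis .
qed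

text \<open>
  The mixing bound speaks of real variables. Splitting both complex factors into real and imaginary
  parts gives four covariances, each at most \<open>\<rho>\<close> since the parts have standard deviation at most 1.
\<close>
lemma complex_cov_le:
  fixes A B :: "'a \<Rightarrow> complex"
  assumes mA: "A \<in> borel_measurable G" and mB: "B \<in> borel_measurable H"
    and sub: "subalgebra M G" "subalgebra M H"
    and A1: "\<And>\<omega>. cmod (A \<omega>) \<le> 1" and B1: "\<And>\<omega>. cmod (B \<omega>) \<le> 1"
    and c: "\<And>f g. f \<in> borel_measurable G \<Longrightarrow> g \<in> borel_measurable H \<Longrightarrow> bdd_rv M f \<Longrightarrow> bdd_rv M g \<Longrightarrow>
              \<bar>cov M f g\<bar> \<le> \<rho> * (sd M f * sd M g)"
    and r: "\<rho> \<ge> 0"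
  shows "cmod (expectation (\<lambda>\<omega>. A \<omega> * B \<omega>) - expectation A * expectation B) \<le> 4 * \<rho>"
proof -
  have mA': "A \<in> borel_measurable M" and mB': "B \<in> borel_measurable M"
    using measurable_from_subalg[OF sub(1) mA] measurable_from_subalg[OF sub(2) mB] by auto
  have iA: "integrable M A" and iB: "integrable M B"
    using mA' mB' A1 B1 by (auto intro!: integrable_const_bound[where B=1])
  have iAB: "integrable M (\<lambda>\<omega>. A \<omega> * B \<omega>)"
    using mA' mB' A1 B1 by (auto intro!: integrable_const_bound[where B=1] simp: norm_mult mult_le_one)
  have rA: "bdd_rv M (\<lambda>\<omega>. Re (A \<omega>))" and jA: "bdd_rv M (\<lambda>\<omega>. Im (A \<omega>))"
    and rB: "bdd_rv M (\<lambda>\<omega>. Re (B \<omega>))" and jB: "bdd_rv M (\<lambda>\<omega>. Im (B \<omega>))"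
    using mA' mB' A1 B1 by (auto intro!: bdd_rvI[where B=1] intro: order_trans[OF abs_Re_le_cmod] order_trans[OF abs_Im_le_cmod])
  have one: "\<bar>cov M f g\<bar> \<le> \<rho>" if "f \<in> borel_measurable G" "g \<in> borel_measurable H"
    "bdd_rv M f" "bdd_rv M g" "\<And>\<omega>. \<bar>f \<omega>\<bar> \<le> 1" "\<And>\<omega>. \<bar>g \<omega>\<bar> \<le> 1" for f g
  proof -
    have "sd M f * sd M g \<le> 1" using that by (intro mult_le_one sd_le_1) (auto dest: bdd_rv_measurable)
    then have "\<rho> * (sd M f * sd M g) \<le> \<rho> * 1" using r by (intro mult_left_mono) auto
    then show ?thesis using c[OF that(1-4)] by simp
  qed
  have mm: "(\<lambda>\<omega>. Re (A \<omega>)) \<in> borel_measurable G" "(\<lambda>\<omega>. Im (A \<omega>)) \<in> borel_measurable G"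
    "(\<lambda>\<omega>. Re (B \<omega>)) \<in> borel_measurable H" "(\<lambda>\<omega>. Im (B \<omega>)) \<in> borel_measurable H"
    using mA mB by auto
  have bb: "\<bar>Re (A \<omega>)\<bar> \<le> 1" "\<bar>Im (A \<omega>)\<bar> \<le> 1" "\<bar>Re (B \<omega>)\<bar> \<le> 1" "\<bar>Im (B \<omega>)\<bar> \<le> 1" for \<omega>
    using A1 B1 by (auto intro: order_trans[OF abs_Re_le_cmod] order_trans[OF abs_Im_le_cmod])
  have E: "Re (expectation f) = expectation (\<lambda>\<omega>. Re (f \<omega>))" "Im (expectation f) = expectation (\<lambda>\<omega>. Im (f \<omega>))"
    if "integrable M f" for f using that by auto
  have re: "Re (expectation (\<lambda>\<omega>. A \<omega> * B \<omega>) - expectation A * expectation B) =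
    cov M (\<lambda>\<omega>. Re (A \<omega>)) (\<lambda>\<omega>. Re (B \<omega>)) - cov M (\<lambda>\<omega>. Im (A \<omega>)) (\<lambda>\<omega>. Im (B \<omega>))"
    using rA rB jA jB by (simp add: E[OF iAB] E[OF iA] E[OF iB] cov_eq bdd_rv_mult bdd_rv_integrable)
  have im: "Im (expectation (\<lambda>\<omega>. A \<omega> * B \<omega>) - expectation A * expectation B) =
    cov M (\<lambda>\<omega>. Re (A \<omega>)) (\<lambda>\<omega>. Im (B \<omega>)) + cov M (\<lambda>\<omega>. Im (A \<omega>)) (\<lambda>\<omega>. Re (B \<omega>))"
    using rA rB jA jB by (simp add: E[OF iAB] E[OF iA] E[OF iB] cov_eq bdd_rv_mult bdd_rv_integrable)
  have "cmod (expectation (\<lambda>\<omega>. A \<omega> * B \<omega>) - expectation A * expectation B) \<le> (\<rho> + \<rho>) + (\<rho> + \<rho>)"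
    using one[OF mm(1) mm(3) rA rB bb(1) bb(3)] one[OF mm(2) mm(4) jA jB bb(2) bb(4)]
      one[OF mm(1) mm(4) rA jB bb(1) bb(4)] one[OF mm(2) mm(3) jA rB bb(2) bb(3)]
    by (intro order_trans[OF cmod_le] add_mono) (auto simp only: re im)
  then show ?thesis by simp
qed

end

text \<open>
  Turns the remainder of the second-order expansion of a characteristic function into a moment
  of any order between 2 and 3.
\<close>
lemma min_square_cube_le_powr:
  fixes x p :: real
  assumes "2 \<le> p" "p \<le> 3" "x \<ge> 0"
  shows "min (6 * x\<^sup>2) (x ^ 3) \<le> 6 * x powr p"
proof (cases "x \<le> 1")
  case True
  have "x ^ 3 \<le> x powr p"
  proof (cases "x = 0")
    case False
    with assms True have "x powr 3 \<le> x powr p" by (intro powr_mono') auto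
    then show ?thesis using False assms by (simp add: powr_numeral)
  qed simp
  also have "\<dots> \<le> 6 * x powr p" by simp
  finally show ?thesis by simp
next
  case False
  then have "x powr 2 \<le> x powr p" using assms by (intro powr_mono) auto
  then show ?thesis using False by (simp add: powr_numeral)
qed

lemma abs_sum_powr_le:
  fixes x :: "'i \<Rightarrow> real"
  assumes "finite I" "p \<ge> 0"
  shows "\<bar>\<Sum>i\<in>I. x i\<bar> powr p \<le> real (card I) powr p * (\<Sum>i\<in>I. \<bar>x i\<bar> powr p)"
proof (cases "I = {}")
  case False
  obtain j where j: "j \<in> I" "\<And>i. i \<in> I \<Longrightarrow> \<bar>x i\<bar> \<le> \<bar>x j\<bar>"
    using obtains_MAX[OF assms(1) False, of "\<lambda>i. \<bar>x i\<bar>"] by (metis Max_ge assms(1) finite_imageI imageI)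
  have "\<bar>\<Sum>i\<in>I. x i\<bar> \<le> (\<Sum>i\<in>I. \<bar>x j\<bar>)" using j by (intro order_trans[OF sum_abs] sum_mono) auto
  then have "\<bar>\<Sum>i\<in>I. x i\<bar> powr p \<le> (real (card I) * \<bar>x j\<bar>) powr p" using assms by (intro powr_mono2) auto
  also have "\<dots> = real (card I) powr p * \<bar>x j\<bar> powr p" by (simp add: powr_mult)
  also have "\<bar>x j\<bar> powr p \<le> (\<Sum>i\<in>I. \<bar>x i\<bar> powr p)" using j assms by (intro member_le_sum) auto
  finally show ?thesis by (simp add: mult_left_mono)
qed simp

lemma exp_neg_linear_approx:
  fixes x :: real
  assumes x0: "x \<ge> 0"
  shows "\<bar>(1 - x) - exp (- x)\<bar> \<le> x\<^sup>2"
proof -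
  have "1 - x \<le> exp (- x)" using exp_ge_add_one_self[of "- x"] by simp
  moreover have "exp (- x) \<le> 1 - x + x\<^sup>2"
  proof (cases "x \<le> 1")
    case True
    have "exp (- x) * exp x \<le> (1 - x + x\<^sup>2) * (1 + x)"
      using x0 by (simp add: exp_minus algebra_simps power2_eq_square)
    also have "\<dots> \<le> (1 - x + x\<^sup>2) * exp x"
      using True x0 by (intro mult_left_mono exp_ge_add_one_self) auto
    finally show ?thesis by simp
  next
    case False
    then have "1 * x \<le> x * x" by (intro mult_right_mono) auto
    then have "1 - x + x\<^sup>2 \<ge> 1" by (simp add: power2_eq_square)
    moreover have "exp (- x) \<le> 1" using x0 by simp
    ultimately show ?thesis by linarith
  qed
  ultimately show ?thesis by simp
qed

lemma exp_neg_diff_le: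
  fixes x y :: real
  assumes "x \<ge> 0" "y \<ge> 0"
  shows "\<bar>exp (- x) - exp (- y)\<bar> \<le> \<bar>x - y\<bar>"
proof -
  have *: "exp (- a) - exp (- b) \<le> b - a" if "0 \<le> a" "a \<le> b" for a b :: real
  proof -
    have "exp (- a) - exp (- b) = exp (- a) * (1 - exp (a - b))"
      by (simp add: right_diff_distrib exp_add[symmetric])
    also have "\<dots> \<le> 1 * (1 - exp (a - b))" using that by (intro mult_right_mono) auto
    also have "\<dots> \<le> b - a" using exp_ge_add_one_self[of "a - b"] by (simp only: mult_1)
    finally show ?thesis .
  qed
  show ?thesis
  proof (cases "x \<le> y")
    case True with *[of x y] assms show ?thesis by (simp add: abs_if)
  next
    case False with *[of y x] assms show ?thesis by (simp add: abs_if)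
  qed
qed

section \<open>A central limit theorem for mixing blocks\<close>

text \<open>
  \<open>U 0, \<dots>, U (K - 1)\<close> are centred block variables, and \<open>G a b\<close> contains the information of the
  blocks \<open>a, \<dots>, b - 1\<close>. A block variable may look into the next block, so mixing is only
  assumed between groups of blocks that leave out two blocks in between.
\<close>
locale mixing_blocks = prob_space M for M :: "'a measure" +
  fixes U :: "nat \<Rightarrow> 'a \<Rightarrow> real" and G :: "nat \<Rightarrow> nat \<Rightarrow> 'a measure"
    and K :: nat and \<rho> p C :: real
  assumes K: "K > 0" and rho: "\<rho> \<ge> 0" and p: "2 < p" "p \<le> 3" and C: "C \<ge> 0"
    and U_bdd: "\<And>i. i < K \<Longrightarrow> bdd_rv M (U i)"
    and U_mean: "\<And>i. i < K \<Longrightarrow> expectation (U i) = 0"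
    and U_moment: "\<And>i. i < K \<Longrightarrow> expectation (\<lambda>\<omega>. \<bar>U i \<omega>\<bar> powr p) \<le> C"
    and G_sub: "\<And>a b. subalgebra M (G a b)"
    and U_meas: "\<And>i a b. a \<le> i \<Longrightarrow> i < b \<Longrightarrow> b \<le> K \<Longrightarrow> U i \<in> borel_measurable (G a b)"
    and mixing: "\<And>a b c d f g. a < b \<Longrightarrow> b + 2 \<le> c \<Longrightarrow> c < d \<Longrightarrow> d \<le> K \<Longrightarrow>
        f \<in> borel_measurable (G a b) \<Longrightarrow> g \<in> borel_measurable (G c d) \<Longrightarrow> bdd_rv M f \<Longrightarrow> bdd_rv M g \<Longrightarrow>
        \<bar>cov M f g\<bar> \<le> \<rho> * (sd M f * sd M g)"
begin

text \<open>
  A block has at most five neighbours, itself included, to which the mixing bound does not apply. \<open>D\<close> therefore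
  bounds the sum of the covariances of one block with all others, and the variance of any partial sum
  is at most \<open>D\<close> per summand.
\<close>
definition D :: real where "D = (1 + C) * (5 + real K * \<rho>)"

lemma D_ge: "D \<ge> 0" "1 + C \<le> D"
proof -
  have "(1 + C) * 1 \<le> (1 + C) * (5 + real K * \<rho>)"
    using rho C by (intro mult_left_mono) auto
  then show "1 + C \<le> D" by (simp add: D_def)
  with C show "D \<ge> 0" by simp
qed

lemma var_U_le: assumes "i < K" shows "cov M (U i) (U i) \<le> 1 + C"
proof -
  have b: "bdd_rv M (\<lambda>\<omega>. \<bar>U i \<omega>\<bar> powr p)" using U_bdd[OF assms] p by (intro bdd_rv_powr) auto
  have sq: "x\<^sup>2 \<le> 1 + \<bar>x\<bar> powr p" for x :: real
  proof (cases "\<bar>x\<bar> \<le> 1")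
    case True
    then have "x\<^sup>2 \<le> 1" by (simp add: abs_square_le_1)
    also have "1 \<le> 1 + \<bar>x\<bar> powr p" by simp
    finally show ?thesis .
  next
    case False
    then have "\<bar>x\<bar> powr 2 \<le> \<bar>x\<bar> powr p" using p by (intro powr_mono) auto
    then show ?thesis using False by (auto simp: powr_numeral)
  qed
  have "cov M (U i) (U i) \<le> expectation (\<lambda>\<omega>. (U i \<omega>)\<^sup>2)" by (rule var_le_square[OF U_bdd[OF assms]])
  also have "\<dots> \<le> expectation (\<lambda>\<omega>. 1 + \<bar>U i \<omega>\<bar> powr p)"
    by (intro integral_mono bdd_rv_integrable bdd_rv_add bdd_rv_const b bdd_rv_power U_bdd[OF assms] sq)
  also have "\<dots> \<le> 1 + C" using bdd_rv_integrable[OF b] U_moment[OF assms] by (simp add: prob_space)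
  finally show ?thesis .
qed

lemma sd_U_le: assumes "i < K" shows "sd M (U i) \<le> sqrt (1 + C)"
  using var_U_le[OF assms] by (simp add: sd_def)

lemma cov_U_le: assumes "i < K" "j < K" shows "\<bar>cov M (U i) (U j)\<bar> \<le> 1 + C"
proof -
  have "\<bar>cov M (U i) (U j)\<bar> \<le> sd M (U i) * sd M (U j)" using assms by (intro cov_le_sd U_bdd)
  also have "\<dots> \<le> sqrt (1 + C) * sqrt (1 + C)" using assms C by (intro mult_mono sd_U_le) auto
  finally show ?thesis using C by simp
qed

lemma cov_U_far: assumes "i < K" "j < K" "i + 3 \<le> j" shows "\<bar>cov M (U i) (U j)\<bar> \<le> \<rho> * (1 + C)"
proof -
  have "\<bar>cov M (U i) (U j)\<bar> \<le> \<rho> * (sd M (U i) * sd M (U j))"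
    by (rule mixing[of i "Suc i" j "Suc j"]) (use assms in \<open>auto intro!: U_bdd U_meas\<close>)
  also have "sd M (U i) * sd M (U j) \<le> sqrt (1 + C) * sqrt (1 + C)"
    using assms C by (intro mult_mono sd_U_le) auto
  finally show ?thesis using C rho by (simp add: mult_left_mono)
qed

text \<open>
  Row sums of the covariance matrix: the five blocks at distance at most two contribute \<open>1 + C\<close> each,
  and the remaining ones \<open>\<rho> (1 + C)\<close> each.
\<close>
lemma var_sum_U_le:
  assumes I: "I \<subseteq> {..<K}"
  shows "cov M (\<lambda>\<omega>. \<Sum>i\<in>I. U i \<omega>) (\<lambda>\<omega>. \<Sum>i\<in>I. U i \<omega>) \<le> real (card I) * D"
proof -
  have fin: "finite I" using I finite_subset by blast
  have b: "\<And>i. i \<in> I \<Longrightarrow> bdd_rv M (U i)" using I U_bdd by auto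
  have row: "(\<Sum>j\<in>I. cov M (U i) (U j)) \<le> D" if i: "i \<in> I" for i
  proof -
    have "(\<Sum>j\<in>I. cov M (U i) (U j)) \<le> (\<Sum>j\<in>I. (1 + C) * (of_bool (j \<in> {i - 2..i + 2}) + \<rho>))"
    proof (rule sum_mono)
      fix j assume j: "j \<in> I"
      have "i < K" "j < K" using i j I by auto
      then show "cov M (U i) (U j) \<le> (1 + C) * (of_bool (j \<in> {i - 2..i + 2}) + \<rho>)"
      proof (cases "j \<in> {i - 2..i + 2}")
        case True
        have "(1 + C) * 1 \<le> (1 + C) * (1 + \<rho>)" using C rho by (intro mult_left_mono) auto
        then show ?thesis using True cov_U_le[OF \<open>i < K\<close> \<open>j < K\<close>] by (simp add: abs_le_iff)
      next
        case False
        then have "i + 3 \<le> j \<or> j + 3 \<le> i" by auto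
        then have "\<bar>cov M (U i) (U j)\<bar> \<le> \<rho> * (1 + C)"
          using cov_U_far[of i j] cov_U_far[of j i] \<open>i < K\<close> \<open>j < K\<close> by (auto simp: cov_commute)
        moreover have z: "of_bool (j \<in> {i - 2..i + 2}) = (0::real)" using False by (simp only: of_bool_def if_False)
        ultimately show ?thesis unfolding z by (simp add: abs_le_iff mult.commute)
      qed
    qed
    also have "\<dots> = (1 + C) * ((\<Sum>j\<in>I. of_bool (j \<in> {i - 2..i + 2})) + real (card I) * \<rho>)"
      by (simp add: sum_distrib_left[symmetric] sum.distrib)
    also have "\<dots> \<le> (1 + C) * (5 + real K * \<rho>)"
    proof (intro mult_left_mono add_mono mult_right_mono)
      have "(\<Sum>j\<in>I. of_bool (j \<in> {i - 2..i + 2})) = real (card (I \<inter> {i - 2..i + 2}))"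
        using fin by (simp add: of_bool_def sum.If_cases Int_def)
      also have "\<dots> \<le> real (card {i - 2..i + 2})" by (intro of_nat_mono card_mono) auto
      also have "\<dots> \<le> 5" by simp
      finally show "(\<Sum>j\<in>I. of_bool (j \<in> {i - 2..i + 2})) \<le> (5::real)" .
      show "real (card I) \<le> real K" using card_mono[OF finite_lessThan I] by simp
    qed (use C rho in auto)
    finally show ?thesis by (simp add: D_def)
  qed
  have "cov M (\<lambda>\<omega>. \<Sum>i\<in>I. U i \<omega>) (\<lambda>\<omega>. \<Sum>i\<in>I. U i \<omega>) = (\<Sum>i\<in>I. \<Sum>j\<in>I. cov M (U i) (U j))"
    using b by (simp add: cov_sum_left cov_sum_right bdd_rv_sum)
  also have "\<dots> \<le> (\<Sum>i\<in>I. D)" by (intro sum_mono row)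
  finally show ?thesis by simp
qed

text \<open>
  The \<open>j\<close>-th group of \<open>m\<close> consecutive blocks without its last two, so that
  different groups satisfy the separation that mixing requires.
\<close>
definition V :: "nat \<Rightarrow> nat \<Rightarrow> 'a \<Rightarrow> real" where
  "V m j \<omega> = (\<Sum>i\<in>{j * m..<j * m + (m - 2)}. U i \<omega>)"

lemma V_index: "j < K div m \<Longrightarrow> m \<ge> 3 \<Longrightarrow> j * m + m \<le> K"
proof -
  assume "j < K div m" "m \<ge> 3"
  then have "Suc j * m \<le> K div m * m" by (intro mult_le_mono1) simp
  also have "\<dots> \<le> K" by simp
  finally show ?thesis by simp
qed

lemma V_bdd: assumes "j < K div m" "m \<ge> 3" shows "bdd_rv M (V m j)"
  unfolding V_def[abs_def] using V_index[OF assms] by (intro bdd_rv_sum U_bdd) auto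

lemma V_mean: assumes "j < K div m" "m \<ge> 3" shows "expectation (V m j) = 0"
proof -
  have "expectation (V m j) = (\<Sum>i\<in>{j * m..<j * m + (m - 2)}. expectation (U i))"
    unfolding V_def[abs_def] using V_index[OF assms] U_bdd
    by (intro Bochner_Integration.integral_sum bdd_rv_integrable) auto
  also have "\<dots> = 0" using V_index[OF assms] U_mean by (intro sum.neutral) auto
  finally show ?thesis .
qed

lemma V_moment:
  assumes "j < K div m" "m \<ge> 3"
  shows "expectation (\<lambda>\<omega>. \<bar>V m j \<omega>\<bar> powr p) \<le> real m powr p * (real m * C)"
proof -
  let ?I = "{j * m..<j * m + (m - 2)}"
  have ii: "i < K" if "i \<in> ?I" for i using that V_index[OF assms] by auto
  have b: "bdd_rv M (\<lambda>\<omega>. \<bar>U i \<omega>\<bar> powr p)" if "i \<in> ?I" for i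
    using that ii U_bdd p by (intro bdd_rv_powr) auto
  have "expectation (\<lambda>\<omega>. \<bar>V m j \<omega>\<bar> powr p) \<le> expectation (\<lambda>\<omega>. real m powr p * (\<Sum>i\<in>?I. \<bar>U i \<omega>\<bar> powr p))"
  proof (rule integral_mono)
    show "integrable M (\<lambda>\<omega>. \<bar>V m j \<omega>\<bar> powr p)"
      using V_bdd[OF assms] p by (intro bdd_rv_integrable bdd_rv_powr) auto
    show "integrable M (\<lambda>\<omega>. real m powr p * (\<Sum>i\<in>?I. \<bar>U i \<omega>\<bar> powr p))"
      using b by (intro bdd_rv_integrable bdd_rv_scale bdd_rv_sum)
    fix \<omega>
    have "\<bar>V m j \<omega>\<bar> powr p \<le> real (card ?I) powr p * (\<Sum>i\<in>?I. \<bar>U i \<omega>\<bar> powr p)"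
      unfolding V_def using p by (intro abs_sum_powr_le) auto
    also have "\<dots> \<le> real m powr p * (\<Sum>i\<in>?I. \<bar>U i \<omega>\<bar> powr p)"
      using p by (intro mult_right_mono powr_mono2 sum_nonneg) auto
    finally show "\<bar>V m j \<omega>\<bar> powr p \<le> real m powr p * (\<Sum>i\<in>?I. \<bar>U i \<omega>\<bar> powr p)" .
  qed
  also have "\<dots> = real m powr p * (\<Sum>i\<in>?I. expectation (\<lambda>\<omega>. \<bar>U i \<omega>\<bar> powr p))"
    using b by (simp add: bdd_rv_integrable)
  also have "\<dots> \<le> real m powr p * (\<Sum>i\<in>?I. C)"
    using ii U_moment by (intro mult_left_mono sum_mono) auto
  also have "\<dots> \<le> real m powr p * (real m * C)" using C by (intro mult_left_mono) (auto intro: mult_right_mono)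
  finally show ?thesis .
qed

lemma V_var: assumes "j < K div m" "m \<ge> 3" shows "cov M (V m j) (V m j) \<le> real m * D"
proof -
  have "cov M (V m j) (V m j) \<le> real (card {j * m..<j * m + (m - 2)}) * D"
    unfolding V_def[abs_def] using V_index[OF assms] by (intro var_sum_U_le) auto
  also have "\<dots> \<le> real m * D" using D_ge by (intro mult_right_mono) auto
  finally show ?thesis .
qed

lemma V_meas:
  assumes "j < K div m" "m \<ge> 3" "a \<le> j * m" "j * m + (m - 2) \<le> b" "b \<le> K"
  shows "V m j \<in> borel_measurable (G a b)"
  unfolding V_def[abs_def] using assms by (intro borel_measurable_sum U_meas) auto

lemma V_cov:
  assumes "i < j" "j < K div m" "m \<ge> 3"
  shows "\<bar>cov M (V m i) (V m j)\<bar> \<le> \<rho> * (real m * D)"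
proof -
  have i: "i < K div m" using assms by simp
  have "Suc i * m \<le> j * m" using assms by (intro mult_le_mono1) simp
  then have le: "i * m + (m - 2) + 2 \<le> j * m" using assms by simp
  have "\<bar>cov M (V m i) (V m j)\<bar> \<le> \<rho> * (sd M (V m i) * sd M (V m j))"
    by (rule mixing[of "i*m" "i*m+(m-2)" "j*m" "j*m+(m-2)"])
       (use assms i le V_index[OF assms(2,3)] in \<open>auto intro!: V_bdd V_meas\<close>)
  also have "sd M (V m i) * sd M (V m j) \<le> sqrt (real m * D) * sqrt (real m * D)"
    using V_var[OF i assms(3)] V_var[OF assms(2,3)] D_ge by (intro mult_mono) (auto simp: sd_def var_nonneg)
  finally show ?thesis using D_ge rho by (simp add: mult_left_mono)
qed

text \<open>
  The groups are decoupled one at a time, at the price of \<open>4\<rho>\<close> for each.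
\<close>
lemma char_product:
  assumes m: "m \<ge> 3" and N: "N \<le> K div m"
  shows "cmod (expectation (\<lambda>\<omega>. \<Prod>j<N. iexp (t * V m j \<omega>)) - (\<Prod>j<N. expectation (\<lambda>\<omega>. iexp (t * V m j \<omega>)))) \<le> 4 * real N * \<rho>"
  using N
proof (induction N)
  case 0 then show ?case by (simp add: prob_space)
next
  case (Suc N)
  let ?A = "\<lambda>\<omega>. \<Prod>j<N. iexp (t * V m j \<omega>)" and ?B = "\<lambda>\<omega>. iexp (t * V m N \<omega>)"
  have NK: "N < K div m" using Suc by simp
  have Bm: "?B \<in> borel_measurable (G (N*m) (N*m+(m-2)))"
    using V_meas[OF NK m order_refl order_refl] V_index[OF NK m] by simp
  have "cmod (expectation (\<lambda>\<omega>. ?A \<omega> * ?B \<omega>) - expectation ?A * expectation ?B) \<le> 4 * \<rho>"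
  proof (cases "N = 0")
    case True then show ?thesis using rho by (simp add: prob_space)
  next
    case False
    then obtain N' where N': "N = Suc N'" by (cases N) auto
    let ?b = "N' * m + (m - 2)"
    have b: "?b + 2 \<le> N * m" using m by (simp add: N')
    show ?thesis
    proof (rule complex_cov_le[where G="G 0 ?b" and H="G (N*m) (N*m+(m-2))"])
      have bK: "?b \<le> K" using b V_index[OF NK m] by simp
      have "V m j \<in> borel_measurable (G 0 ?b)" if "j < N" for j
      proof (rule V_meas)
        have "j * m \<le> N' * m" using that N' by (intro mult_le_mono1) simp
        then show "j * m + (m - 2) \<le> ?b" by simp
      qed (use that NK m bK in auto)
      then show "?A \<in> borel_measurable (G 0 ?b)" by (intro borel_measurable_prod) auto
      show "\<bar>cov M f g\<bar> \<le> \<rho> * (sd M f * sd M g)"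
        if "f \<in> borel_measurable (G 0 ?b)" "g \<in> borel_measurable (G (N*m) (N*m+(m-2)))" "bdd_rv M f" "bdd_rv M g" for f g
        using that b V_index[OF NK m] m by (intro mixing[of 0 ?b "N*m" "N*m+(m-2)"]) auto
    qed (use Bm G_sub rho in \<open>auto simp: prod_norm[symmetric]\<close>)
  qed
  moreover have "cmod (expectation ?A * expectation ?B - (\<Prod>j<N. expectation (\<lambda>\<omega>. iexp (t * V m j \<omega>))) * expectation ?B) \<le> 4 * real N * \<rho>"
  proof -
    have "cmod (expectation ?B) \<le> expectation (\<lambda>\<omega>. cmod (?B \<omega>))" by (rule integral_norm_bound)
    then have "cmod (expectation ?B) \<le> 1" by (simp add: prob_space)
    then have "cmod ((expectation ?A - (\<Prod>j<N. expectation (\<lambda>\<omega>. iexp (t * V m j \<omega>)))) * expectation ?B) \<le> 4 * real N * \<rho> * 1"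
      unfolding norm_mult using Suc rho by (intro mult_mono) auto
    then show ?thesis by (simp add: left_diff_distrib)
  qed
  ultimately have "cmod (expectation (\<lambda>\<omega>. ?A \<omega> * ?B \<omega>) - (\<Prod>j<N. expectation (\<lambda>\<omega>. iexp (t * V m j \<omega>))) * expectation ?B) \<le> 4 * \<rho> + 4 * real N * \<rho>"
    by (rule norm_diff_triangle_le)
  then show ?case by (simp add: algebra_simps)
qed

text \<open>
  The second-order expansion of the characteristic function of a group has an error bounded by its
  \<open>p\<close>-th moment; \<open>1 - x\<close> is then replaced by \<open>exp (-x)\<close>. Summed over at most \<open>K\<close> groups, the error
  vanishes because \<open>p > 2\<close>.
\<close>
lemma V_char:
  assumes "j < K div m" "m \<ge> 3"
  shows "cmod (expectation (\<lambda>\<omega>. iexp (1 / sqrt K * V m j \<omega>)) - exp (- (cov M (V m j) (V m j) / (2 * real K))))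
     \<le> real K powr (- p / 2) * (real m powr p * (real m * C)) + (real m * D / real K)\<^sup>2"
proof -
  let ?X = "\<lambda>\<omega>. 1 / sqrt K * V m j \<omega>"
  note Vb = V_bdd[OF assms]
  have X: "bdd_rv M ?X" using Vb by (rule bdd_rv_scale)
  let ?\<mu> = "distr M borel ?X"
  have char: "char ?\<mu> 1 = expectation (\<lambda>\<omega>. iexp (?X \<omega>))"
    unfolding char_def using X by (subst integral_distr) (auto dest: bdd_rv_measurable)
  have EX: "expectation ?X = 0" using V_mean[OF assms] by simp
  have var: "expectation (\<lambda>\<omega>. (?X \<omega> - expectation ?X)\<^sup>2) = cov M (V m j) (V m j) / real K"
    unfolding EX using K by (simp add: cov_def V_mean[OF assms] power2_eq_square field_simps)
  have "cmod (char ?\<mu> 1 - (1 - 1\<^sup>2 * (cov M (V m j) (V m j) / real K) / 2)) \<le>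
    (1\<^sup>2 / 6) * expectation (\<lambda>\<omega>. min (6 * (?X \<omega>)\<^sup>2) (\<bar>1\<bar> * \<bar>?X \<omega>\<bar> ^ 3))"
    using X EX var
    by (intro char_approx3') (auto intro!: bdd_rv_integrable bdd_rv_power dest: bdd_rv_measurable)
  also have "\<dots> \<le> expectation (\<lambda>\<omega>. \<bar>?X \<omega>\<bar> powr p)"
  proof -
    have b: "bdd_rv M (\<lambda>\<omega>. \<bar>?X \<omega>\<bar> powr p)" using X p by (intro bdd_rv_powr) auto
    have "expectation (\<lambda>\<omega>. min (6 * (?X \<omega>)\<^sup>2) (\<bar>1\<bar> * \<bar>?X \<omega>\<bar> ^ 3)) \<le> expectation (\<lambda>\<omega>. 6 * \<bar>?X \<omega>\<bar> powr p)"
    proof (rule integral_mono)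
      show "integrable M (\<lambda>\<omega>. min (6 * (?X \<omega>)\<^sup>2) (\<bar>1\<bar> * \<bar>?X \<omega>\<bar> ^ 3))"
        by (intro integrable_min bdd_rv_integrable bdd_rv_scale bdd_rv_power bdd_rv_abs Vb)
      show "integrable M (\<lambda>\<omega>. 6 * \<bar>?X \<omega>\<bar> powr p)" using b by (intro bdd_rv_integrable bdd_rv_scale)
      show "min (6 * (?X \<omega>)\<^sup>2) (\<bar>1\<bar> * \<bar>?X \<omega>\<bar> ^ 3) \<le> 6 * \<bar>?X \<omega>\<bar> powr p" for \<omega>
        using min_square_cube_le_powr[of p "\<bar>?X \<omega>\<bar>"] p by (simp only: power2_abs abs_ge_zero) simp
    qed
    then show ?thesis using b by simp
  qed
  also have "\<dots> = real K powr (- p / 2) * expectation (\<lambda>\<omega>. \<bar>V m j \<omega>\<bar> powr p)"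
  proof -
    have "\<bar>?X \<omega>\<bar> powr p = real K powr (- p / 2) * \<bar>V m j \<omega>\<bar> powr p" for \<omega>
    proof -
      have "\<bar>?X \<omega>\<bar> powr p = (1 / sqrt K) powr p * \<bar>V m j \<omega>\<bar> powr p"
        using powr_mult[of "1 / sqrt K" "\<bar>V m j \<omega>\<bar>" p] by (simp add: abs_mult)
      also have "(1 / sqrt K) powr p = real K powr (- p / 2)"
      proof -
        have "(1 / sqrt K) = real K powr (- 1 / 2)" using K by (simp add: powr_minus_divide powr_half_sqrt)
        then show ?thesis by (simp only: powr_powr) simp
      qed
      finally show ?thesis .
    qed
    then show ?thesis by simp
  qed
  also have "\<dots> \<le> real K powr (- p / 2) * (real m powr p * (real m * C))"
    by (intro mult_left_mono V_moment assms) auto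
  finally have "cmod (char ?\<mu> 1 - (1 - 1\<^sup>2 * (cov M (V m j) (V m j) / real K) / 2)) \<le>
     real K powr (- p / 2) * (real m powr p * (real m * C))" .
  then have 1: "cmod (expectation (\<lambda>\<omega>. iexp (?X \<omega>)) - (1 - cov M (V m j) (V m j) / real K / 2)) \<le>
     real K powr (- p / 2) * (real m powr p * (real m * C))" unfolding char by simp
  let ?x = "cov M (V m j) (V m j) / (2 * real K)"
  have x0: "0 \<le> ?x" by (simp add: var_nonneg)
  have x1: "?x \<le> real m * D / real K"
  proof -
    have "?x \<le> cov M (V m j) (V m j) / real K" using K var_nonneg[of "V m j"] by (intro divide_left_mono) auto
    also have "\<dots> \<le> real m * D / real K" using V_var[OF assms] by (intro divide_right_mono) auto
    finally show ?thesis .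
  qed
  have "\<bar>(1 - ?x) - exp (- ?x)\<bar> \<le> ?x\<^sup>2" by (rule exp_neg_linear_approx[OF x0])
  also have "\<dots> \<le> (real m * D / real K)\<^sup>2" using x0 x1 by (intro power_mono)
  finally have "\<bar>(1 - ?x) - exp (- ?x)\<bar> \<le> (real m * D / real K)\<^sup>2" .
  then have 2: "cmod (complex_of_real (1 - ?x) - exp (- ?x)) \<le> (real m * D / real K)\<^sup>2"
    by (metis norm_of_real of_real_diff)
  have "1 - cov M (V m j) (V m j) / real K / 2 = 1 - ?x" by (simp add: mult.commute)
  from 1[unfolded this] have "cmod (expectation (\<lambda>\<omega>. iexp (?X \<omega>)) - complex_of_real (1 - ?x)) \<le>
     real K powr (- p / 2) * (real m powr p * (real m * C))" .
  from norm_diff_triangle_le[OF this 2] show ?thesis by (simp add: exp_of_real)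
qed

definition T :: "'a \<Rightarrow> real" where "T \<omega> = (\<Sum>i<K. U i \<omega>)"

lemma T_bdd: "bdd_rv M T"
  unfolding T_def[abs_def] by (intro bdd_rv_sum U_bdd) auto

text \<open>
  Compares the sum over all blocks with the sum over the groups: the blocks that are left out make up
  a share \<open>2/m\<close> of all blocks plus a last incomplete group. The last term of the bound is their standard
  deviation, which enters once through the characteristic function and once through the variance in
  the exponent. With \<open>m\<close> fixed, only \<open>2/m\<close> survives as \<open>K\<close> grows.
\<close>
lemma char_sum_approx:
  assumes m: "m \<ge> 3"
  shows "cmod (expectation (\<lambda>\<omega>. iexp (1 / sqrt K * T \<omega>)) - exp (- (cov M T T / (2 * real K)))) \<le>
    4 * (real K * \<rho>) + (real K powr (1 - p / 2) * (real m powr p * (real m * C)) + (real m * D)\<^sup>2 / real K)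
    + real K * \<rho> * (real m * D) + sqrt ((2 / real m + real m / real K) * D) * (1 + sqrt D)"
proof -
  define N where "N = K div m"
  define S where "S \<omega> = (\<Sum>j<N. V m j \<omega>)" for \<omega>
  have NK: "N \<le> K" by (simp add: N_def)
  have Nm: "N * m \<le> K" by (simp add: N_def)
  have S_bdd: "bdd_rv M S" unfolding S_def[abs_def] using m by (intro bdd_rv_sum V_bdd) (auto simp: N_def)
  have v0: "cov M (V m j) (V m j) / (2 * real K) \<ge> 0" for j by (simp add: var_nonneg)
  define e where "e = real K powr (- p / 2) * (real m powr p * (real m * C)) + (real m * D / real K)\<^sup>2"
  have e0: "e \<ge> 0" using C by (simp add: e_def)
  (* Decoupling of the groups. *)
  have s1: "cmod (expectation (\<lambda>\<omega>. iexp (1 / sqrt K * S \<omega>)) - (\<Prod>j<N. expectation (\<lambda>\<omega>. iexp (1 / sqrt K * V m j \<omega>)))) \<le> 4 * (real K * \<rho>)"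
  proof -
    have "iexp (1 / sqrt K * S \<omega>) = (\<Prod>j<N. iexp (1 / sqrt K * V m j \<omega>))" for \<omega>
      by (simp add: S_def exp_sum[symmetric] sum_distrib_left sum_divide_distrib)
    then have "cmod (expectation (\<lambda>\<omega>. iexp (1 / sqrt K * S \<omega>)) - (\<Prod>j<N. expectation (\<lambda>\<omega>. iexp (1 / sqrt K * V m j \<omega>)))) \<le> 4 * real N * \<rho>"
      using char_product[OF m, of N "1 / sqrt K"] by (simp only: N_def order_refl)
    also have "\<dots> \<le> 4 * real K * \<rho>" using rho NK by (intro mult_right_mono) auto
    finally show ?thesis by simp
  qed
  (* Gaussian approximation of each group. *)
  have s2: "cmod ((\<Prod>j<N. expectation (\<lambda>\<omega>. iexp (1 / sqrt K * V m j \<omega>))) - (\<Prod>j<N. complex_of_real (exp (- (cov M (V m j) (V m j) / (2 * real K)))))) \<le> real K * e"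
  proof -
    have "cmod ((\<Prod>j<N. expectation (\<lambda>\<omega>. iexp (1 / sqrt K * V m j \<omega>))) - (\<Prod>j<N. complex_of_real (exp (- (cov M (V m j) (V m j) / (2 * real K))))))
      \<le> (\<Sum>j<N. cmod (expectation (\<lambda>\<omega>. iexp (1 / sqrt K * V m j \<omega>)) - complex_of_real (exp (- (cov M (V m j) (V m j) / (2 * real K))))))"
    proof (rule norm_prod_diff)
      fix j assume "j \<in> {..<N}"
      have "cmod (expectation (\<lambda>\<omega>. iexp (1 / sqrt K * V m j \<omega>))) \<le> expectation (\<lambda>\<omega>. cmod (iexp (1 / sqrt K * V m j \<omega>)))"
        by (rule integral_norm_bound)
      then show "cmod (expectation (\<lambda>\<omega>. iexp (1 / sqrt K * V m j \<omega>))) \<le> 1" by (simp add: prob_space)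
      show "cmod (complex_of_real (exp (- (cov M (V m j) (V m j) / (2 * real K))))) \<le> 1"
        using v0[of j] by simp
    qed
    also have "\<dots> \<le> (\<Sum>j<N. e)"
      using V_char[OF _ m] by (intro sum_mono) (auto simp: e_def N_def exp_of_real)
    also have "\<dots> \<le> real K * e" using NK e0 by (simp add: mult_right_mono)
    finally show ?thesis .
  qed
  (* The product of the Gaussian factors, recombined into one with the variance of S. *)
  have s3: "\<bar>(\<Prod>j<N. exp (- (cov M (V m j) (V m j) / (2 * real K)))) - exp (- (cov M S S / (2 * real K)))\<bar> \<le> real K * \<rho> * (real m * D)"
  proof -
    have p: "(\<Prod>j<N. exp (- (cov M (V m j) (V m j) / (2 * real K)))) = exp (- ((\<Sum>j<N. cov M (V m j) (V m j)) / (2 * real K)))"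
      by (simp add: exp_sum[symmetric] sum_negf sum_divide_distrib)
    have "cov M S S = (\<Sum>i<N. \<Sum>j<N. cov M (V m i) (V m j))"
    proof -
      have vb: "bdd_rv M (V m j)" if "j \<in> {..<N}" for j using that V_bdd[OF _ m] by (auto simp: N_def)
      have "cov M S S = (\<Sum>i<N. cov M (V m i) S)"
        unfolding S_def[abs_def] by (intro cov_sum_left bdd_rv_sum vb)
      also have "\<dots> = (\<Sum>i<N. \<Sum>j<N. cov M (V m i) (V m j))"
        unfolding S_def[abs_def] by (intro sum.cong refl cov_sum_right vb)
      finally show ?thesis .
    qed
    also have "\<dots> = (\<Sum>i<N. cov M (V m i) (V m i) + (\<Sum>j\<in>{..<N} - {i}. cov M (V m i) (V m j)))"
      by (intro sum.cong refl sum.remove) auto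
    finally have "cov M S S - (\<Sum>j<N. cov M (V m j) (V m j)) = (\<Sum>i<N. \<Sum>j\<in>{..<N} - {i}. cov M (V m i) (V m j))"
      by (simp add: sum.distrib)
    also have "\<bar>\<dots>\<bar> \<le> (\<Sum>i<N. \<Sum>j\<in>{..<N} - {i}. \<rho> * (real m * D))"
    proof (intro order_trans[OF sum_abs] sum_mono)
      fix i j assume "i \<in> {..<N}" "j \<in> {..<N} - {i}"
      then show "\<bar>cov M (V m i) (V m j)\<bar> \<le> \<rho> * (real m * D)"
        using V_cov[OF _ _ m, of i j] V_cov[OF _ _ m, of j i] by (cases "i < j") (auto simp: N_def cov_commute)
    qed
    also have "\<dots> \<le> (\<Sum>i<N. real K * (\<rho> * (real m * D)))"
      using rho D_ge NK by (intro sum_mono) (auto intro!: mult_right_mono)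
    also have "\<dots> \<le> real K * (real K * (\<rho> * (real m * D)))" using NK rho D_ge by (simp add: mult_right_mono)
    finally have d: "\<bar>cov M S S - (\<Sum>j<N. cov M (V m j) (V m j))\<bar> \<le> real K * (real K * (\<rho> * (real m * D)))" .
    have "\<bar>(\<Prod>j<N. exp (- (cov M (V m j) (V m j) / (2 * real K)))) - exp (- (cov M S S / (2 * real K)))\<bar>
      \<le> \<bar>(\<Sum>j<N. cov M (V m j) (V m j)) / (2 * real K) - cov M S S / (2 * real K)\<bar>"
      unfolding p by (rule exp_neg_diff_le) (auto intro!: divide_nonneg_nonneg sum_nonneg var_nonneg)
    also have "\<dots> = \<bar>cov M S S - (\<Sum>j<N. cov M (V m j) (V m j))\<bar> / (2 * real K)"
      by (simp add: diff_divide_distrib[symmetric] abs_minus_commute)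
    also have "\<dots> \<le> real K * (real K * (\<rho> * (real m * D))) / (2 * real K)"
      using d by (rule divide_right_mono) simp
    also have "\<dots> = (real K * \<rho> * (real m * D)) / 2" using K by simp
    also have "\<dots> \<le> real K * \<rho> * (real m * D)"
      using rho D_ge by (simp add: mult_nonneg_nonneg)
    finally show ?thesis .
  qed
  (* J collects the blocks that are kept; W is the sum of those left out. *)
  define J where "J = (\<Union>j<N. {j * m..<j * m + (m - 2)})"
  have disj: "{i * m..<i * m + (m - 2)} \<inter> {j * m..<j * m + (m - 2)} = {}" if "i \<noteq> j" for i j
  proof -
    have "Suc (min i j) * m \<le> max i j * m" using that by (intro mult_le_mono1) auto
    then show ?thesis using m by (cases "i < j") (auto simp: min_def max_def split: if_splits)
  qed
  have J: "J \<subseteq> {..<K}"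
  proof
    fix i assume "i \<in> J"
    then obtain j where "j < N" "i < j * m + (m - 2)" by (auto simp: J_def)
    with V_index[OF _ m, of j] show "i \<in> {..<K}" by (simp add: N_def)
  qed
  have SJ: "S \<omega> = (\<Sum>i\<in>J. U i \<omega>)" for \<omega>
    unfolding S_def V_def J_def by (rule sum.UNION_disjoint[symmetric]) (use disj in auto)
  define W where "W \<omega> = T \<omega> - S \<omega>" for \<omega>
  have W: "bdd_rv M W" unfolding W_def[abs_def] by (intro bdd_rv_diff T_bdd S_bdd)
  have sdW: "sd M W / sqrt K \<le> sqrt ((2 / real m + real m / real K) * D)"
  proof -
    have cJ: "card J = N * (m - 2)"
      unfolding J_def by (subst card_UN_disjoint) (use disj in auto)
    have WJ: "W = (\<lambda>\<omega>. \<Sum>i\<in>{..<K} - J. U i \<omega>)"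
      unfolding W_def[abs_def] T_def SJ by (intro ext sum_diff[symmetric] finite_lessThan J)
    have "card ({..<K} - J) = K - N * (m - 2)" using J cJ by (simp add: card_Diff_subset finite_subset)
    also have "\<dots> \<le> 2 * N + m"
    proof -
      have "K = N * m + K mod m" by (simp add: N_def)
      also have "N * m = N * (m - 2) + 2 * N" using m by (simp add: diff_mult_distrib2)
      finally show ?thesis using mod_less_divisor[of m K] m by linarith
    qed
    finally have "real (card ({..<K} - J)) \<le> 2 * real N + real m" by linarith
    also have "\<dots> \<le> 2 * (real K / real m) + real m"
    proof -
      have "real N * real m \<le> real K" using Nm by (metis of_nat_le_iff of_nat_mult)
      then have "real N \<le> real K / real m" using m by (simp add: field_simps)
      then show ?thesis by simp
    qed
    finally have cc: "real (card ({..<K} - J)) \<le> 2 * (real K / real m) + real m" .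
    have "cov M W W \<le> real (card ({..<K} - J)) * D" unfolding WJ by (rule var_sum_U_le) auto
    also have "\<dots> \<le> (2 * (real K / real m) + real m) * D" using cc D_ge by (intro mult_right_mono) auto
    finally have "cov M W W / real K \<le> (2 * (real K / real m) + real m) * D / real K"
      by (rule divide_right_mono) simp
    also have "\<dots> = (2 / real m + real m / real K) * D" using K m by (simp add: add_divide_distrib distrib_right)
    finally have "sqrt (cov M W W / real K) \<le> sqrt ((2 / real m + real m / real K) * D)" by (rule real_sqrt_le_mono)
    then show ?thesis by (simp add: sd_def real_sqrt_divide)
  qed
  have EU: "expectation (\<lambda>\<omega>. \<Sum>i\<in>I. U i \<omega>) = 0" if "I \<subseteq> {..<K}" for I
  proof -
    have "expectation (\<lambda>\<omega>. \<Sum>i\<in>I. U i \<omega>) = (\<Sum>i\<in>I. expectation (U i))"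
      using that U_bdd by (intro Bochner_Integration.integral_sum bdd_rv_integrable) auto
    also have "\<dots> = 0" using that U_mean by (intro sum.neutral) auto
    finally show ?thesis .
  qed
  have EW: "expectation W = 0"
  proof -
    have "expectation W = expectation T - expectation S"
      unfolding W_def[abs_def] by (intro Bochner_Integration.integral_diff bdd_rv_integrable T_bdd S_bdd)
    also have "expectation T = 0" unfolding T_def[abs_def] by (rule EU) simp
    also have "expectation S = (\<Sum>j<N. expectation (V m j))"
      unfolding S_def[abs_def] using V_bdd[OF _ m]
      by (intro Bochner_Integration.integral_sum bdd_rv_integrable) (auto simp: N_def)
    also have "\<dots> = 0" using V_mean[OF _ m] by (intro sum.neutral) (auto simp: N_def)
    finally show ?thesis by simp
  qed
  have s4: "cmod (expectation (\<lambda>\<omega>. iexp (1 / sqrt K * T \<omega>)) - expectation (\<lambda>\<omega>. iexp (1 / sqrt K * S \<omega>))) \<le> sd M W / sqrt K"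
  proof -
    have "cmod (expectation (\<lambda>\<omega>. iexp (1 / sqrt K * T \<omega>)) - expectation (\<lambda>\<omega>. iexp (1 / sqrt K * S \<omega>)))
      \<le> expectation (\<lambda>\<omega>. \<bar>1 / sqrt K * T \<omega> - 1 / sqrt K * S \<omega>\<bar>)"
      by (intro iexp_expectation_dist bdd_rv_scale T_bdd S_bdd)
    also have "\<dots> = expectation (\<lambda>\<omega>. \<bar>W \<omega>\<bar>) / sqrt K"
      by (simp add: W_def diff_divide_distrib[symmetric])
    also have "\<dots> \<le> sd M W / sqrt K"
      by (intro divide_right_mono expectation_abs_le_sd[OF W EW]) simp
    finally show ?thesis .
  qed
  have sdS: "sd M S \<le> sqrt (K * D)" and sdT: "sd M T \<le> sqrt (K * D)"
  proof -
    have "cov M T T \<le> real (card {..<K}) * D" unfolding T_def[abs_def] by (rule var_sum_U_le) simp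
    then show "sd M T \<le> sqrt (K * D)" by (simp add: sd_def)
    have "cov M S S \<le> real (card J) * D" unfolding SJ[abs_def] by (rule var_sum_U_le[OF J])
    also have "\<dots> \<le> real K * D" using card_mono[OF finite_lessThan J] D_ge by (intro mult_right_mono) auto
    finally show "sd M S \<le> sqrt (K * D)" by (simp add: sd_def)
  qed
  (* The difference of the variances of S and T factorizes through the standard deviations. *)
  have s5: "\<bar>exp (- (cov M S S / (2 * real K))) - exp (- (cov M T T / (2 * real K)))\<bar> \<le> sd M W / sqrt K * sqrt D"
  proof -
    have "\<bar>exp (- (cov M S S / (2 * real K))) - exp (- (cov M T T / (2 * real K)))\<bar> \<le>
      \<bar>cov M S S / (2 * real K) - cov M T T / (2 * real K)\<bar>"
      by (rule exp_neg_diff_le) (auto intro!: divide_nonneg_nonneg var_nonneg)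
    also have "\<dots> = \<bar>sd M T - sd M S\<bar> * (sd M T + sd M S) / (2 * real K)"
    proof -
      have "\<bar>sd M T - sd M S\<bar> * (sd M T + sd M S) = \<bar>(sd M T - sd M S) * (sd M T + sd M S)\<bar>"
        by (simp add: abs_mult)
      also have "\<dots> = \<bar>cov M S S - cov M T T\<bar>" by (simp add: sd_sq[symmetric] power2_eq_square algebra_simps abs_minus_commute)
      finally show ?thesis by (simp add: diff_divide_distrib[symmetric])
    qed
    also have "\<dots> \<le> sd M W * (2 * sqrt (K * D)) / (2 * real K)"
      using sd_diff_le[OF T_bdd S_bdd] sdS sdT
      by (intro divide_right_mono mult_mono) (auto simp: W_def[abs_def])
    also have "\<dots> = sd M W * sqrt D * (sqrt K / real K)" by (simp add: real_sqrt_mult)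
    also have "sqrt K / real K = 1 / sqrt K" using K by (simp add: real_div_sqrt field_simps)
    also have "sd M W * sqrt D * (1 / sqrt K) = sd M W / sqrt K * sqrt D" by simp
    finally show ?thesis .
  qed
  have Ke: "real K * e = real K powr (1 - p / 2) * (real m powr p * (real m * C)) + (real m * D)\<^sup>2 / real K"
  proof -
    have "real K powr (1 - p / 2) = real K * real K powr (- p / 2)"
      using K powr_add[of "real K" 1 "- p / 2"] by simp
    then show ?thesis using K by (simp add: e_def distrib_left power_divide power2_eq_square mult.assoc[symmetric])
  qed
  have s3': "cmod ((\<Prod>j<N. complex_of_real (exp (- (cov M (V m j) (V m j) / (2 * real K))))) - complex_of_real (exp (- (cov M S S / (2 * real K))))) \<le> real K * \<rho> * (real m * D)"
    using s3 by (simp only: of_real_prod[symmetric] of_real_diff[symmetric] norm_of_real)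
  have s5': "cmod (complex_of_real (exp (- (cov M S S / (2 * real K)))) - complex_of_real (exp (- (cov M T T / (2 * real K))))) \<le> sd M W / sqrt K * sqrt D"
    using s5 by (simp only: of_real_diff[symmetric] norm_of_real)
  have "cmod (expectation (\<lambda>\<omega>. iexp (1 / sqrt K * T \<omega>)) - complex_of_real (exp (- (cov M T T / (2 * real K))))) \<le>
    (((sd M W / sqrt K + 4 * (real K * \<rho>)) + real K * e) + real K * \<rho> * (real m * D)) + sd M W / sqrt K * sqrt D"
    by (rule norm_diff_triangle_le[OF norm_diff_triangle_le[OF norm_diff_triangle_le[OF norm_diff_triangle_le[OF s4 s1] s2] s3'] s5'])
  also have "\<dots> = 4 * (real K * \<rho>) + real K * e + real K * \<rho> * (real m * D) + sd M W / sqrt K * (1 + sqrt D)"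
    by (simp only: distrib_left mult_1_right add.assoc add.commute add.left_commute)
  also have "\<dots> \<le> 4 * (real K * \<rho>) + real K * e + real K * \<rho> * (real m * D) + sqrt ((2 / real m + real m / real K) * D) * (1 + sqrt D)"
    using D_ge by (intro add_left_mono mult_right_mono sdW) auto
  finally show ?thesis unfolding Ke by (simp add: exp_of_real)
qed

end

text \<open>
  The group length \<open>m\<close> is kept fixed while \<open>n\<close> grows and is chosen large afterwards; this avoids
  choosing a sequence of group lengths. The limiting variance is an assumption here, because the
  constants of the application come from a separate computation.
\<close>
theorem mixing_blocks_clt:
  fixes U :: "nat \<Rightarrow> nat \<Rightarrow> 'a \<Rightarrow> real"
  assumes mb: "\<forall>\<^sub>F n in sequentially. mixing_blocks M (U n) (G n) (K n) (\<rho> n) p C"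
    and K: "filterlim K at_top sequentially"
    and rho: "(\<lambda>n. real (K n) * \<rho> n) \<longlonglongrightarrow> 0"
    and var: "(\<lambda>n. cov M (\<lambda>\<omega>. \<Sum>i<K n. U n i \<omega>) (\<lambda>\<omega>. \<Sum>i<K n. U n i \<omega>) / real (K n)) \<longlonglongrightarrow> v"
  shows "(\<lambda>n. \<integral>\<omega>. iexp (1 / sqrt (K n) * (\<Sum>i<K n. U n i \<omega>)) \<partial>M) \<longlonglongrightarrow> exp (- v / 2)"
proof -
  (* The constants p and C are the same for all n, so one index yields their constraints. *)
  obtain n0 where "mixing_blocks M (U n0) (G n0) (K n0) (\<rho> n0) p C"
    using mb by (auto simp: eventually_sequentially)
  then have p: "2 < p" "p \<le> 3" and C: "C \<ge> 0"
    by (auto simp: mixing_blocks_def mixing_blocks_axioms_def)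
  (* Eventually K * \<rho> < 1, which makes the constant uniform in n. *)
  define D where "D = (1 + C) * 6"
  have D: "D \<ge> 0" using C by (simp add: D_def)
  have Kr: "filterlim (\<lambda>n. real (K n)) at_top sequentially"
    using filterlim_compose[OF filterlim_real_sequentially K] .
  let ?T = "\<lambda>n \<omega>. \<Sum>i<K n. U n i \<omega>"
  define b where "b m n = 4 * (real (K n) * \<rho> n) + (real (K n) powr (1 - p / 2) * (real m powr p * (real m * C)) + (real m * D)\<^sup>2 / real (K n))
    + real (K n) * \<rho> n * (real m * D) + sqrt ((2 / real m + real m / real (K n)) * D) * (1 + sqrt D)" for m n
  have bound: "\<forall>\<^sub>F n in sequentially. cmod ((\<integral>\<omega>. iexp (1 / sqrt (K n) * ?T n \<omega>) \<partial>M) - exp (- (cov M (?T n) (?T n) / (2 * real (K n))))) \<le> b m n"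
    if m: "m \<ge> 3" for m
    using mb order_tendstoD(2)[OF rho zero_less_one]
  proof eventually_elim
    case (elim n)
    interpret mixing_blocks M "U n" "G n" "K n" "\<rho> n" p C by (rule elim)
    have TT: "T = ?T n" by (auto simp: T_def)
    have "(1 + C) * (5 + real (K n) * \<rho> n) \<le> (1 + C) * 6" using elim C by (intro mult_left_mono) auto
    then have DD: "local.D \<le> D" by (simp add: local.D_def \<open>D = (1 + C) * 6\<close>)
    have "cmod (expectation (\<lambda>\<omega>. iexp (1 / sqrt (K n) * T \<omega>)) - exp (- (cov M T T / (2 * real (K n))))) \<le>
      4 * (real (K n) * \<rho> n) + (real (K n) powr (1 - p / 2) * (real m powr p * (real m * C)) + (real m * local.D)\<^sup>2 / real (K n))
    + real (K n) * \<rho> n * (real m * local.D) + sqrt ((2 / real m + real m / real (K n)) * local.D) * (1 + sqrt local.D)"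
      by (rule char_sum_approx[OF m])
    also have "\<dots> \<le> b m n" unfolding b_def
      using DD D_ge rho m
      by (intro add_mono mult_left_mono divide_right_mono power_mono mult_mono real_sqrt_le_mono order_refl) auto
    finally show ?case unfolding TT .
  qed
  have lim_b: "b m \<longlonglongrightarrow> sqrt (2 / real m * D) * (1 + sqrt D)" for m
  proof -
    have pw: "(\<lambda>n. real (K n) powr (1 - p / 2)) \<longlonglongrightarrow> 0"
      using p by (intro tendsto_neg_powr Kr) auto
    have inv: "(\<lambda>n. c / real (K n)) \<longlonglongrightarrow> 0" for c
      by (rule real_tendsto_divide_at_top[OF tendsto_const Kr])
    have "b m \<longlonglongrightarrow> 4 * 0 + (0 * (real m powr p * (real m * C)) + 0) + 0 * (real m * D) + sqrt ((2 / real m + 0) * D) * (1 + sqrt D)"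
      unfolding b_def by (intro tendsto_intros rho pw inv)
    then show ?thesis by simp
  qed
  have lim_m: "(\<lambda>m. sqrt (2 / real m * D) * (1 + sqrt D)) \<longlonglongrightarrow> sqrt (0 * D) * (1 + sqrt D)"
    by (intro tendsto_intros real_tendsto_divide_at_top[OF tendsto_const filterlim_real_sequentially])
  have diff: "(\<lambda>n. (\<integral>\<omega>. iexp (1 / sqrt (K n) * ?T n \<omega>) \<partial>M) - exp (- (cov M (?T n) (?T n) / (2 * real (K n))))) \<longlonglongrightarrow> 0"
  proof (rule tendstoI)
    fix e :: real assume e: "e > 0"
    have "\<forall>\<^sub>F m in sequentially. sqrt (2 / real m * D) * (1 + sqrt D) < e"
      using order_tendstoD(2)[OF lim_m, of e] e by simp
    with eventually_ge_at_top[of 3] have "\<forall>\<^sub>F m in sequentially. 3 \<le> m \<and> sqrt (2 / real m * D) * (1 + sqrt D) < e"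
      by eventually_elim auto
    then obtain m where m: "m \<ge> 3" "sqrt (2 / real m * D) * (1 + sqrt D) < e"
      by (auto simp: eventually_sequentially)
    from bound[OF m(1)] order_tendstoD(2)[OF lim_b m(2)]
    show "\<forall>\<^sub>F n in sequentially. dist ((\<integral>\<omega>. iexp (1 / sqrt (K n) * ?T n \<omega>) \<partial>M) - exp (- (cov M (?T n) (?T n) / (2 * real (K n))))) 0 < e"
    proof eventually_elim
      case (elim n)
      then show ?case unfolding dist_norm by simp
    qed
  qed
  have "(\<lambda>n. complex_of_real (exp (- (cov M (?T n) (?T n) / real (K n)) / 2))) \<longlonglongrightarrow> complex_of_real (exp (- v / 2))"
    by (intro tendsto_intros var) auto
  then have "(\<lambda>n. complex_of_real (exp (- (cov M (?T n) (?T n) / (2 * real (K n)))))) \<longlonglongrightarrow> complex_of_real (exp (- v / 2))"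
    by (simp add: mult.commute)
  from tendsto_add[OF diff this] show ?thesis by (simp add: exp_of_real)
qed

section \<open>Exceedances of a fixed threshold\<close>

text \<open>
  Needed to know that the supremum in the maximal correlation coefficient is that of a bounded set, so
  that it dominates each correlation. The inequality of Cauchy and Schwarz is derived here for square
  integrable variables by optimizing \<open>2|FG| \<le> t F\<^sup>2 + G\<^sup>2/t\<close> over \<open>t\<close>.
\<close>
lemma (in prob_space) abs_corr_le_1:
  assumes f: "f \<in> borel_measurable M" "integrable M (\<lambda>\<omega>. (f \<omega>)\<^sup>2)"
    and g: "g \<in> borel_measurable M" "integrable M (\<lambda>\<omega>. (g \<omega>)\<^sup>2)"
    and pos: "var M f > 0" "var M g > 0"
  shows "\<bar>corr M f g\<bar> \<le> 1"
proof -
  define F where "F \<omega> = f \<omega> - expectation f" for \<omega>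
  define G where "G \<omega> = g \<omega> - expectation g" for \<omega>
  have sq: "integrable M (\<lambda>\<omega>. (h \<omega> - c)\<^sup>2)" if h: "h \<in> borel_measurable M" "integrable M (\<lambda>\<omega>. (h \<omega>)\<^sup>2)" for h :: "'a \<Rightarrow> real" and c
  proof (rule Bochner_Integration.integrable_bound)
    show "integrable M (\<lambda>\<omega>. 2 * (h \<omega>)\<^sup>2 + 2 * c\<^sup>2)" using h by simp
    show "AE \<omega> in M. norm ((h \<omega> - c)\<^sup>2) \<le> norm (2 * (h \<omega>)\<^sup>2 + 2 * c\<^sup>2)"
    proof (rule AE_I2)
      fix \<omega>
      have "0 \<le> (h \<omega> + c)\<^sup>2" by simp
      then have "(h \<omega> - c)\<^sup>2 \<le> 2 * (h \<omega>)\<^sup>2 + 2 * c\<^sup>2" by (simp add: power2_eq_square algebra_simps)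
      then show "norm ((h \<omega> - c)\<^sup>2) \<le> norm (2 * (h \<omega>)\<^sup>2 + 2 * c\<^sup>2)" by simp
    qed
  qed (intro borel_measurable_power borel_measurable_diff h borel_measurable_const)
  have iF: "integrable M (\<lambda>\<omega>. (F \<omega>)\<^sup>2)" and iG: "integrable M (\<lambda>\<omega>. (G \<omega>)\<^sup>2)"
    unfolding F_def G_def by (intro sq f g)+
  have vF: "var M f = expectation (\<lambda>\<omega>. (F \<omega>)\<^sup>2)" and vG: "var M g = expectation (\<lambda>\<omega>. (G \<omega>)\<^sup>2)"
    by (simp_all add: var_def F_def G_def)
  define t where "t = sqrt (var M g) / sqrt (var M f)"
  have t: "t > 0" using pos by (simp add: t_def)
  have am: "\<bar>F \<omega> * G \<omega>\<bar> \<le> (t * (F \<omega>)\<^sup>2 + (G \<omega>)\<^sup>2 / t) / 2" for \<omega>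
  proof -
    have "(t * \<bar>F \<omega>\<bar> - \<bar>G \<omega>\<bar>)\<^sup>2 = t * (t * (F \<omega>)\<^sup>2) - t * (2 * \<bar>F \<omega> * G \<omega>\<bar>) + (G \<omega>)\<^sup>2"
      unfolding power2_diff power_mult_distrib abs_mult by (simp add: power2_eq_square)
    then have "0 \<le> (t * (t * (F \<omega>)\<^sup>2) - t * (2 * \<bar>F \<omega> * G \<omega>\<bar>) + (G \<omega>)\<^sup>2) / t"
      using t by (metis divide_nonneg_pos zero_le_power2)
    then have "0 \<le> t * (F \<omega>)\<^sup>2 - 2 * \<bar>F \<omega> * G \<omega>\<bar> + (G \<omega>)\<^sup>2 / t"
      using t by (simp add: add_divide_distrib diff_divide_distrib)
    moreover have "b \<le> (a + c) / 2" if "0 \<le> a - 2 * b + c" for a b c :: real using that by simp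
    ultimately show ?thesis by blast
  qed
  have "\<bar>expectation (\<lambda>\<omega>. F \<omega> * G \<omega>)\<bar> \<le> expectation (\<lambda>\<omega>. (t * (F \<omega>)\<^sup>2 + (G \<omega>)\<^sup>2 / t) / 2)"
  proof (rule order_trans[OF integral_abs_bound])
    have i: "integrable M (\<lambda>\<omega>. (t * (F \<omega>)\<^sup>2 + (G \<omega>)\<^sup>2 / t) / 2)" using iF iG by simp
    have "integrable M (\<lambda>\<omega>. F \<omega> * G \<omega>)"
    proof (rule Bochner_Integration.integrable_bound[OF i])
      show "(\<lambda>\<omega>. F \<omega> * G \<omega>) \<in> borel_measurable M" unfolding F_def G_def by (intro borel_measurable_times borel_measurable_diff f g borel_measurable_const)
      show "AE \<omega> in M. norm (F \<omega> * G \<omega>) \<le> norm ((t * (F \<omega>)\<^sup>2 + (G \<omega>)\<^sup>2 / t) / 2)"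
        using am by (intro AE_I2) (auto intro: order_trans[OF _ abs_ge_self])
    qed
    then show "expectation (\<lambda>\<omega>. \<bar>F \<omega> * G \<omega>\<bar>) \<le> expectation (\<lambda>\<omega>. (t * (F \<omega>)\<^sup>2 + (G \<omega>)\<^sup>2 / t) / 2)"
      using i am by (intro integral_mono) auto
  qed
  also have "\<dots> = (t * var M f + var M g / t) / 2" using iF iG by (simp add: vF vG)
  also have "\<dots> = sqrt (var M f * var M g)"
  proof -
    have 1: "t * var M f = sqrt (var M g) * (var M f / sqrt (var M f))" by (simp add: t_def)
    have 2: "var M g / t = var M g / sqrt (var M g) * sqrt (var M f)" by (simp add: t_def)
    have "var M f / sqrt (var M f) = sqrt (var M f)" "var M g / sqrt (var M g) = sqrt (var M g)"
      using pos by (simp_all add: real_div_sqrt)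
    then show ?thesis by (simp only: 1 2 real_sqrt_mult) simp
  qed
  finally have le: "\<bar>expectation (\<lambda>\<omega>. F \<omega> * G \<omega>)\<bar> \<le> sqrt (var M f * var M g)" .
  have eq: "corr M f g = expectation (\<lambda>\<omega>. F \<omega> * G \<omega>) / sqrt (var M f * var M g)"
    unfolding corr_def F_def G_def ..
  have "sqrt (var M f * var M g) > 0" using pos by simp
  with le show ?thesis unfolding eq abs_divide by (simp only: abs_of_pos pos_divide_le_eq mult_1)
qed

lemma threshold_field_space [simp]: "space (threshold_field M X u a b) = space M"
  by (simp add: threshold_field_def space_measure_of_conv)

lemma threshold_field_mono:
  assumes "{c..d} \<subseteq> {a..b}"
  shows "sets (threshold_field M X u c d) \<subseteq> sets (threshold_field M X u a b)"
proof -
  have "sets (threshold_field M X u c d) = sigma_sets (space M) ((\<lambda>i. {\<omega> \<in> space M. X i \<omega> \<le> u}) ` {c..d})"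
    unfolding threshold_field_def by (rule sets_measure_of) auto
  also have "\<dots> \<subseteq> sigma_sets (space M) ((\<lambda>i. {\<omega> \<in> space M. X i \<omega> \<le> u}) ` {a..b})"
    using assms by (intro sigma_sets_mono') auto
  also have "\<dots> = sets (threshold_field M X u a b)"
    unfolding threshold_field_def by (rule sets_measure_of[symmetric]) auto
  finally show ?thesis .
qed

lemma threshold_field_measurable_mono:
  assumes "f \<in> borel_measurable (threshold_field M X u c d)" "{c..d} \<subseteq> {a..b}"
  shows "f \<in> borel_measurable (threshold_field M X u a b)"
  using assms(1) threshold_field_mono[OF assms(2), of M X u] by (auto simp: measurable_def)

locale stationary_threshold = prob_space M for M :: "'a measure" +
  fixes X :: "nat \<Rightarrow> 'a \<Rightarrow> real" and u :: real and n l :: nat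
  assumes X_meas: "\<And>i. i \<ge> 1 \<Longrightarrow> X i \<in> borel_measurable M"
    and stat: "strictly_stationary M X"
    and l_pos: "l \<ge> 1"
begin

abbreviation "TF \<equiv> threshold_field M X u"

definition \<rho> :: real where "\<rho> = max_corr M X n l u"

lemma TF_sub: assumes "a \<ge> 1" shows "subalgebra M (TF a b)"
proof -
  have "sets (TF a b) = sigma_sets (space M) ((\<lambda>i. {\<omega> \<in> space M. X i \<omega> \<le> u}) ` {a..b})"
    unfolding threshold_field_def by (rule sets_measure_of) auto
  also have "\<dots> \<subseteq> sets M"
  proof (rule sets.sigma_sets_subset)
    show "(\<lambda>i. {\<omega> \<in> space M. X i \<omega> \<le> u}) ` {a..b} \<subseteq> sets M"
    proof clarify
      fix i assume "i \<in> {a..b}"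
      then have [measurable]: "X i \<in> borel_measurable M" using X_meas assms by simp
      show "{\<omega> \<in> space M. X i \<omega> \<le> u} \<in> sets M" by measurable
    qed
  qed
  finally show ?thesis by (simp add: subalgebra_def)
qed

lemma rho_nonneg: "\<rho> \<ge> 0"
  unfolding \<rho>_def max_corr_def by (intro Max_ge) auto

text \<open>
  The form in which the mixing assumption is applied throughout. Variables of zero variance are
  excluded from the supremum, but for them the covariance vanishes.
\<close>
lemma mixing:
  assumes f: "f \<in> borel_measurable (TF a b)" and g: "g \<in> borel_measurable (TF c d)"
    and idx: "1 \<le> a" "1 \<le> b" "b + l \<le> c" "c \<le> n" "d \<le> n"
    and bf: "bdd_rv M f" and bg: "bdd_rv M g"
  shows "\<bar>cov M f g\<bar> \<le> \<rho> * (sd M f * sd M g)"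
proof (cases "sd M f = 0 \<or> sd M g = 0")
  case True
  then show ?thesis using cov_le_sd[OF bf bg] by auto
next
  case False
  have vv: "var M h = cov M h h" for h by (simp add: var_def cov_def power2_eq_square)
  have pos: "var M f > 0" "var M g > 0"
    using False sd_nonneg[of f] sd_nonneg[of g] by (auto simp: vv sd_sq[symmetric])
  have f1: "f \<in> borel_measurable (TF 1 b)" by (rule threshold_field_measurable_mono[OF f]) (use idx in auto)
  have g1: "g \<in> borel_measurable (TF (b + l) n)" by (rule threshold_field_measurable_mono[OF g]) (use idx in auto)
  let ?S = "\<lambda>t. {\<bar>corr M \<xi> \<eta>\<bar> | \<xi> \<eta>. \<xi> \<in> L2 M (TF 1 t) \<and> \<eta> \<in> L2 M (TF (t + l) n) \<and> var M \<xi> > 0 \<and> var M \<eta> > 0}"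
  have "\<bar>corr M f g\<bar> \<in> ?S b"
  proof -
    have "f \<in> L2 M (TF 1 b)" "g \<in> L2 M (TF (b + l) n)"
      using f1 g1 bf bg by (auto simp: L2_def intro!: bdd_rv_integrable)
    with pos show ?thesis by blast
  qed
  moreover have "bdd_above (insert 0 (?S b))"
  proof (rule bdd_aboveI[where M=1])
    fix x assume "x \<in> insert 0 (?S b)"
    then consider "x = 0" | \<xi> \<eta> where "x = \<bar>corr M \<xi> \<eta>\<bar>" "\<xi> \<in> L2 M (TF 1 b)" "\<eta> \<in> L2 M (TF (b + l) n)" "var M \<xi> > 0" "var M \<eta> > 0"
      by auto
    then show "x \<le> 1"
    proof cases
      case 2
      have \<xi>: "\<xi> \<in> borel_measurable (TF 1 b)" "integrable M (\<lambda>\<omega>. (\<xi> \<omega>)\<^sup>2)"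
        and \<eta>: "\<eta> \<in> borel_measurable (TF (b + l) n)" "integrable M (\<lambda>\<omega>. (\<eta> \<omega>)\<^sup>2)"
        using 2 by (auto simp: L2_def)
      have "\<xi> \<in> borel_measurable M" by (rule measurable_from_subalg[OF TF_sub \<xi>(1)]) simp
      moreover have "\<eta> \<in> borel_measurable M" by (rule measurable_from_subalg[OF TF_sub \<eta>(1)]) (use idx in simp)
      ultimately show ?thesis unfolding 2(1) by (intro abs_corr_le_1 \<xi>(2) \<eta>(2) 2(4,5))
    qed simp
  qed
  ultimately have "\<bar>corr M f g\<bar> \<le> Sup (insert 0 (?S b))" by (intro cSup_upper) auto
  also have "\<dots> \<le> \<rho>"
    unfolding \<rho>_def max_corr_def using idx by (intro Max_ge) auto
  finally have "\<bar>corr M f g\<bar> \<le> \<rho>" .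
  moreover have "corr M f g = cov M f g / (sd M f * sd M g)"
    by (simp add: corr_def vv sd_def real_sqrt_mult) (simp add: cov_def)
  ultimately have "\<bar>cov M f g\<bar> / (sd M f * sd M g) \<le> \<rho>" by (simp add: abs_mult)
  then show ?thesis using False sd_nonneg[of f] sd_nonneg[of g]
    by (simp add: divide_le_eq less_le mult_pos_pos)
qed

text \<open>
  With half-open stretches, adjacent ones share an endpoint and \<open>X 0\<close> never occurs.
\<close>
definition N :: "nat \<Rightarrow> nat \<Rightarrow> 'a \<Rightarrow> real" where
  "N a b \<omega> = (\<Sum>i\<in>{a<..b}. of_bool (u < X i \<omega>))"

definition Z :: "nat \<Rightarrow> nat \<Rightarrow> 'a \<Rightarrow> real" where
  "Z a b \<omega> = of_bool (N a b \<omega> = 0)"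

definition p :: real where "p = tail M X u"

definition Q :: "nat \<Rightarrow> real" where "Q L = expectation (Z 0 L)"

definition S2 :: "nat \<Rightarrow> real" where "S2 L = expectation (\<lambda>\<omega>. (N 0 L \<omega>)\<^sup>2)"

lemma N_meas_TF: "a \<le> i + 1 \<Longrightarrow> j \<le> b \<Longrightarrow> N i j \<in> borel_measurable (TF a b)"
proof -
  assume ij: "a \<le> i + 1" "j \<le> b"
  have "(\<lambda>\<omega>. of_bool (u < X k \<omega>) :: real) \<in> borel_measurable (TF a b)" if k: "k \<in> {i<..j}" for k
  proof -
    have "{\<omega> \<in> space M. X k \<omega> \<le> u} \<in> sets (TF a b)"
      unfolding threshold_field_def using k ij by (subst sets_measure_of) auto
    then have m: "{\<omega> \<in> space (TF a b). X k \<omega> \<le> u} \<in> sets (TF a b)" by simp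
    have "(\<lambda>\<omega>. if X k \<omega> \<le> u then 0 else 1 :: real) \<in> borel_measurable (TF a b)"
      by (rule measurable_If) (use m in auto)
    moreover have "(\<lambda>\<omega>. if X k \<omega> \<le> u then 0 else 1 :: real) = (\<lambda>\<omega>. of_bool (u < X k \<omega>))" by auto
    ultimately show ?thesis by simp
  qed
  then show ?thesis unfolding N_def[abs_def] by (rule borel_measurable_sum)
qed

lemma Z_meas_TF: "a \<le> i + 1 \<Longrightarrow> j \<le> b \<Longrightarrow> Z i j \<in> borel_measurable (TF a b)"
  using N_meas_TF[of a i j b] unfolding Z_def[abs_def] of_bool_def by measurable

lemma N_meas [measurable]: "N i j \<in> borel_measurable M"
  using measurable_from_subalg[OF TF_sub N_meas_TF, of 1 i j j] by simp

lemma N_nonneg [simp]: "N a b \<omega> \<ge> 0"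
  by (simp add: N_def sum_nonneg)

lemma N_le: "N a b \<omega> \<le> real (b - a)"
proof -
  have "N a b \<omega> \<le> (\<Sum>i\<in>{a<..b}. 1)" unfolding N_def by (intro sum_mono) auto
  then show ?thesis by simp
qed

lemma N_bdd [simp, intro]: "bdd_rv M (N a b)"
  using N_le by (intro bdd_rvI[where B="real (b - a)"]) auto

lemma Z_01: "0 \<le> Z a b \<omega>" "Z a b \<omega> \<le> 1" by (auto simp: Z_def)

lemma Z_bdd [simp, intro]: "bdd_rv M (Z a b)"
  unfolding Z_def[abs_def] by (intro bdd_rvI[where B=1]) auto

lemma N_split: "a \<le> b \<Longrightarrow> b \<le> c \<Longrightarrow> N a c \<omega> = N a b \<omega> + N b c \<omega>"
proof -
  assume "a \<le> b" "b \<le> c"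
  then have "{a<..c} = {a<..b} \<union> {b<..c}" "{a<..b} \<inter> {b<..c} = {}" by auto
  then show ?thesis unfolding N_def by (simp only: sum.union_disjoint finite_greaterThanAtMost)
qed

lemma N_empty [simp]: "b \<le> a \<Longrightarrow> N a b \<omega> = 0" by (simp add: N_def)

lemma Z_split: "a \<le> b \<Longrightarrow> b \<le> c \<Longrightarrow> Z a c \<omega> = Z a b \<omega> * Z b c \<omega>"
  using N_split[of a b c \<omega>] by (auto simp: Z_def add_nonneg_eq_0_iff)

lemma N_Nat: "\<exists>k::nat. N a b \<omega> = real k"
  by (rule exI[of _ "\<Sum>i\<in>{a<..b}. of_bool (u < X i \<omega>)"]) (simp add: N_def)

lemma N_pos_ge_1: "N a b \<omega> \<noteq> 0 \<Longrightarrow> 1 \<le> N a b \<omega>"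
  using N_Nat[of a b \<omega>] by auto

lemma Z_ge: "1 - Z a b \<omega> \<le> N a b \<omega>"
  using N_pos_ge_1[of a b \<omega>] by (auto simp: Z_def)

lemma N_sum_blocks: "N a (a + q * s) \<omega> = (\<Sum>i<q. N (a + i * s) (a + (i + 1) * s) \<omega>)"
proof (induction q)
  case (Suc q)
  have "N a (a + Suc q * s) \<omega> = N a (a + q * s) \<omega> + N (a + q * s) (a + Suc q * s) \<omega>"
    by (rule N_split) auto
  then show ?case using Suc by simp
qed simp

lemma stationary_N:
  fixes f :: "real \<Rightarrow> real"
  assumes f[measurable]: "f \<in> borel_measurable borel" and ab: "a \<le> b"
  shows "expectation (\<lambda>\<omega>. f (N a b \<omega>)) = expectation (\<lambda>\<omega>. f (N 0 (b - a) \<omega>))"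
proof -
  define L where "L = b - a"
  define \<Phi> where "\<Phi> x = (\<Sum>i\<in>{1..L}. of_bool (u < x i) :: real)" for x :: "nat \<Rightarrow> real"
  let ?P = "\<Pi>\<^sub>M i\<in>{1..L}. (borel :: real measure)"
  have \<Phi>[measurable]: "\<Phi> \<in> borel_measurable ?P"
    unfolding \<Phi>_def[abs_def] of_bool_def
  proof (rule borel_measurable_sum)
    fix i assume [measurable]: "i \<in> {1..L}"
    show "(\<lambda>x. if u < x i then 1 else 0 :: real) \<in> borel_measurable ?P" by measurable
  qed
  have shift: "expectation (\<lambda>\<omega>. f (N h (h + L) \<omega>)) = (\<integral>x. f (\<Phi> x) \<partial>distr M ?P (\<lambda>\<omega>. \<lambda>i\<in>{1..L}. X (i + h) \<omega>))" for h
  proof -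
    have Y: "(\<lambda>\<omega>. \<lambda>i\<in>{1..L}. X (i + h) \<omega>) \<in> measurable M ?P"
      by (intro measurable_restrict X_meas) auto
    have "(\<integral>x. f (\<Phi> x) \<partial>distr M ?P (\<lambda>\<omega>. \<lambda>i\<in>{1..L}. X (i + h) \<omega>)) = expectation (\<lambda>\<omega>. f (\<Phi> (\<lambda>i\<in>{1..L}. X (i + h) \<omega>)))"
      by (rule integral_distr[OF Y]) measurable
    also have "\<dots> = expectation (\<lambda>\<omega>. f (N h (h + L) \<omega>))"
    proof -
      have "\<Phi> (\<lambda>i\<in>{1..L}. X (i + h) \<omega>) = N h (h + L) \<omega>" for \<omega>
        unfolding \<Phi>_def N_def
        by (rule sum.reindex_bij_witness[where i="\<lambda>i. i - h" and j="\<lambda>i. i + h"]) auto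
      then show ?thesis by simp
    qed
    finally show ?thesis ..
  qed
  have "distr M ?P (\<lambda>\<omega>. \<lambda>i\<in>{1..L}. X (i + a) \<omega>) = distr M ?P (\<lambda>\<omega>. \<lambda>i\<in>{1..L}. X (i + 0) \<omega>)"
    using stat by (simp add: strictly_stationary_def)
  with shift[of a] shift[of 0] have "expectation (\<lambda>\<omega>. f (N a (a + L) \<omega>)) = expectation (\<lambda>\<omega>. f (N 0 L \<omega>))" by simp
  then show ?thesis using ab by (simp add: L_def)
qed

lemma E_Z: "a \<le> b \<Longrightarrow> expectation (Z a b) = Q (b - a)"
  using stationary_N[of "\<lambda>x. of_bool (x = 0)" a b] by (simp add: Q_def Z_def[abs_def])

lemma E_N_sq: "a \<le> b \<Longrightarrow> expectation (\<lambda>\<omega>. (N a b \<omega>)\<^sup>2) = S2 (b - a)"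
  using stationary_N[of "\<lambda>x. x\<^sup>2" a b] by (simp add: S2_def)

lemma p_eq: "p = expectation (N 0 1)"
proof -
  have [measurable]: "X 1 \<in> borel_measurable M" by (rule X_meas) simp
  have "N 0 1 \<omega> = of_bool (u < X 1 \<omega>)" for \<omega>
  proof -
    have "{0<..1} = {1::nat}" by auto
    then show ?thesis by (simp add: N_def)
  qed
  then have "expectation (N 0 1) = expectation (indicator {\<omega> \<in> space M. u < X 1 \<omega>})"
    by (intro Bochner_Integration.integral_cong) (auto simp: indicator_def)
  also have "\<dots> = prob {\<omega> \<in> space M. u < X 1 \<omega>}"
    by simp (rule arg_cong[where f=prob], auto)
  also have "\<dots> = 1 - prob {\<omega> \<in> space M. X 1 \<omega> \<le> u}"
  proof -
    have "{\<omega> \<in> space M. X 1 \<omega> \<le> u} \<in> events" by measurable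
    then have "prob (space M - {\<omega> \<in> space M. X 1 \<omega> \<le> u}) = 1 - prob {\<omega> \<in> space M. X 1 \<omega> \<le> u}" by (rule prob_compl)
    moreover have "space M - {\<omega> \<in> space M. X 1 \<omega> \<le> u} = {\<omega> \<in> space M. u < X 1 \<omega>}" by auto
    ultimately show ?thesis by simp
  qed
  also have "prob {\<omega> \<in> space M. X 1 \<omega> \<le> u} = cdf (distr M borel (X 1)) u"
    unfolding cdf_def using X_meas[of 1] by (subst measure_distr) (auto intro!: arg_cong[where f=prob])
  finally show ?thesis by (simp add: p_def tail_def)
qed

lemma p_nonneg: "p \<ge> 0" by (simp add: p_eq)

lemma E_N: "a \<le> b \<Longrightarrow> expectation (N a b) = real (b - a) * p"
proof -
  assume ab: "a \<le> b"
  have one: "expectation (N i (Suc i)) = p" for i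
    using stationary_N[of "\<lambda>x. x" i "Suc i"] by (simp add: p_eq)
  have "expectation (N a b) = expectation (\<lambda>\<omega>. \<Sum>i<b - a. N (a + i) (Suc (a + i)) \<omega>)"
  proof -
    have "N a b = (\<lambda>\<omega>. \<Sum>i<b - a. N (a + i) (Suc (a + i)) \<omega>)"
      using N_sum_blocks[of a "b - a" 1] ab by auto
    then show ?thesis by (rule arg_cong)
  qed
  also have "\<dots> = (\<Sum>i<b - a. expectation (N (a + i) (Suc (a + i))))"
    by (intro Bochner_Integration.integral_sum bdd_rv_integrable N_bdd)
  finally show ?thesis by (simp add: one)
qed

lemma Q_bounds: "0 \<le> Q L" "Q L \<le> 1"
proof -
  show "0 \<le> Q L" unfolding Q_def by (simp add: Z_01)
  have "Q L \<le> expectation (\<lambda>_. 1)" unfolding Q_def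
    by (intro integral_mono bdd_rv_integrable Z_bdd bdd_rv_const Z_01)
  then show "Q L \<le> 1" by (simp add: prob_space)
qed

lemma Q_mono: "a \<le> b \<Longrightarrow> Q b \<le> Q a"
proof -
  assume "a \<le> b"
  then have "Z 0 b \<omega> \<le> Z 0 a \<omega>" for \<omega> using Z_split[of 0 a b \<omega>] Z_01 by (simp add: mult_left_le)
  then show ?thesis unfolding Q_def by (intro integral_mono bdd_rv_integrable Z_bdd)
qed

lemma Q_diff: "a \<le> b \<Longrightarrow> Q a - Q b \<le> real (b - a) * p"
proof -
  assume ab: "a \<le> b"
  have "Z 0 a \<omega> - Z 0 b \<omega> \<le> N a b \<omega>" for \<omega>
  proof -
    have "Z 0 a \<omega> - Z 0 b \<omega> = Z 0 a \<omega> * (1 - Z a b \<omega>)" using Z_split[of 0 a b \<omega>] ab by (simp add: algebra_simps)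
    also have "\<dots> \<le> 1 * (1 - Z a b \<omega>)" by (intro mult_right_mono) (auto simp: Z_01)
    finally show ?thesis using Z_ge[of a b \<omega>] by simp
  qed
  then have "expectation (\<lambda>\<omega>. Z 0 a \<omega> - Z 0 b \<omega>) \<le> expectation (N a b)"
    by (intro integral_mono bdd_rv_integrable bdd_rv_diff Z_bdd N_bdd)
  then show ?thesis using ab by (simp add: Q_def E_N bdd_rv_integrable)
qed

lemma S2_nonneg: "S2 L \<ge> 0" unfolding S2_def by simp

lemma N_sq_integrable: "integrable M (\<lambda>\<omega>. (N a b \<omega>)\<^sup>2)"
  by (intro bdd_rv_integrable bdd_rv_power N_bdd)

lemma N_mono: "c \<le> a \<Longrightarrow> b \<le> d \<Longrightarrow> N a b \<omega> \<le> N c d \<omega>"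
  unfolding N_def by (intro sum_mono2) auto

lemma S2_mono: "a \<le> b \<Longrightarrow> S2 a \<le> S2 b"
  unfolding S2_def by (intro integral_mono N_sq_integrable power_mono N_mono) auto

text \<open>
  Counts are nonnegative, so the square of a sum dominates the sum of squares. This bounds the second
  moment over a short stretch by a proportional share of that over a long one.
\<close>
lemma S2_superadditive: "real q * S2 s \<le> S2 (q * s)"
proof -
  have "real q * S2 s = (\<Sum>i<q. expectation (\<lambda>\<omega>. (N (i * s) ((i + 1) * s) \<omega>)\<^sup>2))"
    by (simp add: E_N_sq)
  also have "\<dots> = expectation (\<lambda>\<omega>. \<Sum>i<q. (N (i * s) ((i + 1) * s) \<omega>)\<^sup>2)"
    by (intro Bochner_Integration.integral_sum[symmetric] N_sq_integrable)
  also have "\<dots> \<le> expectation (\<lambda>\<omega>. (N 0 (q * s) \<omega>)\<^sup>2)"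
  proof (intro integral_mono N_sq_integrable bdd_rv_integrable bdd_rv_sum bdd_rv_power N_bdd)
    fix \<omega>
    have sq: "(\<Sum>i\<in>I. (x i)\<^sup>2) \<le> (\<Sum>i\<in>I. x i)\<^sup>2" if "finite I" "\<And>i. 0 \<le> x i" for I :: "nat set" and x :: "nat \<Rightarrow> real"
      using that(1)
    proof induction
      case (insert i I)
      have "0 \<le> 2 * x i * sum x I" using that by (intro mult_nonneg_nonneg sum_nonneg) auto
      then show ?case using insert by (simp add: power2_sum)
    qed simp
    have "(\<Sum>i<q. (N (i * s) ((i + 1) * s) \<omega>)\<^sup>2) \<le> (\<Sum>i<q. N (i * s) ((i + 1) * s) \<omega>)\<^sup>2"
      by (rule sq) auto
    then show "(\<Sum>i<q. (N (i * s) ((i + 1) * s) \<omega>)\<^sup>2) \<le> (N 0 (q * s) \<omega>)\<^sup>2"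
      using N_sum_blocks[of 0 q s \<omega>] by simp
  qed
  finally show ?thesis by (simp add: S2_def)
qed

lemma S2_multiple_le: "S2 (q * s) \<le> (real q)\<^sup>2 * S2 s"
proof -
  have "S2 (q * s) \<le> expectation (\<lambda>\<omega>. real q * (\<Sum>i<q. (N (i * s) ((i + 1) * s) \<omega>)\<^sup>2))"
    unfolding S2_def
  proof (intro integral_mono N_sq_integrable bdd_rv_integrable bdd_rv_scale bdd_rv_sum bdd_rv_power N_bdd)
    fix \<omega>
    have "(N 0 (q * s) \<omega>)\<^sup>2 = (\<Sum>i<q. N (i * s) ((i + 1) * s) \<omega>)\<^sup>2"
      using N_sum_blocks[of 0 q s \<omega>] by simp
    also have "\<dots> \<le> real q * (\<Sum>i<q. (N (i * s) ((i + 1) * s) \<omega>)\<^sup>2)"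
      using sum_squared_le_sum_of_squares[of "\<lambda>i. N (i * s) ((i + 1) * s) \<omega>" "{..<q}"] by (simp add: mult.commute)
    finally show "(N 0 (q * s) \<omega>)\<^sup>2 \<le> real q * (\<Sum>i<q. (N (i * s) ((i + 1) * s) \<omega>)\<^sup>2)" .
  qed
  also have "\<dots> = real q * (\<Sum>i<q. expectation (\<lambda>\<omega>. (N (i * s) ((i + 1) * s) \<omega>)\<^sup>2))"
    using N_sq_integrable by simp
  also have "\<dots> = real q * (\<Sum>i<q. S2 s)" by (simp add: E_N_sq)
  also have "\<dots> = (real q)\<^sup>2 * S2 s" by (simp add: power2_eq_square)
  finally show ?thesis .
qed

lemma var_N_le: assumes "a \<le> b" "b - a \<le> L" shows "cov M (N a b) (N a b) \<le> S2 L"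
proof -
  have "cov M (N a b) (N a b) \<le> S2 (b - a)" using var_le_square[OF N_bdd, of a b] by (simp add: E_N_sq[OF assms(1)])
  also have "\<dots> \<le> S2 L" by (rule S2_mono) fact
  finally show ?thesis .
qed

lemma sd_N_le: assumes "a \<le> b" "b - a \<le> L" shows "sd M (N a b) \<le> sqrt (S2 L)"
  using var_N_le[OF assms] by (simp add: sd_def)

lemma sd_Z_le: "sd M (Z a b) \<le> 1"
  using Z_01 by (intro sd_le_1 bdd_rv_measurable Z_bdd) auto

lemma cov_Z_Z_le: "\<bar>cov M (Z a b) (Z c d)\<bar> \<le> 1"
proof -
  have "\<bar>cov M (Z a b) (Z c d)\<bar> \<le> sd M (Z a b) * sd M (Z c d)" by (intro cov_le_sd Z_bdd)
  also have "\<dots> \<le> 1" by (intro mult_le_one sd_Z_le) simp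
  finally show ?thesis .
qed

lemma cov_Z_N_le: "c \<le> d \<Longrightarrow> \<bar>cov M (Z a b) (N c d)\<bar> \<le> real (d - c) * p"
proof -
  assume cd: "c \<le> d"
  have "0 \<le> expectation (\<lambda>\<omega>. Z a b \<omega> * N c d \<omega>)" by (intro integral_nonneg_AE AE_I2) (simp add: Z_01)
  moreover have "expectation (\<lambda>\<omega>. Z a b \<omega> * N c d \<omega>) \<le> expectation (N c d)"
    by (intro integral_mono bdd_rv_integrable bdd_rv_mult Z_bdd N_bdd) (simp add: Z_01 mult_left_le_one_le)
  moreover have "0 \<le> expectation (Z a b)" by (simp add: Z_01)
  moreover have "expectation (Z a b) \<le> 1"
  proof -
    have "expectation (Z a b) \<le> expectation (\<lambda>_. 1)"
      by (intro integral_mono bdd_rv_integrable Z_bdd bdd_rv_const Z_01)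
    then show ?thesis by (simp add: prob_space)
  qed
  moreover have "0 \<le> expectation (N c d)" by simp
  ultimately have "0 \<le> expectation (\<lambda>\<omega>. Z a b \<omega> * N c d \<omega>)" "expectation (\<lambda>\<omega>. Z a b \<omega> * N c d \<omega>) \<le> expectation (N c d)"
    "0 \<le> expectation (Z a b) * expectation (N c d)" "expectation (Z a b) * expectation (N c d) \<le> expectation (N c d)"
    by (auto simp: mult_left_le_one_le)
  then show ?thesis unfolding cov_eq[OF Z_bdd N_bdd] E_N[OF cd, symmetric] by linarith
qed

text \<open>
  Clip the first \<open>l\<close> indices off each of the \<open>q\<close> blocks of length \<open>s\<close>. The clipped blocks are decoupled one
  after the other, each at cost \<open>\<rho>\<close>. The indices clipped off, and those beyond the last block, matter
  only if they contain an exceedance, so by the union bound they cost \<open>p\<close> each; the clipped ones cost this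
  twice, once when they are removed and once when \<open>Q (s - l)\<close> is replaced by \<open>Q s\<close>.
\<close>
lemma Q_power_approx:
  assumes ls: "l < s" and qs: "q * s \<le> L" and Ln: "L \<le> n"
  shows "\<bar>Q L - Q s ^ q\<bar> \<le> (2 * real q * real l + real (L - q * s)) * p + real q * \<rho>"
proof -
  define G where "G i = Z (i * s + l) ((i + 1) * s)" for i
  define P where "P k \<omega> = (\<Prod>i<k. G i \<omega>)" for k \<omega>
  have G01: "0 \<le> G i \<omega>" "G i \<omega> \<le> 1" for i \<omega> by (auto simp: G_def Z_01)
  have P01: "0 \<le> P k \<omega>" "P k \<omega> \<le> 1" for k \<omega>
    unfolding P_def by (auto intro!: prod_nonneg prod_le_1 G01)
  have Gb: "bdd_rv M (G i)" for i unfolding G_def by simp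
  have Pb: "bdd_rv M (P k)" for k
  proof (induction k)
    case (Suc k) then show ?case unfolding P_def[abs_def] using Gb by (auto simp: bdd_rv_mult)
  qed (simp add: P_def[abs_def])
  have EG: "expectation (G i) = Q (s - l)" for i
  proof -
    have "expectation (G i) = Q ((i + 1) * s - (i * s + l))" unfolding G_def using ls by (intro E_Z) simp
    then show ?thesis by simp
  qed
  have ind: "\<bar>expectation (P k) - Q (s - l) ^ k\<bar> \<le> real k * \<rho>" if "k \<le> q" for k
    using that
  proof (induction k)
    case 0 then show ?case by (simp add: P_def prob_space)
  next
    case (Suc k)
    have cv: "\<bar>cov M (P k) (G k)\<bar> \<le> \<rho>"
    proof (cases "k = 0")
      case True then show ?thesis using rho_nonneg by (simp add: P_def[abs_def])
    next
      case False
      have ks: "(k + 1) * s \<le> n"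
        using mult_le_mono1[OF Suc.prems, of s] qs Ln by simp
      have "\<bar>cov M (P k) (G k)\<bar> \<le> \<rho> * (sd M (P k) * sd M (G k))"
      proof (rule mixing[where a=1 and b="k * s" and c="k * s+l+1" and d="(k+1) * s"])
        have "G i \<in> borel_measurable (TF 1 (k * s))" if "i < k" for i
          unfolding G_def
        proof (rule Z_meas_TF)
          have "(i + 1) * s \<le> k * s" using that by (intro mult_le_mono1) simp
          then show "(i + 1) * s \<le> k * s" .
        qed simp
        then show "P k \<in> borel_measurable (TF 1 (k * s))"
          unfolding P_def[abs_def] by (intro borel_measurable_prod) auto
        show "G k \<in> borel_measurable (TF (k * s + l + 1) ((k + 1) * s))"
          unfolding G_def by (rule Z_meas_TF) auto
        show "1 \<le> k * s" using False ls by (cases k; cases s) auto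
        show "k * s + l + 1 \<le> n" using ks ls by simp
      qed (use ks Pb Gb in auto)
      also have "sd M (P k) * sd M (G k) \<le> 1"
        using P01 G01 Pb Gb by (intro mult_le_one sd_le_1) (auto dest: bdd_rv_measurable)
      then have "\<rho> * (sd M (P k) * sd M (G k)) \<le> \<rho> * 1" using rho_nonneg by (intro mult_left_mono)
      finally show ?thesis by simp
    qed
    have "expectation (P (Suc k)) = expectation (\<lambda>\<omega>. P k \<omega> * G k \<omega>)" by (simp add: P_def[abs_def])
    also have "\<dots> = cov M (P k) (G k) + expectation (P k) * Q (s - l)"
      using cov_eq[OF Pb Gb] by (simp add: EG)
    finally have "expectation (P (Suc k)) - Q (s - l) ^ Suc k = cov M (P k) (G k) + (expectation (P k) - Q (s - l) ^ k) * Q (s - l)"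
      by (simp add: algebra_simps)
    also have "\<bar>\<dots>\<bar> \<le> \<rho> + real k * \<rho> * 1"
    proof (rule order_trans[OF abs_triangle_ineq], rule add_mono[OF cv])
      show "\<bar>(expectation (P k) - Q (s - l) ^ k) * Q (s - l)\<bar> \<le> real k * \<rho> * 1"
        unfolding abs_mult using Suc Q_bounds rho_nonneg by (intro mult_mono) auto
    qed
    finally show ?case by (simp add: algebra_simps)
  qed
  have pw: "\<bar>Q (s - l) ^ q - Q s ^ q\<bar> \<le> real q * (real l * p)"
  proof -
    have "norm (Q (s - l) ^ q - Q s ^ q) \<le> real q * norm (Q (s - l) - Q s)"
      by (rule norm_power_diff) (use Q_bounds in auto)
    also have "norm (Q (s - l) - Q s) \<le> real l * p"
      using Q_diff[of "s - l" s] Q_mono[of "s - l" s] ls by simp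
    finally show ?thesis by (simp add: mult_left_mono)
  qed
  (* Dropping indices can only remove exceedances, and it changes the indicator only if one of
     the dropped indices is an exceedance. *)
  have pt: "0 \<le> P q \<omega> - Z 0 L \<omega> \<and> P q \<omega> - Z 0 L \<omega> \<le> (\<Sum>i<q. N (i * s) (i * s + l) \<omega>) + N (q * s) L \<omega>" for \<omega>
  proof -
    have split: "N 0 L \<omega> = (\<Sum>i<q. N (i * s) (i * s + l) \<omega>) + (\<Sum>i<q. N (i * s + l) ((i + 1) * s) \<omega>) + N (q * s) L \<omega>"
    proof -
      have "N 0 L \<omega> = N 0 (q * s) \<omega> + N (q * s) L \<omega>" using qs by (intro N_split) auto
      also have "N 0 (q * s) \<omega> = (\<Sum>i<q. N (i * s) ((i + 1) * s) \<omega>)" using N_sum_blocks[of 0 q s \<omega>] by simp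
      also have "\<dots> = (\<Sum>i<q. N (i * s) (i * s + l) \<omega> + N (i * s + l) ((i + 1) * s) \<omega>)"
        using ls by (intro sum.cong refl N_split) auto
      finally show ?thesis by (simp add: sum.distrib)
    qed
    let ?g = "(\<Sum>i<q. N (i * s) (i * s + l) \<omega>) + N (q * s) L \<omega>"
    have g0: "?g \<ge> 0" by (simp add: sum_nonneg)
    show ?thesis
    proof (cases "\<forall>i<q. N (i * s + l) ((i + 1) * s) \<omega> = 0")
      case False
      then obtain i where i: "i < q" "N (i * s + l) ((i + 1) * s) \<omega> \<noteq> 0" by auto
      then have "G i \<omega> = 0" by (simp add: G_def Z_def)
      then have "P q \<omega> = 0" unfolding P_def using i by (intro prod_zero) auto
      moreover have "N 0 L \<omega> \<noteq> 0"
      proof -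
        have "0 < N (i * s + l) ((i + 1) * s) \<omega>" using i(2) by (simp add: less_le)
        also have "\<dots> \<le> (\<Sum>i<q. N (i * s + l) ((i + 1) * s) \<omega>)" using i by (intro member_le_sum) auto
        finally show ?thesis unfolding split using g0 by simp
      qed
      ultimately show ?thesis using g0 by (simp add: Z_def)
    next
      case True
      then have P1: "P q \<omega> = 1" by (simp add: P_def G_def Z_def)
      have NL: "N 0 L \<omega> = ?g" unfolding split using True by simp
      show ?thesis using Z_ge[of 0 L \<omega>] Z_01[of 0 L \<omega>] unfolding P1 NL[symmetric] by simp
    qed
  qed
  have diff: "\<bar>expectation (P q) - Q L\<bar> \<le> (real q * real l + real (L - q * s)) * p"
  proof -
    have e: "expectation (P q) - Q L = expectation (\<lambda>\<omega>. P q \<omega> - Z 0 L \<omega>)"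
      unfolding Q_def using Pb by (simp add: bdd_rv_integrable)
    have "0 \<le> expectation (\<lambda>\<omega>. P q \<omega> - Z 0 L \<omega>)" using pt by (intro integral_nonneg_AE AE_I2) auto
    moreover have "expectation (\<lambda>\<omega>. P q \<omega> - Z 0 L \<omega>) \<le> expectation (\<lambda>\<omega>. (\<Sum>i<q. N (i * s) (i * s + l) \<omega>) + N (q * s) L \<omega>)"
      using pt Pb by (intro integral_mono bdd_rv_integrable bdd_rv_diff bdd_rv_add bdd_rv_sum N_bdd Z_bdd) auto
    moreover have "\<dots> = (\<Sum>i<q. expectation (N (i * s) (i * s + l))) + expectation (N (q * s) L)"
    proof -
      have "integrable M (\<lambda>\<omega>. \<Sum>i<q. N (i * s) (i * s + l) \<omega>)" by (intro bdd_rv_integrable bdd_rv_sum N_bdd)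
      then show ?thesis by (simp add: bdd_rv_integrable)
    qed
    ultimately show ?thesis unfolding e using qs by (simp add: E_N algebra_simps)
  qed
  have "\<bar>Q L - Q s ^ q\<bar> \<le> \<bar>expectation (P q) - Q L\<bar> + \<bar>expectation (P q) - Q (s - l) ^ q\<bar> + \<bar>Q (s - l) ^ q - Q s ^ q\<bar>"
    by linarith
  also have "\<dots> \<le> (real q * real l + real (L - q * s)) * p + real q * \<rho> + real q * (real l * p)"
    using diff ind[of q] pw by simp
  finally show ?thesis by (simp add: algebra_simps)
qed

text \<open>
  Blocks at distance at least 2 are separated by a whole block and hence by \<open>l\<close>. For adjacent blocks the
  first \<open>l\<close> indices of the second one are split off and estimated by Cauchy-Schwarz; the rest
  mixes with the first block.
\<close>
lemma var_N_blocks: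
  assumes ls: "l \<le> s" and qn: "q * s \<le> n" and s: "s > 0"
  shows "\<bar>cov M (N 0 (q * s)) (N 0 (q * s)) - real q * cov M (N 0 s) (N 0 s)\<bar>
    \<le> (real q)\<^sup>2 * \<rho> * S2 s + 2 * real q * (sqrt (S2 s) * sqrt (S2 l) + \<rho> * S2 s)"
proof -
  define B where "B i = N (i * s) ((i + 1) * s)" for i
  have Bb: "bdd_rv M (B i)" for i by (simp add: B_def)
  have sdB: "sd M (B i) \<le> sqrt (S2 s)" for i unfolding B_def by (rule sd_N_le) auto
  have varB: "cov M (B i) (B i) = cov M (N 0 s) (N 0 s)" for i
    unfolding B_def cov_eq[OF N_bdd N_bdd]
    using E_N_sq[of "i * s" "(i+1) * s"] E_N_sq[of 0 s] by (simp add: E_N power2_eq_square)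
  have idx: "(j + 1) * s \<le> n" if "j < q" for j
  proof -
    have "(j + 1) * s \<le> q * s" using that by (intro mult_le_mono1) simp
    with qn show ?thesis by simp
  qed
  have far: "\<bar>cov M (B i) (B j)\<bar> \<le> \<rho> * S2 s" if "i + 2 \<le> j" "j < q" for i j
  proof -
    have le: "(i + 1) * s + s \<le> j * s" using mult_le_mono1[OF that(1), of s] by simp
    have "\<bar>cov M (B i) (B j)\<bar> \<le> \<rho> * (sd M (B i) * sd M (B j))"
    proof (rule mixing[where a=1 and b="(i+1) * s" and c="j * s+1" and d="(j+1) * s"])
      show "B i \<in> borel_measurable (TF 1 ((i + 1) * s))" unfolding B_def by (rule N_meas_TF) auto
      show "B j \<in> borel_measurable (TF (j * s + 1) ((j + 1) * s))" unfolding B_def by (rule N_meas_TF) auto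
    qed (use le ls s idx[OF that(2)] Bb in auto)
    also have "sd M (B i) * sd M (B j) \<le> sqrt (S2 s) * sqrt (S2 s)" by (intro mult_mono sdB) (auto simp: S2_nonneg)
    finally show ?thesis using rho_nonneg by (simp add: S2_nonneg mult_left_mono)
  qed
  have adj: "\<bar>cov M (B i) (B (Suc i))\<bar> \<le> sqrt (S2 s) * sqrt (S2 l) + \<rho> * S2 s" if "Suc i < q" for i
  proof -
    let ?b = "(i + 1) * s"
    have "B (Suc i) = (\<lambda>\<omega>. N ?b (?b + l) \<omega> + N (?b + l) (?b + s) \<omega>)"
      unfolding B_def using N_split[of ?b "?b + l" "?b + s"] ls by (auto simp: add.commute)
    then have "cov M (B i) (B (Suc i)) = cov M (B i) (N ?b (?b + l)) + cov M (B i) (N (?b + l) (?b + s))"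
      using Bb by (simp add: cov_add_right)
    moreover have "\<bar>cov M (B i) (N ?b (?b + l))\<bar> \<le> sqrt (S2 s) * sqrt (S2 l)"
    proof -
      have "\<bar>cov M (B i) (N ?b (?b + l))\<bar> \<le> sd M (B i) * sd M (N ?b (?b + l))" by (intro cov_le_sd Bb N_bdd)
      also have "\<dots> \<le> sqrt (S2 s) * sqrt (S2 l)" by (intro mult_mono sdB sd_N_le) (auto simp: S2_nonneg)
      finally show ?thesis .
    qed
    moreover have "\<bar>cov M (B i) (N (?b + l) (?b + s))\<bar> \<le> \<rho> * S2 s"
    proof (cases "l = s")
      case True then show ?thesis using rho_nonneg S2_nonneg
        by (simp add: cov_def prob_space)
    next
      case False
      have "\<bar>cov M (B i) (N (?b + l) (?b + s))\<bar> \<le> \<rho> * (sd M (B i) * sd M (N (?b + l) (?b + s)))"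
      proof (rule mixing[where a=1 and b="?b" and c="?b+l+1" and d="?b+s"])
        show "B i \<in> borel_measurable (TF 1 ?b)" unfolding B_def by (rule N_meas_TF) auto
        show "N (?b + l) (?b + s) \<in> borel_measurable (TF (?b + l + 1) (?b + s))" by (rule N_meas_TF) auto
      qed (use False ls s idx[OF that] Bb in auto)
      also have "sd M (B i) * sd M (N (?b + l) (?b + s)) \<le> sqrt (S2 s) * sqrt (S2 s)"
        using ls by (intro mult_mono sdB sd_N_le) (auto simp: S2_nonneg)
      finally show ?thesis using rho_nonneg by (simp add: S2_nonneg mult_left_mono)
    qed
    ultimately show ?thesis by linarith
  qed
  define e where "e = sqrt (S2 s) * sqrt (S2 l) + \<rho> * S2 s"
  have e0: "e \<ge> 0" unfolding e_def using rho_nonneg S2_nonneg by simp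
  have row: "\<bar>(\<Sum>j<q. cov M (B i) (B j)) - cov M (N 0 s) (N 0 s)\<bar> \<le> real q * (\<rho> * S2 s) + 2 * e" if i: "i < q" for i
  proof -
    have "(\<Sum>j<q. cov M (B i) (B j)) = cov M (B i) (B i) + (\<Sum>j\<in>{..<q} - {i}. cov M (B i) (B j))"
      using i by (intro sum.remove) auto
    then have "\<bar>(\<Sum>j<q. cov M (B i) (B j)) - cov M (N 0 s) (N 0 s)\<bar> = \<bar>\<Sum>j\<in>{..<q} - {i}. cov M (B i) (B j)\<bar>"
      by (simp add: varB)
    also have "\<dots> \<le> (\<Sum>j\<in>{..<q} - {i}. \<rho> * S2 s + e * of_bool (j = i + 1) + e * of_bool (j + 1 = i))"
    proof (intro order_trans[OF sum_abs] sum_mono)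
      fix j assume j: "j \<in> {..<q} - {i}"
      have r0: "0 \<le> \<rho> * S2 s" using rho_nonneg S2_nonneg by simp
      consider "j = i + 1" | "j + 1 = i" | "i + 2 \<le> j" | "j + 2 \<le> i" using j by fastforce
      then show "\<bar>cov M (B i) (B j)\<bar> \<le> \<rho> * S2 s + e * of_bool (j = i + 1) + e * of_bool (j + 1 = i)"
      proof cases
        case 1
        then have "\<bar>cov M (B i) (B j)\<bar> \<le> e" using adj[of i] j by (auto simp: e_def)
        then show ?thesis using 1 r0 by auto
      next
        case 2
        then have "\<bar>cov M (B i) (B j)\<bar> \<le> e" using adj[of j] i by (auto simp: e_def cov_commute)
        then show ?thesis using 2 r0 by auto
      next
        case 3
        then have "\<bar>cov M (B i) (B j)\<bar> \<le> \<rho> * S2 s" using far[of i j] j by auto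
        then show ?thesis using 3 by auto
      next
        case 4
        then have "\<bar>cov M (B i) (B j)\<bar> \<le> \<rho> * S2 s" using far[of j i] i by (auto simp: cov_commute)
        then show ?thesis using 4 by auto
      qed
    qed
    also have "\<dots> \<le> (\<Sum>j<q. \<rho> * S2 s + e * of_bool (j = i + 1) + e * of_bool (j + 1 = i))"
      using e0 rho_nonneg S2_nonneg by (intro sum_mono2) auto
    also have "\<dots> = real q * (\<rho> * S2 s) + e * (\<Sum>j<q. of_bool (j = i + 1)) + e * (\<Sum>j<q. of_bool (j + 1 = i))"
      by (simp add: sum.distrib sum_distrib_left)
    also have "\<dots> \<le> real q * (\<rho> * S2 s) + e * 1 + e * 1"
    proof -
      have 1: "(\<Sum>j<q. of_bool (j = i + 1)) \<le> (1::real)" by (simp add: of_bool_def sum.delta)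
      have "(\<Sum>j<q. of_bool (j + 1 = i)) \<le> (\<Sum>j<q. of_bool (j = i - 1) :: real)" by (intro sum_mono) auto
      also have "\<dots> \<le> 1" by (simp add: of_bool_def sum.delta)
      finally have 2: "(\<Sum>j<q. of_bool (j + 1 = i)) \<le> (1::real)" .
      show ?thesis by (intro add_mono order_refl mult_left_mono[OF 1 e0] mult_left_mono[OF 2 e0])
    qed
    finally show ?thesis by simp
  qed
  have "N 0 (q * s) = (\<lambda>\<omega>. \<Sum>i<q. B i \<omega>)" using N_sum_blocks[of 0 q s] by (auto simp: B_def)
  then have "cov M (N 0 (q * s)) (N 0 (q * s)) = cov M (\<lambda>\<omega>. \<Sum>i<q. B i \<omega>) (\<lambda>\<omega>. \<Sum>i<q. B i \<omega>)" by simp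
  also have "\<dots> = (\<Sum>i<q. cov M (B i) (\<lambda>\<omega>. \<Sum>i<q. B i \<omega>))" by (intro cov_sum_left bdd_rv_sum Bb)
  also have "\<dots> = (\<Sum>i<q. \<Sum>j<q. cov M (B i) (B j))" by (intro sum.cong refl cov_sum_right Bb)
  finally have "cov M (N 0 (q * s)) (N 0 (q * s)) - real q * cov M (N 0 s) (N 0 s) = (\<Sum>i<q. (\<Sum>j<q. cov M (B i) (B j)) - cov M (N 0 s) (N 0 s))"
    by (simp add: sum_subtractf)
  also have "\<bar>\<dots>\<bar> \<le> (\<Sum>i<q. real q * (\<rho> * S2 s) + 2 * e)"
    by (intro order_trans[OF sum_abs] sum_mono row) auto
  finally show ?thesis by (simp add: e_def power2_eq_square algebra_simps)
qed

section \<open>Covariances of windows and counts\<close>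

text \<open>
  Inside the window the product of the indicator and the count vanishes, so the covariance is minus
  the product of the means. Exceedances within \<open>l\<close> of the window contribute at most their mean
  number, and more distant ones are controlled by mixing. The minimum accounts for a window that
  reaches beyond \<open>L\<close>.
\<close>
lemma cov_window_count:
  assumes a: "a \<le> L" and L: "L \<le> n" and r: "r \<ge> 1" and ar: "a + r \<le> n"
  defines "w \<equiv> min (a + r) L"
  shows "\<bar>cov M (Z a (a + r)) (N 0 L) + Q r * (real (w - a) * p)\<bar> \<le> 2 * real l * p + 2 * \<rho> * sqrt (S2 L)"
proof -
  let ?J = "Z a (a + r)"
  define b where "b = min (w + l) L"
  have w: "a \<le> w" "w \<le> L" "w \<le> a + r" using a by (auto simp: w_def)
  have b: "w \<le> b" "b \<le> L" using w by (auto simp: b_def)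
  have split: "N 0 L = (\<lambda>\<omega>. N 0 (a - l) \<omega> + (N (a - l) a \<omega> + (N a w \<omega> + (N w b \<omega> + N b L \<omega>))))"
    using N_split[of 0 "a - l" L] N_split[of "a - l" a L] N_split[of a w L] N_split[of w b L] a w b by auto
  have c: "cov M ?J (N 0 L) = cov M ?J (N 0 (a - l)) + (cov M ?J (N (a - l) a) + (cov M ?J (N a w) + (cov M ?J (N w b) + cov M ?J (N b L))))"
    unfolding split by (simp add: cov_add_right bdd_rv_add)
  have in_w: "cov M ?J (N a w) = - (Q r * (real (w - a) * p))"
  proof -
    have "?J \<omega> * N a w \<omega> = 0" for \<omega>
      using N_mono[of a a w "a + r" \<omega>] w N_nonneg[of a w \<omega>] by (auto simp: Z_def simp del: N_nonneg)
    then have "(\<lambda>\<omega>. ?J \<omega> * N a w \<omega>) = (\<lambda>\<omega>. 0)" by auto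
    then show ?thesis unfolding cov_eq[OF Z_bdd N_bdd] using w by (simp add: E_Z E_N)
  qed
  have nearL: "\<bar>cov M ?J (N (a - l) a)\<bar> \<le> real l * p"
  proof -
    have "\<bar>cov M ?J (N (a - l) a)\<bar> \<le> real (a - (a - l)) * p" by (rule cov_Z_N_le) simp
    also have "\<dots> \<le> real l * p" using p_nonneg by (intro mult_right_mono) auto
    finally show ?thesis .
  qed
  have nearR: "\<bar>cov M ?J (N w b)\<bar> \<le> real l * p"
  proof -
    have "\<bar>cov M ?J (N w b)\<bar> \<le> real (b - w) * p" by (rule cov_Z_N_le) (rule b)
    also have "\<dots> \<le> real l * p" using p_nonneg by (intro mult_right_mono) (auto simp: b_def)
    finally show ?thesis .
  qed
  have far: "\<bar>cov M f g\<bar> \<le> \<rho> * sqrt (S2 L)" if "\<bar>cov M f g\<bar> \<le> \<rho> * (sd M f * sd M g)" "sd M f * sd M g \<le> 1 * sqrt (S2 L)" for f g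
    using that mult_left_mono[OF that(2) rho_nonneg] by simp
  have farL: "\<bar>cov M ?J (N 0 (a - l))\<bar> \<le> \<rho> * sqrt (S2 L)"
  proof (cases "a \<le> l")
    case True
    then have "N 0 (a - l) = (\<lambda>\<omega>. 0)" by auto
    then show ?thesis using rho_nonneg S2_nonneg by simp
  next
    case False
    have "\<bar>cov M (N 0 (a - l)) ?J\<bar> \<le> \<rho> * sqrt (S2 L)"
    proof (rule far)
      show "\<bar>cov M (N 0 (a - l)) ?J\<bar> \<le> \<rho> * (sd M (N 0 (a - l)) * sd M ?J)"
        by (rule mixing[where a=1 and b="a - l" and c="a + 1" and d="a + r"])
           (use False ar r in \<open>auto intro!: N_meas_TF Z_meas_TF\<close>)
      have "sd M (N 0 (a - l)) * sd M ?J \<le> sqrt (S2 L) * 1"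
        using a by (intro mult_mono sd_N_le sd_Z_le) (auto simp: S2_nonneg)
      then show "sd M (N 0 (a - l)) * sd M ?J \<le> 1 * sqrt (S2 L)" by simp
    qed
    then show ?thesis by (simp add: cov_commute)
  qed
  have farR: "\<bar>cov M ?J (N b L)\<bar> \<le> \<rho> * sqrt (S2 L)"
  proof (cases "b = L")
    case True
    then have "N b L = (\<lambda>\<omega>. 0)" by auto
    then show ?thesis using rho_nonneg S2_nonneg by simp
  next
    case False
    then have bl: "b = a + r + l" "b < L" by (auto simp: b_def w_def min_def split: if_splits)
    show ?thesis
    proof (rule far)
      show "\<bar>cov M ?J (N b L)\<bar> \<le> \<rho> * (sd M ?J * sd M (N b L))"
        by (rule mixing[where a="a + 1" and b="a + r" and c="b + 1" and d=L])
           (use bl L r in \<open>auto intro!: N_meas_TF Z_meas_TF\<close>)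
      show "sd M ?J * sd M (N b L) \<le> 1 * sqrt (S2 L)"
        using bl by (intro mult_mono sd_N_le sd_Z_le) (auto simp: S2_nonneg)
    qed
  qed
  show ?thesis using nearL nearR farL farR unfolding c in_w by linarith
qed

text \<open>
  The covariance of two windows of length \<open>r\<close> at distance \<open>d \<le> r\<close>.
\<close>
definition c :: "nat \<Rightarrow> nat \<Rightarrow> real" where "c r d = Q (r + d) - (Q r)\<^sup>2"

lemma cov_windows_overlap:
  assumes "d \<le> r" shows "cov M (Z a (a + r)) (Z (a + d) (a + d + r)) = c r d"
proof -
  have "Z a (a + r) \<omega> * Z (a + d) (a + d + r) \<omega> = Z a (a + d + r) \<omega>" for \<omega>
  proof -
    have "Z a (a + r) \<omega> = Z a (a + d) \<omega> * Z (a + d) (a + r) \<omega>" using assms by (intro Z_split) auto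
    moreover have "Z (a + d) (a + d + r) \<omega> = Z (a + d) (a + r) \<omega> * Z (a + r) (a + d + r) \<omega>" using assms by (intro Z_split) auto
    moreover have "Z a (a + d + r) \<omega> = Z a (a + d) \<omega> * (Z (a + d) (a + r) \<omega> * Z (a + r) (a + d + r) \<omega>)"
      using assms Z_split[of a "a + d" "a + d + r" \<omega>] Z_split[of "a + d" "a + r" "a + d + r" \<omega>] by simp
    ultimately show ?thesis by (auto simp: Z_def)
  qed
  then show ?thesis unfolding cov_eq[OF Z_bdd Z_bdd] by (simp add: E_Z c_def power2_eq_square add.commute)
qed

lemma cov_windows_far:
  assumes "a + r + l \<le> b + 1" "b + r \<le> n" "r \<ge> 1"
  shows "\<bar>cov M (Z a (a + r)) (Z b (b + r))\<bar> \<le> \<rho>"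
proof -
  have "\<bar>cov M (Z a (a + r)) (Z b (b + r))\<bar> \<le> \<rho> * (sd M (Z a (a + r)) * sd M (Z b (b + r)))"
    by (rule mixing[where a="a + 1" and b="a + r" and c="b + 1" and d="b + r"])
       (use assms in \<open>auto intro!: Z_meas_TF\<close>)
  also have "\<dots> \<le> \<rho> * 1" using rho_nonneg by (intro mult_left_mono mult_le_one sd_Z_le) auto
  finally show ?thesis by simp
qed

lemma c_le: "d \<le> r \<Longrightarrow> \<bar>c r d\<bar> \<le> 1"
  using cov_windows_overlap[of d r 0] cov_Z_Z_le[of 0 "0 + r" "0 + d" "0 + d + r"] by simp

text \<open>
  The sum of \<open>c r |d|\<close> over all integers \<open>d\<close> with \<open>|d| < r\<close>.
\<close>
definition \<kappa> :: "nat \<Rightarrow> real" where "\<kappa> r = 2 * (\<Sum>d<r. c r d) - c r 0"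

lemma kappa_le: "\<bar>\<kappa> r\<bar> \<le> 2 * real r + 1"
proof -
  have "\<bar>\<Sum>d<r. c r d\<bar> \<le> (\<Sum>d<r. 1)" by (intro order_trans[OF sum_abs] sum_mono c_le) auto
  then show ?thesis using c_le[of 0 r] unfolding \<kappa>_def by simp
qed

lemma sum_of_bool_interval_le:
  assumes "finite I" "I \<inter> A \<subseteq> {x..<x + m}"
  shows "(\<Sum>b\<in>I. of_bool (b \<in> A)) \<le> real m"
proof -
  have "(\<Sum>b\<in>I. of_bool (b \<in> A)) = real (card (I \<inter> A))"
    using assms(1) by (simp add: of_bool_def sum.If_cases Int_def)
  also have "\<dots> \<le> real (card {x..<x + m})" using assms(2) by (intro of_nat_mono card_mono) auto
  finally show ?thesis by simp
qed

text \<open>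
  Overlapping windows contribute \<open>\<kappa> r\<close> in total if all shifts up to \<open>r\<close> are available on both sides. The
  at most \<open>2l\<close> windows that are disjoint from the given one but too close for mixing contribute at most
  1 each, the others \<open>\<rho>\<close>. Near the two ends the shifts are incomplete, and the crude bounds \<open>2r\<close> for
  the overlapping windows and \<open>2r + 1\<close> for \<open>\<kappa> r\<close> add up to at most \<open>5r\<close>.
\<close>
lemma cov_window_row:
  assumes a: "a < L" and L: "L + r \<le> n" and r: "r \<ge> 1"
  shows "\<bar>(\<Sum>b<L. cov M (Z a (a + r)) (Z b (b + r))) - \<kappa> r\<bar>
     \<le> 2 * real l + real L * \<rho> + (if r \<le> a \<and> a + r \<le> L then 0 else 5 * real r)"
proof -
  let ?c = "\<lambda>b. cov M (Z a (a + r)) (Z b (b + r))"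
  let ?near = "\<lambda>b. a < b + r \<and> b < a + r"
  define A where "A = {b. b < L \<and> ?near b}"
  have A: "A \<subseteq> {..<L}" by (auto simp: A_def)
  have finA: "finite A" using A finite_subset by blast
  have rest: "\<bar>\<Sum>b\<in>{..<L} - A. ?c b\<bar> \<le> 2 * real l + real L * \<rho>"
  proof -
    have "\<bar>\<Sum>b\<in>{..<L} - A. ?c b\<bar> \<le> (\<Sum>b\<in>{..<L} - A. of_bool (b \<in> {a + r..<a + r + l}) + of_bool (b \<in> {b. b + r \<le> a \<and> a < b + r + l}) + \<rho>)"
    proof (intro order_trans[OF sum_abs] sum_mono)
      fix b assume b: "b \<in> {..<L} - A"
      consider "b \<in> {a + r..<a + r + l}" | "b \<in> {b. b + r \<le> a \<and> a < b + r + l}" | "a + r + l \<le> b" | "b + r + l \<le> a"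
        using b by (fastforce simp: A_def)
      then show "\<bar>?c b\<bar> \<le> of_bool (b \<in> {a + r..<a + r + l}) + of_bool (b \<in> {b. b + r \<le> a \<and> a < b + r + l}) + \<rho>"
      proof cases
        case 1
        then have "of_bool (b \<in> {a + r..<a + r + l}) = (1::real)" by simp
        then show ?thesis using cov_Z_Z_le[of a "a+r" b "b+r"] rho_nonneg by simp
      next
        case 2
        then have "of_bool (b \<in> {b. b + r \<le> a \<and> a < b + r + l}) = (1::real)" by simp
        then show ?thesis using cov_Z_Z_le[of a "a+r" b "b+r"] rho_nonneg by simp
      next
        case 3
        then have "\<bar>?c b\<bar> \<le> \<rho>" using b L r by (intro cov_windows_far) auto
        then show ?thesis by (simp add: add_increasing)
      next
        case 4
        then have "\<bar>cov M (Z b (b + r)) (Z a (a + r))\<bar> \<le> \<rho>" using a L r by (intro cov_windows_far) auto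
        then show ?thesis by (simp add: cov_commute add_increasing)
      qed
    qed
    also have "\<dots> = (\<Sum>b\<in>{..<L} - A. of_bool (b \<in> {a + r..<a + r + l})) + (\<Sum>b\<in>{..<L} - A. of_bool (b \<in> {b. b + r \<le> a \<and> a < b + r + l})) + real (card ({..<L} - A)) * \<rho>"
      by (simp add: sum.distrib)
    also have "\<dots> \<le> real l + real l + real L * \<rho>"
    proof (intro add_mono mult_right_mono rho_nonneg)
      show "(\<Sum>b\<in>{..<L} - A. of_bool (b \<in> {a + r..<a + r + l})) \<le> real l"
        by (rule sum_of_bool_interval_le[where x="a + r"]) auto
      show "(\<Sum>b\<in>{..<L} - A. of_bool (b \<in> {b. b + r \<le> a \<and> a < b + r + l})) \<le> real l"
        by (rule sum_of_bool_interval_le[where x="a + 1 - (r + l)"]) auto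
      show "real (card ({..<L} - A)) \<le> real L"
        using card_mono[of "{..<L}" "{..<L} - A"] by simp
    qed
    finally show ?thesis by simp
  qed
  have total: "(\<Sum>b<L. ?c b) = (\<Sum>b\<in>A. ?c b) + (\<Sum>b\<in>{..<L} - A. ?c b)"
    using sum.subset_diff[OF A, of ?c] by simp
  show ?thesis
  proof (cases "r \<le> a \<and> a + r \<le> L")
    case True
    have A_eq: "A = {a + 1 - r..<a} \<union> {a..<a + r}" using True r by (auto simp: A_def)
    have "(\<Sum>b\<in>A. ?c b) = (\<Sum>b\<in>{a + 1 - r..<a}. ?c b) + (\<Sum>b\<in>{a..<a + r}. ?c b)"
      unfolding A_eq by (rule sum.union_disjoint) auto
    also have "(\<Sum>b\<in>{a..<a + r}. ?c b) = (\<Sum>d<r. c r d)"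
    proof (rule sum.reindex_bij_witness[where i="\<lambda>d. a + d" and j="\<lambda>b. b - a"])
      fix b assume b: "b \<in> {a..<a + r}"
      then have "b - a \<le> r" by auto
      from cov_windows_overlap[OF this, of a] show "c r (b - a) = ?c b" using b by simp
    qed auto
    also have "(\<Sum>b\<in>{a + 1 - r..<a}. ?c b) = (\<Sum>d\<in>{1..<r}. c r d)"
    proof (rule sum.reindex_bij_witness[where i="\<lambda>d. a - d" and j="\<lambda>b. a - b"])
      fix b assume b: "b \<in> {a + 1 - r..<a}"
      then have "a - b \<le> r" by auto
      from cov_windows_overlap[OF this, of b] show "c r (a - b) = ?c b" using b by (simp add: cov_commute)
    qed (use True in auto)
    also have "(\<Sum>d\<in>{1..<r}. c r d) = (\<Sum>d<r. c r d) - c r 0"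
    proof -
      have "(\<Sum>d<r. c r d) = c r 0 + (\<Sum>d\<in>{..<r} - {0}. c r d)" using r by (intro sum.remove) auto
      moreover have "{..<r} - {0} = {1..<r}" by auto
      ultimately show ?thesis by simp
    qed
    finally have "(\<Sum>b\<in>A. ?c b) = \<kappa> r" by (simp add: \<kappa>_def)
    then show ?thesis using rest True unfolding total by simp
  next
    case False
    have "\<bar>\<Sum>b\<in>A. ?c b\<bar> \<le> (\<Sum>b\<in>A. 1)" by (intro order_trans[OF sum_abs] sum_mono cov_Z_Z_le)
    also have "\<dots> = real (card A)" by simp
    also have "\<dots> \<le> real (card {a + 1 - r..<a + r})" by (intro of_nat_mono card_mono) (auto simp: A_def)
    also have "\<dots> \<le> 2 * real r" by simp
    finally have "\<bar>\<Sum>b\<in>A. ?c b\<bar> \<le> 2 * real r" .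
    moreover have "1 \<le> real r" using r by simp
    ultimately have "\<bar>(\<Sum>b\<in>A. ?c b) + (\<Sum>b\<in>{..<L} - A. ?c b) - \<kappa> r\<bar> \<le> 2 * real l + real L * \<rho> + 5 * real r"
      using rest kappa_le[of r] by linarith
    then show ?thesis using False unfolding total by auto
  qed
qed

end

text \<open>
  \<open>K\<close> blocks of length \<open>r\<close> with one further block to spare: a window that starts in one of the \<open>K\<close>
  blocks may end in the next one.
\<close>
locale blocked_threshold = stationary_threshold M X u n l
  for M :: "'a measure" and X u n l +
  fixes r K :: nat
  assumes r_pos: "r \<ge> 1" and l_le_r: "l \<le> r" and K_pos: "K \<ge> 1" and Kr: "(K + 1) * r \<le> n"
begin

abbreviation "J a \<equiv> Z a (a + r)"

definition TI :: "'a \<Rightarrow> real" where "TI \<omega> = (\<Sum>i<K. J (i * r) \<omega>)"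
definition TS :: "'a \<Rightarrow> real" where "TS \<omega> = (\<Sum>a<K * r. J a \<omega>)"
definition TN :: "'a \<Rightarrow> real" where "TN = N 0 (K * r)"

lemma TI_bdd: "bdd_rv M TI" unfolding TI_def[abs_def] by (intro bdd_rv_sum Z_bdd)
lemma TS_bdd: "bdd_rv M TS" unfolding TS_def[abs_def] by (intro bdd_rv_sum Z_bdd)
lemma TN_bdd: "bdd_rv M TN" unfolding TN_def by (rule N_bdd)

lemma block_start: "i < K \<Longrightarrow> i * r + r \<le> K * r"
  using mult_le_mono1[of "Suc i" K r] by simp

lemma block_start_less: "i < K \<Longrightarrow> i * r < K * r"
  using block_start[of i] r_pos by simp

lemma Kr': "K * r + r \<le> n" using Kr by simp

lemma cov_TI_expand: "bdd_rv M f \<Longrightarrow> cov M TI f = (\<Sum>i<K. cov M (J (i * r)) f)"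
  unfolding TI_def[abs_def] by (intro cov_sum_left Z_bdd)

lemma cov_TS_expand: "bdd_rv M f \<Longrightarrow> cov M TS f = (\<Sum>a<K * r. cov M (J a) f)"
  unfolding TS_def[abs_def] by (intro cov_sum_left Z_bdd)

text \<open>
  Adjacent blocks are too close for mixing. Their covariance is \<open>c r r\<close>, which becomes small because two
  adjacent blocks form a window of length \<open>2r\<close>.
\<close>
lemma var_TI: "\<bar>cov M TI TI - real K * c r 0\<bar> \<le> 2 * real K * \<bar>c r r\<bar> + (real K)\<^sup>2 * \<rho>"
proof -
  have row: "\<bar>(\<Sum>j<K. cov M (J (i * r)) (J (j * r))) - c r 0\<bar> \<le> 2 * \<bar>c r r\<bar> + real K * \<rho>" if i: "i < K" for i
  proof -
    have "(\<Sum>j<K. cov M (J (i * r)) (J (j * r))) = cov M (J (i * r)) (J (i * r)) + (\<Sum>j\<in>{..<K} - {i}. cov M (J (i * r)) (J (j * r)))"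
      using i by (intro sum.remove) auto
    also have "cov M (J (i * r)) (J (i * r)) = c r 0" using cov_windows_overlap[of 0 r "i * r"] by simp
    finally have "\<bar>(\<Sum>j<K. cov M (J (i * r)) (J (j * r))) - c r 0\<bar> = \<bar>\<Sum>j\<in>{..<K} - {i}. cov M (J (i * r)) (J (j * r))\<bar>" by simp
    also have "\<dots> \<le> (\<Sum>j\<in>{..<K} - {i}. \<bar>c r r\<bar> * of_bool (j = i + 1) + \<bar>c r r\<bar> * of_bool (j + 1 = i) + \<rho>)"
    proof (intro order_trans[OF sum_abs] sum_mono)
      fix j assume j: "j \<in> {..<K} - {i}"
      consider "j = i + 1" | "i = j + 1" | "i + 2 \<le> j" | "j + 2 \<le> i" using j by fastforce
      then show "\<bar>cov M (J (i * r)) (J (j * r))\<bar> \<le> \<bar>c r r\<bar> * of_bool (j = i + 1) + \<bar>c r r\<bar> * of_bool (j + 1 = i) + \<rho>"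
      proof cases
        case 1
        then have "cov M (J (i * r)) (J (j * r)) = c r r"
          using cov_windows_overlap[of r r "i * r"] by (simp add: add.commute)
        then show ?thesis using 1 rho_nonneg by simp
      next
        case 2
        then have "cov M (J (j * r)) (J (i * r)) = c r r"
          using cov_windows_overlap[of r r "j * r"] by (simp add: add.commute)
        then show ?thesis using 2 rho_nonneg by (simp add: cov_commute)
      next
        case 3
        then have "i * r + r + r \<le> j * r" using mult_le_mono1[of "i + 2" j r] by simp
        then have "\<bar>cov M (J (i * r)) (J (j * r))\<bar> \<le> \<rho>"
          using j block_start[of j] Kr' l_le_r r_pos by (intro cov_windows_far) auto
        then show ?thesis using 3 by simp
      next
        case 4
        then have "j * r + r + r \<le> i * r" using mult_le_mono1[of "j + 2" i r] by simp
        then have "\<bar>cov M (J (j * r)) (J (i * r))\<bar> \<le> \<rho>"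
          using i block_start[of i] Kr' l_le_r r_pos by (intro cov_windows_far) auto
        then show ?thesis using 4 by (simp add: cov_commute)
      qed
    qed
    also have "\<dots> \<le> (\<Sum>j<K. \<bar>c r r\<bar> * of_bool (j = i + 1) + \<bar>c r r\<bar> * of_bool (j + 1 = i) + \<rho>)"
      using rho_nonneg by (intro sum_mono2) auto
    also have "\<dots> = \<bar>c r r\<bar> * (\<Sum>j<K. of_bool (j = i + 1)) + \<bar>c r r\<bar> * (\<Sum>j<K. of_bool (j + 1 = i)) + real K * \<rho>"
      by (simp add: sum.distrib sum_distrib_left)
    also have "\<dots> \<le> \<bar>c r r\<bar> * 1 + \<bar>c r r\<bar> * 1 + real K * \<rho>"
    proof -
      have 1: "(\<Sum>j<K. of_bool (j = i + 1)) \<le> (1::real)" by (simp add: of_bool_def sum.delta)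
      have "(\<Sum>j<K. of_bool (j + 1 = i)) \<le> (\<Sum>j<K. of_bool (j = i - 1) :: real)" by (intro sum_mono) auto
      also have "\<dots> \<le> 1" by (simp add: of_bool_def sum.delta)
      finally have 2: "(\<Sum>j<K. of_bool (j + 1 = i)) \<le> (1::real)" .
      show ?thesis by (intro add_mono order_refl mult_left_mono[OF 1 abs_ge_zero] mult_left_mono[OF 2 abs_ge_zero])
    qed
    finally show ?thesis by simp
  qed
  have "cov M TI TI = (\<Sum>i<K. cov M (J (i * r)) TI)" by (rule cov_TI_expand[OF TI_bdd])
  also have "\<dots> = (\<Sum>i<K. \<Sum>j<K. cov M (J (i * r)) (J (j * r)))"
    unfolding TI_def[abs_def] by (intro sum.cong refl cov_sum_right Z_bdd)
  finally have eq: "cov M TI TI - real K * c r 0 = (\<Sum>i<K. (\<Sum>j<K. cov M (J (i * r)) (J (j * r))) - c r 0)"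
    by (simp add: sum_subtractf)
  have "\<bar>cov M TI TI - real K * c r 0\<bar> \<le> (\<Sum>i<K. 2 * \<bar>c r r\<bar> + real K * \<rho>)"
    unfolding eq by (intro order_trans[OF sum_abs] sum_mono row) auto
  also have "\<dots> = real K * (2 * \<bar>c r r\<bar> + real K * \<rho>)" by simp
  also have "\<dots> = 2 * real K * \<bar>c r r\<bar> + (real K)\<^sup>2 * \<rho>" by (simp only: distrib_left power2_eq_square mult.assoc mult.left_commute)
  finally show ?thesis .
qed

lemma cov_J_TS:
  assumes "a < K * r"
  shows "\<bar>cov M (J a) TS - \<kappa> r\<bar> \<le> 2 * real l + real (K * r) * \<rho> + (if r \<le> a \<and> a + r \<le> K * r then 0 else 5 * real r)"
proof -
  have "cov M (J a) TS = (\<Sum>b<K * r. cov M (J a) (J b))"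
    unfolding TS_def[abs_def] by (intro cov_sum_right Z_bdd)
  then show ?thesis using cov_window_row[OF assms Kr' r_pos] by simp
qed

text \<open>
  Only the first block is an end position in the sense of \<open>cov_window_row\<close>.
\<close>
lemma cov_TI_TS: "\<bar>cov M TI TS - real K * \<kappa> r\<bar> \<le> real K * (2 * real l + real (K * r) * \<rho>) + 5 * real r"
proof -
  have eq: "cov M TI TS - real K * \<kappa> r = (\<Sum>i<K. cov M (J (i * r)) TS - \<kappa> r)"
    by (simp add: cov_TI_expand[OF TS_bdd] sum_subtractf)
  have "\<bar>cov M TI TS - real K * \<kappa> r\<bar> \<le> (\<Sum>i<K. 2 * real l + real (K * r) * \<rho> + 5 * real r * of_bool (i = 0))"
    unfolding eq
  proof (intro order_trans[OF sum_abs] sum_mono)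
    fix i assume i: "i \<in> {..<K}"
    have "\<bar>cov M (J (i * r)) TS - \<kappa> r\<bar> \<le> 2 * real l + real (K * r) * \<rho> + (if r \<le> i * r \<and> i * r + r \<le> K * r then 0 else 5 * real r)"
      using i block_start_less by (intro cov_J_TS) simp
    also have "(if r \<le> i * r \<and> i * r + r \<le> K * r then 0 else 5 * real r) \<le> 5 * real r * of_bool (i = 0)"
      using i block_start[of i] by (cases i) auto
    finally show "\<bar>cov M (J (i * r)) TS - \<kappa> r\<bar> \<le> 2 * real l + real (K * r) * \<rho> + 5 * real r * of_bool (i = 0)" by simp
  qed
  also have "\<dots> = real K * (2 * real l + real (K * r) * \<rho>) + 5 * real r * (\<Sum>i<K. of_bool (i = 0))"
    by (simp only: sum.distrib sum_distrib_left[symmetric] sum_constant card_lessThan) (simp only: distrib_left mult.left_commute)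
  also have "(\<Sum>i<K. of_bool (i = 0)) = (1::real)" using K_pos by (simp add: of_bool_def sum.delta)
  finally show ?thesis by simp
qed

text \<open>
  The windows that start in the first block, and those that reach beyond the last one, are the end
  positions: \<open>2r\<close> rows with an additional error \<open>5r\<close> each.
\<close>
lemma var_TS: "\<bar>cov M TS TS - real (K * r) * \<kappa> r\<bar> \<le> real (K * r) * (2 * real l + real (K * r) * \<rho>) + 10 * (real r)\<^sup>2"
proof -
  have eq: "cov M TS TS - real (K * r) * \<kappa> r = (\<Sum>a<K * r. cov M (J a) TS - \<kappa> r)"
    by (simp add: cov_TS_expand[OF TS_bdd] sum_subtractf)
  have "\<bar>cov M TS TS - real (K * r) * \<kappa> r\<bar> \<le> (\<Sum>a<K * r. 2 * real l + real (K * r) * \<rho> + (5 * real r * of_bool (a \<in> {..<r}) + 5 * real r * of_bool (a \<in> {a. K * r < a + r})))"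
    unfolding eq
  proof (intro order_trans[OF sum_abs] sum_mono)
    fix a assume a: "a \<in> {..<K * r}"
    have "\<bar>cov M (J a) TS - \<kappa> r\<bar> \<le> 2 * real l + real (K * r) * \<rho> + (if r \<le> a \<and> a + r \<le> K * r then 0 else 5 * real r)"
      using a by (intro cov_J_TS) simp
    also have "(if r \<le> a \<and> a + r \<le> K * r then 0 else 5 * real r) \<le> 5 * real r * of_bool (a \<in> {..<r}) + 5 * real r * of_bool (a \<in> {a. K * r < a + r})"
      by auto
    finally show "\<bar>cov M (J a) TS - \<kappa> r\<bar> \<le> 2 * real l + real (K * r) * \<rho> + (5 * real r * of_bool (a \<in> {..<r}) + 5 * real r * of_bool (a \<in> {a. K * r < a + r}))" by simp
  qed
  also have "\<dots> = real (K * r) * (2 * real l + real (K * r) * \<rho>) + (5 * real r * (\<Sum>a<K * r. of_bool (a \<in> {..<r})) + 5 * real r * (\<Sum>a<K * r. of_bool (a \<in> {a. K * r < a + r})))"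
    by (simp only: sum.distrib sum_distrib_left[symmetric] sum_constant card_lessThan) (simp only: distrib_left mult.left_commute)
  also have "\<dots> \<le> real (K * r) * (2 * real l + real (K * r) * \<rho>) + (5 * real r * real r + 5 * real r * real r)"
  proof (intro add_left_mono add_mono mult_left_mono)
    show "(\<Sum>a<K * r. of_bool (a \<in> {..<r})) \<le> real r"
      by (rule sum_of_bool_interval_le[where x=0]) auto
    show "(\<Sum>a<K * r. of_bool (a \<in> {a. K * r < a + r})) \<le> real r"
      by (rule sum_of_bool_interval_le[where x="K * r - r"]) auto
  qed auto
  finally show ?thesis by (simp add: power2_eq_square)
qed

text \<open>
  The error of \<open>cov_window_count\<close> for the stretch of all \<open>K\<close> blocks, whose second moment is at most
  \<open>K\<^sup>2\<close> times that of one block.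
\<close>
definition errN :: real where "errN = 2 * real l * p + 2 * \<rho> * (real K * sqrt (S2 r))"

lemma errN_nonneg: "errN \<ge> 0"
  unfolding errN_def using p_nonneg rho_nonneg S2_nonneg by simp

lemma cov_J_TN:
  assumes "a < K * r"
  shows "\<bar>cov M (J a) TN + Q r * (real r * p)\<bar> \<le> errN + (if a + r \<le> K * r then 0 else real r * p)"
proof -
  let ?w = "min (a + r) (K * r)"
  have 1: "\<bar>cov M (J a) TN + Q r * (real (?w - a) * p)\<bar> \<le> 2 * real l * p + 2 * \<rho> * sqrt (S2 (K * r))"
    unfolding TN_def using assms Kr' r_pos by (intro cov_window_count) auto
  have "sqrt (S2 (K * r)) \<le> real K * sqrt (S2 r)"
    using real_sqrt_le_mono[OF S2_multiple_le[of K r]] by (simp add: real_sqrt_mult)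
  then have "2 * real l * p + 2 * \<rho> * sqrt (S2 (K * r)) \<le> errN"
    unfolding errN_def using rho_nonneg by (intro add_left_mono mult_left_mono) auto
  with 1 have 2: "\<bar>cov M (J a) TN + Q r * (real (?w - a) * p)\<bar> \<le> errN" by simp
  show ?thesis
  proof (cases "a + r \<le> K * r")
    case True then show ?thesis using 2 by simp
  next
    case False
    have "0 \<le> Q r * (real (?w - a) * p)" using Q_bounds p_nonneg by simp
    moreover have "Q r * (real (?w - a) * p) \<le> Q r * (real r * p)"
      using Q_bounds p_nonneg by (intro mult_left_mono mult_right_mono) auto
    moreover have "Q r * (real r * p) \<le> real r * p" using Q_bounds p_nonneg by (intro mult_left_le_one_le) auto
    ultimately show ?thesis using 2 False by (auto simp: abs_le_iff)
  qed
qed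

lemma cov_TI_TN: "\<bar>cov M TI TN + real K * (Q r * (real r * p))\<bar> \<le> real K * errN"
proof -
  have eq: "cov M TI TN + real K * (Q r * (real r * p)) = (\<Sum>i<K. cov M (J (i * r)) TN + Q r * (real r * p))"
    by (simp add: cov_TI_expand[OF TN_bdd] sum.distrib)
  have "\<bar>cov M TI TN + real K * (Q r * (real r * p))\<bar> \<le> (\<Sum>i<K. errN)"
    unfolding eq
  proof (intro order_trans[OF sum_abs] sum_mono)
    fix i assume "i \<in> {..<K}"
    then show "\<bar>cov M (J (i * r)) TN + Q r * (real r * p)\<bar> \<le> errN"
      using cov_J_TN[OF block_start_less[of i]] block_start[of i] by simp
  qed
  then show ?thesis by simp
qed

lemma cov_TS_TN: "\<bar>cov M TS TN + real (K * r) * (Q r * (real r * p))\<bar> \<le> real (K * r) * errN + real r * (real r * p)"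
proof -
  have eq: "cov M TS TN + real (K * r) * (Q r * (real r * p)) = (\<Sum>a<K * r. cov M (J a) TN + Q r * (real r * p))"
    by (simp add: cov_TS_expand[OF TN_bdd] sum.distrib)
  have "\<bar>cov M TS TN + real (K * r) * (Q r * (real r * p))\<bar> \<le> (\<Sum>a<K * r. errN + real r * p * of_bool (a \<in> {a. K * r < a + r}))"
    unfolding eq
  proof (intro order_trans[OF sum_abs] sum_mono)
    fix a assume "a \<in> {..<K * r}"
    then show "\<bar>cov M (J a) TN + Q r * (real r * p)\<bar> \<le> errN + real r * p * of_bool (a \<in> {a. K * r < a + r})"
      using cov_J_TN[of a] by (cases "a + r \<le> K * r") auto
  qed
  also have "\<dots> = real (K * r) * errN + real r * p * (\<Sum>a<K * r. of_bool (a \<in> {a. K * r < a + r}))"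
    by (simp only: sum.distrib sum_distrib_left[symmetric] sum_constant card_lessThan)
  also have "\<dots> \<le> real (K * r) * errN + real r * p * real r"
    using p_nonneg by (intro add_left_mono mult_left_mono sum_of_bool_interval_le[where x="K * r - r"]) auto
  finally show ?thesis by (simp add: algebra_simps)
qed

end

section \<open>Limits of the window probabilities\<close>

lemma tendsto_eventually_eqI:
  assumes "(f \<longlongrightarrow> a) F" "\<forall>\<^sub>F n in F. f n = g n" "a = b"
  shows "(g \<longlongrightarrow> b) F"
  using Lim_transform_eventually[OF assms(1,2)] assms(3) by simp

lemma dominating_at_top:
  fixes l r :: "nat \<Rightarrow> nat"
  assumes l: "\<And>n. n \<ge> 1 \<Longrightarrow> l n > 0" and lr: "(\<lambda>n. real (l n) / real (r n)) \<longlonglongrightarrow> 0"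
    and r: "\<And>n. n \<ge> 1 \<Longrightarrow> r n > 0"
  shows "filterlim r at_top sequentially"
proof -
  have "(\<lambda>n. inverse (real (r n))) \<longlonglongrightarrow> 0"
  proof (rule tendsto_sandwich[OF _ _ tendsto_const lr])
    show "\<forall>\<^sub>F n in sequentially. inverse (real (r n)) \<le> real (l n) / real (r n)"
      using eventually_ge_at_top[of 1]
    proof eventually_elim
      case (elim n)
      then have "1 \<le> real (l n)" using l[of n] by simp
      then show ?case by (simp add: inverse_eq_divide divide_right_mono)
    qed
  qed simp
  moreover have "\<forall>\<^sub>F n in sequentially. 0 < inverse (real (r n))"
    using eventually_ge_at_top[of 1] by eventually_elim (use r in simp)
  ultimately have "filterlim (\<lambda>n. inverse (inverse (real (r n)))) at_top sequentially"
    by (rule filterlim_inverse_at_top)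
  then show ?thesis by (simp add: filterlim_sequentially_iff_filterlim_real)
qed

lemma abs_weighted_diff_le:
  fixes a b x y :: real
  assumes "0 \<le> a" "0 \<le> b"
  shows "\<bar>- (a * x) + b * y\<bar> \<le> a * \<bar>x\<bar> + b * \<bar>y\<bar>"
  using abs_triangle_ineq[of "- (a * x)" "b * y"] assms by (simp add: abs_mult)

text \<open>
  Asymptotic orders are stated as limits of quotients. The threshold is indexed by \<open>n\<close> directly, so that
  \<open>u n\<close> is the threshold that belongs to the block length \<open>r n\<close>.
\<close>
locale exceedance_array = prob_space M for M :: "'a measure" +
  fixes X :: "nat \<Rightarrow> 'a \<Rightarrow> real" and u :: "nat \<Rightarrow> real" and r l s :: "nat \<Rightarrow> nat" and \<theta> \<tau> :: real
  assumes X_meas: "\<And>i. i \<ge> 1 \<Longrightarrow> X i \<in> borel_measurable M"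
    and stat: "strictly_stationary M X"
    and pos: "\<And>n. n \<ge> 1 \<Longrightarrow> r n > 0" "\<And>n. n \<ge> 1 \<Longrightarrow> l n > 0" "\<And>n. n \<ge> 1 \<Longrightarrow> s n > 0"
    and ls: "(\<lambda>n. real (l n) / real (s n)) \<longlonglongrightarrow> 0"
    and sr: "(\<lambda>n. real (s n) / real (r n)) \<longlonglongrightarrow> 0"
    and rn: "(\<lambda>n. real (r n) / real n) \<longlonglongrightarrow> 0"
    and rho_lim: "(\<lambda>n. max_corr M X n (l n) (u n) / (real (s n) / real n)) \<longlonglongrightarrow> 0"
    and \<theta>: "\<theta> > 0" and \<tau>: "\<tau> > 0"
    and tail_lim: "(\<lambda>n. real (r n) * tail M X (u n)) \<longlonglongrightarrow> \<tau>"
    and theta_lim: "(\<lambda>n. (theta_block M X (r n) (u n) - \<theta>) / (1 / sqrt (real (n div r n)))) \<longlonglongrightarrow> 0"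
begin

abbreviation "Qn n \<equiv> stationary_threshold.Q M X (u n)"
abbreviation "S2n n \<equiv> stationary_threshold.S2 M X (u n)"
abbreviation "pn n \<equiv> tail M X (u n)"
abbreviation "rho n \<equiv> max_corr M X n (l n) (u n)"
abbreviation "k n \<equiv> n div r n"
definition "\<alpha> = \<tau> * \<theta>"

lemma alpha_pos: "\<alpha> > 0" using \<theta> \<tau> by (simp add: \<alpha>_def)

lemma st: "n \<ge> 1 \<Longrightarrow> stationary_threshold M X (l n)"
  using pos X_meas stat prob_space_axioms
  by (simp add: stationary_threshold_def stationary_threshold_axioms_def Suc_le_eq)

lemma p_eq': "n \<ge> 1 \<Longrightarrow> stationary_threshold.p M X (u n) = pn n"
  using stationary_threshold.p_def[OF st] by simp

lemma rho_eq: "n \<ge> 1 \<Longrightarrow> stationary_threshold.\<rho> M X (u n) n (l n) = rho n"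
  using stationary_threshold.\<rho>_def[OF st] by simp

lemma ev1: "\<forall>\<^sub>F n in sequentially. n \<ge> 1" by (rule eventually_ge_at_top)

lemma ev1_pos: "(\<And>n. n \<ge> 1 \<Longrightarrow> f n > (0::nat)) \<Longrightarrow> \<forall>\<^sub>F n in sequentially. f n > 0"
  using ev1 by eventually_elim auto

lemma lr: "(\<lambda>n. real (l n) / real (r n)) \<longlonglongrightarrow> 0"
proof -
  have "(\<lambda>n. (real (l n) / real (s n)) * (real (s n) / real (r n))) \<longlonglongrightarrow> 0 * 0"
    by (intro tendsto_mult ls sr)
  moreover have "\<forall>\<^sub>F n in sequentially. (real (l n) / real (s n)) * (real (s n) / real (r n)) = real (l n) / real (r n)"
    using ev1 by eventually_elim (use pos in force)
  ultimately show ?thesis by (rule tendsto_eventually_eqI) simp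
qed

lemma r_at_top: "filterlim (\<lambda>n. real (r n)) at_top sequentially"
  using dominating_at_top[OF pos(2) lr pos(1)] by (simp add: filterlim_sequentially_iff_filterlim_real)

lemma rho_nonneg: "n \<ge> 1 \<Longrightarrow> rho n \<ge> 0"
  using stationary_threshold.rho_nonneg[OF st, of n "u n" n] rho_eq by simp

lemma p_nonneg: "n \<ge> 1 \<Longrightarrow> pn n \<ge> 0"
  using stationary_threshold.p_nonneg[OF st, of n "u n"] p_eq' by simp

lemma n_rho: "(\<lambda>n. real n / real (s n) * rho n) \<longlonglongrightarrow> 0"
  using rho_lim by (simp add: mult.commute)

lemma n_rho_r: "(\<lambda>n. real n / real (r n) * rho n) \<longlonglongrightarrow> 0"
proof -
  have "(\<lambda>n. (real n / real (s n) * rho n) * (real (s n) / real (r n))) \<longlonglongrightarrow> 0 * 0"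
    by (intro tendsto_mult n_rho sr)
  moreover have "\<forall>\<^sub>F n in sequentially. (real n / real (s n) * rho n) * (real (s n) / real (r n)) = real n / real (r n) * rho n"
    using ev1 by eventually_elim (use pos in force)
  ultimately show ?thesis by (rule tendsto_eventually_eqI) simp
qed

lemma ev_lt:
  assumes "(\<lambda>n. real (f n) / real (g n)) \<longlonglongrightarrow> 0" "\<And>n. n \<ge> 1 \<Longrightarrow> g n > 0" "c > 0"
  shows "\<forall>\<^sub>F n in sequentially. real (f n) < c * real (g n)"
  using order_tendstoD(2)[OF assms(1,3)] ev1
proof eventually_elim
  case (elim n)
  then show ?case using assms(2)[of n] by (simp add: divide_less_eq)
qed

lemma ev_ls: "\<forall>\<^sub>F n in sequentially. l n < s n"
  using ev_lt[OF ls pos(3), of 1] by simp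
lemma ev_lr: "\<forall>\<^sub>F n in sequentially. l n < r n"
  using ev_lt[OF lr pos(1), of 1] by simp
lemma ev_sr: "\<forall>\<^sub>F n in sequentially. s n < r n"
  using ev_lt[OF sr pos(1), of 1] by simp
lemma ev_rn: "\<forall>\<^sub>F n in sequentially. 4 * r n < n"
proof -
  have "\<forall>\<^sub>F n in sequentially. real (r n) < (1/4) * real n"
    by (rule ev_lt[OF rn]) auto
  then show ?thesis by eventually_elim linarith
qed

lemma div_ratio:
  fixes f g :: "nat \<Rightarrow> nat"
  assumes "(\<lambda>n. real (g n) / real (f n)) \<longlonglongrightarrow> 0"
    and fg: "\<forall>\<^sub>F n in sequentially. f n > 0" "\<forall>\<^sub>F n in sequentially. g n > 0"
  shows "(\<lambda>n. real (f n div g n) * real (g n) / real (f n)) \<longlonglongrightarrow> 1"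
proof (rule tendsto_sandwich[where f="\<lambda>n. 1 - real (g n) / real (f n)" and h="\<lambda>_. 1"])
  show "(\<lambda>n. 1 - real (g n) / real (f n)) \<longlonglongrightarrow> 1" using tendsto_diff[OF tendsto_const assms(1), of 1] by simp
  show "\<forall>\<^sub>F n in sequentially. 1 - real (g n) / real (f n) \<le> real (f n div g n) * real (g n) / real (f n)"
    using fg
  proof eventually_elim
    case (elim n)
    have "f n < (f n div g n) * g n + g n" using elim by (metis add.commute dividend_less_div_times)
    then have "real (f n) \<le> real (f n div g n) * real (g n) + real (g n)"
      by (metis less_imp_le of_nat_add of_nat_le_iff of_nat_mult)
    then have "(real (f n) - real (g n)) / real (f n) \<le> real (f n div g n) * real (g n) / real (f n)"
      by (intro divide_right_mono) auto
    then show ?case using elim by (simp add: diff_divide_distrib)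
  qed
  show "\<forall>\<^sub>F n in sequentially. real (f n div g n) * real (g n) / real (f n) \<le> 1"
    using fg
  proof eventually_elim
    case (elim n)
    have "real (f n div g n) * real (g n) \<le> real (f n)"
      by (metis div_times_less_eq_dividend of_nat_le_iff of_nat_mult)
    then show ?case using elim by simp
  qed
qed simp

lemma sp: "(\<lambda>n. real (s n) * pn n) \<longlonglongrightarrow> 0"
proof -
  have "(\<lambda>n. real (s n) / real (r n) * (real (r n) * pn n)) \<longlonglongrightarrow> 0 * \<tau>" by (intro tendsto_mult sr tail_lim)
  moreover have "\<forall>\<^sub>F n in sequentially. real (s n) / real (r n) * (real (r n) * pn n) = real (s n) * pn n"
    using ev1 by eventually_elim (use pos in force)
  ultimately show ?thesis by (rule tendsto_eventually_eqI) simp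
qed

text \<open>
  The bound of \<open>Q_power_approx\<close> vanishes: there are at most \<open>2r/s\<close> short blocks, the total number of clipped
  indices is of order \<open>rl/s = o(r)\<close>, and \<open>n/s\<close> times the mixing coefficient tends to 0.
\<close>
lemma Q_power_lim:
  assumes L: "\<forall>\<^sub>F n in sequentially. L n \<le> 2 * r n"
  shows "(\<lambda>n. Qn n (L n) - Qn n (s n) ^ (L n div s n)) \<longlonglongrightarrow> 0"
proof (rule Lim_null_comparison)
  let ?b = "\<lambda>n. 4 * (real (l n) / real (s n)) * (real (r n) * pn n) + real (s n) * pn n + real n / real (s n) * rho n"
  show "\<forall>\<^sub>F n in sequentially. norm (Qn n (L n) - Qn n (s n) ^ (L n div s n)) \<le> ?b n"
    using L ev1 ev_ls ev_rn
  proof eventually_elim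
    case (elim n)
    interpret st: stationary_threshold M X "u n" n "l n" by (rule st) fact
    let ?q = "L n div s n"
    have sp: "real (s n) > 0" using pos elim by simp
    have qs: "?q * s n \<le> L n" by simp
    have "L n - ?q * s n = L n mod s n" by (simp add: minus_div_mult_eq_mod)
    also have "\<dots> \<le> s n" using pos(3)[of n] elim by (simp add: less_imp_le)
    finally have rest: "real (L n - ?q * s n) \<le> real (s n)" by (rule of_nat_mono)
    have "real ?q * real (s n) \<le> real (L n)" by (metis qs of_nat_le_iff of_nat_mult)
    also have "\<dots> \<le> 2 * real (r n)" using elim by simp
    finally have q1: "real ?q \<le> 2 * real (r n) / real (s n)" using sp by (simp add: pos_le_divide_eq)
    also have "\<dots> \<le> real n / real (s n)" using elim by (intro divide_right_mono) auto
    finally have q2: "real ?q \<le> real n / real (s n)" .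
    have "norm (Qn n (L n) - Qn n (s n) ^ ?q) \<le> (2 * real ?q * real (l n) + real (L n - ?q * s n)) * pn n + real ?q * rho n"
      using st.Q_power_approx[OF _ qs] elim by (simp add: p_eq' rho_eq)
    also have "\<dots> \<le> (2 * (2 * real (r n) / real (s n)) * real (l n) + real (s n)) * pn n + real n / real (s n) * rho n"
      using q1 q2 rest p_nonneg[of n] rho_nonneg[of n] elim
      by (intro add_mono mult_right_mono mult_left_mono) auto
    also have "\<dots> = ?b n" by (simp add: algebra_simps)
    finally show ?case .
  qed
  have "?b \<longlonglongrightarrow> 4 * 0 * \<tau> + 0 + 0" by (intro tendsto_intros ls tail_lim sp n_rho)
  then show "?b \<longlonglongrightarrow> 0" by simp
qed

lemma cdf_max_eq: "n \<ge> 1 \<Longrightarrow> L \<ge> 1 \<Longrightarrow> cdf_max M X L (u n) = Qn n L"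
proof -
  assume n: "n \<ge> 1" and L: "L \<ge> 1"
  interpret st: stationary_threshold M X "u n" n "l n" by (rule st) fact
  have e: "st.Z 0 L \<omega> = of_bool (block_max X 0 L \<omega> \<le> u n)" for \<omega>
  proof -
    have "st.N 0 L \<omega> = 0 \<longleftrightarrow> (\<forall>i\<in>{0<..L}. X i \<omega> \<le> u n)"
      unfolding st.N_def by (subst sum_nonneg_eq_0_iff) (auto simp: not_less)
    also have "\<dots> \<longleftrightarrow> block_max X 0 L \<omega> \<le> u n"
      unfolding block_max_def using L by (subst Max_le_iff) auto
    finally show ?thesis by (simp add: st.Z_def)
  qed
  have m: "{\<omega> \<in> space M. st.Z 0 L \<omega> = 1} \<in> events"
    using bdd_rv_measurable[OF st.Z_bdd] by measurable
  have "Qn n L = expectation (indicator {\<omega> \<in> space M. block_max X 0 L \<omega> \<le> u n})"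
    unfolding st.Q_def by (intro Bochner_Integration.integral_cong) (auto simp: e indicator_def)
  also have "\<dots> = prob ({\<omega> \<in> space M. block_max X 0 L \<omega> \<le> u n} \<inter> space M)" by simp
  also have "{\<omega> \<in> space M. block_max X 0 L \<omega> \<le> u n} \<inter> space M = {\<omega> \<in> space M. block_max X 0 L \<omega> \<le> u n}" by auto
  finally show ?thesis by (simp add: cdf_max_def)
qed

lemma rK: "(\<lambda>n. real (k n) * real (r n) / real n) \<longlonglongrightarrow> 1"
  by (rule div_ratio[OF rn ev1_pos[OF _] ev1_pos[OF pos(1)]]) simp

lemma k_at_top: "filterlim (\<lambda>n. real (k n)) at_top sequentially"
proof -
  have "(\<lambda>n. inverse (real n / real (r n))) \<longlonglongrightarrow> 0" using rn by simp
  then have "filterlim (\<lambda>n. inverse (inverse (real n / real (r n)))) at_top sequentially"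
    by (rule filterlim_inverse_at_top) (use ev1 in eventually_elim, use pos in auto)
  then have "filterlim (\<lambda>n. real n / real (r n)) at_top sequentially" by simp
  from filterlim_tendsto_pos_mult_at_top[OF rK _ this]
  have "filterlim (\<lambda>n. real (k n) * real (r n) / real n * (real n / real (r n))) at_top sequentially" by simp
  moreover have "\<forall>\<^sub>F n in sequentially. real (k n) * real (r n) / real n * (real n / real (r n)) = real (k n)"
    using ev1 by eventually_elim (use pos in force)
  ultimately show ?thesis using filterlim_cong[OF refl refl] by fast
qed

text \<open>
  The number \<open>k\<close> of blocks tends to infinity, so the assumed rate implies convergence of \<open>\<theta>\<^sub>r\<close> to \<open>\<theta>\<close>.
  Together with the limit of the tail this determines the limit of \<open>P(M\<^sub>r \<le> u)\<close>.
\<close>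
lemma theta_block_lim: "(\<lambda>n. theta_block M X (r n) (u n)) \<longlonglongrightarrow> \<theta>"
proof -
  have "filterlim (\<lambda>n. sqrt (real (k n))) at_top sequentially"
    by (rule filterlim_compose[OF sqrt_at_top k_at_top])
  then have i: "(\<lambda>n. 1 / sqrt (real (k n))) \<longlonglongrightarrow> 0"
    by (rule real_tendsto_divide_at_top[OF tendsto_const])
  have "(\<lambda>n. (theta_block M X (r n) (u n) - \<theta>) / (1 / sqrt (real (k n))) * (1 / sqrt (real (k n)))) \<longlonglongrightarrow> 0 * 0"
    by (rule tendsto_mult[OF theta_lim i])
  moreover have "\<forall>\<^sub>F n in sequentially. (theta_block M X (r n) (u n) - \<theta>) / (1 / sqrt (real (k n))) * (1 / sqrt (real (k n))) = theta_block M X (r n) (u n) - \<theta>"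
    using filterlim_at_top_dense[THEN iffD1, OF k_at_top, rule_format, of 0] by eventually_elim simp
  ultimately have "(\<lambda>n. theta_block M X (r n) (u n) - \<theta>) \<longlonglongrightarrow> 0" by (rule tendsto_eventually_eqI) simp
  then show ?thesis by (rule LIM_zero_cancel)
qed

lemma ln_Qr: "(\<lambda>n. - ln (Qn n (r n))) \<longlonglongrightarrow> \<alpha>"
proof -
  have "(\<lambda>n. theta_block M X (r n) (u n) * (real (r n) * pn n)) \<longlonglongrightarrow> \<theta> * \<tau>"
    by (intro tendsto_mult theta_block_lim tail_lim)
  moreover have "\<forall>\<^sub>F n in sequentially. theta_block M X (r n) (u n) * (real (r n) * pn n) = - ln (Qn n (r n))"
    using ev1 order_tendstoD(1)[OF tail_lim \<tau>]
  proof eventually_elim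
    case (elim n)
    then have "r n \<ge> 1" using pos(1)[of n] by simp
    then have "cdf_max M X (r n) (u n) = Qn n (r n)" using elim by (intro cdf_max_eq) auto
    then have "theta_block M X (r n) (u n) = - ln (Qn n (r n)) / (real (r n) * pn n)"
      by (simp only: theta_block_def tau_block_def)
    then show ?case by (rule iffD1[OF nonzero_eq_divide_eq[OF less_imp_neq[OF elim(2), symmetric]]])
  qed
  ultimately show ?thesis by (rule tendsto_eventually_eqI) (simp add: \<alpha>_def mult.commute)
qed

lemma Q_bounds: "n \<ge> 1 \<Longrightarrow> 0 \<le> Qn n L" "n \<ge> 1 \<Longrightarrow> Qn n L \<le> 1"
  using stationary_threshold.Q_bounds[OF st] by auto

lemma Qr_lim: "(\<lambda>n. Qn n (r n)) \<longlonglongrightarrow> exp (- \<alpha>)"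
proof -
  have "(\<lambda>n. exp (- (- ln (Qn n (r n))))) \<longlonglongrightarrow> exp (- \<alpha>)" by (intro tendsto_intros ln_Qr)
  moreover have "\<forall>\<^sub>F n in sequentially. exp (- (- ln (Qn n (r n)))) = Qn n (r n)"
    using ev1 order_tendstoD(1)[OF ln_Qr alpha_pos]
  proof eventually_elim
    case (elim n)
    then have "Qn n (r n) \<noteq> 0" by auto
    then have "Qn n (r n) > 0" using Q_bounds(1)[of n "r n"] elim by simp
    then show ?case by simp
  qed
  ultimately show ?thesis by (rule tendsto_eventually_eqI) simp
qed

lemma exceed_prob_le: "n \<ge> 1 \<Longrightarrow> 1 - Qn n (s n) \<le> real (s n) * pn n"
proof -
  assume n: "n \<ge> 1"
  interpret st: stationary_threshold M X "u n" n "l n" by (rule st) fact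
  have "st.Q 0 = 1" by (simp add: st.Q_def st.Z_def[abs_def] prob_space)
  then show ?thesis using st.Q_diff[of 0 "s n"] n by (simp add: p_eq')
qed

lemma Qs_lim: "(\<lambda>n. Qn n (s n)) \<longlonglongrightarrow> 1"
proof -
  have "(\<lambda>n. 1 - Qn n (s n)) \<longlonglongrightarrow> 0"
    by (rule tendsto_sandwich[OF _ _ tendsto_const sp])
       (use ev1 in eventually_elim, use Q_bounds exceed_prob_le in auto)+
  from tendsto_diff[OF tendsto_const this, of 1] show ?thesis by simp
qed

text \<open>
  The rate of a single short block, read off from \<open>P(M\<^sub>r \<le> u) \<approx> P(M\<^sub>s \<le> u)\<^sup>r\<^sup>/\<^sup>s\<close>.
\<close>
lemma ln_Qs: "(\<lambda>n. real (r n) / real (s n) * ln (Qn n (s n))) \<longlonglongrightarrow> - \<alpha>"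
proof -
  have "(\<lambda>n. Qn n (r n) - (Qn n (r n) - Qn n (s n) ^ (r n div s n))) \<longlonglongrightarrow> exp (- \<alpha>) - 0"
    by (intro tendsto_diff Qr_lim Q_power_lim) simp
  then have "(\<lambda>n. Qn n (s n) ^ (r n div s n)) \<longlonglongrightarrow> exp (- \<alpha>)" by simp
  then have "(\<lambda>n. ln (Qn n (s n) ^ (r n div s n))) \<longlonglongrightarrow> ln (exp (- \<alpha>))" by (intro tendsto_ln) auto
  moreover have "\<forall>\<^sub>F n in sequentially. ln (Qn n (s n) ^ (r n div s n)) = real (r n div s n) * ln (Qn n (s n))"
    using order_tendstoD(1)[OF Qs_lim zero_less_one] by eventually_elim (simp add: ln_realpow)
  ultimately have 1: "(\<lambda>n. real (r n div s n) * ln (Qn n (s n))) \<longlonglongrightarrow> - \<alpha>" by (rule tendsto_eventually_eqI) simp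
  have "(\<lambda>n. real (r n div s n) * real (s n) / real (r n)) \<longlonglongrightarrow> 1" by (rule div_ratio[OF sr ev1_pos[OF pos(1)] ev1_pos[OF pos(3)]])
  from tendsto_divide[OF 1 this]
  have "(\<lambda>n. real (r n div s n) * ln (Qn n (s n)) / (real (r n div s n) * real (s n) / real (r n))) \<longlonglongrightarrow> - \<alpha>" by simp
  moreover have "\<forall>\<^sub>F n in sequentially. real (r n div s n) * ln (Qn n (s n)) / (real (r n div s n) * real (s n) / real (r n)) = real (r n) / real (s n) * ln (Qn n (s n))"
    using ev1 ev_sr
  proof eventually_elim
    case (elim n)
    then have "r n div s n > 0" using pos(3)[of n] by (simp add: div_greater_zero_iff)
    then show ?case by simp
  qed
  ultimately show ?thesis by (rule tendsto_eventually_eqI) simp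
qed

text \<open>
  The exceedance-free probability decays exponentially in the length of the window. The sequence \<open>L\<close> is arbitrary,
  which makes the approximation uniform over all lengths up to \<open>2r\<close>.
\<close>
lemma Q_lim:
  assumes L: "\<forall>\<^sub>F n in sequentially. L n \<le> 2 * r n"
  shows "(\<lambda>n. Qn n (L n) - exp (- (\<alpha> * real (L n) / real (r n)))) \<longlonglongrightarrow> 0"
proof -
  let ?y = "\<lambda>n. real (r n) / real (s n) * ln (Qn n (s n))"
  let ?b = "\<lambda>n. 2 * \<bar>?y n + \<alpha>\<bar> + real (s n) / real (r n) * \<bar>?y n\<bar>"
  have "(\<lambda>n. Qn n (s n) ^ (L n div s n) - exp (- (\<alpha> * real (L n) / real (r n)))) \<longlonglongrightarrow> 0"
  proof (rule Lim_null_comparison)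
    show "\<forall>\<^sub>F n in sequentially. norm (Qn n (s n) ^ (L n div s n) - exp (- (\<alpha> * real (L n) / real (r n)))) \<le> ?b n"
      using L ev1 order_tendstoD(1)[OF Qs_lim zero_less_one]
    proof eventually_elim
      case (elim n)
      let ?q = "L n div s n"
      have rp: "real (r n) > 0" and sp: "real (s n) > 0" using pos elim by auto
      have e: "Qn n (s n) ^ ?q = exp (- (- (real ?q * ln (Qn n (s n)))))"
        using elim by (simp add: exp_of_nat_mult)
      have l0: "ln (Qn n (s n)) \<le> 0" using elim Q_bounds(2)[of n "s n"] by simp
      have "norm (Qn n (s n) ^ ?q - exp (- (\<alpha> * real (L n) / real (r n)))) \<le> \<bar>- (real ?q * ln (Qn n (s n))) - \<alpha> * real (L n) / real (r n)\<bar>"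
        unfolding e real_norm_def
        by (rule exp_neg_diff_le) (use l0 alpha_pos in \<open>auto intro: mult_nonneg_nonpos\<close>)
      also have "- (real ?q * ln (Qn n (s n))) - \<alpha> * real (L n) / real (r n) =
        - (real (L n) / real (r n) * (?y n + \<alpha>)) + (real (L n) - real ?q * real (s n)) / real (r n) * ?y n"
        using rp sp by (simp add: field_simps)
      also have "\<bar>\<dots>\<bar> \<le> real (L n) / real (r n) * \<bar>?y n + \<alpha>\<bar> + (real (L n) - real ?q * real (s n)) / real (r n) * \<bar>?y n\<bar>"
      proof -
        have "0 \<le> real (L n) - real ?q * real (s n)"
          using div_times_less_eq_dividend[of "L n" "s n"] by (simp flip: of_nat_mult)
        then show ?thesis by (intro abs_weighted_diff_le) auto
      qed
      also have "\<dots> \<le> 2 * \<bar>?y n + \<alpha>\<bar> + real (s n) / real (r n) * \<bar>?y n\<bar>"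
      proof (intro add_mono mult_right_mono divide_right_mono abs_ge_zero)
        have "real (L n) \<le> 2 * real (r n)" using elim by simp
        then show "real (L n) / real (r n) \<le> 2" using rp by (simp add: pos_divide_le_eq)
        have "L n < ?q * s n + s n" using sp by (metis add.commute dividend_less_div_times of_nat_0_less_iff)
        then have "real (L n) < real ?q * real (s n) + real (s n)" by (metis of_nat_add of_nat_less_iff of_nat_mult)
        then show "real (L n) - real ?q * real (s n) \<le> real (s n)" by simp
      qed simp
      finally show ?case .
    qed
    have "?b \<longlonglongrightarrow> 2 * \<bar>- \<alpha> + \<alpha>\<bar> + 0 * \<bar>- \<alpha>\<bar>" by (intro tendsto_intros ln_Qs sr)
    then show "?b \<longlonglongrightarrow> 0" by simp
  qed
  from tendsto_add[OF Q_power_lim[OF L] this] show ?thesis by simp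
qed

lemma exceed_prob_lim: "(\<lambda>n. real (r n) / real (s n) * (1 - Qn n (s n))) \<longlonglongrightarrow> \<alpha>"
proof -
  let ?y = "\<lambda>n. real (r n) / real (s n) * ln (Qn n (s n))"
  show ?thesis
  proof (rule tendsto_sandwich[where f="\<lambda>n. - ?y n * Qn n (s n)" and h="\<lambda>n. - ?y n"])
  show "(\<lambda>n. - ?y n) \<longlonglongrightarrow> \<alpha>" using tendsto_minus[OF ln_Qs] by simp
  show "(\<lambda>n. - ?y n * Qn n (s n)) \<longlonglongrightarrow> \<alpha>" using tendsto_mult[OF tendsto_minus[OF ln_Qs] Qs_lim] by simp
  show "\<forall>\<^sub>F n in sequentially. real (r n) / real (s n) * (1 - Qn n (s n)) \<le> - ?y n"
    using order_tendstoD(1)[OF Qs_lim zero_less_one]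
  proof eventually_elim
    case (elim n)
    have "1 - Qn n (s n) \<le> - ln (Qn n (s n))" using ln_le_minus_one[OF elim] by simp
    then have "real (r n) / real (s n) * (1 - Qn n (s n)) \<le> real (r n) / real (s n) * (- ln (Qn n (s n)))"
      by (intro mult_left_mono) auto
    then show ?case by simp
  qed
  show "\<forall>\<^sub>F n in sequentially. - ?y n * Qn n (s n) \<le> real (r n) / real (s n) * (1 - Qn n (s n))"
    using order_tendstoD(1)[OF Qs_lim zero_less_one]
  proof eventually_elim
    case (elim n)
    have "ln (inverse (Qn n (s n))) \<le> inverse (Qn n (s n)) - 1" using elim by (intro ln_le_minus_one) simp
    then have "- ln (Qn n (s n)) * Qn n (s n) \<le> (inverse (Qn n (s n)) - 1) * Qn n (s n)"
      using elim by (intro mult_right_mono) (auto simp: ln_inverse)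
    also have "\<dots> = 1 - Qn n (s n)" using elim by (simp add: left_diff_distrib)
    finally have "real (r n) / real (s n) * (- ln (Qn n (s n)) * Qn n (s n)) \<le> real (r n) / real (s n) * (1 - Qn n (s n))"
      by (intro mult_left_mono) auto
    then show ?case by simp
  qed
  qed
qed

end

section \<open>Moments of the cluster size distribution\<close>

lemma infsum_positive_nat_limit:
  fixes f :: "nat \<Rightarrow> real"
  assumes "f summable_on {1..}"
  shows "(\<lambda>J. \<Sum>j\<in>{1..J}. f j) \<longlonglongrightarrow> (\<Sum>\<^sub>\<infinity>j\<in>{1..}. f j)"
proof -
  let ?S = "\<Sum>\<^sub>\<infinity>j\<in>{1..}. f j"
  have "(f has_sum ?S) {1..}" using assms by simp
  then have "((\<lambda>j. if j = 0 then 0 else f j) has_sum ?S) UNIV"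
    by (subst has_sum_cong_neutral[where T="{1..}" and g=f]) auto
  then have "(\<lambda>j. if j = 0 then 0 else f j) sums ?S" by (rule has_sum_imp_sums)
  then have "(\<lambda>J. \<Sum>j<Suc J. if j = 0 then 0 else f j) \<longlonglongrightarrow> ?S"
    unfolding sums_def by (rule LIMSEQ_Suc)
  moreover have "(\<Sum>j<Suc J. if j = 0 then 0 else f j) = (\<Sum>j\<in>{1..J}. f j)" for J
    by (rule sum.mono_neutral_cong_right) auto
  ultimately show ?thesis by simp
qed

locale exceedance_clusters = exceedance_array M X u r l s \<theta> \<tau>
  for M :: "'a measure" and X u r l s \<theta> \<tau> +
  fixes \<pi> :: "nat pmf"
  assumes cluster_lim: "\<And>j. j \<ge> 1 \<Longrightarrow>
           (\<lambda>n. \<P>(\<omega> in M. exceedances X (s n) (u n) \<omega> = j \<bar> block_max X 0 (s n) \<omega> > u n)) \<longlonglongrightarrow> pmf \<pi> j"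
    and m2_summable: "(\<lambda>j. real j ^ 2 * pmf \<pi> j) summable_on {1..}"
    and m2_lim: "(\<lambda>n. cond_expect M (\<lambda>\<omega>. real (exceedances X (s n) (u n) \<omega>) ^ 2) (\<lambda>\<omega>. block_max X 0 (s n) \<omega> > u n))
           \<longlonglongrightarrow> (\<Sum>\<^sub>\<infinity>j\<in>{1..}. real j ^ 2 * pmf \<pi> j)"
begin

abbreviation "m2 \<equiv> pmf_moment \<pi> 2"

lemma exceedances_eq: "real (exceedances X L (u n) \<omega>) = stationary_threshold.N X (u n) 0 L \<omega>" if "n \<ge> 1"
proof -
  interpret st: stationary_threshold M X "u n" n "l n" by (rule st) fact
  have "{1..L} = {0<..L}" by auto
  then show ?thesis by (simp add: exceedances_def st.N_def)
qed

lemma block_max_eq: "block_max X 0 L \<omega> > u n \<longleftrightarrow> stationary_threshold.N X (u n) 0 L \<omega> \<noteq> 0" if "n \<ge> 1" "L \<ge> 1"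
proof -
  interpret st: stationary_threshold M X "u n" n "l n" by (rule st) fact
  have "st.N 0 L \<omega> = 0 \<longleftrightarrow> (\<forall>i\<in>{0<..L}. X i \<omega> \<le> u n)"
    unfolding st.N_def by (subst sum_nonneg_eq_0_iff) (auto simp: not_less)
  also have "\<dots> \<longleftrightarrow> block_max X 0 L \<omega> \<le> u n"
    unfolding block_max_def using that by (subst Max_le_iff) auto
  finally show ?thesis by auto
qed

lemma Qs_less_1: "\<forall>\<^sub>F n in sequentially. Qn n (s n) < 1"
  using order_tendstoD(1)[OF exceed_prob_lim alpha_pos] ev1
proof eventually_elim
  case (elim n)
  then have "1 - Qn n (s n) \<noteq> 0" by auto
  then show ?case using Q_bounds(2)[of n "s n"] elim by simp
qed

lemma prob_exceed: assumes "n \<ge> 1" "L \<ge> 1" shows "prob {\<omega> \<in> space M. block_max X 0 L \<omega> > u n} = 1 - Qn n L"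
proof -
  interpret st: stationary_threshold M X "u n" n "l n" by (rule st) fact
  have m: "{\<omega> \<in> space M. st.N 0 L \<omega> = 0} \<in> events" by measurable
  have "st.Q L = expectation (indicator {\<omega> \<in> space M. st.N 0 L \<omega> = 0})"
    unfolding st.Q_def by (intro Bochner_Integration.integral_cong) (auto simp: st.Z_def indicator_def)
  also have "\<dots> = prob ({\<omega> \<in> space M. st.N 0 L \<omega> = 0} \<inter> space M)" by simp
  also have "{\<omega> \<in> space M. st.N 0 L \<omega> = 0} \<inter> space M = {\<omega> \<in> space M. st.N 0 L \<omega> = 0}" by auto
  finally have Q: "st.Q L = prob {\<omega> \<in> space M. st.N 0 L \<omega> = 0}" .
  have "{\<omega> \<in> space M. block_max X 0 L \<omega> > u n} = space M - {\<omega> \<in> space M. st.N 0 L \<omega> = 0}"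
    using block_max_eq[OF assms] by auto
  then show ?thesis using prob_compl[OF m] Q by simp
qed

lemma cond_expect_eq:
  assumes "n \<ge> 1" "L \<ge> 1" "Qn n L < 1"
  shows "cond_expect M (\<lambda>\<omega>. real (exceedances X L (u n) \<omega>) ^ 2) (\<lambda>\<omega>. block_max X 0 L \<omega> > u n) = S2n n L / (1 - Qn n L)"
proof -
  interpret st: stationary_threshold M X "u n" n "l n" by (rule st) fact
  define A where "A = {\<omega> \<in> space M. block_max X 0 L \<omega> > u n}"
  have A_eq: "A = {\<omega> \<in> space M. st.N 0 L \<omega> \<noteq> 0}" using block_max_eq[OF assms(1,2)] by (auto simp: A_def)
  have [measurable]: "A \<in> events" unfolding A_eq by measurable
  have pA: "prob A = 1 - Qn n L" unfolding A_def by (rule prob_exceed) fact+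
  have "cond_expect M (\<lambda>\<omega>. real (exceedances X L (u n) \<omega>) ^ 2) (\<lambda>\<omega>. block_max X 0 L \<omega> > u n)
    = (\<integral>\<omega>. (st.N 0 L \<omega>)\<^sup>2 \<partial>uniform_measure M A)"
    using exceedances_eq[OF assms(1)] by (simp add: cond_expect_def A_def)
  also have "\<dots> = (\<integral>\<omega>. (st.N 0 L \<omega>)\<^sup>2 \<partial>density M (\<lambda>\<omega>. ennreal (indicator A \<omega> / prob A)))"
  proof -
    have "indicator A \<omega> / emeasure M A = ennreal (indicator A \<omega> / prob A)" for \<omega>
      using pA assms(3) divide_ennreal[of 1 "1 - Qn n L"] by (auto simp: emeasure_eq_measure indicator_def)
    then show ?thesis by (simp add: uniform_measure_def)
  qed
  also have "\<dots> = (\<integral>\<omega>. (indicator A \<omega> / prob A) *\<^sub>R (st.N 0 L \<omega>)\<^sup>2 \<partial>M)"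
    by (rule integral_density) auto
  also have "\<dots> = (\<integral>\<omega>. (st.N 0 L \<omega>)\<^sup>2 / prob A \<partial>M)"
    by (intro Bochner_Integration.integral_cong) (auto simp: A_eq indicator_def)
  also have "\<dots> = S2n n L / (1 - Qn n L)" by (simp add: st.S2_def pA)
  finally show ?thesis .
qed

lemma S2s_ratio: "(\<lambda>n. S2n n (s n) / (1 - Qn n (s n))) \<longlonglongrightarrow> m2"
proof -
  have "\<forall>\<^sub>F n in sequentially. cond_expect M (\<lambda>\<omega>. real (exceedances X (s n) (u n) \<omega>) ^ 2) (\<lambda>\<omega>. block_max X 0 (s n) \<omega> > u n) = S2n n (s n) / (1 - Qn n (s n))"
    using ev1 Qs_less_1
  proof eventually_elim
    case (elim n)
    then have "s n \<ge> 1" using pos(3)[of n] by simp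
    then show ?case using elim by (intro cond_expect_eq)
  qed
  from tendsto_eventually_eqI[OF m2_lim this] show ?thesis by (simp add: pmf_moment_def)
qed

lemma S2s_lim: "(\<lambda>n. real (r n) / real (s n) * S2n n (s n)) \<longlonglongrightarrow> \<alpha> * m2"
proof -
  have "(\<lambda>n. real (r n) / real (s n) * (1 - Qn n (s n)) * (S2n n (s n) / (1 - Qn n (s n)))) \<longlonglongrightarrow> \<alpha> * m2"
    by (intro tendsto_mult exceed_prob_lim S2s_ratio)
  moreover have "\<forall>\<^sub>F n in sequentially. real (r n) / real (s n) * (1 - Qn n (s n)) * (S2n n (s n) / (1 - Qn n (s n))) = real (r n) / real (s n) * S2n n (s n)"
    using Qs_less_1 by eventually_elim simp
  ultimately show ?thesis by (rule tendsto_eventually_eqI) simp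
qed

text \<open>
  The mean number of exceedances is \<open>\<tau>s/r\<close>, and the probability of at least one is \<open>\<alpha>s/r\<close> asymptotically.
\<close>
lemma cluster_mean_lim: "(\<lambda>n. real (s n) * pn n / (1 - Qn n (s n))) \<longlonglongrightarrow> 1 / \<theta>"
proof -
  have "(\<lambda>n. (real (r n) * pn n) / (real (r n) / real (s n) * (1 - Qn n (s n)))) \<longlonglongrightarrow> \<tau> / \<alpha>"
    using alpha_pos by (intro tendsto_divide tail_lim exceed_prob_lim) auto
  moreover have "\<forall>\<^sub>F n in sequentially. (real (r n) * pn n) / (real (r n) / real (s n) * (1 - Qn n (s n))) = real (s n) * pn n / (1 - Qn n (s n))"
    using ev1
  proof eventually_elim
    case (elim n)
    then have "real (r n) \<noteq> 0" "real (s n) \<noteq> 0" using pos by auto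
    moreover have "(R * P) / (R / S * a) = S * P / a" if "R \<noteq> 0" "S \<noteq> 0" for R S P a :: real
      using that by (cases "a = 0") (auto simp: field_simps)
    ultimately show ?case by blast
  qed
  ultimately show ?thesis by (rule tendsto_eventually_eqI) (use \<theta> \<tau> in \<open>simp add: \<alpha>_def\<close>)
qed

lemma cluster_prob_eq:
  assumes "n \<ge> 1" "L \<ge> 1" "j \<ge> 1"
  shows "\<P>(\<omega> in M. exceedances X L (u n) \<omega> = j \<bar> block_max X 0 L \<omega> > u n)
     = prob {\<omega> \<in> space M. stationary_threshold.N X (u n) 0 L \<omega> = real j} / (1 - Qn n L)"
proof -
  interpret st: stationary_threshold M X "u n" n "l n" by (rule st) fact
  have "(exceedances X L (u n) \<omega> = j \<and> block_max X 0 L \<omega> > u n) \<longleftrightarrow> st.N 0 L \<omega> = real j" for \<omega>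
  proof -
    have "exceedances X L (u n) \<omega> = j \<longleftrightarrow> st.N 0 L \<omega> = real j"
      using exceedances_eq[OF assms(1), of L \<omega>] by (metis of_nat_eq_iff)
    moreover have "st.N 0 L \<omega> = real j \<Longrightarrow> block_max X 0 L \<omega> > u n"
      using block_max_eq[OF assms(1,2), of \<omega>] assms(3) by simp
    ultimately show ?thesis by auto
  qed
  then show ?thesis using prob_exceed[OF assms(1,2)] by (simp add: cond_prob_def)
qed

text \<open>
  Cutting the mean off at \<open>J\<close> costs at most the second moment divided by \<open>J\<close>. Only the truncated
  mean is a finite sum of the probabilities whose limits are assumed.
\<close>
lemma truncated_mean:
  fixes J L :: nat
  assumes n: "n \<ge> 1" and J: "J \<ge> 1"
  defines "P \<equiv> (\<Sum>j\<in>{1..J}. real j * prob {\<omega> \<in> space M. stationary_threshold.N X (u n) 0 L \<omega> = real j})"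
  shows "P \<le> real L * pn n" "real L * pn n \<le> P + S2n n L / real J"
proof -
  interpret st: stationary_threshold M X "u n" n "l n" by (rule st) fact
  let ?E = "\<lambda>j. {\<omega> \<in> space M. st.N 0 L \<omega> = real j}"
  have EE: "?E j \<in> events" for j by measurable
  define T where "T \<omega> = (\<Sum>j\<in>{1..J}. real j * indicator (?E j) \<omega>)" for \<omega>
  have Tb: "bdd_rv M T" unfolding T_def[abs_def]
    by (intro bdd_rv_sum bdd_rv_scale bdd_rvI[where B=1]) (use EE in \<open>auto simp: indicator_def\<close>)
  have ET: "expectation T = P"
  proof -
    have "expectation T = (\<Sum>j\<in>{1..J}. expectation (\<lambda>\<omega>. real j * indicator (?E j) \<omega>))"
      unfolding T_def[abs_def]
      by (intro Bochner_Integration.integral_sum bdd_rv_integrable bdd_rv_scale bdd_rvI[where B=1])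
         (use EE in \<open>auto simp: indicator_def\<close>)
    also have "\<dots> = P"
    proof (unfold P_def, intro sum.cong refl)
      fix j
      have "?E j \<inter> space M = ?E j" by auto
      then show "expectation (\<lambda>\<omega>. real j * indicator (?E j) \<omega>) = real j * prob (?E j)" by simp
    qed
    finally show ?thesis .
  qed
  have pt: "T \<omega> = (if st.N 0 L \<omega> \<le> real J then st.N 0 L \<omega> else 0)" if \<omega>: "\<omega> \<in> space M" for \<omega>
  proof -
    obtain m where m: "st.N 0 L \<omega> = real m" using st.N_Nat by blast
    have "T \<omega> = (\<Sum>j\<in>{1..J}. if j = m then real m else 0)"
      unfolding T_def using \<omega> by (intro sum.cong) (auto simp: m indicator_def)
    also have "\<dots> = (if m \<in> {1..J} then real m else 0)" by simp
    finally show ?thesis by (auto simp: m)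
  qed
  have EN: "expectation (st.N 0 L) = real L * pn n" using st.E_N[of 0 L] n by (simp add: p_eq')
  have "expectation T \<le> expectation (st.N 0 L)"
    by (intro integral_mono bdd_rv_integrable Tb st.N_bdd) (auto simp: pt)
  then show "P \<le> real L * pn n" by (simp add: ET EN)
  have "expectation (st.N 0 L) \<le> expectation (\<lambda>\<omega>. T \<omega> + (st.N 0 L \<omega>)\<^sup>2 / real J)"
  proof (intro integral_mono bdd_rv_integrable bdd_rv_add bdd_rv_divide bdd_rv_power Tb st.N_bdd)
    fix \<omega> assume \<omega>: "\<omega> \<in> space M"
    show "st.N 0 L \<omega> \<le> T \<omega> + (st.N 0 L \<omega>)\<^sup>2 / real J"
    proof (cases "st.N 0 L \<omega> \<le> real J")
      case True then show ?thesis by (simp add: pt[OF \<omega>])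
    next
      case False
      then have "st.N 0 L \<omega> * real J \<le> (st.N 0 L \<omega>)\<^sup>2" by (simp add: power2_eq_square mult_left_mono)
      then show ?thesis using False J by (simp add: pt[OF \<omega>] pos_le_divide_eq)
    qed
  qed
  also have "\<dots> = expectation T + expectation (\<lambda>\<omega>. (st.N 0 L \<omega>)\<^sup>2 / real J)"
    by (intro Bochner_Integration.integral_add bdd_rv_integrable bdd_rv_divide bdd_rv_power Tb st.N_bdd)
  finally show "real L * pn n \<le> P + S2n n L / real J" by (simp add: ET EN st.S2_def)
qed

text \<open>
  The second moments are bounded, so the means of the conditional laws converge to the mean of \<open>\<pi>\<close>.
\<close>
lemma m1_eq: "pmf_moment \<pi> 1 = 1 / \<theta>"
proof -
  define B where "B J = (\<Sum>j\<in>{1..J}. real j * pmf \<pi> j)" for J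
  have "(\<lambda>j. real j ^ 1 * pmf \<pi> j) summable_on {1..}"
  proof (rule summable_on_comparison_test[OF m2_summable])
    fix j :: nat assume j: "j \<in> {1..}"
    have "real j \<le> real j ^ 2" using j by (simp add: self_le_power)
    then show "real j ^ 1 * pmf \<pi> j \<le> real j ^ 2 * pmf \<pi> j" by (simp add: mult_right_mono)
  qed simp
  from infsum_positive_nat_limit[OF this] have B1: "B \<longlonglongrightarrow> pmf_moment \<pi> 1"
    by (simp add: B_def[abs_def] pmf_moment_def)
  have sums: "(\<lambda>n. (\<Sum>j\<in>{1..J}. real j * prob {\<omega> \<in> space M. stationary_threshold.N X (u n) 0 (s n) \<omega> = real j}) / (1 - Qn n (s n))) \<longlonglongrightarrow> B J" for J
  proof -
    have "(\<lambda>n. \<Sum>j\<in>{1..J}. real j * \<P>(\<omega> in M. exceedances X (s n) (u n) \<omega> = j \<bar> block_max X 0 (s n) \<omega> > u n)) \<longlonglongrightarrow> B J"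
      unfolding B_def by (intro tendsto_sum tendsto_mult tendsto_const cluster_lim) auto
    moreover have "\<forall>\<^sub>F n in sequentially. (\<Sum>j\<in>{1..J}. real j * \<P>(\<omega> in M. exceedances X (s n) (u n) \<omega> = j \<bar> block_max X 0 (s n) \<omega> > u n))
      = (\<Sum>j\<in>{1..J}. real j * prob {\<omega> \<in> space M. stationary_threshold.N X (u n) 0 (s n) \<omega> = real j}) / (1 - Qn n (s n))"
      using ev1
    proof eventually_elim
      case (elim n)
      then have "s n \<ge> 1" using pos(3)[of n] by simp
      then show ?case using elim by (simp add: cluster_prob_eq sum_divide_distrib)
    qed
    ultimately show ?thesis by (rule tendsto_eventually_eqI) simp
  qed
  have up: "B J \<le> 1 / \<theta>" if J: "J \<ge> 1" for J
  proof (rule tendsto_le[OF _ cluster_mean_lim sums])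
    show "\<forall>\<^sub>F n in sequentially. (\<Sum>j\<in>{1..J}. real j * prob {\<omega> \<in> space M. stationary_threshold.N X (u n) 0 (s n) \<omega> = real j}) / (1 - Qn n (s n)) \<le> real (s n) * pn n / (1 - Qn n (s n))"
      using ev1 Qs_less_1 by eventually_elim (intro divide_right_mono truncated_mean J, auto)
  qed simp
  have lo: "1 / \<theta> \<le> B J + m2 / real J" if J: "J \<ge> 1" for J
  proof (rule tendsto_le[OF _ tendsto_add[OF sums tendsto_divide[OF S2s_ratio tendsto_const]] cluster_mean_lim])
    show "\<forall>\<^sub>F n in sequentially. real (s n) * pn n / (1 - Qn n (s n)) \<le>
      (\<Sum>j\<in>{1..J}. real j * prob {\<omega> \<in> space M. stationary_threshold.N X (u n) 0 (s n) \<omega> = real j}) / (1 - Qn n (s n)) + S2n n (s n) / (1 - Qn n (s n)) / real J"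
      using ev1 Qs_less_1
    proof eventually_elim
      case (elim n)
      have "real (s n) * pn n / (1 - Qn n (s n)) \<le> ((\<Sum>j\<in>{1..J}. real j * prob {\<omega> \<in> space M. stationary_threshold.N X (u n) 0 (s n) \<omega> = real j}) + S2n n (s n) / real J) / (1 - Qn n (s n))"
        using elim by (intro divide_right_mono truncated_mean J) auto
      then show ?case by (simp add: add_divide_distrib mult.commute)
    qed
  qed (use J in auto)
  have "pmf_moment \<pi> 1 \<le> 1 / \<theta>"
    by (rule tendsto_le[OF _ tendsto_const B1]) (auto intro: eventually_mono[OF eventually_ge_at_top[of 1]] up)
  moreover have "1 / \<theta> \<le> pmf_moment \<pi> 1 + 0"
  proof (rule tendsto_le[OF _ _ tendsto_const])
    show "(\<lambda>J. B J + m2 / real J) \<longlonglongrightarrow> pmf_moment \<pi> 1 + 0"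
      by (intro tendsto_add B1 real_tendsto_divide_at_top[OF tendsto_const filterlim_real_sequentially])
    show "\<forall>\<^sub>F J in sequentially. 1 / \<theta> \<le> B J + m2 / real J"
      using eventually_ge_at_top[of 1] by eventually_elim (rule lo)
  qed simp
  ultimately show ?thesis by simp
qed

abbreviation "c2 \<equiv> sq_coeff_var \<pi>"

lemma c2_eq: "c2 = \<theta>\<^sup>2 * m2 - 1"
  using \<theta> unfolding sq_coeff_var_def m1_eq by (simp add: field_simps power2_eq_square)

text \<open>
  The squared mean never exceeds the second moment; in the prelimit this follows from the mean of the square of the
  difference between the count and a multiple of the indicator of an exceedance.
\<close>
lemma c2_nonneg: "c2 \<ge> 0"
proof -
  have "(1 / \<theta>)\<^sup>2 \<le> m2"
  proof (rule tendsto_le[OF _ S2s_ratio tendsto_power[OF cluster_mean_lim]])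
    show "\<forall>\<^sub>F n in sequentially. (real (s n) * pn n / (1 - Qn n (s n)))\<^sup>2 \<le> S2n n (s n) / (1 - Qn n (s n))"
      using ev1 Qs_less_1
    proof eventually_elim
      case (elim n)
      interpret st: stationary_threshold M X "u n" n "l n" by (rule st) fact
      let ?N = "st.N 0 (s n)" and ?Z = "st.Z 0 (s n)"
      define a where "a = 1 - Qn n (s n)"
      define b where "b = real (s n) * pn n"
      have a: "a > 0" using elim by (simp add: a_def)
      have "0 \<le> expectation (\<lambda>\<omega>. (?N \<omega> - b / a * (1 - ?Z \<omega>))\<^sup>2)" by simp
      also have "(\<lambda>\<omega>. (?N \<omega> - b / a * (1 - ?Z \<omega>))\<^sup>2) = (\<lambda>\<omega>. ((?N \<omega>)\<^sup>2 - 2 * (b / a) * ?N \<omega>) + (b / a)\<^sup>2 * (1 - ?Z \<omega>))"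
        by (auto simp: st.Z_def power2_diff power_divide)
      also have "expectation \<dots> = (expectation (\<lambda>\<omega>. (?N \<omega>)\<^sup>2) - 2 * (b / a) * expectation ?N) + (b / a)\<^sup>2 * (1 - expectation ?Z)"
        using st.N_sq_integrable[of 0 "s n"] bdd_rv_integrable[OF st.N_bdd[of 0 "s n"]] bdd_rv_integrable[OF st.Z_bdd[of 0 "s n"]]
        by (simp add: prob_space)
      also have "\<dots> = (S2n n (s n) - 2 * (b / a) * b) + (b / a)\<^sup>2 * a"
        using st.E_N[of 0 "s n"] elim by (simp add: st.S2_def a_def b_def st.Q_def p_eq')
      finally have "0 \<le> ((S2n n (s n) - 2 * (b / a) * b) + (b / a)\<^sup>2 * a) / a" using a by simp
      also have "\<dots> = S2n n (s n) / a - (b / a)\<^sup>2" using a by (simp add: field_simps power2_eq_square)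
      finally show ?case by (simp add: a_def b_def)
    qed
  qed simp
  then have "\<theta>\<^sup>2 * (1 / \<theta>)\<^sup>2 \<le> \<theta>\<^sup>2 * m2" by (intro mult_left_mono) auto
  then show ?thesis using \<theta> by (simp add: c2_eq power_divide)
qed

end

section \<open>Limits of the covariances\<close>

context exceedance_array
begin

abbreviation "F \<equiv> exp (- \<alpha>)"

text \<open>
  The integral of \<open>exp (-\<alpha>(1 + x)) - exp (-2\<alpha>)\<close> over \<open>0 \<le> x \<le> 1\<close>, the limit of the average of \<open>c r d\<close>
  over \<open>d < r\<close>.
\<close>
definition g :: real where "g = F * (1 - F) / \<alpha> - F\<^sup>2"

abbreviation "cn n \<equiv> stationary_threshold.c M X (u n) (r n)"

lemma c_eq: "n \<ge> 1 \<Longrightarrow> cn n d = Qn n (r n + d) - (Qn n (r n))\<^sup>2"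
  using stationary_threshold.c_def[OF st] by simp

lemma c_0_lim: "(\<lambda>n. cn n 0) \<longlonglongrightarrow> F - F\<^sup>2"
proof -
  have "(\<lambda>n. Qn n (r n) - (Qn n (r n))\<^sup>2) \<longlonglongrightarrow> F - F\<^sup>2" by (intro tendsto_intros Qr_lim)
  moreover have "\<forall>\<^sub>F n in sequentially. Qn n (r n) - (Qn n (r n))\<^sup>2 = cn n 0"
    using ev1 by eventually_elim (simp add: c_eq)
  ultimately show ?thesis by (rule tendsto_eventually_eqI) simp
qed

lemma c_r_lim: "(\<lambda>n. cn n (r n)) \<longlonglongrightarrow> 0"
proof -
  have "(\<lambda>n. Qn n (r n + r n) - exp (- (\<alpha> * real (r n + r n) / real (r n)))) \<longlonglongrightarrow> 0"
    by (rule Q_lim) simp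
  moreover have "\<forall>\<^sub>F n in sequentially. Qn n (r n + r n) - exp (- (\<alpha> * real (r n + r n) / real (r n))) = Qn n (r n + r n) - F\<^sup>2"
    using ev1
  proof eventually_elim
    case (elim n)
    then have "r n \<noteq> 0" using pos(1)[of n] by simp
    then have "\<alpha> * real (r n + r n) / real (r n) = 2 * \<alpha>" by simp
    moreover have "exp (- (2 * \<alpha>)) = F\<^sup>2" by (simp add: power2_eq_square exp_add[symmetric])
    ultimately show ?case by simp
  qed
  ultimately have 1: "(\<lambda>n. Qn n (r n + r n) - F\<^sup>2) \<longlonglongrightarrow> 0" by (rule tendsto_eventually_eqI) simp
  have "(\<lambda>n. (Qn n (r n + r n) - F\<^sup>2) + (F\<^sup>2 - (Qn n (r n))\<^sup>2)) \<longlonglongrightarrow> 0 + (F\<^sup>2 - F\<^sup>2)"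
    by (intro tendsto_add 1 tendsto_diff tendsto_const tendsto_power Qr_lim)
  moreover have "\<forall>\<^sub>F n in sequentially. (Qn n (r n + r n) - F\<^sup>2) + (F\<^sup>2 - (Qn n (r n))\<^sup>2) = cn n (r n)"
    using ev1 by eventually_elim (simp add: c_eq)
  ultimately show ?thesis by (rule tendsto_eventually_eqI) simp
qed

text \<open>
  The Riemann sum is a finite geometric series.
\<close>
lemma geometric_riemann: "(\<lambda>n. (\<Sum>d<r n. exp (- (\<alpha> * real (r n + d) / real (r n)))) / real (r n)) \<longlonglongrightarrow> F * (1 - F) / \<alpha>"
proof -
  define y where "y n = \<alpha> / real (r n)" for n
  have y0: "y \<longlonglongrightarrow> 0" unfolding y_def[abs_def] by (rule real_tendsto_divide_at_top[OF tendsto_const r_at_top])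
  have d: "(\<lambda>n. real (r n) * (1 - exp (- y n))) \<longlonglongrightarrow> \<alpha>"
  proof (rule LIM_zero_cancel, rule Lim_null_comparison)
    show "\<forall>\<^sub>F n in sequentially. norm (real (r n) * (1 - exp (- y n)) - \<alpha>) \<le> \<alpha> * y n"
      using ev1
    proof eventually_elim
      case (elim n)
      then have r: "real (r n) > 0" using pos by simp
      have yn: "y n \<ge> 0" using alpha_pos by (simp add: y_def)
      have a: "\<alpha> = real (r n) * y n" using r by (simp add: y_def)
      have "real (r n) * (1 - exp (- y n)) - \<alpha> = real (r n) * ((1 - y n) - exp (- y n))"
        unfolding a by (simp add: algebra_simps)
      then have "norm (real (r n) * (1 - exp (- y n)) - \<alpha>) = real (r n) * \<bar>(1 - y n) - exp (- y n)\<bar>"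
        using r by (simp add: abs_mult)
      also have "\<dots> \<le> real (r n) * (y n)\<^sup>2"
        using r by (intro mult_left_mono exp_neg_linear_approx yn) auto
      also have "\<dots> = \<alpha> * y n" unfolding a by (simp add: power2_eq_square)
      finally show ?case .
    qed
    show "(\<lambda>n. \<alpha> * y n) \<longlonglongrightarrow> 0" using tendsto_mult_left[OF y0, of \<alpha>] by simp
  qed
  have "(\<lambda>n. F * (1 - F) / (real (r n) * (1 - exp (- y n)))) \<longlonglongrightarrow> F * (1 - F) / \<alpha>"
    using alpha_pos by (intro tendsto_divide tendsto_const d) auto
  moreover have "\<forall>\<^sub>F n in sequentially. F * (1 - F) / (real (r n) * (1 - exp (- y n))) = (\<Sum>d<r n. exp (- (\<alpha> * real (r n + d) / real (r n)))) / real (r n)"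
    using ev1
  proof eventually_elim
    case (elim n)
    then have r: "real (r n) > 0" using pos by simp
    have yn: "y n > 0" using alpha_pos r by (simp add: y_def)
    have x1: "exp (- y n) \<noteq> 1" using yn by simp
    have "exp (- (\<alpha> * real (r n + d) / real (r n))) = F * exp (- y n) ^ d" for d
    proof -
      have "\<alpha> * real (r n + d) / real (r n) = \<alpha> + real d * y n" using r by (simp add: y_def field_simps)
      then show ?thesis by (simp add: exp_add exp_of_nat_mult[symmetric] exp_diff exp_minus field_simps)
    qed
    then have "(\<Sum>d<r n. exp (- (\<alpha> * real (r n + d) / real (r n)))) = F * (\<Sum>d<r n. exp (- y n) ^ d)"
      by (simp add: sum_distrib_left)
    also have "(\<Sum>d<r n. exp (- y n) ^ d) = (1 - exp (- y n) ^ r n) / (1 - exp (- y n))"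
      using x1 by (simp add: sum_gp_strict)
    also have "exp (- y n) ^ r n = F" using r by (simp add: exp_of_nat_mult[symmetric] y_def)
    finally show ?case by simp
  qed
  ultimately show ?thesis by (rule tendsto_eventually_eqI) simp
qed

text \<open>
  A Riemann sum of the limiting covariance function. Uniformity in the shift comes from applying \<open>Q_lim\<close> to the
  shifts at which the error is largest.
\<close>
lemma kappa_lim: "(\<lambda>n. stationary_threshold.\<kappa> M X (u n) (r n) / real (r n)) \<longlonglongrightarrow> 2 * g"
proof -
  define err where "err n d = \<bar>Qn n (r n + d) - exp (- (\<alpha> * real (r n + d) / real (r n)))\<bar>" for n d
  have "\<exists>d\<in>{..r n}. \<forall>d'\<in>{..r n}. err n d' \<le> err n d" for n
    using obtains_MAX[of "{..r n}" "err n"] by (metis Max_ge atMost_iff empty_iff finite_atMost finite_imageI imageI le0)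
  then obtain D where D: "\<And>n. D n \<le> r n" "\<And>n d. d \<le> r n \<Longrightarrow> err n d \<le> err n (D n)" by (metis atMost_iff)
  have "(\<lambda>n. Qn n (r n + D n) - exp (- (\<alpha> * real (r n + D n) / real (r n)))) \<longlonglongrightarrow> 0"
    using D(1) by (intro Q_lim always_eventually allI) (simp add: mult_2)
  then have E0: "(\<lambda>n. err n (D n)) \<longlonglongrightarrow> 0" unfolding err_def by (rule tendsto_rabs_zero)
  have S: "(\<lambda>n. (\<Sum>d<r n. Qn n (r n + d)) / real (r n)) \<longlonglongrightarrow> F * (1 - F) / \<alpha>"
  proof -
    have "(\<lambda>n. (\<Sum>d<r n. Qn n (r n + d)) / real (r n) - (\<Sum>d<r n. exp (- (\<alpha> * real (r n + d) / real (r n)))) / real (r n)) \<longlonglongrightarrow> 0"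
    proof (rule Lim_null_comparison[OF _ E0])
      show "\<forall>\<^sub>F n in sequentially. norm ((\<Sum>d<r n. Qn n (r n + d)) / real (r n) - (\<Sum>d<r n. exp (- (\<alpha> * real (r n + d) / real (r n)))) / real (r n)) \<le> err n (D n)"
        using ev1
      proof eventually_elim
        case (elim n)
        then have r: "real (r n) > 0" using pos by simp
        have "\<bar>\<Sum>d<r n. Qn n (r n + d) - exp (- (\<alpha> * real (r n + d) / real (r n)))\<bar> \<le> (\<Sum>d<r n. err n (D n))"
          by (intro order_trans[OF sum_abs] sum_mono) (use D(2) in \<open>auto simp: err_def\<close>)
        then have "\<bar>\<Sum>d<r n. Qn n (r n + d) - exp (- (\<alpha> * real (r n + d) / real (r n)))\<bar> / real (r n) \<le> err n (D n)"
          using r by (simp add: pos_divide_le_eq mult.commute)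
        then show ?case using r by (simp add: sum_subtractf diff_divide_distrib[symmetric])
      qed
    qed
    from tendsto_add[OF this geometric_riemann] show ?thesis by simp
  qed
  have "(\<lambda>n. 2 * ((\<Sum>d<r n. Qn n (r n + d)) / real (r n) - (Qn n (r n))\<^sup>2) - cn n 0 / real (r n)) \<longlonglongrightarrow> 2 * (F * (1 - F) / \<alpha> - F\<^sup>2) - 0"
    by (intro tendsto_diff tendsto_mult tendsto_const S tendsto_power Qr_lim tendsto_divide_0[OF c_0_lim] filterlim_at_top_imp_at_infinity r_at_top)
  moreover have "\<forall>\<^sub>F n in sequentially. 2 * ((\<Sum>d<r n. Qn n (r n + d)) / real (r n) - (Qn n (r n))\<^sup>2) - cn n 0 / real (r n) = stationary_threshold.\<kappa> M X (u n) (r n) / real (r n)"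
    using ev1
  proof eventually_elim
    case (elim n)
    then have r: "real (r n) > 0" using pos by simp
    have "(\<Sum>d<r n. cn n d) = (\<Sum>d<r n. Qn n (r n + d)) - real (r n) * (Qn n (r n))\<^sup>2"
      using elim by (simp add: c_eq sum_subtractf)
    then have "stationary_threshold.\<kappa> M X (u n) (r n) = 2 * ((\<Sum>d<r n. Qn n (r n + d)) - real (r n) * (Qn n (r n))\<^sup>2) - cn n 0"
      using stationary_threshold.\<kappa>_def[OF st[OF elim], of "u n" "r n"] by simp
    then show ?case using r by (simp add: diff_divide_distrib)
  qed
  ultimately show ?thesis by (rule tendsto_eventually_eqI) (simp add: g_def)
qed

text \<open>
  One block fewer than there are, so that every window that starts in a block is contained in
  the sample.
\<close>
definition K :: "nat \<Rightarrow> nat" where "K n = k n - 1"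

lemma K_at_top_nat: "filterlim K at_top sequentially"
proof -
  have "filterlim k at_top sequentially"
    using k_at_top by (simp add: filterlim_sequentially_iff_filterlim_real)
  then have "filterlim (\<lambda>n. k n - 1) at_top sequentially"
    by (rule filterlim_compose[OF filterlim_minus_const_nat_at_top])
  then show ?thesis by (simp add: K_def[abs_def])
qed

lemma K_at_top: "filterlim (\<lambda>n. real (K n)) at_top sequentially"
  using K_at_top_nat by (simp add: filterlim_sequentially_iff_filterlim_real)

lemma ev_K: "\<forall>\<^sub>F n in sequentially. K n \<ge> 1"
  using K_at_top_nat by (simp add: filterlim_at_top)

lemma ev_kK: "\<forall>\<^sub>F n in sequentially. k n = K n + 1"
  using ev_K by eventually_elim (simp add: K_def)

lemma Kr_le: "(K n + 1) * r n \<le> n" if "K n \<ge> 1"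
proof -
  have "K n + 1 = k n" using that by (simp add: K_def)
  then show ?thesis by simp
qed

lemma blocked: "\<forall>\<^sub>F n in sequentially. blocked_threshold M X n (l n) (r n) (K n)"
  using ev1 ev_lr ev_K
proof eventually_elim
  case (elim n)
  interpret st: stationary_threshold M X "u n" n "l n" by (rule st) fact
  show ?case
    by unfold_locales (use elim pos(1)[of n] Kr_le[of n] in auto)
qed

lemma K_div_k: "(\<lambda>n. real (K n) / real (k n)) \<longlonglongrightarrow> 1"
proof -
  have "(\<lambda>n. 1 - 1 / real (k n)) \<longlonglongrightarrow> 1 - 0"
    by (intro tendsto_diff tendsto_const real_tendsto_divide_at_top[OF tendsto_const k_at_top])
  moreover have "\<forall>\<^sub>F n in sequentially. 1 - 1 / real (k n) = real (K n) / real (k n)"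
    using ev_kK by eventually_elim (simp add: field_simps)
  ultimately show ?thesis by (rule tendsto_eventually_eqI) simp
qed

lemma K_le: assumes "n \<ge> 1" "K n \<ge> 1" shows "real (K n) \<le> real n / real (r n)" "real (K n * r n) \<le> real n"
proof -
  have "K n * r n \<le> n" using Kr_le[OF assms(2)] by simp
  then show "real (K n * r n) \<le> real n" by (rule of_nat_mono)
  then show "real (K n) \<le> real n / real (r n)" using pos(1)[OF assms(1)] by (simp add: pos_le_divide_eq)
qed

lemma K_rho: "(\<lambda>n. real (K n) * rho n) \<longlonglongrightarrow> 0"
proof (rule tendsto_sandwich[OF _ _ tendsto_const n_rho_r])
  show "\<forall>\<^sub>F n in sequentially. 0 \<le> real (K n) * rho n"
    using ev1 by eventually_elim (simp add: rho_nonneg)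
  show "\<forall>\<^sub>F n in sequentially. real (K n) * rho n \<le> real n / real (r n) * rho n"
    using ev1 ev_K by eventually_elim (intro mult_right_mono K_le rho_nonneg, auto)
qed

lemma rho_0: "rho \<longlonglongrightarrow> 0"
proof (rule tendsto_sandwich[OF _ _ tendsto_const K_rho])
  show "\<forall>\<^sub>F n in sequentially. 0 \<le> rho n" using ev1 by eventually_elim (simp add: rho_nonneg)
  show "\<forall>\<^sub>F n in sequentially. rho n \<le> real (K n) * rho n"
    using ev1 ev_K
  proof eventually_elim
    case (elim n)
    then have "1 * rho n \<le> real (K n) * rho n" by (intro mult_right_mono rho_nonneg) auto
    then show ?case by simp
  qed
qed

end

context exceedance_clusters
begin

abbreviation "h n \<equiv> real (r n) / real (s n) * S2n n (s n)"

lemma S2_nonneg: "n \<ge> 1 \<Longrightarrow> S2n n L \<ge> 0"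
  using stationary_threshold.S2_nonneg[OF st] by simp

text \<open>
  At least \<open>s / 2l\<close> disjoint stretches of length \<open>l\<close> fit into one of length \<open>s\<close>.
\<close>
lemma S2l_le:
  assumes "n \<ge> 1" "l n < s n"
  shows "S2n n (l n) \<le> 2 * (real (l n) / real (s n)) * S2n n (s n)"
proof -
  interpret st: stationary_threshold M X "u n" n "l n" by (rule st) fact
  define q where "q = s n div l n"
  have l: "l n > 0" using pos assms by simp
  have ql: "q * l n \<le> s n" by (simp add: q_def)
  have q1: "q \<ge> 1" using assms l by (simp add: q_def div_greater_zero_iff Suc_le_eq)
  have "s n < q * l n + l n" using l unfolding q_def by (metis add.commute dividend_less_div_times)
  also have "\<dots> \<le> 2 * (q * l n)" using mult_le_mono1[OF q1, of "l n"] by simp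
  finally have "s n \<le> 2 * q * l n" by simp
  then have "real (s n) \<le> real (2 * q * l n)" by (rule of_nat_mono)
  then have sq: "real (s n) \<le> 2 * real q * real (l n)" by simp
  have "real q * S2n n (l n) \<le> S2n n (s n)"
    using st.S2_superadditive[of q "l n"] st.S2_mono[OF ql] by simp
  then have "2 * real (l n) * (real q * S2n n (l n)) \<le> 2 * real (l n) * S2n n (s n)" by (intro mult_left_mono) auto
  moreover have "real (s n) * S2n n (l n) \<le> 2 * real q * real (l n) * S2n n (l n)"
    using sq S2_nonneg[OF assms(1)] by (intro mult_right_mono) auto
  ultimately have "real (s n) * S2n n (l n) \<le> 2 * real (l n) * S2n n (s n)" by (simp add: ac_simps)
  then show ?thesis using pos(3)[OF assms(1)] by (simp add: pos_le_divide_eq mult.commute)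
qed

lemma S2s_0: "(\<lambda>n. S2n n (s n)) \<longlonglongrightarrow> 0"
proof -
  have "(\<lambda>n. h n * (real (s n) / real (r n))) \<longlonglongrightarrow> \<alpha> * m2 * 0" by (intro tendsto_mult S2s_lim sr)
  moreover have "\<forall>\<^sub>F n in sequentially. h n * (real (s n) / real (r n)) = S2n n (s n)"
    using ev1
  proof eventually_elim
    case (elim n)
    then have "real (r n) \<noteq> 0" "real (s n) \<noteq> 0" using pos by auto
    then show ?case by simp
  qed
  ultimately show ?thesis by (rule tendsto_eventually_eqI) simp
qed

lemma var_Ns_lim: "(\<lambda>n. real (r n) / real (s n) * (S2n n (s n) - (real (s n) * pn n)\<^sup>2)) \<longlonglongrightarrow> \<alpha> * m2"
proof -
  have "(\<lambda>n. h n - (real (r n) * pn n) * (real (s n) * pn n)) \<longlonglongrightarrow> \<alpha> * m2 - \<tau> * 0"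
    by (intro tendsto_diff tendsto_mult S2s_lim tail_lim sp)
  moreover have "\<forall>\<^sub>F n in sequentially. h n - (real (r n) * pn n) * (real (s n) * pn n) = real (r n) / real (s n) * (S2n n (s n) - (real (s n) * pn n)\<^sup>2)"
    using ev1
  proof eventually_elim
    case (elim n)
    then have "real (s n) \<noteq> 0" using pos by auto
    then show ?case by (simp add: right_diff_distrib power2_eq_square)
  qed
  ultimately show ?thesis by (rule tendsto_eventually_eqI) simp
qed

text \<open>
  Short blocks are nearly uncorrelated, so the variance is about \<open>Kr/s\<close> times that of a short block, whose
  squared mean is negligible against its second moment \<open>\<alpha>m\<^sub>2s/r\<close>. The indices after the last complete
  short block are removed at the level of standard deviations, by the triangle inequality.
\<close>
lemma var_TN_lim: "(\<lambda>n. cov M (blocked_threshold.TN X (u n) (r n) (K n)) (blocked_threshold.TN X (u n) (r n) (K n)) / real (K n)) \<longlonglongrightarrow> \<alpha> * m2"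
proof -
  define L where "L n = K n * r n" for n
  define q where "q n = L n div s n" for n
  let ?N = "\<lambda>n. stationary_threshold.N X (u n)"
  let ?main = "\<lambda>n. ?N n 0 (q n * s n)"
  have L_pos: "\<forall>\<^sub>F n in sequentially. L n > 0" using ev_K ev1 by eventually_elim (use pos in \<open>auto simp: L_def\<close>)
  have sL: "(\<lambda>n. real (s n) / real (L n)) \<longlonglongrightarrow> 0"
  proof (rule tendsto_sandwich[OF _ _ tendsto_const sr])
    show "\<forall>\<^sub>F n in sequentially. real (s n) / real (L n) \<le> real (s n) / real (r n)"
      using ev1 ev_K
    proof eventually_elim
      case (elim n)
      have "1 * real (r n) \<le> real (K n) * real (r n)" using elim by (intro mult_right_mono) auto
      then show ?case unfolding L_def using pos(1)[of n] elim by (intro divide_left_mono) auto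
    qed
  qed simp
  have qs: "(\<lambda>n. real (q n) * real (s n) / real (L n)) \<longlonglongrightarrow> 1"
    unfolding q_def by (rule div_ratio[OF sL L_pos ev1_pos[OF pos(3)]])
  let ?v = "\<lambda>n. S2n n (s n) - (real (s n) * pn n)\<^sup>2"
  have qv: "(\<lambda>n. real (q n) * ?v n / real (K n)) \<longlonglongrightarrow> \<alpha> * m2"
  proof -
    have "(\<lambda>n. (real (q n) * real (s n) / real (L n)) * (real (r n) / real (s n) * ?v n)) \<longlonglongrightarrow> 1 * (\<alpha> * m2)"
      by (intro tendsto_mult qs var_Ns_lim)
    moreover have "\<forall>\<^sub>F n in sequentially. (real (q n) * real (s n) / real (L n)) * (real (r n) / real (s n) * ?v n) = real (q n) * ?v n / real (K n)"
      using ev1 ev_K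
    proof eventually_elim
      case (elim n)
      then have "real (r n) \<noteq> 0" "real (s n) \<noteq> 0" "real (K n) \<noteq> 0" using pos by auto
      then show ?case by (simp add: L_def)
    qed
    ultimately show ?thesis by (rule tendsto_eventually_eqI) simp
  qed
  let ?b = "\<lambda>n. h n * (real n / real (s n) * rho n) + 2 * (h n * sqrt (2 * (real (l n) / real (s n))) + h n * rho n)"
  have main: "(\<lambda>n. cov M (?main n) (?main n) / real (K n)) \<longlonglongrightarrow> \<alpha> * m2"
  proof -
    have "(\<lambda>n. cov M (?main n) (?main n) / real (K n) - real (q n) * ?v n / real (K n)) \<longlonglongrightarrow> 0"
    proof (rule Lim_null_comparison)
      show "\<forall>\<^sub>F n in sequentially. norm (cov M (?main n) (?main n) / real (K n) - real (q n) * ?v n / real (K n)) \<le> ?b n"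
        using ev1 ev_K ev_ls
      proof eventually_elim
        case (elim n)
        interpret st: stationary_threshold M X "u n" n "l n" by (rule st) fact
        have rs: "real (r n) > 0" "real (s n) > 0" and K0: "real (K n) > 0" using pos elim by auto
        have Ln: "L n \<le> n" using Kr_le[of n] elim by (simp add: L_def)
        have qsL: "q n * s n \<le> L n" by (simp add: q_def)
        have "real (q n) * real (s n) \<le> real (L n)" using qsL by (metis of_nat_le_iff of_nat_mult)
        then have q1: "real (q n) / real (K n) \<le> real (r n) / real (s n)"
          using rs K0 by (simp add: L_def field_simps)
        have "real (q n) * real (s n) \<le> real n" using qsL Ln by (metis le_trans of_nat_le_iff of_nat_mult)
        then have q2: "real (q n) \<le> real n / real (s n)" using rs by (simp add: pos_le_divide_eq)
        have S2: "S2n n (s n) \<ge> 0" using S2_nonneg elim by simp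
        have var: "cov M (st.N 0 (s n)) (st.N 0 (s n)) = ?v n"
          using elim by (simp add: cov_eq st.E_N st.S2_def power2_eq_square p_eq')
        have sqs: "sqrt (S2n n (s n)) * sqrt (S2n n (l n)) \<le> S2n n (s n) * sqrt (2 * (real (l n) / real (s n)))"
        proof -
          have "sqrt (S2n n (s n)) * sqrt (S2n n (l n)) \<le> sqrt (S2n n (s n)) * sqrt (2 * (real (l n) / real (s n)) * S2n n (s n))"
            using S2l_le[of n] elim S2 by (intro mult_left_mono real_sqrt_le_mono) auto
          also have "\<dots> = (sqrt (S2n n (s n)) * sqrt (S2n n (s n))) * sqrt (2 * (real (l n) / real (s n)))"
            by (simp only: real_sqrt_mult ac_simps)
          finally show ?thesis using S2 by simp
        qed
        have "\<bar>cov M (?main n) (?main n) - real (q n) * ?v n\<bar> \<le> (real (q n))\<^sup>2 * rho n * S2n n (s n) + 2 * real (q n) * (sqrt (S2n n (s n)) * sqrt (S2n n (l n)) + rho n * S2n n (s n))"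
          using st.var_N_blocks[of "s n" "q n"] elim qsL Ln pos(3)[of n] unfolding var by (simp add: rho_eq)
        also have "\<dots> \<le> real (q n) * (real n / real (s n)) * rho n * S2n n (s n) + 2 * real (q n) * (S2n n (s n) * sqrt (2 * (real (l n) / real (s n))) + rho n * S2n n (s n))"
          unfolding power2_eq_square using q2 sqs S2 rho_nonneg[of n] elim
          by (intro add_mono mult_right_mono mult_left_mono) auto
        finally have "\<bar>cov M (?main n) (?main n) - real (q n) * ?v n\<bar> / real (K n) \<le>
          (real (q n) * (real n / real (s n)) * rho n * S2n n (s n) + 2 * real (q n) * (S2n n (s n) * sqrt (2 * (real (l n) / real (s n))) + rho n * S2n n (s n))) / real (K n)"
          using K0 by (intro divide_right_mono) auto
        also have "\<dots> = (real (q n) / real (K n)) * (S2n n (s n) * ((real n / real (s n)) * rho n) + 2 * (S2n n (s n) * sqrt (2 * (real (l n) / real (s n))) + rho n * S2n n (s n)))"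
          by (simp add: add_divide_distrib algebra_simps)
        also have "\<dots> \<le> (real (r n) / real (s n)) * (S2n n (s n) * ((real n / real (s n)) * rho n) + 2 * (S2n n (s n) * sqrt (2 * (real (l n) / real (s n))) + rho n * S2n n (s n)))"
          using q1 S2 rho_nonneg[of n] elim by (intro mult_right_mono) auto
        also have "\<dots> = ?b n" by (simp add: algebra_simps)
        finally show ?case by (simp add: diff_divide_distrib[symmetric])
      qed
      have "?b \<longlonglongrightarrow> \<alpha> * m2 * 0 + 2 * (\<alpha> * m2 * sqrt (2 * 0) + \<alpha> * m2 * 0)"
        by (intro tendsto_intros S2s_lim n_rho ls rho_0)
      then show "?b \<longlonglongrightarrow> 0" by simp
    qed
    from tendsto_add[OF this qv] show ?thesis by simp
  qed
  have sdmain: "(\<lambda>n. sd M (?main n) / sqrt (real (K n))) \<longlonglongrightarrow> sqrt (\<alpha> * m2)"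
    using tendsto_real_sqrt[OF main] by (simp add: sd_def real_sqrt_divide)
  let ?T = "\<lambda>n. blocked_threshold.TN X (u n) (r n) (K n)"
  have "(\<lambda>n. sd M (?T n) / sqrt (real (K n)) - sd M (?main n) / sqrt (real (K n))) \<longlonglongrightarrow> 0"
  proof (rule Lim_null_comparison)
    show "\<forall>\<^sub>F n in sequentially. norm (sd M (?T n) / sqrt (real (K n)) - sd M (?main n) / sqrt (real (K n))) \<le> sqrt (S2n n (s n))"
      using ev1 ev_K blocked
    proof eventually_elim
      case (elim n)
      interpret bt: blocked_threshold M X "u n" n "l n" "r n" "K n" by (rule elim)
      have qsL: "q n * s n \<le> L n" by (simp add: q_def)
      have "L n - q n * s n = L n mod s n" by (simp add: minus_div_mult_eq_mod q_def)
      also have "\<dots> \<le> s n" using pos(3)[of n] elim by (simp add: less_imp_le)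
      finally have rest: "L n - q n * s n \<le> s n" .
      have "bt.TN = (\<lambda>\<omega>. bt.N 0 (q n * s n) \<omega> + bt.N (q n * s n) (L n) \<omega>)"
        unfolding bt.TN_def L_def[symmetric] using bt.N_split[OF _ qsL, of 0] by auto
      then have "(\<lambda>\<omega>. bt.TN \<omega> - bt.N 0 (q n * s n) \<omega>) = bt.N (q n * s n) (L n)" by auto
      then have "\<bar>sd M bt.TN - sd M (bt.N 0 (q n * s n))\<bar> \<le> sd M (bt.N (q n * s n) (L n))"
        using sd_diff_le[OF bt.TN_bdd bt.N_bdd[of 0 "q n * s n"]] by simp
      also have "\<dots> \<le> sqrt (S2n n (s n))" by (rule bt.sd_N_le[OF qsL rest])
      finally have le: "\<bar>sd M bt.TN - sd M (bt.N 0 (q n * s n))\<bar> \<le> sqrt (S2n n (s n))" .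
      have "sqrt (real (K n)) \<ge> 1" using elim by simp
      then have "\<bar>sd M bt.TN - sd M (bt.N 0 (q n * s n))\<bar> / sqrt (real (K n)) \<le> \<bar>sd M bt.TN - sd M (bt.N 0 (q n * s n))\<bar> / 1"
        by (intro divide_left_mono) auto
      with le show ?case by (simp add: diff_divide_distrib[symmetric])
    qed
    show "(\<lambda>n. sqrt (S2n n (s n))) \<longlonglongrightarrow> 0" using tendsto_real_sqrt[OF S2s_0] by simp
  qed
  from tendsto_add[OF this sdmain] have "(\<lambda>n. sd M (?T n) / sqrt (real (K n))) \<longlonglongrightarrow> sqrt (\<alpha> * m2)" by simp
  from tendsto_power[OF this, of 2] have "(\<lambda>n. (sd M (?T n) / sqrt (real (K n)))\<^sup>2) \<longlonglongrightarrow> (sqrt (\<alpha> * m2))\<^sup>2" .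
  moreover have "\<forall>\<^sub>F n in sequentially. (sd M (?T n) / sqrt (real (K n)))\<^sup>2 = cov M (?T n) (?T n) / real (K n)"
    by (simp add: power_divide sd_sq)
  moreover have "(sqrt (\<alpha> * m2))\<^sup>2 = \<alpha> * m2"
  proof -
    have "m2 \<ge> 0"
      by (rule tendsto_lowerbound[OF S2s_ratio]) (use ev1 Qs_less_1 in eventually_elim, use S2_nonneg in auto)
    then show ?thesis using alpha_pos by simp
  qed
  ultimately show ?thesis by (rule tendsto_eventually_eqI)
qed

end

section \<open>Asymptotic normality of the block sums\<close>

lemma add_powr_le:
  fixes x y q :: real
  assumes "x \<ge> 0" "y \<ge> 0" "q \<ge> 0"
  shows "(x + y) powr q \<le> 2 powr q * (x powr q + y powr q)"
proof -
  have "(x + y) powr q \<le> (2 * max x y) powr q" using assms by (intro powr_mono2) auto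
  also have "\<dots> = 2 powr q * max x y powr q" using assms by (simp add: powr_mult)
  also have "max x y powr q \<le> x powr q + y powr q" by (auto simp: max_def)
  finally show ?thesis by (simp add: mult_left_mono)
qed

lemma powr_le_1_plus_powr:
  fixes x a b :: real
  assumes "0 \<le> x" "0 \<le> a" "a \<le> b" shows "x powr a \<le> 1 + x powr b"
proof (cases "x \<le> 1")
  case True
  then have "x powr a \<le> 1" using assms by (intro powr_le1) auto
  then show ?thesis by (simp add: add_increasing2)
next
  case False
  then have "x powr a \<le> x powr b" using assms by (intro powr_mono) auto
  then show ?thesis by simp
qed

lemma (in prob_space) var_lincomb3:
  assumes f: "bdd_rv M f" and g: "bdd_rv M g" and h: "bdd_rv M h"
  shows "cov M (\<lambda>\<omega>. a * (f \<omega> - x) + b * (g \<omega> - y) + c * (h \<omega> - z)) (\<lambda>\<omega>. a * (f \<omega> - x) + b * (g \<omega> - y) + c * (h \<omega> - z))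
    = a\<^sup>2 * cov M f f + b\<^sup>2 * cov M g g + c\<^sup>2 * cov M h h
      + 2 * a * b * cov M f g + 2 * a * c * cov M f h + 2 * b * c * cov M g h"
proof -
  let ?T = "\<lambda>\<omega>. a * (f \<omega> - x) + b * (g \<omega> - y) + c * (h \<omega> - z)"
  have b: "bdd_rv M (\<lambda>\<omega>. a * (f \<omega> - x))" "bdd_rv M (\<lambda>\<omega>. b * (g \<omega> - y))" "bdd_rv M (\<lambda>\<omega>. c * (h \<omega> - z))"
    using f g h by (auto intro!: bdd_rv_scale bdd_rv_diff)
  have T: "bdd_rv M ?T" by (intro bdd_rv_add b)
  have right: "cov M k ?T = a * cov M k f + b * cov M k g + c * cov M k h" if "bdd_rv M k" for k
  proof -
    have "cov M k ?T = cov M k (\<lambda>\<omega>. a * (f \<omega> - x)) + cov M k (\<lambda>\<omega>. b * (g \<omega> - y)) + cov M k (\<lambda>\<omega>. c * (h \<omega> - z))"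
      using that b by (simp only: cov_add_right bdd_rv_add)
    also have "\<dots> = a * cov M k f + b * cov M k g + c * cov M k h"
      using that f g h by (simp add: cov_scale_right bdd_rv_diff cov_diff_const_right)
    finally show ?thesis .
  qed
  have "cov M ?T ?T = a * cov M ?T f + b * cov M ?T g + c * cov M ?T h" by (rule right[OF T])
  also have "\<dots> = a * (a * cov M f f + b * cov M f g + c * cov M f h) + b * (a * cov M g f + b * cov M g g + c * cov M g h)
      + c * (a * cov M h f + b * cov M h g + c * cov M h h)"
    using right[OF f] right[OF g] right[OF h] by (simp only: cov_commute[of M ?T])
  also have "\<dots> = a\<^sup>2 * cov M f f + b\<^sup>2 * cov M g g + c\<^sup>2 * cov M h h
      + 2 * a * b * cov M f g + 2 * a * c * cov M f h + 2 * b * c * cov M g h"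
    by (simp add: cov_commute[of M g f] cov_commute[of M h f] cov_commute[of M h g] power2_eq_square algebra_simps)
  finally show ?thesis .
qed

context blocked_threshold
begin

text \<open>
  The share of block \<open>i\<close> in the linear combination: a sliding window belongs to the block in which it
  starts. The weight \<open>1/r\<close> puts the \<open>r\<close> sliding windows of a block on the scale of the one disjoint window.
\<close>
definition U :: "real \<Rightarrow> real \<Rightarrow> real \<Rightarrow> nat \<Rightarrow> 'a \<Rightarrow> real" where
  "U A B C i \<omega> = A * (J (i * r) \<omega> - Q r) + B / real r * (\<Sum>h<r. J (i * r + h) \<omega> - Q r)
     + C * (N (i * r) (i * r + r) \<omega> - real r * p)"

lemma U_bdd: "bdd_rv M (U A B C i)"
  unfolding U_def[abs_def] by (intro bdd_rv_add bdd_rv_scale bdd_rv_diff bdd_rv_sum Z_bdd N_bdd bdd_rv_const)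

lemma sum_U:
  "(\<Sum>i<K. U A B C i \<omega>) = A * (TI \<omega> - real K * Q r) + B / real r * (TS \<omega> - real (K * r) * Q r) + C * (TN \<omega> - real (K * r) * p)"
proof -
  have 1: "(\<Sum>i<K. J (i * r) \<omega> - Q r) = TI \<omega> - real K * Q r" by (simp add: TI_def sum_subtractf)
  have "(\<Sum>i<K. \<Sum>h<r. J (i * r + h) \<omega> - Q r) = (\<Sum>a<K * r. J a \<omega> - Q r)"
  proof (induction K)
    case (Suc K)
    have "(\<Sum>a<Suc K * r. J a \<omega> - Q r) = (\<Sum>a<K * r + r. J a \<omega> - Q r)" by (simp add: add.commute)
    also have "\<dots> = (\<Sum>a<K * r. J a \<omega> - Q r) + (\<Sum>h<r. J (K * r + h) \<omega> - Q r)"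
    proof -
      have "{..<K * r + r} = {..<K * r} \<union> {K * r..<K * r + r}" "{..<K * r} \<inter> {K * r..<K * r + r} = {}" by auto
      moreover have "(\<Sum>a\<in>{K * r..<K * r + r}. J a \<omega> - Q r) = (\<Sum>h<r. J (K * r + h) \<omega> - Q r)"
        by (rule sum.reindex_bij_witness[where i="\<lambda>h. K * r + h" and j="\<lambda>a. a - K * r"]) auto
      ultimately show ?thesis by (simp only: sum.union_disjoint finite_lessThan finite_atLeastLessThan)
    qed
    finally show ?case using Suc.IH by (simp only: sum.lessThan_Suc)
  qed simp
  also have "\<dots> = TS \<omega> - real (K * r) * Q r" by (simp add: TS_def sum_subtractf)
  finally have 2: "(\<Sum>i<K. \<Sum>h<r. J (i * r + h) \<omega> - Q r) = TS \<omega> - real (K * r) * Q r" .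
  have "(\<Sum>i<K. N (i * r) (i * r + r) \<omega>) = TN \<omega>"
    using N_sum_blocks[of 0 K r \<omega>] by (simp add: TN_def add.commute)
  then have 3: "(\<Sum>i<K. N (i * r) (i * r + r) \<omega> - real r * p) = TN \<omega> - real (K * r) * p"
    by (simp add: sum_subtractf)
  show ?thesis unfolding U_def sum.distrib sum_distrib_left[symmetric] 1 2 3 ..
qed

lemma var_sum_U:
  "cov M (\<lambda>\<omega>. \<Sum>i<K. U A B C i \<omega>) (\<lambda>\<omega>. \<Sum>i<K. U A B C i \<omega>)
    = A\<^sup>2 * cov M TI TI + (B / real r)\<^sup>2 * cov M TS TS + C\<^sup>2 * cov M TN TN
      + 2 * A * (B / real r) * cov M TI TS + 2 * A * C * cov M TI TN + 2 * (B / real r) * C * cov M TS TN"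
  unfolding sum_U by (rule var_lincomb3[OF TI_bdd TS_bdd TN_bdd])

lemma U_mean: "expectation (U A B C i) = 0"
proof -
  have J: "expectation (\<lambda>\<omega>. J a \<omega> - Q r) = 0" for a
    using bdd_rv_integrable[OF Z_bdd[of a "a + r"]] by (simp add: E_Z prob_space)
  have N: "expectation (\<lambda>\<omega>. N (i * r) (i * r + r) \<omega> - real r * p) = 0"
    using bdd_rv_integrable[OF N_bdd[of "i * r" "i * r + r"]] by (simp add: E_N prob_space)
  have iJ: "integrable M (\<lambda>\<omega>. J a \<omega> - Q r)" for a by (intro bdd_rv_integrable bdd_rv_diff Z_bdd bdd_rv_const)
  have iN: "integrable M (\<lambda>\<omega>. N (i * r) (i * r + r) \<omega> - real r * p)" by (intro bdd_rv_integrable bdd_rv_diff N_bdd bdd_rv_const)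
  have iS: "integrable M (\<lambda>\<omega>. \<Sum>h<r. J (i * r + h) \<omega> - Q r)" by (intro Bochner_Integration.integrable_sum iJ)
  have S: "expectation (\<lambda>\<omega>. \<Sum>h<r. J (i * r + h) \<omega> - Q r) = 0"
    using Bochner_Integration.integral_sum[OF iJ, of "\<lambda>h. i * r + h" "{..<r}"] by (simp only: J sum.neutral_const)
  have "expectation (U A B C i) = expectation (\<lambda>\<omega>. A * (J (i * r) \<omega> - Q r) + B / real r * (\<Sum>h<r. J (i * r + h) \<omega> - Q r))
     + expectation (\<lambda>\<omega>. C * (N (i * r) (i * r + r) \<omega> - real r * p))"
    unfolding U_def[abs_def]
    by (intro Bochner_Integration.integral_add Bochner_Integration.integrable_add integrable_mult_right iJ iN iS)
  also have "expectation (\<lambda>\<omega>. A * (J (i * r) \<omega> - Q r) + B / real r * (\<Sum>h<r. J (i * r + h) \<omega> - Q r))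
    = expectation (\<lambda>\<omega>. A * (J (i * r) \<omega> - Q r)) + expectation (\<lambda>\<omega>. B / real r * (\<Sum>h<r. J (i * r + h) \<omega> - Q r))"
    by (intro Bochner_Integration.integral_add integrable_mult_right iJ iS)
  finally show ?thesis by (simp only: integral_mult_right_zero J N S mult_zero_right add_0)
qed

lemma U_abs_le: "\<bar>U A B C i \<omega>\<bar> \<le> (\<bar>A\<bar> + \<bar>B\<bar> + \<bar>C\<bar> * (real r * p)) + \<bar>C\<bar> * N (i * r) (i * r + r) \<omega>"
proof -
  have J: "\<bar>J a \<omega> - Q r\<bar> \<le> 1" for a using Z_01[of a "a + r" \<omega>] Q_bounds[of r] by (auto simp: abs_le_iff)
  have 1: "\<bar>A * (J (i * r) \<omega> - Q r)\<bar> \<le> \<bar>A\<bar>"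
    using mult_left_mono[OF J abs_ge_zero, of A] by (simp add: abs_mult)
  have "\<bar>\<Sum>h<r. J (i * r + h) \<omega> - Q r\<bar> \<le> (\<Sum>h<r. 1)" by (intro order_trans[OF sum_abs] sum_mono J)
  then have "\<bar>B\<bar> / real r * \<bar>\<Sum>h<r. J (i * r + h) \<omega> - Q r\<bar> \<le> \<bar>B\<bar> / real r * real r" by (intro mult_left_mono) auto
  then have 2: "\<bar>B / real r * (\<Sum>h<r. J (i * r + h) \<omega> - Q r)\<bar> \<le> \<bar>B\<bar>" using r_pos by (simp add: abs_mult)
  have "\<bar>N (i * r) (i * r + r) \<omega> - real r * p\<bar> \<le> N (i * r) (i * r + r) \<omega> + real r * p"
    using N_nonneg[of "i * r" "i * r + r" \<omega>] p_nonneg by (auto simp: abs_le_iff)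
  from mult_left_mono[OF this abs_ge_zero, of C]
  have 3: "\<bar>C * (N (i * r) (i * r + r) \<omega> - real r * p)\<bar> \<le> \<bar>C\<bar> * N (i * r) (i * r + r) \<omega> + \<bar>C\<bar> * (real r * p)"
    by (simp add: abs_mult distrib_left)
  have tri: "\<bar>x + y + z\<bar> \<le> \<bar>x\<bar> + \<bar>y\<bar> + \<bar>z\<bar>" for x y z :: real by simp
  show ?thesis unfolding U_def using order_trans[OF tri add_mono[OF add_mono[OF 1 2] 3]] by simp
qed

lemma U_moment:
  assumes q: "q \<ge> 0" and m: "expectation (\<lambda>\<omega>. N 0 r \<omega> powr q) \<le> m"
  shows "expectation (\<lambda>\<omega>. \<bar>U A B C i \<omega>\<bar> powr q) \<le> 2 powr q * ((\<bar>A\<bar> + \<bar>B\<bar> + \<bar>C\<bar> * (real r * p)) powr q + \<bar>C\<bar> powr q * m)"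
proof -
  let ?a = "\<bar>A\<bar> + \<bar>B\<bar> + \<bar>C\<bar> * (real r * p)"
  let ?N = "N (i * r) (i * r + r)"
  have a: "?a \<ge> 0" using p_nonneg by simp
  have bN: "bdd_rv M (\<lambda>\<omega>. ?N \<omega> powr q)" using bdd_rv_powr[OF N_bdd q] by simp
  have EN: "expectation (\<lambda>\<omega>. ?N \<omega> powr q) \<le> m"
    using stationary_N[of "\<lambda>x. x powr q" "i * r" "i * r + r"] m by simp
  have "expectation (\<lambda>\<omega>. \<bar>U A B C i \<omega>\<bar> powr q) \<le> expectation (\<lambda>\<omega>. 2 powr q * (?a powr q + \<bar>C\<bar> powr q * ?N \<omega> powr q))"
  proof (intro integral_mono bdd_rv_integrable bdd_rv_powr U_bdd q bdd_rv_scale bdd_rv_add bdd_rv_const bN)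
    fix \<omega>
    have "\<bar>U A B C i \<omega>\<bar> powr q \<le> (?a + \<bar>C\<bar> * ?N \<omega>) powr q" using U_abs_le q by (intro powr_mono2) auto
    also have "\<dots> \<le> 2 powr q * (?a powr q + (\<bar>C\<bar> * ?N \<omega>) powr q)" using a q by (intro add_powr_le) auto
    finally show "\<bar>U A B C i \<omega>\<bar> powr q \<le> 2 powr q * (?a powr q + \<bar>C\<bar> powr q * ?N \<omega> powr q)"
      by (simp add: powr_mult)
  qed
  also have "\<dots> = 2 powr q * (?a powr q + \<bar>C\<bar> powr q * expectation (\<lambda>\<omega>. ?N \<omega> powr q))"
    using bdd_rv_integrable[OF bN] by (simp add: prob_space)
  also have "\<dots> \<le> 2 powr q * (?a powr q + \<bar>C\<bar> powr q * m)" using EN by (intro mult_left_mono add_left_mono) auto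
  finally show ?thesis .
qed

text \<open>
  \<open>U i\<close> depends on the indices of the blocks \<open>i\<close> and \<open>i + 1\<close>, whence the \<open>b + 1\<close> in the
  field. When two blocks are left out, the index sets are a full block of length \<open>r \<ge> l\<close> apart.
\<close>
lemma mixing_blocks_U:
  assumes q: "2 < q" "q \<le> 3" and C': "C' \<ge> 0"
    and m: "\<And>i. expectation (\<lambda>\<omega>. \<bar>U A B C i \<omega>\<bar> powr q) \<le> C'"
  shows "mixing_blocks M (U A B C) (\<lambda>a b. TF (a * r + 1) ((b + 1) * r)) K \<rho> q C'"
proof (unfold_locales; (intro U_bdd U_mean m TF_sub)?)
  fix i a b assume ab: "a \<le> i" "i < b" "b \<le> K"
  have 1: "a * r \<le> i * r" using ab by (intro mult_le_mono1)
  have 2: "i * r + r + r \<le> (b + 1) * r" using mult_le_mono1[of "i + 2" "b + 1" r] ab by simp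
  have "J (i * r + h) \<in> borel_measurable (TF (a * r + 1) ((b + 1) * r))" if "h \<le> r" for h
    by (rule Z_meas_TF) (use that 1 2 in linarith)+
  from this[of 0] this have J: "J (i * r) \<in> borel_measurable (TF (a * r + 1) ((b + 1) * r))"
    "\<And>h. h < r \<Longrightarrow> J (i * r + h) \<in> borel_measurable (TF (a * r + 1) ((b + 1) * r))" by auto
  have N: "N (i * r) (i * r + r) \<in> borel_measurable (TF (a * r + 1) ((b + 1) * r))"
    by (rule N_meas_TF) (use 1 2 in linarith)+
  show "U A B C i \<in> borel_measurable (TF (a * r + 1) ((b + 1) * r))"
    unfolding U_def[abs_def]
    by (intro borel_measurable_add borel_measurable_times borel_measurable_const borel_measurable_diff borel_measurable_sum J N) auto
next
  fix a b c d f g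
  assume idx: "a < b" "b + 2 \<le> c" "c < d" "d \<le> K"
    and f: "f \<in> borel_measurable (TF (a * r + 1) ((b + 1) * r))" and g: "g \<in> borel_measurable (TF (c * r + 1) ((d + 1) * r))"
    and bd: "bdd_rv M f" "bdd_rv M g"
  have 1: "(b + 1) * r + r \<le> c * r" using mult_le_mono1[of "b + 2" c r] idx by simp
  have "(c + 1) * r \<le> (d + 1) * r" using idx by (intro mult_le_mono1) simp
  have "(d + 1) * r \<le> (K + 1) * r" using idx by (intro mult_le_mono1) simp
  then have 3: "(d + 1) * r \<le> n" using Kr by (rule le_trans)
  with \<open>(c + 1) * r \<le> (d + 1) * r\<close> have "(c + 1) * r \<le> n" by (rule le_trans)
  then have 2: "c * r + r \<le> n" by simp
  show "\<bar>cov M f g\<bar> \<le> \<rho> * (sd M f * sd M g)"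
    by (rule mixing[OF f g _ _ _ _ _ bd]) (use 1 2 3 l_le_r r_pos in auto)
qed (use K_pos rho_nonneg q C' in auto)

end

locale exceedance_moments = exceedance_clusters M X u r l s \<theta> \<tau> \<pi>
  for M :: "'a measure" and X u r l s \<theta> \<tau> \<pi> +
  fixes p0 Cm :: real
  assumes p0: "p0 > 1"
    and moment: "\<forall>\<^sub>F n in sequentially. (\<integral>\<omega>. real (exceedances X (r n) (u n) \<omega>) powr (2 * p0) \<partial>M) \<le> Cm"
begin

abbreviation "TI n \<equiv> blocked_threshold.TI X (u n) (r n) (K n)"
abbreviation "TS n \<equiv> blocked_threshold.TS X (u n) (r n) (K n)"
abbreviation "TN n \<equiv> blocked_threshold.TN X (u n) (r n) (K n)"

lemma moment_le:
  assumes "0 \<le> q" "q \<le> 2 * p0"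
  shows "\<forall>\<^sub>F n in sequentially. expectation (\<lambda>\<omega>. stationary_threshold.N X (u n) 0 (r n) \<omega> powr q) \<le> 1 + Cm"
  using moment ev1
proof eventually_elim
  case (elim n)
  interpret st: stationary_threshold M X "u n" n "l n" by (rule st) fact
  have b: "bdd_rv M (\<lambda>\<omega>. st.N 0 (r n) \<omega> powr a)" if "0 \<le> a" for a
    using bdd_rv_powr[OF st.N_bdd that] by simp
  have "expectation (\<lambda>\<omega>. st.N 0 (r n) \<omega> powr q) \<le> expectation (\<lambda>\<omega>. 1 + st.N 0 (r n) \<omega> powr (2 * p0))"
    using assms p0 by (intro integral_mono bdd_rv_integrable bdd_rv_add bdd_rv_const b powr_le_1_plus_powr) auto
  also have "\<dots> = 1 + expectation (\<lambda>\<omega>. st.N 0 (r n) \<omega> powr (2 * p0))"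
    using bdd_rv_integrable[OF b[of "2 * p0"]] p0 by (simp add: prob_space)
  also have "\<dots> \<le> 1 + Cm" using elim by (simp add: exceedances_eq)
  finally show ?case .
qed

lemma S2r_le: "\<forall>\<^sub>F n in sequentially. S2n n (r n) \<le> 1 + Cm"
proof -
  have "\<forall>\<^sub>F n in sequentially. expectation (\<lambda>\<omega>. stationary_threshold.N X (u n) 0 (r n) \<omega> powr 2) \<le> 1 + Cm"
    using p0 by (intro moment_le) auto
  with ev1 show ?thesis
  proof eventually_elim
    case (elim n)
    interpret st: stationary_threshold M X "u n" n "l n" by (rule st) fact
    have "st.N 0 (r n) \<omega> powr 2 = (st.N 0 (r n) \<omega>)\<^sup>2" for \<omega>
      using st.N_nonneg[of 0 "r n" \<omega>] by (cases "st.N 0 (r n) \<omega> = 0") (auto simp: powr_numeral)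
    then show ?case using elim by (simp add: st.S2_def)
  qed
qed

text \<open>
  The moment assumption bounds the second moment of a whole block of length \<open>r\<close>.
\<close>
lemma errN_lim: "(\<lambda>n. blocked_threshold.errN M X (u n) n (l n) (r n) (K n)) \<longlonglongrightarrow> 0"
proof (rule Lim_null_comparison)
  let ?b = "\<lambda>n. 2 * (real (l n) / real (r n)) * (real (r n) * pn n) + 2 * (real (K n) * rho n) * sqrt (1 + Cm)"
  show "\<forall>\<^sub>F n in sequentially. norm (blocked_threshold.errN M X (u n) n (l n) (r n) (K n)) \<le> ?b n"
    using blocked S2r_le ev1
  proof eventually_elim
    case (elim n)
    interpret bt: blocked_threshold M X "u n" n "l n" "r n" "K n" by (rule elim)
    have r0: "real (r n) \<noteq> 0" using pos elim by simp
    have "norm bt.errN = 2 * real (l n) * pn n + 2 * (real (K n) * rho n) * sqrt (S2n n (r n))"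
      using bt.errN_nonneg elim by (simp add: bt.errN_def p_eq' rho_eq)
    also have "\<dots> \<le> 2 * real (l n) * pn n + 2 * (real (K n) * rho n) * sqrt (1 + Cm)"
      using elim rho_nonneg by (intro add_left_mono mult_left_mono real_sqrt_le_mono) auto
    also have "\<dots> = ?b n" using r0 by simp
    finally show ?case .
  qed
  have "?b \<longlonglongrightarrow> 2 * 0 * \<tau> + 2 * 0 * sqrt (1 + Cm)" by (intro tendsto_intros lr tail_lim K_rho)
  then show "?b \<longlonglongrightarrow> 0" by simp
qed

lemma inv_K: "(\<lambda>n. c / real (K n)) \<longlonglongrightarrow> 0"
  by (rule real_tendsto_divide_at_top[OF tendsto_const K_at_top])

lemma normalized_tendsto_from_bound:
  assumes "\<forall>\<^sub>F n in sequentially. \<bar>f n - d n * x n\<bar> \<le> e n" "\<forall>\<^sub>F n in sequentially. d n > (0::real)"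
    and "x \<longlonglongrightarrow> y" "(\<lambda>n. e n / d n) \<longlonglongrightarrow> 0"
  shows "(\<lambda>n. f n / d n) \<longlonglongrightarrow> y"
proof -
  have "(\<lambda>n. f n / d n - x n) \<longlonglongrightarrow> 0"
  proof (rule Lim_null_comparison[OF _ assms(4)])
    show "\<forall>\<^sub>F n in sequentially. norm (f n / d n - x n) \<le> e n / d n"
      using assms(1,2)
    proof eventually_elim
      case (elim n)
      have "f n / d n - x n = (f n - d n * x n) / d n" using elim by (simp add: diff_divide_distrib)
      then show ?case using elim by (simp add: divide_right_mono)
    qed
  qed
  from tendsto_add[OF this assms(3)] show ?thesis by simp
qed

lemma ev_K_pos: "\<forall>\<^sub>F n in sequentially. real (K n) > 0"
  using ev_K by eventually_elim simp

lemma ev_Kr_pos: "\<forall>\<^sub>F n in sequentially. real (K n) * real (r n) > 0"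
  using ev_K ev1 by eventually_elim (use pos in simp)

lemma var_TI_lim: "(\<lambda>n. cov M (TI n) (TI n) / real (K n)) \<longlonglongrightarrow> F - F\<^sup>2"
proof (rule normalized_tendsto_from_bound[OF _ ev_K_pos c_0_lim])
  show "\<forall>\<^sub>F n in sequentially. \<bar>cov M (TI n) (TI n) - real (K n) * cn n 0\<bar> \<le> real (K n) * (2 * \<bar>cn n (r n)\<bar> + real (K n) * rho n)"
    using blocked ev1
  proof eventually_elim
    case (elim n)
    interpret bt: blocked_threshold M X "u n" n "l n" "r n" "K n" by (rule elim)
    show ?case using bt.var_TI elim by (simp add: rho_eq power2_eq_square algebra_simps)
  qed
  have "(\<lambda>n. 2 * \<bar>cn n (r n)\<bar> + real (K n) * rho n) \<longlonglongrightarrow> 2 * \<bar>0\<bar> + 0" by (intro tendsto_intros c_r_lim K_rho)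
  moreover have "\<forall>\<^sub>F n in sequentially. 2 * \<bar>cn n (r n)\<bar> + real (K n) * rho n = real (K n) * (2 * \<bar>cn n (r n)\<bar> + real (K n) * rho n) / real (K n)"
    using ev_K_pos by eventually_elim simp
  ultimately show "(\<lambda>n. real (K n) * (2 * \<bar>cn n (r n)\<bar> + real (K n) * rho n) / real (K n)) \<longlonglongrightarrow> 0" by (rule tendsto_eventually_eqI) simp
qed

abbreviation "kp n \<equiv> stationary_threshold.\<kappa> M X (u n) (r n) / real (r n)"

lemma cov_TI_TS_lim: "(\<lambda>n. cov M (TI n) (TS n) / (real (K n) * real (r n))) \<longlonglongrightarrow> 2 * g"
proof (rule normalized_tendsto_from_bound[OF _ ev_Kr_pos kappa_lim])
  let ?e = "\<lambda>n. real (K n) * (2 * real (l n) + real (K n * r n) * rho n) + 5 * real (r n)"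
  show "\<forall>\<^sub>F n in sequentially. \<bar>cov M (TI n) (TS n) - real (K n) * real (r n) * kp n\<bar> \<le> ?e n"
    using blocked ev1
  proof eventually_elim
    case (elim n)
    interpret bt: blocked_threshold M X "u n" n "l n" "r n" "K n" by (rule elim)
    have "real (r n) \<noteq> 0" using pos elim by simp
    then show ?case using bt.cov_TI_TS elim by (simp add: rho_eq)
  qed
  have "(\<lambda>n. 2 * (real (l n) / real (r n)) + real (K n) * rho n + 5 / real (K n)) \<longlonglongrightarrow> 2 * 0 + 0 + 0"
    by (intro tendsto_add tendsto_mult tendsto_const lr K_rho inv_K)
  moreover have "\<forall>\<^sub>F n in sequentially. 2 * (real (l n) / real (r n)) + real (K n) * rho n + 5 / real (K n) = ?e n / (real (K n) * real (r n))"
    using ev_Kr_pos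
  proof eventually_elim
    case (elim n)
    then have "real (r n) \<noteq> 0" "real (K n) \<noteq> 0" by (auto simp: zero_less_mult_iff)
    then show ?case by (simp add: field_simps power2_eq_square)
  qed
  ultimately show "(\<lambda>n. ?e n / (real (K n) * real (r n))) \<longlonglongrightarrow> 0" by (rule tendsto_eventually_eqI) simp
qed

lemma var_TS_lim: "(\<lambda>n. cov M (TS n) (TS n) / (real (K n) * (real (r n))\<^sup>2)) \<longlonglongrightarrow> 2 * g"
proof (rule normalized_tendsto_from_bound[OF _ _ kappa_lim])
  let ?e = "\<lambda>n. real (K n * r n) * (2 * real (l n) + real (K n * r n) * rho n) + 10 * (real (r n))\<^sup>2"
  show "\<forall>\<^sub>F n in sequentially. \<bar>cov M (TS n) (TS n) - real (K n) * (real (r n))\<^sup>2 * kp n\<bar> \<le> ?e n"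
    using blocked ev1
  proof eventually_elim
    case (elim n)
    interpret bt: blocked_threshold M X "u n" n "l n" "r n" "K n" by (rule elim)
    have "real (r n) \<noteq> 0" using pos elim by simp
    then show ?case using bt.var_TS elim by (simp add: rho_eq power2_eq_square)
  qed
  show "\<forall>\<^sub>F n in sequentially. real (K n) * (real (r n))\<^sup>2 > 0" using ev_Kr_pos by eventually_elim (auto simp: zero_less_mult_iff)
  have "(\<lambda>n. 2 * (real (l n) / real (r n)) + real (K n) * rho n + 10 / real (K n)) \<longlonglongrightarrow> 2 * 0 + 0 + 0"
    by (intro tendsto_add tendsto_mult tendsto_const lr K_rho inv_K)
  moreover have "\<forall>\<^sub>F n in sequentially. 2 * (real (l n) / real (r n)) + real (K n) * rho n + 10 / real (K n) = ?e n / (real (K n) * (real (r n))\<^sup>2)"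
    using ev_Kr_pos
  proof eventually_elim
    case (elim n)
    then have "real (r n) \<noteq> 0" "real (K n) \<noteq> 0" by (auto simp: zero_less_mult_iff)
    then show ?case by (simp add: field_simps power2_eq_square)
  qed
  ultimately show "(\<lambda>n. ?e n / (real (K n) * (real (r n))\<^sup>2)) \<longlonglongrightarrow> 0" by (rule tendsto_eventually_eqI) simp
qed

lemma QN_lim: "(\<lambda>n. - (Qn n (r n) * (real (r n) * pn n))) \<longlonglongrightarrow> - (F * \<tau>)"
  by (intro tendsto_minus tendsto_mult Qr_lim tail_lim)

lemma cov_TI_TN_lim: "(\<lambda>n. cov M (TI n) (TN n) / real (K n)) \<longlonglongrightarrow> - (F * \<tau>)"
proof (rule normalized_tendsto_from_bound[OF _ ev_K_pos QN_lim])
  let ?e = "\<lambda>n. real (K n) * blocked_threshold.errN M X (u n) n (l n) (r n) (K n)"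
  show "\<forall>\<^sub>F n in sequentially. \<bar>cov M (TI n) (TN n) - real (K n) * - (Qn n (r n) * (real (r n) * pn n))\<bar> \<le> ?e n"
    using blocked ev1
  proof eventually_elim
    case (elim n)
    interpret bt: blocked_threshold M X "u n" n "l n" "r n" "K n" by (rule elim)
    show ?case using bt.cov_TI_TN elim by (simp add: p_eq')
  qed
  have "\<forall>\<^sub>F n in sequentially. blocked_threshold.errN M X (u n) n (l n) (r n) (K n) = ?e n / real (K n)"
    using ev_K_pos by eventually_elim simp
  from tendsto_eventually_eqI[OF errN_lim this refl] show "(\<lambda>n. ?e n / real (K n)) \<longlonglongrightarrow> 0" .
qed

lemma cov_TS_TN_lim: "(\<lambda>n. cov M (TS n) (TN n) / (real (K n) * real (r n))) \<longlonglongrightarrow> - (F * \<tau>)"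
proof (rule normalized_tendsto_from_bound[OF _ ev_Kr_pos QN_lim])
  let ?err = "\<lambda>n. blocked_threshold.errN M X (u n) n (l n) (r n) (K n)"
  let ?e = "\<lambda>n. real (K n * r n) * ?err n + real (r n) * (real (r n) * pn n)"
  show "\<forall>\<^sub>F n in sequentially. \<bar>cov M (TS n) (TN n) - real (K n) * real (r n) * - (Qn n (r n) * (real (r n) * pn n))\<bar> \<le> ?e n"
    using blocked ev1
  proof eventually_elim
    case (elim n)
    interpret bt: blocked_threshold M X "u n" n "l n" "r n" "K n" by (rule elim)
    show ?case using bt.cov_TS_TN elim by (simp add: p_eq')
  qed
  have "(\<lambda>n. ?err n + (real (r n) * pn n) * (1 / real (K n))) \<longlonglongrightarrow> 0 + \<tau> * 0"
    by (intro tendsto_add tendsto_mult errN_lim tail_lim inv_K)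
  moreover have "\<forall>\<^sub>F n in sequentially. ?err n + (real (r n) * pn n) * (1 / real (K n)) = ?e n / (real (K n) * real (r n))"
    using ev_Kr_pos by eventually_elim (auto simp: add_divide_distrib)
  ultimately show "(\<lambda>n. ?e n / (real (K n) * real (r n))) \<longlonglongrightarrow> 0" by (rule tendsto_eventually_eqI) simp
qed

text \<open>
  The limiting variance per block; the coefficients \<open>A\<close>, \<open>B\<close>, \<open>C\<close> belong to the disjoint windows, the sliding
  windows and the counts.
\<close>
definition \<sigma>2 :: "real \<Rightarrow> real \<Rightarrow> real \<Rightarrow> real" where
  "\<sigma>2 A B C = A\<^sup>2 * (F - F\<^sup>2) + B\<^sup>2 * (2 * g) + C\<^sup>2 * (\<alpha> * m2) + 2 * A * B * (2 * g) + 2 * A * C * (- (F * \<tau>)) + 2 * B * C * (- (F * \<tau>))"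

abbreviation "Ub n \<equiv> blocked_threshold.U M X (u n) (r n)"

lemma var_lim: "(\<lambda>n. cov M (\<lambda>\<omega>. \<Sum>i<K n. Ub n A B C i \<omega>) (\<lambda>\<omega>. \<Sum>i<K n. Ub n A B C i \<omega>) / real (K n)) \<longlonglongrightarrow> \<sigma>2 A B C"
proof -
  have "(\<lambda>n. A\<^sup>2 * (cov M (TI n) (TI n) / real (K n)) + B\<^sup>2 * (cov M (TS n) (TS n) / (real (K n) * (real (r n))\<^sup>2)) + C\<^sup>2 * (cov M (TN n) (TN n) / real (K n))
      + 2 * A * B * (cov M (TI n) (TS n) / (real (K n) * real (r n))) + 2 * A * C * (cov M (TI n) (TN n) / real (K n))
      + 2 * B * C * (cov M (TS n) (TN n) / (real (K n) * real (r n)))) \<longlonglongrightarrow> \<sigma>2 A B C"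
    unfolding \<sigma>2_def
    by (intro tendsto_add tendsto_mult_left var_TI_lim var_TS_lim var_TN_lim cov_TI_TS_lim cov_TI_TN_lim cov_TS_TN_lim)
  then show ?thesis
  proof (rule tendsto_eventually_eqI)
    show "\<forall>\<^sub>F n in sequentially. A\<^sup>2 * (cov M (TI n) (TI n) / real (K n)) + B\<^sup>2 * (cov M (TS n) (TS n) / (real (K n) * (real (r n))\<^sup>2)) + C\<^sup>2 * (cov M (TN n) (TN n) / real (K n))
      + 2 * A * B * (cov M (TI n) (TS n) / (real (K n) * real (r n))) + 2 * A * C * (cov M (TI n) (TN n) / real (K n))
      + 2 * B * C * (cov M (TS n) (TN n) / (real (K n) * real (r n))) =
      cov M (\<lambda>\<omega>. \<Sum>i<K n. Ub n A B C i \<omega>) (\<lambda>\<omega>. \<Sum>i<K n. Ub n A B C i \<omega>) / real (K n)"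
      using blocked
    proof eventually_elim
      case (elim n)
      interpret bt: blocked_threshold M X "u n" n "l n" "r n" "K n" by (rule elim)
      show ?case unfolding bt.var_sum_U by (simp add: add_divide_distrib power_divide mult.commute mult.left_commute)
    qed
  qed simp
qed

theorem block_clt:
  "(\<lambda>n. \<integral>\<omega>. iexp (1 / sqrt (K n) * (\<Sum>i<K n. Ub n A B C i \<omega>)) \<partial>M) \<longlonglongrightarrow> exp (- \<sigma>2 A B C / 2)"
proof -
  (* An order between 2 and 3, as the expansion of the characteristic functions requires. *)
  define q where "q = min 3 (2 * p0)"
  have q: "2 < q" "q \<le> 3" "q \<le> 2 * p0" using p0 by (auto simp: q_def)
  define C' where "C' = 2 powr q * ((\<bar>A\<bar> + \<bar>B\<bar> + \<bar>C\<bar> * (\<tau> + 1)) powr q + \<bar>C\<bar> powr q * \<bar>1 + Cm\<bar>)"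
  have mom: "\<forall>\<^sub>F n in sequentially. expectation (\<lambda>\<omega>. stationary_threshold.N X (u n) 0 (r n) \<omega> powr q) \<le> 1 + Cm"
    using q by (intro moment_le) auto
  have "\<forall>\<^sub>F n in sequentially. mixing_blocks M (Ub n A B C)
     (\<lambda>a b. threshold_field M X (u n) (a * r n + 1) ((b + 1) * r n)) (K n) (rho n) q C'"
    using blocked ev1 mom order_tendstoD(2)[OF tail_lim less_add_one[of \<tau>]]
  proof eventually_elim
    case (elim n)
    interpret bt: blocked_threshold M X "u n" n "l n" "r n" "K n" by (rule elim)
    have "expectation (\<lambda>\<omega>. bt.N 0 (r n) \<omega> powr q) \<le> \<bar>1 + Cm\<bar>" using elim q by simp
    then have m: "expectation (\<lambda>\<omega>. \<bar>bt.U A B C i \<omega>\<bar> powr q) \<le> 2 powr q * ((\<bar>A\<bar> + \<bar>B\<bar> + \<bar>C\<bar> * (real (r n) * bt.p)) powr q + \<bar>C\<bar> powr q * \<bar>1 + Cm\<bar>)" for i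
      using q by (intro bt.U_moment) auto
    have le: "2 powr q * ((\<bar>A\<bar> + \<bar>B\<bar> + \<bar>C\<bar> * (real (r n) * bt.p)) powr q + \<bar>C\<bar> powr q * \<bar>1 + Cm\<bar>) \<le> C'"
      unfolding C'_def using elim q bt.p_nonneg
      by (intro mult_left_mono add_right_mono powr_mono2 add_left_mono) (auto simp: p_eq')
    then have "mixing_blocks M (bt.U A B C) (\<lambda>a b. bt.TF (a * r n + 1) ((b + 1) * r n)) (K n) bt.\<rho> q C'"
      using q order_trans[OF m le] by (intro bt.mixing_blocks_U) (auto simp: C'_def)
    then show ?case using elim by (simp add: rho_eq)
  qed
  from mixing_blocks_clt[OF this K_at_top_nat K_rho var_lim] show ?thesis .
qed

end

section \<open>Stochastic boundedness and the delta method\<close>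

context prob_space
begin

definition tight_seq :: "(nat \<Rightarrow> 'a \<Rightarrow> real) \<Rightarrow> bool" where
  "tight_seq D \<longleftrightarrow> (\<forall>\<epsilon>>0. \<exists>L. \<forall>\<^sub>F n in sequentially. prob {\<omega> \<in> space M. \<bar>D n \<omega>\<bar> > L} < \<epsilon>)"

definition null_seq :: "(nat \<Rightarrow> 'a \<Rightarrow> real) \<Rightarrow> bool" where
  "null_seq R \<longleftrightarrow> (\<forall>\<epsilon>>0. (\<lambda>n. prob {\<omega> \<in> space M. \<bar>R n \<omega>\<bar> > \<epsilon>}) \<longlonglongrightarrow> 0)"

lemma null_seqD: "null_seq R \<Longrightarrow> \<epsilon> > 0 \<Longrightarrow> (\<lambda>n. prob {\<omega> \<in> space M. \<bar>R n \<omega>\<bar> > \<epsilon>}) \<longlonglongrightarrow> 0"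
  by (simp add: null_seq_def)

lemma null_seqD_less:
  "null_seq R \<Longrightarrow> \<epsilon> > 0 \<Longrightarrow> \<gamma> > 0 \<Longrightarrow> \<forall>\<^sub>F n in sequentially. prob {\<omega> \<in> space M. \<bar>R n \<omega>\<bar> > \<epsilon>} < \<gamma>"
  by (rule order_tendstoD(2)[OF null_seqD])

lemma prob_abs_sum_le:
  fixes f g :: "'a \<Rightarrow> real"
  assumes [measurable]: "f \<in> borel_measurable M" "g \<in> borel_measurable M"
  shows "prob {\<omega> \<in> space M. \<bar>f \<omega> + g \<omega>\<bar> > a + b} \<le> prob {\<omega> \<in> space M. \<bar>f \<omega>\<bar> > a} + prob {\<omega> \<in> space M. \<bar>g \<omega>\<bar> > b}"
proof -
  have "prob {\<omega> \<in> space M. \<bar>f \<omega> + g \<omega>\<bar> > a + b} \<le> prob ({\<omega> \<in> space M. \<bar>f \<omega>\<bar> > a} \<union> {\<omega> \<in> space M. \<bar>g \<omega>\<bar> > b})"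
  proof (intro finite_measure_mono)
    show "{\<omega> \<in> space M. \<bar>f \<omega> + g \<omega>\<bar> > a + b} \<subseteq> {\<omega> \<in> space M. \<bar>f \<omega>\<bar> > a} \<union> {\<omega> \<in> space M. \<bar>g \<omega>\<bar> > b}"
    proof
      fix \<omega> assume \<omega>: "\<omega> \<in> {\<omega> \<in> space M. \<bar>f \<omega> + g \<omega>\<bar> > a + b}"
      then have "\<bar>f \<omega> + g \<omega>\<bar> > a + b" by simp
      then have "\<bar>f \<omega>\<bar> > a \<or> \<bar>g \<omega>\<bar> > b" using abs_triangle_ineq[of "f \<omega>" "g \<omega>"] by linarith
      then show "\<omega> \<in> {\<omega> \<in> space M. \<bar>f \<omega>\<bar> > a} \<union> {\<omega> \<in> space M. \<bar>g \<omega>\<bar> > b}" using \<omega> by auto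
    qed
  qed measurable
  also have "\<dots> \<le> prob {\<omega> \<in> space M. \<bar>f \<omega>\<bar> > a} + prob {\<omega> \<in> space M. \<bar>g \<omega>\<bar> > b}"
    by (rule measure_Un_le) measurable
  finally show ?thesis .
qed

lemma null_seq_add:
  assumes m: "\<forall>\<^sub>F n in sequentially. R n \<in> borel_measurable M" "\<forall>\<^sub>F n in sequentially. S n \<in> borel_measurable M"
    and "null_seq R" "null_seq S"
  shows "null_seq (\<lambda>n \<omega>. R n \<omega> + S n \<omega>)"
  unfolding null_seq_def
proof (intro allI impI)
  fix \<epsilon> :: real assume "\<epsilon> > 0"
  then have lim: "(\<lambda>n. prob {\<omega> \<in> space M. \<bar>R n \<omega>\<bar> > \<epsilon> / 2} + prob {\<omega> \<in> space M. \<bar>S n \<omega>\<bar> > \<epsilon> / 2}) \<longlonglongrightarrow> 0 + 0"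
    by (intro tendsto_add null_seqD assms(3,4)) auto
  have le: "\<forall>\<^sub>F n in sequentially. prob {\<omega> \<in> space M. \<bar>R n \<omega> + S n \<omega>\<bar> > \<epsilon>} \<le> prob {\<omega> \<in> space M. \<bar>R n \<omega>\<bar> > \<epsilon> / 2} + prob {\<omega> \<in> space M. \<bar>S n \<omega>\<bar> > \<epsilon> / 2}"
    using m
  proof eventually_elim
    case (elim n)
    show ?case using prob_abs_sum_le[OF elim, where a="\<epsilon> / 2" and b="\<epsilon> / 2"] by (simp only: field_sum_of_halves)
  qed
  show "(\<lambda>n. prob {\<omega> \<in> space M. \<bar>R n \<omega> + S n \<omega>\<bar> > \<epsilon>}) \<longlonglongrightarrow> 0"
    by (rule tendsto_sandwich[OF _ le tendsto_const lim[unfolded add_0_left]]) simp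
qed

lemma null_seq_cong:
  assumes "null_seq R" "\<forall>\<^sub>F n in sequentially. \<forall>\<omega>\<in>space M. R n \<omega> = S n \<omega>"
  shows "null_seq S"
  unfolding null_seq_def
proof (intro allI impI)
  fix \<epsilon> :: real assume "\<epsilon> > 0"
  have "\<forall>\<^sub>F n in sequentially. prob {\<omega> \<in> space M. \<bar>R n \<omega>\<bar> > \<epsilon>} = prob {\<omega> \<in> space M. \<bar>S n \<omega>\<bar> > \<epsilon>}"
    using assms(2)
  proof eventually_elim
    case (elim n)
    then have "{\<omega> \<in> space M. \<bar>R n \<omega>\<bar> > \<epsilon>} = {\<omega> \<in> space M. \<bar>S n \<omega>\<bar> > \<epsilon>}" by auto
    then show ?case by simp
  qed
  from tendsto_eventually_eqI[OF null_seqD[OF assms(1) \<open>\<epsilon> > 0\<close>] this refl]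
  show "(\<lambda>n. prob {\<omega> \<in> space M. \<bar>S n \<omega>\<bar> > \<epsilon>}) \<longlonglongrightarrow> 0" .
qed

lemma null_seq_scale:
  assumes "null_seq R" shows "null_seq (\<lambda>n \<omega>. c * R n \<omega>)"
  unfolding null_seq_def
proof (intro allI impI)
  fix \<epsilon> :: real assume e: "\<epsilon> > 0"
  show "(\<lambda>n. prob {\<omega> \<in> space M. \<bar>c * R n \<omega>\<bar> > \<epsilon>}) \<longlonglongrightarrow> 0"
  proof (cases "c = 0")
    case False
    have "\<bar>c * x\<bar> > \<epsilon> \<longleftrightarrow> \<bar>x\<bar> > \<epsilon> / \<bar>c\<bar>" for x
      using False by (simp add: abs_mult pos_divide_less_eq mult.commute)
    then show ?thesis using assms e False by (simp add: null_seq_def)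
  qed (use e in simp)
qed

lemma null_seq_const: "c \<longlonglongrightarrow> 0 \<Longrightarrow> null_seq (\<lambda>n \<omega>. c n)"
  unfolding null_seq_def
proof (intro allI impI)
  fix \<epsilon> :: real assume "c \<longlonglongrightarrow> 0" "\<epsilon> > 0"
  then have "\<forall>\<^sub>F n in sequentially. \<bar>c n\<bar> < \<epsilon>" using order_tendstoD(2)[OF tendsto_rabs_zero] by blast
  then have "\<forall>\<^sub>F n in sequentially. 0 = prob {\<omega> \<in> space M. \<bar>c n\<bar> > \<epsilon>}" by eventually_elim simp
  from tendsto_eventually_eqI[OF tendsto_const this refl] show "(\<lambda>n. prob {\<omega> \<in> space M. \<bar>c n\<bar> > \<epsilon>}) \<longlonglongrightarrow> 0" .
qed

lemma tight_seqD_null: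
  assumes m: "\<forall>\<^sub>F n in sequentially. D n \<in> borel_measurable M" "\<forall>\<^sub>F n in sequentially. R n \<in> borel_measurable M"
    and "tight_seq D" "null_seq R"
  shows "tight_seq (\<lambda>n \<omega>. D n \<omega> + R n \<omega>)"
  unfolding tight_seq_def
proof (intro allI impI)
  fix \<epsilon> :: real assume e: "\<epsilon> > 0"
  then obtain L where L: "\<forall>\<^sub>F n in sequentially. prob {\<omega> \<in> space M. \<bar>D n \<omega>\<bar> > L} < \<epsilon> / 2"
    using assms(3) unfolding tight_seq_def by (meson half_gt_zero)
  have "\<forall>\<^sub>F n in sequentially. prob {\<omega> \<in> space M. \<bar>R n \<omega>\<bar> > 1} < \<epsilon> / 2"
    using e by (intro null_seqD_less[OF assms(4)]) auto
  with L m have "\<forall>\<^sub>F n in sequentially. prob {\<omega> \<in> space M. \<bar>D n \<omega> + R n \<omega>\<bar> > L + 1} < \<epsilon>"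
  proof eventually_elim
    case (elim n) then show ?case using prob_abs_sum_le[of "D n" "R n" L 1] by linarith
  qed
  then show "\<exists>L. \<forall>\<^sub>F n in sequentially. prob {\<omega> \<in> space M. \<bar>D n \<omega> + R n \<omega>\<bar> > L} < \<epsilon>" by blast
qed

lemma Markov_abs:
  assumes "bdd_rv M f" "a > 0"
  shows "prob {\<omega> \<in> space M. \<bar>f \<omega>\<bar> > a} \<le> expectation (\<lambda>\<omega>. \<bar>f \<omega>\<bar>) / a"
proof -
  have [measurable]: "f \<in> borel_measurable M" using assms bdd_rv_measurable by blast
  have "prob {\<omega> \<in> space M. \<bar>f \<omega>\<bar> > a} \<le> prob {\<omega> \<in> space M. a \<le> \<bar>f \<omega>\<bar>}"
    by (intro finite_measure_mono) auto
  also have "\<dots> \<le> expectation (\<lambda>\<omega>. \<bar>f \<omega>\<bar>) / a"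
    by (rule integral_Markov_inequality_measure[where A="{}"]) (use assms in auto)
  finally show ?thesis .
qed

lemma tight_seq_L1:
  assumes "\<forall>\<^sub>F n in sequentially. bdd_rv M (D n) \<and> expectation (\<lambda>\<omega>. \<bar>D n \<omega>\<bar>) \<le> C"
  shows "tight_seq D"
  unfolding tight_seq_def
proof (intro allI impI)
  fix \<epsilon> :: real assume e: "\<epsilon> > 0"
  define L where "L = (\<bar>C\<bar> + 1) / \<epsilon>"
  have L: "L > 0" using e by (simp add: L_def)
  from assms have "\<forall>\<^sub>F n in sequentially. prob {\<omega> \<in> space M. \<bar>D n \<omega>\<bar> > L} < \<epsilon>"
  proof eventually_elim
    case (elim n)
    then have "prob {\<omega> \<in> space M. \<bar>D n \<omega>\<bar> > L} \<le> C / L"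
      using Markov_abs[of "D n" L] L divide_right_mono[of "expectation (\<lambda>\<omega>. \<bar>D n \<omega>\<bar>)" C L] by simp
    also have "C / L < \<epsilon>" using L e by (simp add: pos_divide_less_eq) (simp add: L_def)
    finally show ?case .
  qed
  then show "\<exists>L. \<forall>\<^sub>F n in sequentially. prob {\<omega> \<in> space M. \<bar>D n \<omega>\<bar> > L} < \<epsilon>" by blast
qed

lemma null_seq_L1:
  assumes "\<forall>\<^sub>F n in sequentially. bdd_rv M (R n) \<and> expectation (\<lambda>\<omega>. \<bar>R n \<omega>\<bar>) \<le> b n" "b \<longlonglongrightarrow> 0"
  shows "null_seq R"
  unfolding null_seq_def
proof (intro allI impI)
  fix \<epsilon> :: real assume e: "\<epsilon> > 0"
  show "(\<lambda>n. prob {\<omega> \<in> space M. \<bar>R n \<omega>\<bar> > \<epsilon>}) \<longlonglongrightarrow> 0"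
  proof (rule tendsto_sandwich[OF _ _ tendsto_const])
    show "\<forall>\<^sub>F n in sequentially. prob {\<omega> \<in> space M. \<bar>R n \<omega>\<bar> > \<epsilon>} \<le> b n / \<epsilon>"
      using assms(1)
    proof eventually_elim
      case (elim n)
      then show ?case using Markov_abs[of "R n" \<epsilon>] e divide_right_mono[of "expectation (\<lambda>\<omega>. \<bar>R n \<omega>\<bar>)" "b n" \<epsilon>] by simp
    qed
    show "(\<lambda>n. b n / \<epsilon>) \<longlonglongrightarrow> 0" using tendsto_divide[OF assms(2) tendsto_const, of \<epsilon>] e by simp
  qed simp
qed

lemma char_null_seq:
  fixes f g :: "nat \<Rightarrow> 'a \<Rightarrow> real"
  assumes ev_m: "\<forall>\<^sub>F n in sequentially. f n \<in> borel_measurable M" "\<forall>\<^sub>F n in sequentially. g n \<in> borel_measurable M"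
    and null: "null_seq (\<lambda>n \<omega>. f n \<omega> - g n \<omega>)"
    and lim: "(\<lambda>n. expectation (\<lambda>\<omega>. iexp (g n \<omega>))) \<longlonglongrightarrow> z"
  shows "(\<lambda>n. expectation (\<lambda>\<omega>. iexp (f n \<omega>))) \<longlonglongrightarrow> z"
proof -
  have i: "integrable M (\<lambda>\<omega>. iexp (h \<omega>))" if [measurable]: "h \<in> borel_measurable M" for h :: "'a \<Rightarrow> real"
    by (intro integrable_const_bound[where B=1]) auto
  have bound: "cmod (expectation (\<lambda>\<omega>. iexp (f n \<omega>)) - expectation (\<lambda>\<omega>. iexp (g n \<omega>))) \<le> \<epsilon> + 2 * prob {\<omega> \<in> space M. \<bar>f n \<omega> - g n \<omega>\<bar> > \<epsilon>}"
    if e: "\<epsilon> > 0" and m[measurable]: "f n \<in> borel_measurable M" "g n \<in> borel_measurable M" for n \<epsilon>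
  proof -
    let ?A = "{\<omega> \<in> space M. \<bar>f n \<omega> - g n \<omega>\<bar> > \<epsilon>}"
    have A: "?A \<in> events" by measurable
    have iA: "integrable M (\<lambda>\<omega>. \<epsilon> + 2 * indicator ?A \<omega> :: real)" using A by (auto simp: emeasure_eq_measure)
    have "cmod (expectation (\<lambda>\<omega>. iexp (f n \<omega>)) - expectation (\<lambda>\<omega>. iexp (g n \<omega>))) = cmod (expectation (\<lambda>\<omega>. iexp (f n \<omega>) - iexp (g n \<omega>)))"
      using i[OF m(1)] i[OF m(2)] by simp
    also have "\<dots> \<le> expectation (\<lambda>\<omega>. cmod (iexp (f n \<omega>) - iexp (g n \<omega>)))" by (rule integral_norm_bound)
    also have "\<dots> \<le> expectation (\<lambda>\<omega>. \<epsilon> + 2 * indicator ?A \<omega>)"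
    proof (rule integral_mono[OF _ iA])
      show "integrable M (\<lambda>\<omega>. cmod (iexp (f n \<omega>) - iexp (g n \<omega>)))" using i[OF m(1)] i[OF m(2)] by auto
      fix \<omega> assume \<omega>: "\<omega> \<in> space M"
      have "iexp (f n \<omega>) - iexp (g n \<omega>) = iexp (g n \<omega>) * (iexp (f n \<omega> - g n \<omega>) - 1)"
        by (simp add: algebra_simps exp_add[symmetric])
      then have "cmod (iexp (f n \<omega>) - iexp (g n \<omega>)) = cmod (iexp (f n \<omega> - g n \<omega>) - 1)" by (simp add: norm_mult)
      also have "\<dots> \<le> \<bar>f n \<omega> - g n \<omega>\<bar>" using iexp_approx1[of "f n \<omega> - g n \<omega>" 0] by simp
      finally have 1: "cmod (iexp (f n \<omega>) - iexp (g n \<omega>)) \<le> \<bar>f n \<omega> - g n \<omega>\<bar>" .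
      have 2: "cmod (iexp (f n \<omega>) - iexp (g n \<omega>)) \<le> 2" using norm_triangle_ineq4[of "iexp (f n \<omega>)" "iexp (g n \<omega>)"] by simp
      show "cmod (iexp (f n \<omega>) - iexp (g n \<omega>)) \<le> \<epsilon> + 2 * indicator ?A \<omega>"
      proof (cases "\<bar>f n \<omega> - g n \<omega>\<bar> > \<epsilon>")
        case True with 2 e \<omega> show ?thesis by simp
      next
        case False with 1 show ?thesis by simp
      qed
    qed
    also have "\<dots> = \<epsilon> + 2 * prob ?A" using A by (simp add: emeasure_eq_measure prob_space)
    finally show ?thesis .
  qed
  have "(\<lambda>n. expectation (\<lambda>\<omega>. iexp (f n \<omega>)) - expectation (\<lambda>\<omega>. iexp (g n \<omega>))) \<longlonglongrightarrow> 0"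
  proof (rule tendstoI)
    fix \<epsilon> :: real assume e: "\<epsilon> > 0"
    have "\<forall>\<^sub>F n in sequentially. prob {\<omega> \<in> space M. \<bar>f n \<omega> - g n \<omega>\<bar> > \<epsilon> / 2} < \<epsilon> / 4"
      using e by (intro null_seqD_less[OF null]) auto
    with ev_m show "\<forall>\<^sub>F n in sequentially. dist (expectation (\<lambda>\<omega>. iexp (f n \<omega>)) - expectation (\<lambda>\<omega>. iexp (g n \<omega>))) 0 < \<epsilon>"
    proof eventually_elim
      case (elim n) then show ?case using bound[of "\<epsilon> / 2" n, OF _ elim(1,2)] e unfolding dist_norm by simp
    qed
  qed
  from tendsto_add[OF this lim] show ?thesis by simp
qed

end

text \<open>
  The derivative of \<open>-ln f / t\<close> at \<open>(f0, t0)\<close> is a strict one: both arguments \<open>x\<close>, \<open>y\<close> may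
  vary near that point. Subtracting the linear part leaves a function \<open>h\<close> whose derivative is small
  near the point, so that the mean value inequality applies.
\<close>
lemma log_ratio_strict_derivative:
  fixes f0 t0 \<epsilon> :: real
  assumes "f0 > 0" "t0 > 0" "\<epsilon> > 0"
  obtains \<delta> where "\<delta> > 0"
    "\<And>x y. x \<in> ball (f0, t0) \<delta> \<Longrightarrow> y \<in> ball (f0, t0) \<delta> \<Longrightarrow> fst x > 0 \<and> snd x > 0 \<and>
       \<bar>(- ln (fst x) / snd x) - (- ln (fst y) / snd y) - ((- 1 / (f0 * t0)) * (fst x - fst y) + (ln f0 / t0\<^sup>2) * (snd x - snd y))\<bar> \<le> \<epsilon> * dist x y"
proof -
  define c1 where "c1 z = - 1 / (fst z * snd z)" for z :: "real \<times> real"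
  define c2 where "c2 z = ln (fst z) / (snd z)\<^sup>2" for z :: "real \<times> real"
  let ?z = "(f0, t0)"
  have "(c1 \<longlongrightarrow> c1 ?z) (at ?z)" "(c2 \<longlongrightarrow> c2 ?z) (at ?z)"
    unfolding c1_def c2_def using assms by (auto intro!: tendsto_eq_intros)
  then have "\<forall>\<^sub>F z in at ?z. dist (c1 z) (c1 ?z) < \<epsilon> / 2" "\<forall>\<^sub>F z in at ?z. dist (c2 z) (c2 ?z) < \<epsilon> / 2"
    using half_gt_zero[OF assms(3)] by (blast dest: tendstoD)+
  then obtain d1 d2 where d: "d1 > 0" "d2 > 0"
    "\<And>z. z \<noteq> ?z \<Longrightarrow> dist z ?z < d1 \<Longrightarrow> dist (c1 z) (c1 ?z) < \<epsilon> / 2"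
    "\<And>z. z \<noteq> ?z \<Longrightarrow> dist z ?z < d2 \<Longrightarrow> dist (c2 z) (c2 ?z) < \<epsilon> / 2"
    unfolding eventually_at by auto
  define \<delta> where "\<delta> = min (min d1 d2) (min f0 t0)"
  have dpos: "\<delta> > 0" using d assms by (simp add: \<delta>_def)
  have pos: "fst z > 0 \<and> snd z > 0" if "z \<in> ball ?z \<delta>" for z
  proof -
    have "dist (fst z) f0 < \<delta>" "dist (snd z) t0 < \<delta>"
      using that dist_fst_le[of z ?z] dist_snd_le[of z ?z] by (auto simp: dist_commute)
    then show ?thesis by (auto simp: \<delta>_def dist_real_def)
  qed
  have close: "\<bar>c1 z - c1 ?z\<bar> \<le> \<epsilon> / 2 \<and> \<bar>c2 z - c2 ?z\<bar> \<le> \<epsilon> / 2" if "z \<in> ball ?z \<delta>" for z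
  proof (cases "z = ?z")
    case True then show ?thesis using assms by simp
  next
    case False
    have "dist z ?z < d1" "dist z ?z < d2" using that by (simp_all add: \<delta>_def dist_commute)
    from d(3)[OF False this(1)] d(4)[OF False this(2)] show ?thesis unfolding dist_real_def by linarith
  qed
  define h where "h z = - ln (fst z) / snd z - (c1 ?z * fst z + c2 ?z * snd z)" for z
  have deriv: "(h has_derivative (\<lambda>v. (c1 z - c1 ?z) * fst v + (c2 z - c2 ?z) * snd v)) (at z within ball ?z \<delta>)"
    if z: "z \<in> ball ?z \<delta>" for z
  proof -
    have p: "fst z > 0" "snd z > 0" using pos[OF z] by auto
    have 1: "((\<lambda>z. ln (fst z)) has_derivative (\<lambda>v. fst v * inverse (fst z))) (at z within ball ?z \<delta>)"
      using has_derivative_ln[OF p(1) has_derivative_fst[OF has_derivative_ident]] by simp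
    have 2: "((\<lambda>z. c1 ?z * fst z + c2 ?z * snd z) has_derivative (\<lambda>v. c1 ?z * fst v + c2 ?z * snd v)) (at z within ball ?z \<delta>)"
      by (intro has_derivative_add has_derivative_mult_right has_derivative_fst has_derivative_snd has_derivative_ident)
    have ne: "snd z \<noteq> 0" using p by simp
    have "(h has_derivative (\<lambda>v. - (- ln (fst z)) * (inverse (snd z) * snd v * inverse (snd z)) + - (fst v * inverse (fst z)) / snd z
        - (c1 ?z * fst v + c2 ?z * snd v))) (at z within ball ?z \<delta>)"
      unfolding h_def[abs_def]
      by (rule has_derivative_diff[OF has_derivative_divide[OF has_derivative_minus[OF 1] has_derivative_snd[OF has_derivative_ident] ne] 2])
    moreover have "(\<lambda>v. - (- ln (fst z)) * (inverse (snd z) * snd v * inverse (snd z)) + - (fst v * inverse (fst z)) / snd z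
        - (c1 ?z * fst v + c2 ?z * snd v)) = (\<lambda>v. (c1 z - c1 ?z) * fst v + (c2 z - c2 ?z) * snd v)"
    proof
      fix v :: "real \<times> real"
      have "- (- ln (fst z)) * (inverse (snd z) * snd v * inverse (snd z)) = c2 z * snd v"
        by (simp add: c2_def power2_eq_square divide_inverse)
      moreover have "- (fst v * inverse (fst z)) / snd z = c1 z * fst v"
        by (simp add: c1_def divide_inverse)
      ultimately show "- (- ln (fst z)) * (inverse (snd z) * snd v * inverse (snd z)) + - (fst v * inverse (fst z)) / snd z
        - (c1 ?z * fst v + c2 ?z * snd v) = (c1 z - c1 ?z) * fst v + (c2 z - c2 ?z) * snd v"
        by (simp only: left_diff_distrib)
    qed
    ultimately show ?thesis by simp
  qed
  have lip: "norm (h x - h y) \<le> \<epsilon> * norm (x - y)" if xy: "x \<in> ball ?z \<delta>" "y \<in> ball ?z \<delta>" for x y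
  proof (rule differentiable_bound[OF convex_ball deriv _ xy])
    fix z assume z: "z \<in> ball ?z \<delta>"
    show "onorm (\<lambda>v. (c1 z - c1 ?z) * fst v + (c2 z - c2 ?z) * snd v) \<le> \<epsilon>"
    proof (rule onorm_le)
      fix v :: "real \<times> real"
      have "norm ((c1 z - c1 ?z) * fst v + (c2 z - c2 ?z) * snd v) \<le> \<bar>c1 z - c1 ?z\<bar> * \<bar>fst v\<bar> + \<bar>c2 z - c2 ?z\<bar> * \<bar>snd v\<bar>"
        using abs_triangle_ineq[of "(c1 z - c1 ?z) * fst v" "(c2 z - c2 ?z) * snd v"] by (simp add: abs_mult)
      also have "\<dots> \<le> \<epsilon> / 2 * norm v + \<epsilon> / 2 * norm v"
      proof -
        have "\<bar>fst v\<bar> \<le> norm v" "\<bar>snd v\<bar> \<le> norm v"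
          using norm_fst_le[of "fst v" "snd v"] norm_snd_le[of "snd v" "fst v"] by simp_all
        then show ?thesis
          using close[OF z] assms(3) by (intro add_mono mult_mono) simp_all
      qed
      finally show "norm ((c1 z - c1 ?z) * fst v + (c2 z - c2 ?z) * snd v) \<le> \<epsilon> * norm v" by (simp add: field_simps)
    qed
  qed
  have "\<bar>(- ln (fst x) / snd x) - (- ln (fst y) / snd y) - ((- 1 / (f0 * t0)) * (fst x - fst y) + (ln f0 / t0\<^sup>2) * (snd x - snd y))\<bar> \<le> \<epsilon> * dist x y"
    if xy: "x \<in> ball ?z \<delta>" "y \<in> ball ?z \<delta>" for x y
  proof -
    have "h x - h y = (- ln (fst x) / snd x) - (- ln (fst y) / snd y) - (c1 ?z * (fst x - fst y) + c2 ?z * (snd x - snd y))"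
      unfolding h_def right_diff_distrib by linarith
    with lip[OF xy] show ?thesis by (simp only: real_norm_def dist_norm c1_def c2_def fst_conv snd_conv)
  qed
  then show ?thesis using that[OF dpos] pos by blast
qed

text \<open>
  The centring constants \<open>a n\<close>, \<open>b n\<close> vary with \<open>n\<close>, which is why a strict derivative is needed. The estimator \<open>e\<close>
  is only constrained where both arguments are positive; this happens with
  probability tending to 1.
\<close>
lemma (in prob_space) log_ratio_delta_method:
  fixes f t :: "nat \<Rightarrow> 'a \<Rightarrow> real" and a b c :: "nat \<Rightarrow> real"
  assumes pos: "f0 > 0" "t0 > 0"
    and a: "a \<longlonglongrightarrow> f0" and b: "b \<longlonglongrightarrow> t0" and c: "filterlim c at_top sequentially"
    and m: "\<And>n. f n \<in> borel_measurable M" "\<And>n. t n \<in> borel_measurable M"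
    and tight: "tight_seq (\<lambda>n \<omega>. c n * (f n \<omega> - a n))" "tight_seq (\<lambda>n \<omega>. c n * (t n \<omega> - b n))"
    and est: "\<And>n \<omega>. f n \<omega> > 0 \<Longrightarrow> t n \<omega> > 0 \<Longrightarrow> e n \<omega> = - ln (f n \<omega>) / t n \<omega>"
  shows "null_seq (\<lambda>n \<omega>. c n * (e n \<omega> - (- ln (a n) / b n))
     - ((- 1 / (f0 * t0)) * (c n * (f n \<omega> - a n)) + (ln f0 / t0\<^sup>2) * (c n * (t n \<omega> - b n))))"
  unfolding null_seq_def
proof (intro allI impI)
  fix \<eta> :: real assume \<eta>: "\<eta> > 0"
  note [measurable] = m
  let ?R = "\<lambda>n \<omega>. c n * (e n \<omega> - (- ln (a n) / b n))
     - ((- 1 / (f0 * t0)) * (c n * (f n \<omega> - a n)) + (ln f0 / t0\<^sup>2) * (c n * (t n \<omega> - b n)))"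
  show "(\<lambda>n. prob {\<omega> \<in> space M. \<bar>?R n \<omega>\<bar> > \<eta>}) \<longlonglongrightarrow> 0"
  proof (rule tendstoI)
    fix \<gamma> :: real assume \<gamma>: "\<gamma> > 0"
    obtain L1 where L1: "\<forall>\<^sub>F n in sequentially. prob {\<omega> \<in> space M. \<bar>c n * (f n \<omega> - a n)\<bar> > L1} < \<gamma> / 2"
      using tight(1) \<gamma> unfolding tight_seq_def by (meson half_gt_zero)
    obtain L2 where L2: "\<forall>\<^sub>F n in sequentially. prob {\<omega> \<in> space M. \<bar>c n * (t n \<omega> - b n)\<bar> > L2} < \<gamma> / 2"
      using tight(2) \<gamma> unfolding tight_seq_def by (meson half_gt_zero)
    define L where "L = max 1 (max L1 L2)"
    have L: "L \<ge> 1" "L \<ge> L1" "L \<ge> L2" by (auto simp: L_def)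
    define \<epsilon> where "\<epsilon> = \<eta> / (2 * L)"
    have e: "\<epsilon> > 0" using \<eta> L by (simp add: \<epsilon>_def)
    obtain \<delta> where \<delta>: "\<delta> > 0" and strict: "\<And>x y. x \<in> ball (f0, t0) \<delta> \<Longrightarrow> y \<in> ball (f0, t0) \<delta> \<Longrightarrow> fst x > 0 \<and> snd x > 0 \<and>
       \<bar>(- ln (fst x) / snd x) - (- ln (fst y) / snd y) - ((- 1 / (f0 * t0)) * (fst x - fst y) + (ln f0 / t0\<^sup>2) * (snd x - snd y))\<bar> \<le> \<epsilon> * dist x y"
      using log_ratio_strict_derivative[OF pos e] by metis
    have "\<forall>\<^sub>F n in sequentially. c n > max 1 (4 * L / \<delta>)" by (rule spec[OF iffD1[OF filterlim_at_top_dense c]])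
    moreover have "\<forall>\<^sub>F n in sequentially. dist (a n) f0 < \<delta> / 4" by (rule tendstoD[OF a]) (use \<delta> in simp)
    moreover have "\<forall>\<^sub>F n in sequentially. dist (b n) t0 < \<delta> / 4" by (rule tendstoD[OF b]) (use \<delta> in simp)
    ultimately show "\<forall>\<^sub>F n in sequentially. dist (prob {\<omega> \<in> space M. \<bar>?R n \<omega>\<bar> > \<eta>}) 0 < \<gamma>"
      using L1 L2
    proof eventually_elim
      case (elim n)
      have c1: "c n > 0" and cL: "L / c n < \<delta> / 4"
        using elim \<delta> by (auto simp: field_simps)
      have good: "\<bar>?R n \<omega>\<bar> \<le> \<eta>" if F: "\<bar>c n * (f n \<omega> - a n)\<bar> \<le> L" and T: "\<bar>c n * (t n \<omega> - b n)\<bar> \<le> L" for \<omega>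
      proof -
        have fa: "\<bar>f n \<omega> - a n\<bar> \<le> L / c n" and tb: "\<bar>t n \<omega> - b n\<bar> \<le> L / c n"
          using F T c1 by (simp_all add: abs_mult pos_le_divide_eq mult.commute)
        have d2: "dist (x1, x2) (y1, y2) \<le> \<bar>x1 - y1\<bar> + \<bar>x2 - y2\<bar>" for x1 x2 y1 y2 :: real
          unfolding dist_Pair_Pair dist_real_def by (rule order_trans[OF sqrt_sum_squares_le_sum_abs]) simp
        let ?x = "(f n \<omega>, t n \<omega>)" and ?y = "(a n, b n)"
        have xb: "?x \<in> ball (f0, t0) \<delta>"
        proof -
          have "\<bar>f0 - f n \<omega>\<bar> < \<delta> / 2" "\<bar>t0 - t n \<omega>\<bar> < \<delta> / 2"
            using fa tb cL elim unfolding dist_real_def by linarith+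
          then show ?thesis using d2[of f0 t0 "f n \<omega>" "t n \<omega>"] by simp
        qed
        have yb: "?y \<in> ball (f0, t0) \<delta>"
          using d2[of f0 t0 "a n" "b n"] elim \<delta> by (simp add: dist_real_def abs_minus_commute)
        have s: "fst ?x > 0 \<and> snd ?x > 0 \<and>
           \<bar>(- ln (fst ?x) / snd ?x) - (- ln (fst ?y) / snd ?y) - ((- 1 / (f0 * t0)) * (fst ?x - fst ?y) + (ln f0 / t0\<^sup>2) * (snd ?x - snd ?y))\<bar> \<le> \<epsilon> * dist ?x ?y"
          by (rule strict[OF xb yb])
        have en: "e n \<omega> = - ln (f n \<omega>) / t n \<omega>" using s by (intro est) auto
        define A where "A = (- ln (f n \<omega>) / t n \<omega>) - (- ln (a n) / b n) - ((- 1 / (f0 * t0)) * (f n \<omega> - a n) + (ln f0 / t0\<^sup>2) * (t n \<omega> - b n))"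
        have "?R n \<omega> = c n * A" unfolding A_def en by (simp only: right_diff_distrib distrib_left mult.left_commute)
        then have "\<bar>?R n \<omega>\<bar> = c n * \<bar>A\<bar>" using c1 by (simp add: abs_mult)
        also have "\<dots> \<le> c n * (\<epsilon> * dist ?x ?y)" using s c1 by (intro mult_left_mono) (auto simp: A_def)
        also have "\<dots> \<le> c n * (\<epsilon> * (L / c n + L / c n))"
          using d2[of "f n \<omega>" "t n \<omega>" "a n" "b n"] fa tb e c1 by (intro mult_left_mono) auto
        also have "\<dots> = \<eta>" using c1 L by (simp add: \<epsilon>_def field_simps)
        finally show ?thesis .
      qed
      have "prob {\<omega> \<in> space M. \<bar>?R n \<omega>\<bar> > \<eta>} \<le> prob ({\<omega> \<in> space M. \<bar>c n * (f n \<omega> - a n)\<bar> > L1} \<union> {\<omega> \<in> space M. \<bar>c n * (t n \<omega> - b n)\<bar> > L2})"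
      proof (rule finite_measure_mono)
        show "{\<omega> \<in> space M. \<bar>?R n \<omega>\<bar> > \<eta>} \<subseteq> {\<omega> \<in> space M. \<bar>c n * (f n \<omega> - a n)\<bar> > L1} \<union> {\<omega> \<in> space M. \<bar>c n * (t n \<omega> - b n)\<bar> > L2}"
        proof
          fix \<omega> assume \<omega>: "\<omega> \<in> {\<omega> \<in> space M. \<bar>?R n \<omega>\<bar> > \<eta>}"
          then have "\<not> (\<bar>c n * (f n \<omega> - a n)\<bar> \<le> L \<and> \<bar>c n * (t n \<omega> - b n)\<bar> \<le> L)" using good[of \<omega>] by auto
          then have "\<bar>c n * (f n \<omega> - a n)\<bar> > L1 \<or> \<bar>c n * (t n \<omega> - b n)\<bar> > L2" using L by linarith
          then show "\<omega> \<in> {\<omega> \<in> space M. \<bar>c n * (f n \<omega> - a n)\<bar> > L1} \<union> {\<omega> \<in> space M. \<bar>c n * (t n \<omega> - b n)\<bar> > L2}" using \<omega> by auto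
        qed
      qed auto
      also have "\<dots> \<le> prob {\<omega> \<in> space M. \<bar>c n * (f n \<omega> - a n)\<bar> > L1} + prob {\<omega> \<in> space M. \<bar>c n * (t n \<omega> - b n)\<bar> > L2}"
        by (rule measure_Un_le) measurable
      finally show ?case using elim by simp
    qed
  qed
qed

section \<open>The estimators as perturbed block sums\<close>

lemma block_max_measurable:
  assumes "\<And>i. i \<ge> 1 \<Longrightarrow> X i \<in> borel_measurable M"
  shows "block_max X a b \<in> borel_measurable M"
proof (cases "{a<..b} = {}")
  case True
  then show ?thesis by (simp add: block_max_def[abs_def])
next
  case False
  show ?thesis unfolding block_max_def[abs_def]
    by (rule borel_measurable_Max) (use assms in auto)
qed

context
  fixes M :: "'a measure" and X :: "nat \<Rightarrow> 'a \<Rightarrow> real"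
  assumes X: "\<And>i. i \<ge> 1 \<Longrightarrow> X i \<in> borel_measurable M"
begin

lemma of_bool_block_max_measurable: "(\<lambda>\<omega>. of_bool (block_max X a b \<omega> \<le> v) :: real) \<in> borel_measurable M"
  using block_max_measurable[OF X, where a=a and b=b] unfolding of_bool_def by measurable

lemma F_dj_measurable: "F_dj X n r v \<in> borel_measurable M"
  unfolding F_dj_def[abs_def]
  by (intro borel_measurable_divide borel_measurable_sum of_bool_block_max_measurable borel_measurable_const)

lemma F_sl_measurable: "F_sl X n r v \<in> borel_measurable M"
  unfolding F_sl_def[abs_def]
  by (intro borel_measurable_divide borel_measurable_sum of_bool_block_max_measurable borel_measurable_const)

lemma tau_hat_measurable: "tau_hat X n r v \<in> borel_measurable M"
proof -
  have "(\<lambda>\<omega>. of_bool (v < X i \<omega>) :: real) \<in> borel_measurable M" if "i \<in> {1..r * (n div r)}" for i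
  proof -
    have [measurable]: "X i \<in> borel_measurable M" using X that by simp
    show ?thesis unfolding of_bool_def by measurable
  qed
  then show ?thesis unfolding tau_hat_def[abs_def]
    by (intro borel_measurable_divide borel_measurable_sum borel_measurable_const)
qed

lemma theta_dj_measurable: "theta_dj d X n r v \<in> borel_measurable M"
  using F_dj_measurable[of n r v] tau_hat_measurable[of n r v] unfolding theta_dj_def[abs_def] by measurable

lemma theta_sl_measurable: "theta_sl d X n r v \<in> borel_measurable M"
  using F_sl_measurable[of n r v] tau_hat_measurable[of n r v] unfolding theta_sl_def[abs_def] by measurable

end

context blocked_threshold
begin

lemma block_max_eq_Z: "a < b \<Longrightarrow> of_bool (block_max X a b \<omega> \<le> u) = Z a b \<omega>"
proof -
  assume ab: "a < b"
  have "N a b \<omega> = 0 \<longleftrightarrow> (\<forall>i\<in>{a<..b}. X i \<omega> \<le> u)"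
    unfolding N_def by (subst sum_nonneg_eq_0_iff) (auto simp: not_less)
  also have "\<dots> \<longleftrightarrow> block_max X a b \<omega> \<le> u"
    unfolding block_max_def using ab by (subst Max_le_iff) auto
  finally show ?thesis by (simp add: Z_def)
qed

lemma F_dj_eq:
  assumes "n div r = K + 1"
  shows "F_dj X n r u \<omega> = (TI \<omega> + J (K * r) \<omega>) / real (K + 1)"
proof -
  have "(\<Sum>i=1..K + 1. of_bool (block_max X ((i - 1) * r) (i * r) \<omega> \<le> u)) = (\<Sum>i<K + 1. J (i * r) \<omega>)"
  proof (rule sum.reindex_bij_witness[where i="\<lambda>i. i + 1" and j="\<lambda>i. i - 1"])
    fix i assume i: "i \<in> {1..K + 1}"
    then obtain j where j: "i = Suc j" by (cases i) auto
    show "J ((i - 1) * r) \<omega> = of_bool (block_max X ((i - 1) * r) (i * r) \<omega> \<le> u)"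
      using block_max_eq_Z[of "j * r" "j * r + r" \<omega>] r_pos by (simp add: j add.commute)
  qed auto
  then show ?thesis unfolding F_dj_def assms by (simp add: TI_def)
qed

lemma tau_hat_eq:
  assumes "n div r = K + 1"
  shows "tau_hat X n r u \<omega> = (TN \<omega> + N (K * r) (K * r + r) \<omega>) / real (K + 1)"
proof -
  have "{1..r * (K + 1)} = {0<..K * r + r}" by (auto simp: mult.commute)
  then have "(\<Sum>i=1..r * (K + 1). of_bool (u < X i \<omega>)) = N 0 (K * r + r) \<omega>" by (simp only: N_def)
  also have "\<dots> = TN \<omega> + N (K * r) (K * r + r) \<omega>" unfolding TN_def by (rule N_split) auto
  finally show ?thesis unfolding tau_hat_def assms by simp
qed

lemma F_sl_eq:
  "F_sl X n r u \<omega> = (TS \<omega> + (\<Sum>a\<in>{K * r..n - r}. J a \<omega>)) / real (n - r + 1)"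
proof -
  have "(\<Sum>i=0..n - r. of_bool (block_max X i (i + r) \<omega> \<le> u)) = (\<Sum>a\<in>{0..n - r}. J a \<omega>)"
    by (intro sum.cong refl block_max_eq_Z) (use r_pos in auto)
  also have "\<dots> = TS \<omega> + (\<Sum>a\<in>{K * r..n - r}. J a \<omega>)"
  proof -
    have "{0..n - r} = {..<K * r} \<union> {K * r..n - r}" using Kr' by auto
    moreover have "(\<Sum>a\<in>{..<K * r} \<union> {K * r..n - r}. J a \<omega>) = TS \<omega> + (\<Sum>a\<in>{K * r..n - r}. J a \<omega>)"
      unfolding TS_def by (rule sum.union_disjoint) auto
    ultimately show ?thesis by simp
  qed
  finally have eq: "(\<Sum>i=0..n - r. of_bool (block_max X i (i + r) \<omega> \<le> u)) = TS \<omega> + (\<Sum>a\<in>{K * r..n - r}. J a \<omega>)" .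
  show ?thesis unfolding F_sl_def eq ..
qed

lemma E_TI: "expectation TI = real K * Q r"
proof -
  have "expectation TI = (\<Sum>i<K. expectation (J (i * r)))"
    unfolding TI_def[abs_def] by (intro Bochner_Integration.integral_sum bdd_rv_integrable Z_bdd)
  then show ?thesis by (simp add: E_Z)
qed

lemma E_TS: "expectation TS = real (K * r) * Q r"
proof -
  have "expectation TS = (\<Sum>a<K * r. expectation (J a))"
    unfolding TS_def[abs_def] by (intro Bochner_Integration.integral_sum bdd_rv_integrable Z_bdd)
  then show ?thesis by (simp add: E_Z)
qed

lemma E_TN: "expectation TN = real (K * r) * p"
  unfolding TN_def by (simp add: E_N)

end

lemma sqrt_mult_divide:
  fixes c x :: real
  assumes "c > 0" shows "sqrt c * (x / c) = x / sqrt c"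
proof -
  define s where "s = sqrt c"
  have "c = s * s" "s \<noteq> 0" using assms by (simp_all add: s_def)
  then have "s * (x / c) = x / s" by simp
  then show ?thesis by (simp add: s_def)
qed

lemma (in prob_space) expectation_abs_centred_le:
  assumes f: "bdd_rv M f" and "expectation f = m" and c: "c > 0"
  shows "bdd_rv M (\<lambda>\<omega>. (f \<omega> - m) / c) \<and> expectation (\<lambda>\<omega>. \<bar>(f \<omega> - m) / c\<bar>) \<le> sqrt (cov M f f / c\<^sup>2)"
proof
  have d: "bdd_rv M (\<lambda>\<omega>. f \<omega> - m)" by (intro bdd_rv_diff f bdd_rv_const)
  then show "bdd_rv M (\<lambda>\<omega>. (f \<omega> - m) / c)" by (rule bdd_rv_divide)
  have "expectation (\<lambda>\<omega>. f \<omega> - m) = 0" using assms bdd_rv_integrable[OF f] by (simp add: prob_space)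
  then have "expectation (\<lambda>\<omega>. \<bar>f \<omega> - m\<bar>) \<le> sd M f"
    using expectation_abs_le_sd[OF d] sd_diff_const[OF f] by simp
  then have "expectation (\<lambda>\<omega>. \<bar>f \<omega> - m\<bar>) / c \<le> sd M f / c" using c by (intro divide_right_mono) auto
  then show "expectation (\<lambda>\<omega>. \<bar>(f \<omega> - m) / c\<bar>) \<le> sqrt (cov M f f / c\<^sup>2)"
    using c by (simp add: sd_def real_sqrt_divide)
qed

text \<open>
  The common form of the three replacements below: a factor that tends to 1 in front of the block sum,
  and a remainder from the indices after the \<open>K\<close> blocks.
\<close>
lemma (in prob_space) null_seq_perturbation:
  assumes W: "\<forall>\<^sub>F n in sequentially. bdd_rv M (W n) \<and> expectation (\<lambda>\<omega>. \<bar>W n \<omega>\<bar>) \<le> C"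
    and e: "\<forall>\<^sub>F n in sequentially. bdd_rv M (e n) \<and> expectation (\<lambda>\<omega>. \<bar>e n \<omega>\<bar>) \<le> b n"
    and c: "c \<longlonglongrightarrow> 0" and b: "b \<longlonglongrightarrow> 0"
    and R: "\<forall>\<^sub>F n in sequentially. \<forall>\<omega>\<in>space M. c n * W n \<omega> + e n \<omega> = R n \<omega>"
  shows "null_seq R"
proof (rule null_seq_cong[OF null_seq_L1 R])
  show "\<forall>\<^sub>F n in sequentially. bdd_rv M (\<lambda>\<omega>. c n * W n \<omega> + e n \<omega>) \<and> expectation (\<lambda>\<omega>. \<bar>c n * W n \<omega> + e n \<omega>\<bar>) \<le> \<bar>c n\<bar> * C + b n"
    using W e
  proof eventually_elim
    case (elim n)
    have i: "integrable M (\<lambda>\<omega>. \<bar>W n \<omega>\<bar>)" "integrable M (\<lambda>\<omega>. \<bar>e n \<omega>\<bar>)" using elim by (auto intro!: bdd_rv_integrable bdd_rv_abs)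
    have bd: "bdd_rv M (\<lambda>\<omega>. c n * W n \<omega> + e n \<omega>)" using elim by (auto intro!: bdd_rv_add bdd_rv_scale)
    have "expectation (\<lambda>\<omega>. \<bar>c n * W n \<omega> + e n \<omega>\<bar>) \<le> expectation (\<lambda>\<omega>. \<bar>c n\<bar> * \<bar>W n \<omega>\<bar> + \<bar>e n \<omega>\<bar>)"
    proof (intro integral_mono)
      show "integrable M (\<lambda>\<omega>. \<bar>c n * W n \<omega> + e n \<omega>\<bar>)" using bd by (intro bdd_rv_integrable bdd_rv_abs)
      show "integrable M (\<lambda>\<omega>. \<bar>c n\<bar> * \<bar>W n \<omega>\<bar> + \<bar>e n \<omega>\<bar>)" using i by auto
      show "\<bar>c n * W n \<omega> + e n \<omega>\<bar> \<le> \<bar>c n\<bar> * \<bar>W n \<omega>\<bar> + \<bar>e n \<omega>\<bar>" for \<omega>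
        by (rule order_trans[OF abs_triangle_ineq]) (simp add: abs_mult)
    qed
    also have "\<dots> = \<bar>c n\<bar> * expectation (\<lambda>\<omega>. \<bar>W n \<omega>\<bar>) + expectation (\<lambda>\<omega>. \<bar>e n \<omega>\<bar>)" using i by simp
    also have "\<dots> \<le> \<bar>c n\<bar> * C + b n" using elim by (intro add_mono mult_left_mono) auto
    finally show ?case using bd by simp
  qed
  have "(\<lambda>n. \<bar>c n\<bar> * C + b n) \<longlonglongrightarrow> \<bar>0\<bar> * C + 0" by (intro tendsto_intros c b)
  then show "(\<lambda>n. \<bar>c n\<bar> * C + b n) \<longlonglongrightarrow> 0" by simp
qed

context exceedance_moments
begin

definition "WI n \<omega> = (TI n \<omega> - real (K n) * Qn n (r n)) / sqrt (real (K n))"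
definition "WS n \<omega> = (TS n \<omega> - real (K n * r n) * Qn n (r n)) / (real (r n) * sqrt (real (K n)))"
definition "WN n \<omega> = (TN n \<omega> - real (K n * r n) * pn n) / sqrt (real (K n))"

abbreviation "sk n \<equiv> sqrt (real (k n))"

lemma ev_le_of_tendsto:
  assumes "f \<longlonglongrightarrow> (a::real)" shows "\<forall>\<^sub>F n in sequentially. f n \<le> a + 1"
  using order_tendstoD(2)[OF assms less_add_one] by eventually_elim simp

lemma WI_L1: "\<exists>C. \<forall>\<^sub>F n in sequentially. bdd_rv M (WI n) \<and> expectation (\<lambda>\<omega>. \<bar>WI n \<omega>\<bar>) \<le> C"
proof -
  have "(\<lambda>n. sqrt (cov M (TI n) (TI n) / real (K n))) \<longlonglongrightarrow> sqrt (F - F\<^sup>2)" by (intro tendsto_real_sqrt var_TI_lim)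
  note ev = ev_le_of_tendsto[OF this]
  have "\<forall>\<^sub>F n in sequentially. bdd_rv M (WI n) \<and> expectation (\<lambda>\<omega>. \<bar>WI n \<omega>\<bar>) \<le> sqrt (F - F\<^sup>2) + 1"
    using ev blocked ev_K_pos
  proof eventually_elim
    case (elim n)
    interpret bt: blocked_threshold M X "u n" n "l n" "r n" "K n" by (rule elim)
    show ?case using expectation_abs_centred_le[OF bt.TI_bdd bt.E_TI, of "sqrt (real (K n))"] elim
      by (auto simp: WI_def[abs_def])
  qed
  then show ?thesis by blast
qed

lemma WS_L1: "\<exists>C. \<forall>\<^sub>F n in sequentially. bdd_rv M (WS n) \<and> expectation (\<lambda>\<omega>. \<bar>WS n \<omega>\<bar>) \<le> C"
proof -
  have "(\<lambda>n. sqrt (cov M (TS n) (TS n) / (real (K n) * (real (r n))\<^sup>2))) \<longlonglongrightarrow> sqrt (2 * g)" by (intro tendsto_real_sqrt var_TS_lim)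
  note ev = ev_le_of_tendsto[OF this]
  have "\<forall>\<^sub>F n in sequentially. bdd_rv M (WS n) \<and> expectation (\<lambda>\<omega>. \<bar>WS n \<omega>\<bar>) \<le> sqrt (2 * g) + 1"
    using ev blocked ev_K_pos ev_Kr_pos
  proof eventually_elim
    case (elim n)
    interpret bt: blocked_threshold M X "u n" n "l n" "r n" "K n" by (rule elim)
    have "real (r n) * sqrt (real (K n)) > 0" using elim by (simp add: zero_less_mult_iff)
    from expectation_abs_centred_le[OF bt.TS_bdd bt.E_TS this] elim show ?case
      by (auto simp: WS_def[abs_def] power_mult_distrib mult.commute)
  qed
  then show ?thesis by blast
qed

lemma WN_L1: "\<exists>C. \<forall>\<^sub>F n in sequentially. bdd_rv M (WN n) \<and> expectation (\<lambda>\<omega>. \<bar>WN n \<omega>\<bar>) \<le> C"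
proof -
  have "(\<lambda>n. sqrt (cov M (TN n) (TN n) / real (K n))) \<longlonglongrightarrow> sqrt (\<alpha> * m2)" by (intro tendsto_real_sqrt var_TN_lim)
  note ev = ev_le_of_tendsto[OF this]
  have "\<forall>\<^sub>F n in sequentially. bdd_rv M (WN n) \<and> expectation (\<lambda>\<omega>. \<bar>WN n \<omega>\<bar>) \<le> sqrt (\<alpha> * m2) + 1"
    using ev blocked ev_K_pos ev1
  proof eventually_elim
    case (elim n)
    interpret bt: blocked_threshold M X "u n" n "l n" "r n" "K n" by (rule elim)
    show ?case using expectation_abs_centred_le[OF bt.TN_bdd bt.E_TN, of "sqrt (real (K n))"] elim
      by (auto simp: WN_def[abs_def] p_eq')
  qed
  then show ?thesis by blast
qed

lemma W_measurable:
  "\<forall>\<^sub>F n in sequentially. WI n \<in> borel_measurable M"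
  "\<forall>\<^sub>F n in sequentially. WS n \<in> borel_measurable M"
  "\<forall>\<^sub>F n in sequentially. WN n \<in> borel_measurable M"
proof -
  show "\<forall>\<^sub>F n in sequentially. WI n \<in> borel_measurable M"
    using WI_L1 by (auto elim!: eventually_mono intro: bdd_rv_measurable)
  show "\<forall>\<^sub>F n in sequentially. WS n \<in> borel_measurable M"
    using WS_L1 by (auto elim!: eventually_mono intro: bdd_rv_measurable)
  show "\<forall>\<^sub>F n in sequentially. WN n \<in> borel_measurable M"
    using WN_L1 by (auto elim!: eventually_mono intro: bdd_rv_measurable)
qed

lemma sk_at_top: "filterlim sk at_top sequentially"
  by (rule filterlim_compose[OF sqrt_at_top k_at_top])

lemma inv_sk: "(\<lambda>n. c / sk n) \<longlonglongrightarrow> 0"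
  by (rule real_tendsto_divide_at_top[OF tendsto_const sk_at_top])

lemma sqrt_ratio: "(\<lambda>n. sqrt (real (K n)) / sk n) \<longlonglongrightarrow> 1"
  using tendsto_real_sqrt[OF K_div_k] by (simp add: real_sqrt_divide)

lemma ev_sk_pos: "\<forall>\<^sub>F n in sequentially. sk n > 0"
  using ev_kK by eventually_elim simp

lemma F_dj_null: "null_seq (\<lambda>n \<omega>. sk n * (F_dj X n (r n) (u n) \<omega> - Qn n (r n)) - WI n \<omega>)"
proof -
  obtain C where C: "\<forall>\<^sub>F n in sequentially. bdd_rv M (WI n) \<and> expectation (\<lambda>\<omega>. \<bar>WI n \<omega>\<bar>) \<le> C" using WI_L1 by blast
  let ?J = "\<lambda>n. stationary_threshold.Z X (u n) (K n * r n) (K n * r n + r n)"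
  show ?thesis
  proof (rule null_seq_perturbation[OF C, where c="\<lambda>n. sqrt (real (K n)) / sk n - 1"
        and e="\<lambda>n \<omega>. (?J n \<omega> - Qn n (r n)) / sk n" and b="\<lambda>n. 1 / sk n"])
    show "(\<lambda>n. sqrt (real (K n)) / sk n - 1) \<longlonglongrightarrow> 0" using tendsto_diff[OF sqrt_ratio tendsto_const, of 1] by simp
    show "(\<lambda>n. 1 / sk n) \<longlonglongrightarrow> 0" by (rule inv_sk)
    show "\<forall>\<^sub>F n in sequentially. bdd_rv M (\<lambda>\<omega>. (?J n \<omega> - Qn n (r n)) / sk n) \<and> expectation (\<lambda>\<omega>. \<bar>(?J n \<omega> - Qn n (r n)) / sk n\<bar>) \<le> 1 / sk n"
      using blocked ev_sk_pos
    proof eventually_elim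
      case (elim n)
      interpret bt: blocked_threshold M X "u n" n "l n" "r n" "K n" by (rule elim)
      have b: "bdd_rv M (\<lambda>\<omega>. (?J n \<omega> - Qn n (r n)) / sk n)" by (intro bdd_rv_divide bdd_rv_diff bt.Z_bdd bdd_rv_const)
      have "\<bar>(?J n \<omega> - Qn n (r n)) / sk n\<bar> \<le> 1 / sk n" for \<omega>
      proof -
        have "\<bar>?J n \<omega> - Qn n (r n)\<bar> \<le> 1"
          using bt.Z_01[of "K n * r n" "K n * r n + r n" \<omega>] bt.Q_bounds[of "r n"] by (auto simp: abs_le_iff)
        then show ?thesis using elim by (simp add: divide_right_mono)
      qed
      then have "expectation (\<lambda>\<omega>. \<bar>(?J n \<omega> - Qn n (r n)) / sk n\<bar>) \<le> expectation (\<lambda>\<omega>. 1 / sk n)"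
        by (intro integral_mono bdd_rv_integrable bdd_rv_abs b bdd_rv_const)
      with b show ?case by (simp add: prob_space)
    qed
    show "\<forall>\<^sub>F n in sequentially. \<forall>\<omega>\<in>space M. (sqrt (real (K n)) / sk n - 1) * WI n \<omega> + (?J n \<omega> - Qn n (r n)) / sk n = sk n * (F_dj X n (r n) (u n) \<omega> - Qn n (r n)) - WI n \<omega>"
      using blocked ev_sk_pos ev_kK ev_K_pos
    proof eventually_elim
      case (elim n)
      interpret bt: blocked_threshold M X "u n" n "l n" "r n" "K n" by (rule elim)
      show ?case
      proof
        fix \<omega>
        define t where "t = TI n \<omega> - real (K n) * Qn n (r n)"
        have "F_dj X n (r n) (u n) \<omega> = (TI n \<omega> + ?J n \<omega>) / real (k n)"
          using bt.F_dj_eq[OF elim(3)] elim(3) by simp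
        moreover have "sk n * ((TI n \<omega> + ?J n \<omega>) / real (k n) - Qn n (r n)) = (t + (?J n \<omega> - Qn n (r n))) / sk n"
        proof -
          have "(TI n \<omega> + ?J n \<omega>) / real (k n) - Qn n (r n) = (t + (?J n \<omega> - Qn n (r n))) / real (k n)"
            using elim by (simp add: t_def field_simps)
          then show ?thesis using sqrt_mult_divide[of "real (k n)"] elim(2) by simp
        qed
        moreover have "WI n \<omega> = t / sqrt (real (K n))" by (simp add: WI_def t_def)
        moreover have "sqrt (real (K n)) / sk n * (t / sqrt (real (K n))) = t / sk n" using elim(4) by simp
        ultimately show "(sqrt (real (K n)) / sk n - 1) * WI n \<omega> + (?J n \<omega> - Qn n (r n)) / sk n = sk n * (F_dj X n (r n) (u n) \<omega> - Qn n (r n)) - WI n \<omega>"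
          by (simp only: left_diff_distrib add_divide_distrib)
      qed
    qed
  qed
qed

lemma tau_hat_null: "null_seq (\<lambda>n \<omega>. sk n * (tau_hat X n (r n) (u n) \<omega> - real (r n) * pn n) - WN n \<omega>)"
proof -
  obtain C where C: "\<forall>\<^sub>F n in sequentially. bdd_rv M (WN n) \<and> expectation (\<lambda>\<omega>. \<bar>WN n \<omega>\<bar>) \<le> C" using WN_L1 by blast
  let ?N = "\<lambda>n. stationary_threshold.N X (u n) (K n * r n) (K n * r n + r n)"
  let ?m = "\<lambda>n. real (r n) * pn n"
  show ?thesis
  proof (rule null_seq_perturbation[OF C, where c="\<lambda>n. sqrt (real (K n)) / sk n - 1"
        and e="\<lambda>n \<omega>. (?N n \<omega> - ?m n) / sk n" and b="\<lambda>n. 2 * ?m n * (1 / sk n)"])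
    show "(\<lambda>n. sqrt (real (K n)) / sk n - 1) \<longlonglongrightarrow> 0" using tendsto_diff[OF sqrt_ratio tendsto_const, of 1] by simp
    have "(\<lambda>n. 2 * ?m n * (1 / sk n)) \<longlonglongrightarrow> 2 * \<tau> * 0" by (intro tendsto_mult tendsto_const tail_lim inv_sk)
    then show "(\<lambda>n. 2 * ?m n * (1 / sk n)) \<longlonglongrightarrow> 0" by simp
    show "\<forall>\<^sub>F n in sequentially. bdd_rv M (\<lambda>\<omega>. (?N n \<omega> - ?m n) / sk n) \<and> expectation (\<lambda>\<omega>. \<bar>(?N n \<omega> - ?m n) / sk n\<bar>) \<le> 2 * ?m n * (1 / sk n)"
      using blocked ev_sk_pos ev1
    proof eventually_elim
      case (elim n)
      interpret bt: blocked_threshold M X "u n" n "l n" "r n" "K n" by (rule elim)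
      have b: "bdd_rv M (\<lambda>\<omega>. (?N n \<omega> - ?m n) / sk n)" by (intro bdd_rv_divide bdd_rv_diff bt.N_bdd bdd_rv_const)
      have m0: "?m n \<ge> 0" using p_nonneg elim by simp
      have "\<bar>(?N n \<omega> - ?m n) / sk n\<bar> \<le> (?N n \<omega> + ?m n) / sk n" for \<omega>
      proof -
        have "\<bar>?N n \<omega> - ?m n\<bar> \<le> ?N n \<omega> + ?m n"
          using bt.N_nonneg[of "K n * r n" "K n * r n + r n" \<omega>] m0 by (auto simp: abs_le_iff)
        then show ?thesis using elim by (simp add: divide_right_mono)
      qed
      then have "expectation (\<lambda>\<omega>. \<bar>(?N n \<omega> - ?m n) / sk n\<bar>) \<le> expectation (\<lambda>\<omega>. (?N n \<omega> + ?m n) / sk n)"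
        by (intro integral_mono bdd_rv_integrable bdd_rv_abs b bdd_rv_divide bdd_rv_add bt.N_bdd bdd_rv_const)
      also have "\<dots> = 2 * ?m n * (1 / sk n)"
        using bdd_rv_integrable[OF bt.N_bdd[of "K n * r n" "K n * r n + r n"]] elim(3)
        by (simp add: prob_space bt.E_N p_eq' add_divide_distrib[symmetric])
      finally show ?case using b by simp
    qed
    show "\<forall>\<^sub>F n in sequentially. \<forall>\<omega>\<in>space M. (sqrt (real (K n)) / sk n - 1) * WN n \<omega> + (?N n \<omega> - ?m n) / sk n = sk n * (tau_hat X n (r n) (u n) \<omega> - ?m n) - WN n \<omega>"
      using blocked ev_sk_pos ev_kK ev_K_pos
    proof eventually_elim
      case (elim n)
      interpret bt: blocked_threshold M X "u n" n "l n" "r n" "K n" by (rule elim)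
      show ?case
      proof
        fix \<omega>
        define t where "t = TN n \<omega> - real (K n * r n) * pn n"
        have "tau_hat X n (r n) (u n) \<omega> = (TN n \<omega> + ?N n \<omega>) / real (k n)"
          using bt.tau_hat_eq[OF elim(3)] elim(3) by simp
        moreover have "sk n * ((TN n \<omega> + ?N n \<omega>) / real (k n) - ?m n) = (t + (?N n \<omega> - ?m n)) / sk n"
        proof -
          have "(TN n \<omega> + ?N n \<omega>) / real (k n) - ?m n = (t + (?N n \<omega> - ?m n)) / real (k n)"
            using elim by (simp add: t_def field_simps)
          then show ?thesis using sqrt_mult_divide[of "real (k n)"] elim(2) by simp
        qed
        moreover have "WN n \<omega> = t / sqrt (real (K n))" by (simp add: WN_def t_def)
        moreover have "sqrt (real (K n)) / sk n * (t / sqrt (real (K n))) = t / sk n" using elim(4) by simp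
        ultimately show "(sqrt (real (K n)) / sk n - 1) * WN n \<omega> + (?N n \<omega> - ?m n) / sk n = sk n * (tau_hat X n (r n) (u n) \<omega> - ?m n) - WN n \<omega>"
          by (simp only: left_diff_distrib add_divide_distrib)
      qed
    qed
  qed
qed

text \<open>
  Fewer than \<open>2r\<close> indices lie beyond the \<open>K\<close> blocks, so at most \<open>r\<close> windows are missing. The
  number of windows is at least \<open>n/2\<close>, whence the remainder is of order \<open>1 / sqrt k\<close>.
\<close>
lemma F_sl_null: "null_seq (\<lambda>n \<omega>. sk n * (F_sl X n (r n) (u n) \<omega> - Qn n (r n)) - WS n \<omega>)"
proof -
  obtain C where C: "\<forall>\<^sub>F n in sequentially. bdd_rv M (WS n) \<and> expectation (\<lambda>\<omega>. \<bar>WS n \<omega>\<bar>) \<le> C" using WS_L1 by blast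
  let ?m = "\<lambda>n. real (n - r n + 1)"
  let ?J = "\<lambda>n a \<omega>. stationary_threshold.Z X (u n) a (a + r n) \<omega> - Qn n (r n)"
  let ?E = "\<lambda>n \<omega>. \<Sum>a\<in>{K n * r n..n - r n}. ?J n a \<omega>"
  have m_pos: "?m n > 0" for n by simp
  have mn: "(\<lambda>n. ?m n / real n) \<longlonglongrightarrow> 1"
  proof -
    have "(\<lambda>n. 1 - real (r n) / real n + 1 / real n) \<longlonglongrightarrow> 1 - 0 + 0"
      by (intro tendsto_add tendsto_diff tendsto_const rn real_tendsto_divide_at_top[OF tendsto_const filterlim_real_sequentially])
    moreover have "\<forall>\<^sub>F n in sequentially. 1 - real (r n) / real n + 1 / real n = ?m n / real n"
      using ev_rn
    proof eventually_elim
      case (elim n)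
      then have "?m n = real n - real (r n) + 1" by (simp add: of_nat_diff)
      then show ?case using elim by (simp only:) (simp add: diff_divide_distrib add_divide_distrib)
    qed
    ultimately show ?thesis by (rule tendsto_eventually_eqI) simp
  qed
  show ?thesis
  proof (rule null_seq_perturbation[OF C, where c="\<lambda>n. sk n / ?m n * (real (r n) * sqrt (real (K n))) - 1"
        and e="\<lambda>n \<omega>. sk n / ?m n * ?E n \<omega>" and b="\<lambda>n. 2 / sk n"])
    have "(\<lambda>n. (sqrt (real (K n)) / sk n) * (real (k n) * real (r n) / real n) / (?m n / real n)) \<longlonglongrightarrow> 1 * 1 / 1"
      by (intro tendsto_mult tendsto_divide sqrt_ratio rK mn) simp
    moreover have "\<forall>\<^sub>F n in sequentially. (sqrt (real (K n)) / sk n) * (real (k n) * real (r n) / real n) / (?m n / real n) = sk n / ?m n * (real (r n) * sqrt (real (K n)))"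
      using ev_sk_pos ev1
    proof eventually_elim
      case (elim n)
      have gen: "(a / s) * (c * b / m) = a * s * b / m" if "c = s * s" "s \<noteq> 0" for a b c m s :: real
        using that by simp
      have "(sqrt (real (K n)) / sk n) * (real (k n) * real (r n) / real n) = sqrt (real (K n)) * sk n * real (r n) / real n"
        by (rule gen) (use elim(1) in simp_all)
      then show ?case using elim(2) by simp
    qed
    ultimately have "(\<lambda>n. sk n / ?m n * (real (r n) * sqrt (real (K n)))) \<longlonglongrightarrow> 1" by (rule tendsto_eventually_eqI) simp
    from tendsto_diff[OF this tendsto_const, of 1] show "(\<lambda>n. sk n / ?m n * (real (r n) * sqrt (real (K n))) - 1) \<longlonglongrightarrow> 0" by simp
    show "(\<lambda>n. 2 / sk n) \<longlonglongrightarrow> 0" by (rule inv_sk)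
    show "\<forall>\<^sub>F n in sequentially. bdd_rv M (\<lambda>\<omega>. sk n / ?m n * ?E n \<omega>) \<and> expectation (\<lambda>\<omega>. \<bar>sk n / ?m n * ?E n \<omega>\<bar>) \<le> 2 / sk n"
      using blocked ev_sk_pos ev_kK ev_rn
    proof eventually_elim
      case (elim n)
      interpret bt: blocked_threshold M X "u n" n "l n" "r n" "K n" by (rule elim)
      have b: "bdd_rv M (\<lambda>\<omega>. sk n / ?m n * ?E n \<omega>)" by (intro bdd_rv_scale bdd_rv_sum bdd_rv_diff bt.Z_bdd bdd_rv_const)
      have n_lt: "n < (K n + 2) * r n"
      proof -
        have "n < k n * r n + r n" using bt.r_pos by (metis add.commute dividend_less_div_times Suc_le_eq One_nat_def)
        then show ?thesis using elim(3) by simp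
      qed
      have card: "card {K n * r n..n - r n} \<le> r n" using n_lt by simp
      have "\<bar>?E n \<omega>\<bar> \<le> real (r n)" for \<omega>
      proof -
        have "\<bar>?J n a \<omega>\<bar> \<le> 1" for a
          using bt.Z_01[of a "a + r n" \<omega>] bt.Q_bounds[of "r n"] by (auto simp: abs_le_iff)
        then have "\<bar>?E n \<omega>\<bar> \<le> (\<Sum>a\<in>{K n * r n..n - r n}. 1)" by (intro order_trans[OF sum_abs] sum_mono)
        also have "\<dots> = real (card {K n * r n..n - r n})" by simp
        also have "\<dots> \<le> real (r n)" using card by (rule of_nat_mono)
        finally show ?thesis .
      qed
      then have "\<bar>sk n / ?m n * ?E n \<omega>\<bar> \<le> sk n / ?m n * real (r n)" for \<omega>
        unfolding abs_mult using elim(2) by (intro mult_mono) auto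
      also have "sk n / ?m n * real (r n) \<le> 2 / sk n"
      proof -
        have "k n * r n \<le> n" by simp
        then have "real (k n) * real (r n) \<le> real n" by (metis of_nat_le_iff of_nat_mult)
        also have "real n \<le> 2 * ?m n" using elim(4) by simp
        finally have "real (k n) * real (r n) / ?m n \<le> 2" using m_pos[of n] by (simp only: pos_divide_le_eq)
        then have "real (k n) * real (r n) / ?m n / sk n \<le> 2 / sk n" using elim(2) by (intro divide_right_mono) auto
        moreover have "real (k n) * real (r n) / ?m n / sk n = sk n / ?m n * real (r n)"
        proof -
          have gen: "c * b / m / s = s / m * b" if "c = s * s" "s \<noteq> 0" for b c m s :: real
            using that by simp
          show ?thesis by (rule gen) (use elim(2) in simp_all)
        qed
        ultimately show ?thesis by simp
      qed
      finally have "\<bar>sk n / ?m n * ?E n \<omega>\<bar> \<le> 2 / sk n" for \<omega> .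
      then have "expectation (\<lambda>\<omega>. \<bar>sk n / ?m n * ?E n \<omega>\<bar>) \<le> expectation (\<lambda>\<omega>. 2 / sk n)"
        by (intro integral_mono bdd_rv_integrable bdd_rv_abs b bdd_rv_const)
      with b show ?case by (simp add: prob_space)
    qed
    show "\<forall>\<^sub>F n in sequentially. \<forall>\<omega>\<in>space M. (sk n / ?m n * (real (r n) * sqrt (real (K n))) - 1) * WS n \<omega> + sk n / ?m n * ?E n \<omega> = sk n * (F_sl X n (r n) (u n) \<omega> - Qn n (r n)) - WS n \<omega>"
      using blocked ev_Kr_pos
    proof eventually_elim
      case (elim n)
      interpret bt: blocked_threshold M X "u n" n "l n" "r n" "K n" by (rule elim)
      show ?case
      proof
        fix \<omega>
        define t where "t = TS n \<omega> - real (K n * r n) * Qn n (r n)"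
        let ?Z = "\<Sum>a\<in>{K n * r n..n - r n}. stationary_threshold.Z X (u n) a (a + r n) \<omega>"
        have card: "real (K n * r n) + real (card {K n * r n..n - r n}) = ?m n"
          using bt.Kr' by (simp add: of_nat_diff)
        have E: "?E n \<omega> = ?Z - real (card {K n * r n..n - r n}) * Qn n (r n)" by (simp add: sum_subtractf)
        have "F_sl X n (r n) (u n) \<omega> - Qn n (r n) = (TS n \<omega> + ?Z - ?m n * Qn n (r n)) / ?m n"
          unfolding bt.F_sl_eq using m_pos[of n] by (simp only: diff_divide_distrib nonzero_mult_div_cancel_left[OF less_imp_neq[OF m_pos, symmetric]])
        also have "TS n \<omega> + ?Z - ?m n * Qn n (r n) = t + ?E n \<omega>"
          unfolding E t_def card[symmetric] by (simp only: distrib_right)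
        finally have Fs: "sk n * (F_sl X n (r n) (u n) \<omega> - Qn n (r n)) = sk n / ?m n * t + sk n / ?m n * ?E n \<omega>"
          by (simp only: times_divide_eq_left times_divide_eq_right distrib_left add_divide_distrib)
        have "real (r n) * sqrt (real (K n)) \<noteq> 0" using elim(2) by (auto simp: zero_less_mult_iff)
        then have "real (r n) * sqrt (real (K n)) * WS n \<omega> = t" by (simp add: WS_def t_def)
        then have "sk n / ?m n * (real (r n) * sqrt (real (K n))) * WS n \<omega> = sk n / ?m n * t" by (simp only: mult.assoc)
        then show "(sk n / ?m n * (real (r n) * sqrt (real (K n))) - 1) * WS n \<omega> + sk n / ?m n * ?E n \<omega> = sk n * (F_sl X n (r n) (u n) \<omega> - Qn n (r n)) - WS n \<omega>"
          unfolding Fs left_diff_distrib by simp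
      qed
    qed
  qed
qed

end

section \<open>The limit law of the estimators\<close>

lemma asymp_cov_shear:
  "asymp_cov \<theta> \<alpha> c2 = vector [vector [d + w, w], vector [w, w]]"
  if "w = 2 * (\<theta>\<^sup>2 / \<alpha> ^ 3) * (exp \<alpha> - 1 - \<alpha> - \<alpha>\<^sup>2 / 2) + \<theta>\<^sup>2 * c2 / \<alpha>"
    "d = \<theta>\<^sup>2 / \<alpha>\<^sup>2 * (exp \<alpha> - 1 - \<alpha>) + \<theta>\<^sup>2 * c2 / \<alpha> - w"
  unfolding asymp_cov_def Let_def that(2) by (simp add: that(1))

lemma exp_gt_quadratic:
  fixes \<alpha> :: real assumes "\<alpha> > 0" shows "exp \<alpha> - 1 - \<alpha> - \<alpha>\<^sup>2 / 2 > 0"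
proof -
  have "(\<lambda>x. exp x - 1 - x - x\<^sup>2 / 2) 0 < (\<lambda>x. exp x - 1 - x - x\<^sup>2 / 2) \<alpha>"
  proof (rule DERIV_pos_imp_increasing_open[OF assms])
    fix x :: real assume x: "0 < x" "x < \<alpha>"
    have "((\<lambda>x. exp x - 1 - x - x\<^sup>2 / 2) has_real_derivative exp x - 1 - x) (at x)"
      by (auto intro!: derivative_eq_intros)
    moreover have "exp x - 1 - x > 0" using exp_lower_Taylor_quadratic[of x] x by (smt (verit) half_gt_zero zero_less_power)
    ultimately show "\<exists>y. ((\<lambda>x. exp x - 1 - x - x\<^sup>2 / 2) has_real_derivative y) (at x) \<and> 0 < y" by blast
  qed (auto intro!: continuous_intros)
  then show ?thesis by simp
qed

text \<open>
  The left-hand side and its derivative vanish at 0, and the second derivative \<open>\<alpha> exp \<alpha>\<close> is positive.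
\<close>
lemma asymp_var_gap_pos:
  fixes \<alpha> :: real assumes "\<alpha> > 0" shows "(\<alpha> - 2) * exp \<alpha> + \<alpha> + 2 > 0"
proof -
  have 1: "(x - 1) * exp x + 1 > 0" if x: "x > 0" for x :: real
  proof -
    have "(\<lambda>x. (x - 1) * exp x + 1) 0 < (\<lambda>x. (x - 1) * exp x + 1) x"
    proof (rule DERIV_pos_imp_increasing_open[OF x])
      fix y :: real assume y: "0 < y" "y < x"
      have "((\<lambda>x. (x - 1) * exp x + 1) has_real_derivative y * exp y) (at y)"
        by (auto intro!: derivative_eq_intros simp: algebra_simps)
      then show "\<exists>z. ((\<lambda>x. (x - 1) * exp x + 1) has_real_derivative z) (at y) \<and> 0 < z" using y by (intro exI[of _ "y * exp y"]) simp
    qed (intro continuous_intros)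
    then show ?thesis by simp
  qed
  have "(\<lambda>x. (x - 2) * exp x + x + 2) 0 < (\<lambda>x. (x - 2) * exp x + x + 2) \<alpha>"
  proof (rule DERIV_pos_imp_increasing_open[OF assms])
    fix y :: real assume y: "0 < y" "y < \<alpha>"
    have "((\<lambda>x. (x - 2) * exp x + x + 2) has_real_derivative (y - 1) * exp y + 1) (at y)"
      by (auto intro!: derivative_eq_intros simp: algebra_simps)
    then show "\<exists>z. ((\<lambda>x. (x - 2) * exp x + x + 2) has_real_derivative z) (at y) \<and> 0 < z" using 1[OF y(1)] by blast
  qed (intro continuous_intros)
  then show ?thesis by simp
qed

lemma asymp_cov_pos:
  fixes \<theta> \<alpha> c :: real
  assumes "\<theta> > 0" "\<alpha> > 0" "c \<ge> 0"
  defines "w \<equiv> 2 * (\<theta>\<^sup>2 / \<alpha> ^ 3) * (exp \<alpha> - 1 - \<alpha> - \<alpha>\<^sup>2 / 2) + \<theta>\<^sup>2 * c / \<alpha>"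
  shows "w > 0" "\<theta>\<^sup>2 / \<alpha>\<^sup>2 * (exp \<alpha> - 1 - \<alpha>) + \<theta>\<^sup>2 * c / \<alpha> - w > 0"
proof -
  have "2 * (\<theta>\<^sup>2 / \<alpha> ^ 3) * (exp \<alpha> - 1 - \<alpha> - \<alpha>\<^sup>2 / 2) > 0"
    using assms exp_gt_quadratic[OF assms(2)] by (intro mult_pos_pos) auto
  moreover have "\<theta>\<^sup>2 * c / \<alpha> \<ge> 0" using assms by simp
  ultimately show "w > 0" unfolding w_def by linarith
  have "\<theta>\<^sup>2 / \<alpha>\<^sup>2 * (E - 1 - \<alpha>) - 2 * (\<theta>\<^sup>2 / \<alpha> ^ 3) * (E - 1 - \<alpha> - \<alpha>\<^sup>2 / 2) = \<theta>\<^sup>2 / \<alpha> ^ 3 * ((\<alpha> - 2) * E + \<alpha> + 2)" for E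
    using assms(2) by (simp add: field_simps power2_eq_square power3_eq_cube)
  from this[of "exp \<alpha>"] have "\<theta>\<^sup>2 / \<alpha>\<^sup>2 * (exp \<alpha> - 1 - \<alpha>) - 2 * (\<theta>\<^sup>2 / \<alpha> ^ 3) * (exp \<alpha> - 1 - \<alpha> - \<alpha>\<^sup>2 / 2) > 0"
    using assms asymp_var_gap_pos[OF assms(2)] by simp
  then show "\<theta>\<^sup>2 / \<alpha>\<^sup>2 * (exp \<alpha> - 1 - \<alpha>) + \<theta>\<^sup>2 * c / \<alpha> - w > 0" unfolding w_def by simp
qed

text \<open>
  The variance of the linearized estimators as a quadratic form. Here \<open>E\<close> stands for \<open>exp \<alpha>\<close>, \<open>m\<close> for the second moment
  of the cluster sizes, and \<open>A\<close>, \<open>B\<close>, \<open>C\<close> are the coefficients that the delta method produces from \<open>t1\<close> and \<open>t2\<close>. All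
  terms are brought to the denominator \<open>\<tau>\<^sup>2\<close>. Apart from a multiple of \<open>t1\<^sup>2\<close>, only \<open>(t1 + t2)\<^sup>2\<close> occurs,
  because the covariance of the disjoint with the sliding part equals the variance of the latter.
\<close>
lemma asymp_variance_algebra:
  fixes E \<alpha> \<theta> \<tau> c m t1 t2 :: real
  assumes pos: "E > 0" "\<theta> > 0" "\<tau> > 0" and \<alpha>: "\<alpha> = \<tau> * \<theta>" and m: "c = \<theta>\<^sup>2 * m - 1"
  defines "w \<equiv> 2 * (\<theta>\<^sup>2 / \<alpha> ^ 3) * (E - 1 - \<alpha> - \<alpha>\<^sup>2 / 2) + \<theta>\<^sup>2 * c / \<alpha>"
    and "v \<equiv> \<theta>\<^sup>2 / \<alpha>\<^sup>2 * (E - 1 - \<alpha>) + \<theta>\<^sup>2 * c / \<alpha>"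
    and "g \<equiv> (1 / E) * (1 - 1 / E) / \<alpha> - (1 / E)\<^sup>2"
    and "A \<equiv> - (t1 * E / \<tau>)" and "B \<equiv> - (t2 * E / \<tau>)" and "C \<equiv> - ((t1 + t2) * \<alpha> / \<tau>\<^sup>2)"
  shows "A\<^sup>2 * (1 / E - (1 / E)\<^sup>2) + B\<^sup>2 * (2 * g) + C\<^sup>2 * (\<alpha> * m) + 2 * A * B * (2 * g)
      + 2 * A * C * (- (1 / E * \<tau>)) + 2 * B * C * (- (1 / E * \<tau>)) = (v - w) * t1\<^sup>2 + w * (t1 + t2)\<^sup>2"
proof -
  have a0: "\<alpha> > 0" using pos \<alpha> by simp
  define G where "G = 2 * ((E - 1) / \<alpha> - 1)"
  have 1: "A\<^sup>2 * (1 / E - (1 / E)\<^sup>2) = t1\<^sup>2 * (E - 1) / \<tau>\<^sup>2"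
    using pos by (simp add: A_def power2_eq_square field_simps)
  have Eg: "E\<^sup>2 * (2 * g) = G" using pos a0 by (simp add: g_def G_def power2_eq_square field_simps)
  have 2: "B\<^sup>2 * (2 * g) + 2 * A * B * (2 * g) = (t2\<^sup>2 + 2 * t1 * t2) * G / \<tau>\<^sup>2"
    unfolding Eg[symmetric] by (simp add: A_def B_def power2_eq_square add_divide_distrib algebra_simps)
  have 3: "C\<^sup>2 * (\<alpha> * m) = (t1 + t2)\<^sup>2 * (\<alpha> * (c + 1)) / \<tau>\<^sup>2"
  proof -
    have "C\<^sup>2 * (\<alpha> * m) = (t1 + t2)\<^sup>2 * (\<alpha> * ((\<alpha> / \<tau>)\<^sup>2 * m)) / \<tau>\<^sup>2"
      using pos by (simp add: C_def power2_eq_square field_simps)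
    also have "\<alpha> / \<tau> = \<theta>" using pos \<alpha> by simp
    also have "\<theta>\<^sup>2 * m = c + 1" using m by simp
    finally show ?thesis .
  qed
  have 4: "2 * A * C * (- (1 / E * \<tau>)) + 2 * B * C * (- (1 / E * \<tau>)) = - (2 * (t1 + t2)\<^sup>2 * \<alpha>) / \<tau>\<^sup>2"
  proof -
    have "2 * A * C * (- (1 / E * \<tau>)) + 2 * B * C * (- (1 / E * \<tau>)) = - (2 * ((A + B) * (1 / E * \<tau>)) * C)"
      by (simp add: algebra_simps add_divide_distrib)
    also have "(A + B) * (1 / E * \<tau>) = - (t1 + t2)" using pos by (simp add: A_def B_def field_simps)
    also have "- (2 * - (t1 + t2) * C) = - (2 * (t1 + t2)\<^sup>2 * \<alpha>) / \<tau>\<^sup>2"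
    proof -
      have "- (2 * - x * - (x * \<alpha> / \<tau>\<^sup>2)) = - (2 * x\<^sup>2 * \<alpha>) / \<tau>\<^sup>2" for x by (simp add: power2_eq_square)
      then show ?thesis unfolding C_def .
    qed
    finally show ?thesis .
  qed
  have w: "w = (G - \<alpha> + \<alpha> * c) / \<tau>\<^sup>2" and v: "v = (E - 1 - \<alpha> + \<alpha> * c) / \<tau>\<^sup>2"
  proof -
    have t2: "\<theta>\<^sup>2 = \<alpha>\<^sup>2 / \<tau>\<^sup>2" using pos \<alpha> by (simp add: power_mult_distrib)
    show "w = (G - \<alpha> + \<alpha> * c) / \<tau>\<^sup>2" unfolding w_def t2 G_def using a0 pos(3)
      by (simp add: field_simps power2_eq_square power3_eq_cube)
    show "v = (E - 1 - \<alpha> + \<alpha> * c) / \<tau>\<^sup>2" unfolding v_def t2 using a0 pos(3)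
      by (simp add: field_simps power2_eq_square)
  qed
  have "A\<^sup>2 * (1 / E - (1 / E)\<^sup>2) + B\<^sup>2 * (2 * g) + C\<^sup>2 * (\<alpha> * m) + 2 * A * B * (2 * g)
      + 2 * A * C * (- (1 / E * \<tau>)) + 2 * B * C * (- (1 / E * \<tau>))
    = t1\<^sup>2 * (E - 1) / \<tau>\<^sup>2 + (t2\<^sup>2 + 2 * t1 * t2) * G / \<tau>\<^sup>2 + (t1 + t2)\<^sup>2 * (\<alpha> * (c + 1)) / \<tau>\<^sup>2 + - (2 * (t1 + t2)\<^sup>2 * \<alpha>) / \<tau>\<^sup>2"
    using 1 2 3 4 by linarith
  also have "\<dots> = (t1\<^sup>2 * (E - 1) + (t2\<^sup>2 + 2 * t1 * t2) * G + (t1 + t2)\<^sup>2 * (\<alpha> * (c + 1)) + - (2 * (t1 + t2)\<^sup>2 * \<alpha>)) / \<tau>\<^sup>2"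
    by (simp only: add_divide_distrib)
  also have "t1\<^sup>2 * (E - 1) + (t2\<^sup>2 + 2 * t1 * t2) * G + (t1 + t2)\<^sup>2 * (\<alpha> * (c + 1)) + - (2 * (t1 + t2)\<^sup>2 * \<alpha>)
    = ((E - 1 - \<alpha> + \<alpha> * c) - (G - \<alpha> + \<alpha> * c)) * t1\<^sup>2 + (G - \<alpha> + \<alpha> * c) * (t1 + t2)\<^sup>2"
    by (simp add: power2_eq_square algebra_simps)
  also have "\<dots> / \<tau>\<^sup>2 = (v - w) * t1\<^sup>2 + w * (t1 + t2)\<^sup>2"
  proof -
    have "(x * y + x' * y') / z = x / z * y + x' / z * y'" for x y x' y' z :: real
      by (simp add: add_divide_distrib)
    then show ?thesis unfolding v w diff_divide_distrib[symmetric] .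
  qed
  finally show ?thesis .
qed

context exceedance_moments
begin

text \<open>
  The partial derivatives of \<open>-ln f / t\<close> at \<open>f = F\<close> and \<open>t = \<tau>\<close>.
\<close>
definition "coef_F = - 1 / (F * \<tau>)"
definition "coef_tau = ln F / \<tau>\<^sup>2"

lemma W_tight:
  assumes W: "\<exists>C. \<forall>\<^sub>F n in sequentially. bdd_rv M (W n) \<and> expectation (\<lambda>\<omega>. \<bar>W n \<omega>\<bar>) \<le> C"
    and f: "\<And>n. f n \<in> borel_measurable M" and null: "null_seq (\<lambda>n \<omega>. f n \<omega> - W n \<omega>)"
  shows "tight_seq f"
proof -
  obtain C where C: "\<forall>\<^sub>F n in sequentially. bdd_rv M (W n) \<and> expectation (\<lambda>\<omega>. \<bar>W n \<omega>\<bar>) \<le> C" using W by blast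
  have m: "\<forall>\<^sub>F n in sequentially. W n \<in> borel_measurable M"
    using C by eventually_elim (auto dest: bdd_rv_measurable)
  have "tight_seq (\<lambda>n \<omega>. W n \<omega> + (f n \<omega> - W n \<omega>))"
    by (rule tight_seqD_null[OF m _ tight_seq_L1[OF C] null])
       (use m in eventually_elim, use f in measurable)
  then show ?thesis by simp
qed

text \<open>
  The delta method centres at \<open>\<theta>\<^sub>r\<close>, the value of \<open>-ln f / t\<close> at the exact probability and mean.
  The rate that is assumed for \<open>\<theta>\<^sub>r - \<theta>\<close> is what allows centring at \<open>\<theta>\<close> instead.
\<close>
lemma estimator_linearization:
  fixes f e :: "nat \<Rightarrow> 'a \<Rightarrow> real"
  assumes f: "\<And>n. f n \<in> borel_measurable M" and em: "\<And>n. e n \<in> borel_measurable M"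
    and W: "\<exists>C. \<forall>\<^sub>F n in sequentially. bdd_rv M (W n) \<and> expectation (\<lambda>\<omega>. \<bar>W n \<omega>\<bar>) \<le> C"
    and null: "null_seq (\<lambda>n \<omega>. sk n * (f n \<omega> - Qn n (r n)) - W n \<omega>)"
    and est: "\<And>n \<omega>. f n \<omega> > 0 \<Longrightarrow> tau_hat X n (r n) (u n) \<omega> > 0 \<Longrightarrow> e n \<omega> = - ln (f n \<omega>) / tau_hat X n (r n) (u n) \<omega>"
  shows "null_seq (\<lambda>n \<omega>. sk n * (e n \<omega> - \<theta>) - (coef_F * W n \<omega> + coef_tau * WN n \<omega>))"
proof -
  let ?t = "\<lambda>n. tau_hat X n (r n) (u n)"
  let ?m = "\<lambda>n. real (r n) * pn n"
  let ?h = "\<lambda>n. - ln (Qn n (r n)) / ?m n"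
  have tm: "\<And>n. ?t n \<in> borel_measurable M" by (rule tau_hat_measurable[OF X_meas])
  have Wm: "\<forall>\<^sub>F n in sequentially. W n \<in> borel_measurable M"
    using W by (auto elim!: eventually_mono dest: bdd_rv_measurable)
  note WNm = W_measurable(3)
  have tf: "tight_seq (\<lambda>n \<omega>. sk n * (f n \<omega> - Qn n (r n)))"
    by (rule W_tight[OF W _ null]) (use f in measurable)
  have tt: "tight_seq (\<lambda>n \<omega>. sk n * (?t n \<omega> - ?m n))"
    by (rule W_tight[OF WN_L1 _ tau_hat_null]) (use tm in measurable)
  have D: "null_seq (\<lambda>n \<omega>. sk n * (e n \<omega> - ?h n) - (coef_F * (sk n * (f n \<omega> - Qn n (r n))) + coef_tau * (sk n * (?t n \<omega> - ?m n))))"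
    unfolding coef_F_def coef_tau_def
    by (rule log_ratio_delta_method[OF _ \<tau> Qr_lim tail_lim sk_at_top f tm tf tt]) (simp, rule est)
  have hc: "null_seq (\<lambda>n \<omega>. sk n * (?h n - \<theta>))"
  proof (rule null_seq_const)
    have "\<forall>\<^sub>F n in sequentially. (theta_block M X (r n) (u n) - \<theta>) / (1 / sk n) = sk n * (?h n - \<theta>)"
      using ev1
    proof eventually_elim
      case (elim n)
      then have "cdf_max M X (r n) (u n) = Qn n (r n)" using pos(1)[of n] by (intro cdf_max_eq) auto
      then show ?case by (simp add: theta_block_def tau_block_def mult.commute)
    qed
    from tendsto_eventually_eqI[OF theta_lim this refl] show "(\<lambda>n. sk n * (?h n - \<theta>)) \<longlonglongrightarrow> 0" .
  qed
  have m1: "\<forall>\<^sub>F n in sequentially. (\<lambda>\<omega>. sk n * (e n \<omega> - ?h n) - (coef_F * (sk n * (f n \<omega> - Qn n (r n))) + coef_tau * (sk n * (?t n \<omega> - ?m n)))) \<in> borel_measurable M"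
    by (intro always_eventually allI) (use em f tm in measurable)
  have m2: "\<forall>\<^sub>F n in sequentially. (\<lambda>\<omega>. coef_F * (sk n * (f n \<omega> - Qn n (r n)) - W n \<omega>)) \<in> borel_measurable M"
    using Wm by eventually_elim (use f in measurable)
  have m3: "\<forall>\<^sub>F n in sequentially. (\<lambda>\<omega>. coef_tau * (sk n * (?t n \<omega> - ?m n) - WN n \<omega>)) \<in> borel_measurable M"
    using WNm by eventually_elim (use tm in measurable)
  have m4: "\<forall>\<^sub>F n in sequentially. (\<lambda>\<omega>. sk n * (?h n - \<theta>)) \<in> borel_measurable M" by simp
  have m23: "\<forall>\<^sub>F n in sequentially. (\<lambda>\<omega>. coef_F * (sk n * (f n \<omega> - Qn n (r n)) - W n \<omega>) + coef_tau * (sk n * (?t n \<omega> - ?m n) - WN n \<omega>)) \<in> borel_measurable M"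
    using m2 m3 by eventually_elim (rule borel_measurable_add)
  have m14: "\<forall>\<^sub>F n in sequentially. (\<lambda>\<omega>. (sk n * (e n \<omega> - ?h n) - (coef_F * (sk n * (f n \<omega> - Qn n (r n))) + coef_tau * (sk n * (?t n \<omega> - ?m n)))) + sk n * (?h n - \<theta>)) \<in> borel_measurable M"
    using m1 m4 by eventually_elim (rule borel_measurable_add)
  have "null_seq (\<lambda>n \<omega>. ((sk n * (e n \<omega> - ?h n) - (coef_F * (sk n * (f n \<omega> - Qn n (r n))) + coef_tau * (sk n * (?t n \<omega> - ?m n)))) + sk n * (?h n - \<theta>))
     + (coef_F * (sk n * (f n \<omega> - Qn n (r n)) - W n \<omega>) + coef_tau * (sk n * (?t n \<omega> - ?m n) - WN n \<omega>)))"
    by (intro null_seq_add[OF m14 m23] null_seq_add[OF m1 m4] null_seq_add[OF m2 m3] D hc null_seq_scale null tau_hat_null)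
  then show ?thesis
  proof (rule null_seq_cong, intro always_eventually allI ballI)
    fix n \<omega>
    show "((sk n * (e n \<omega> - ?h n) - (coef_F * (sk n * (f n \<omega> - Qn n (r n))) + coef_tau * (sk n * (?t n \<omega> - ?m n)))) + sk n * (?h n - \<theta>))
     + (coef_F * (sk n * (f n \<omega> - Qn n (r n)) - W n \<omega>) + coef_tau * (sk n * (?t n \<omega> - ?m n) - WN n \<omega>)) = sk n * (e n \<omega> - \<theta>) - (coef_F * W n \<omega> + coef_tau * WN n \<omega>)"
      unfolding right_diff_distrib by linarith
  qed
qed

lemma dj_linearization: "null_seq (\<lambda>n \<omega>. sk n * (theta_dj d X n (r n) (u n) \<omega> - \<theta>) - (coef_F * WI n \<omega> + coef_tau * WN n \<omega>))"
  by (rule estimator_linearization[OF F_dj_measurable[OF X_meas] theta_dj_measurable[OF X_meas] WI_L1 F_dj_null])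
     (auto simp: theta_dj_def)

lemma sl_linearization: "null_seq (\<lambda>n \<omega>. sk n * (theta_sl d X n (r n) (u n) \<omega> - \<theta>) - (coef_F * WS n \<omega> + coef_tau * WN n \<omega>))"
  by (rule estimator_linearization[OF F_sl_measurable[OF X_meas] theta_sl_measurable[OF X_meas] WS_L1 F_sl_null])
     (auto simp: theta_sl_def)

lemma linear_combination_clt:
  "(\<lambda>n. \<integral>\<omega>. iexp (A * WI n \<omega> + B * WS n \<omega> + C * WN n \<omega>) \<partial>M) \<longlonglongrightarrow> exp (- \<sigma>2 A B C / 2)"
proof -
  have "\<forall>\<^sub>F n in sequentially. (\<integral>\<omega>. iexp (1 / sqrt (K n) * (\<Sum>i<K n. Ub n A B C i \<omega>)) \<partial>M) = (\<integral>\<omega>. iexp (A * WI n \<omega> + B * WS n \<omega> + C * WN n \<omega>) \<partial>M)"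
    using blocked ev1
  proof eventually_elim
    case (elim n)
    interpret bt: blocked_threshold M X "u n" n "l n" "r n" "K n" by (rule elim)
    have "1 / sqrt (K n) * (\<Sum>i<K n. Ub n A B C i \<omega>) = A * WI n \<omega> + B * WS n \<omega> + C * WN n \<omega>" for \<omega>
      unfolding bt.sum_U WI_def WS_def WN_def p_eq'[OF elim(2)]
      by (simp add: add_divide_distrib distrib_left)
    then show ?case by simp
  qed
  from tendsto_eventually_eqI[OF block_clt this refl] show ?thesis .
qed

lemma L1_bounded_combination:
  assumes V: "\<exists>C. \<forall>\<^sub>F n in sequentially. bdd_rv M (V n) \<and> expectation (\<lambda>\<omega>. \<bar>V n \<omega>\<bar>) \<le> C"
    and W: "\<exists>C. \<forall>\<^sub>F n in sequentially. bdd_rv M (W n) \<and> expectation (\<lambda>\<omega>. \<bar>W n \<omega>\<bar>) \<le> C"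
  shows "\<exists>C. \<forall>\<^sub>F n in sequentially. bdd_rv M (\<lambda>\<omega>. a * V n \<omega> + b * W n \<omega>) \<and> expectation (\<lambda>\<omega>. \<bar>a * V n \<omega> + b * W n \<omega>\<bar>) \<le> C"
proof -
  obtain C D where C: "\<forall>\<^sub>F n in sequentially. bdd_rv M (V n) \<and> expectation (\<lambda>\<omega>. \<bar>V n \<omega>\<bar>) \<le> C"
    and D: "\<forall>\<^sub>F n in sequentially. bdd_rv M (W n) \<and> expectation (\<lambda>\<omega>. \<bar>W n \<omega>\<bar>) \<le> D" using V W by blast
  from C D have "\<forall>\<^sub>F n in sequentially. bdd_rv M (\<lambda>\<omega>. a * V n \<omega> + b * W n \<omega>) \<and> expectation (\<lambda>\<omega>. \<bar>a * V n \<omega> + b * W n \<omega>\<bar>) \<le> \<bar>a\<bar> * C + \<bar>b\<bar> * D"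
  proof eventually_elim
    case (elim n)
    have i: "integrable M (\<lambda>\<omega>. \<bar>V n \<omega>\<bar>)" "integrable M (\<lambda>\<omega>. \<bar>W n \<omega>\<bar>)" using elim by (auto intro!: bdd_rv_integrable bdd_rv_abs)
    have bd: "bdd_rv M (\<lambda>\<omega>. a * V n \<omega> + b * W n \<omega>)" using elim by (auto intro!: bdd_rv_add bdd_rv_scale)
    have "expectation (\<lambda>\<omega>. \<bar>a * V n \<omega> + b * W n \<omega>\<bar>) \<le> expectation (\<lambda>\<omega>. \<bar>a\<bar> * \<bar>V n \<omega>\<bar> + \<bar>b\<bar> * \<bar>W n \<omega>\<bar>)"
    proof (intro integral_mono)
      show "integrable M (\<lambda>\<omega>. \<bar>a * V n \<omega> + b * W n \<omega>\<bar>)" using bd by (intro bdd_rv_integrable bdd_rv_abs)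
      show "integrable M (\<lambda>\<omega>. \<bar>a\<bar> * \<bar>V n \<omega>\<bar> + \<bar>b\<bar> * \<bar>W n \<omega>\<bar>)" using i by auto
      show "\<bar>a * V n \<omega> + b * W n \<omega>\<bar> \<le> \<bar>a\<bar> * \<bar>V n \<omega>\<bar> + \<bar>b\<bar> * \<bar>W n \<omega>\<bar>" for \<omega>
        by (rule order_trans[OF abs_triangle_ineq]) (simp add: abs_mult)
    qed
    also have "\<dots> = \<bar>a\<bar> * expectation (\<lambda>\<omega>. \<bar>V n \<omega>\<bar>) + \<bar>b\<bar> * expectation (\<lambda>\<omega>. \<bar>W n \<omega>\<bar>)" using i by simp
    also have "\<dots> \<le> \<bar>a\<bar> * C + \<bar>b\<bar> * D" using elim by (intro add_mono mult_left_mono) auto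
    finally show ?case using bd by simp
  qed
  then show ?thesis by blast
qed

text \<open>
  The joint characteristic function of the two estimators is, up to null sequences, that of a linear
  combination of the three block sums. Its limit is recognized through the shear.
\<close>
theorem estimators_converge:
  "converges_in_distribution M
     (\<lambda>n \<omega>. sk n *\<^sub>R (vector [theta_dj d_dj X n (r n) (u n) \<omega> - \<theta>, theta_sl d_sl X n (r n) (u n) \<omega> - \<theta>] :: real ^ 2))
     (multi_normal 0 (asymp_cov \<theta> (\<tau> * \<theta>) c2))"
proof -
  define w where "w = 2 * (\<theta>\<^sup>2 / \<alpha> ^ 3) * (exp \<alpha> - 1 - \<alpha> - \<alpha>\<^sup>2 / 2) + \<theta>\<^sup>2 * c2 / \<alpha>"
  define d where "d = \<theta>\<^sup>2 / \<alpha>\<^sup>2 * (exp \<alpha> - 1 - \<alpha>) + \<theta>\<^sup>2 * c2 / \<alpha> - w"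
  have w0: "w > 0" and d0: "d > 0"
    using asymp_cov_pos[OF \<theta> alpha_pos c2_nonneg] unfolding d_def w_def by simp_all
  have cov: "asymp_cov \<theta> (\<tau> * \<theta>) c2 = vector [vector [d + w, w], vector [w, w]]"
    unfolding \<alpha>_def[symmetric] by (rule asymp_cov_shear[OF w_def d_def])
  define Y1 where "Y1 n \<omega> = sk n * (theta_dj d_dj X n (r n) (u n) \<omega> - \<theta>)" for n \<omega>
  define Y2 where "Y2 n \<omega> = sk n * (theta_sl d_sl X n (r n) (u n) \<omega> - \<theta>)" for n \<omega>
  have Y1m[measurable]: "Y1 n \<in> borel_measurable M" for n
    unfolding Y1_def[abs_def] using theta_dj_measurable[OF X_meas, where d = d_dj and n = n and r = "r n" and v = "u n"] by measurable
  have Y2m[measurable]: "Y2 n \<in> borel_measurable M" for n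
    unfolding Y2_def[abs_def] using theta_sl_measurable[OF X_meas, where d = d_sl and n = n and r = "r n" and v = "u n"] by measurable
  have Y: "(\<lambda>n \<omega>. sk n *\<^sub>R (vector [theta_dj d_dj X n (r n) (u n) \<omega> - \<theta>, theta_sl d_sl X n (r n) (u n) \<omega> - \<theta>] :: real ^ 2))
    = (\<lambda>n \<omega>. vector [Y1 n \<omega>, Y2 n \<omega>])"
    by (intro ext) (simp add: vec_eq_iff forall_2 Y1_def Y2_def)
  have L1: "null_seq (\<lambda>n \<omega>. Y1 n \<omega> - (coef_F * WI n \<omega> + coef_tau * WN n \<omega>))"
    unfolding Y1_def by (rule dj_linearization)
  have L2: "null_seq (\<lambda>n \<omega>. Y2 n \<omega> - (coef_F * WS n \<omega> + coef_tau * WN n \<omega>))"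
    unfolding Y2_def by (rule sl_linearization)
  have T1: "tight_seq Y1" by (rule W_tight[OF L1_bounded_combination[OF WI_L1 WN_L1] Y1m L1])
  have T2: "tight_seq Y2" by (rule W_tight[OF L1_bounded_combination[OF WS_L1 WN_L1] Y2m L2])
  show ?thesis unfolding Y cov
  proof (rule converges_in_distribution_charI[OF prob_space_axioms prob_space_multi_normal_shear[OF d0 w0]])
    show "sets (multi_normal 0 (vector [vector [d + w, w], vector [w, w]] :: real ^ 2 ^ 2)) = sets borel"
      by (simp add: multi_normal_def)
    show "(\<lambda>\<omega>. vector [Y1 n \<omega>, Y2 n \<omega>] :: real ^ 2) \<in> borel_measurable M" for n
      by (rule measurable_vector_2) (rule Y1m Y2m)+
  next
    fix \<epsilon> :: real assume e: "\<epsilon> > 0"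
    obtain A where A: "\<forall>\<^sub>F n in sequentially. prob {\<omega> \<in> space M. \<bar>Y1 n \<omega>\<bar> > A} < \<epsilon> / 2"
      using T1 e unfolding tight_seq_def by (meson half_gt_zero)
    obtain B where B: "\<forall>\<^sub>F n in sequentially. prob {\<omega> \<in> space M. \<bar>Y2 n \<omega>\<bar> > B} < \<epsilon> / 2"
      using T2 e unfolding tight_seq_def by (meson half_gt_zero)
    have "\<forall>\<^sub>F n in sequentially. prob {\<omega> \<in> space M. norm (vector [Y1 n \<omega>, Y2 n \<omega>] :: real ^ 2) > A + B} < \<epsilon>"
      using A B
    proof eventually_elim
      case (elim n)
      have nv: "norm (vector [a, b] :: real ^ 2) \<le> \<bar>a\<bar> + \<bar>b\<bar>" for a b :: real
        using norm_le_l1_cart[of "vector [a, b] :: real ^ 2"] by (simp add: sum_2)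
      have "prob {\<omega> \<in> space M. norm (vector [Y1 n \<omega>, Y2 n \<omega>] :: real ^ 2) > A + B} \<le> prob ({\<omega> \<in> space M. \<bar>Y1 n \<omega>\<bar> > A} \<union> {\<omega> \<in> space M. \<bar>Y2 n \<omega>\<bar> > B})"
      proof (rule finite_measure_mono)
        show "{\<omega> \<in> space M. norm (vector [Y1 n \<omega>, Y2 n \<omega>] :: real ^ 2) > A + B} \<subseteq> {\<omega> \<in> space M. \<bar>Y1 n \<omega>\<bar> > A} \<union> {\<omega> \<in> space M. \<bar>Y2 n \<omega>\<bar> > B}"
        proof
          fix \<omega> assume \<omega>: "\<omega> \<in> {\<omega> \<in> space M. norm (vector [Y1 n \<omega>, Y2 n \<omega>] :: real ^ 2) > A + B}"
          then have "\<bar>Y1 n \<omega>\<bar> > A \<or> \<bar>Y2 n \<omega>\<bar> > B" using nv[of "Y1 n \<omega>" "Y2 n \<omega>"] by auto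
          then show "\<omega> \<in> {\<omega> \<in> space M. \<bar>Y1 n \<omega>\<bar> > A} \<union> {\<omega> \<in> space M. \<bar>Y2 n \<omega>\<bar> > B}" using \<omega> by auto
        qed
      qed measurable
      also have "\<dots> \<le> prob {\<omega> \<in> space M. \<bar>Y1 n \<omega>\<bar> > A} + prob {\<omega> \<in> space M. \<bar>Y2 n \<omega>\<bar> > B}"
        by (rule measure_Un_le) measurable
      finally show ?case using elim by simp
    qed
    then show "\<exists>L. \<forall>\<^sub>F n in sequentially. prob {\<omega> \<in> space M. norm (vector [Y1 n \<omega>, Y2 n \<omega>] :: real ^ 2) > L} < \<epsilon>" by blast
  next
    fix t :: "real ^ 2"
    define A where "A = t $ 1 * coef_F"
    define B where "B = t $ 2 * coef_F"
    define C where "C = (t $ 1 + t $ 2) * coef_tau"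
    have inner: "t \<bullet> vector [Y1 n \<omega>, Y2 n \<omega>] = t $ 1 * Y1 n \<omega> + t $ 2 * Y2 n \<omega>" for n \<omega>
      by (simp add: inner_2)
    have s2: "\<sigma>2 A B C = d * (t $ 1)\<^sup>2 + w * (t $ 1 + t $ 2)\<^sup>2"
    proof -
      have E: "exp (- \<alpha>) = 1 / exp \<alpha>" by (simp add: exp_minus inverse_eq_divide)
      have "coef_F = - (exp \<alpha> / \<tau>)" by (simp add: coef_F_def E)
      then have AB: "A = - (t $ 1 * exp \<alpha> / \<tau>)" "B = - (t $ 2 * exp \<alpha> / \<tau>)" by (simp_all add: A_def B_def)
      have Cc: "C = - ((t $ 1 + t $ 2) * \<alpha> / \<tau>\<^sup>2)" by (simp add: C_def coef_tau_def)
      show ?thesis unfolding \<sigma>2_def AB Cc g_def E d_def w_def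
        by (rule asymp_variance_algebra[OF exp_gt_zero \<theta> \<tau> \<alpha>_def c2_eq])
    qed
    have m1: "\<forall>\<^sub>F n in sequentially. (\<lambda>\<omega>. t $ 1 * (Y1 n \<omega> - (coef_F * WI n \<omega> + coef_tau * WN n \<omega>))) \<in> borel_measurable M"
      using W_measurable(1,3) by eventually_elim (intro borel_measurable_times borel_measurable_add borel_measurable_diff borel_measurable_const Y1m Y2m; assumption)
    have m2: "\<forall>\<^sub>F n in sequentially. (\<lambda>\<omega>. t $ 2 * (Y2 n \<omega> - (coef_F * WS n \<omega> + coef_tau * WN n \<omega>))) \<in> borel_measurable M"
      using W_measurable(2,3) by eventually_elim (intro borel_measurable_times borel_measurable_add borel_measurable_diff borel_measurable_const Y1m Y2m; assumption)
    have "null_seq (\<lambda>n \<omega>. t $ 1 * (Y1 n \<omega> - (coef_F * WI n \<omega> + coef_tau * WN n \<omega>)) + t $ 2 * (Y2 n \<omega> - (coef_F * WS n \<omega> + coef_tau * WN n \<omega>)))"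
      by (intro null_seq_add[OF m1 m2] null_seq_scale L1 L2)
    then have null: "null_seq (\<lambda>n \<omega>. (t $ 1 * Y1 n \<omega> + t $ 2 * Y2 n \<omega>) - (A * WI n \<omega> + B * WS n \<omega> + C * WN n \<omega>))"
      by (rule null_seq_cong) (auto simp: A_def B_def C_def algebra_simps)
    have "(\<lambda>n. expectation (\<lambda>\<omega>. iexp (t $ 1 * Y1 n \<omega> + t $ 2 * Y2 n \<omega>))) \<longlonglongrightarrow> exp (- \<sigma>2 A B C / 2)"
    proof (rule char_null_seq[OF _ _ null linear_combination_clt])
      show "\<forall>\<^sub>F n in sequentially. (\<lambda>\<omega>. t $ 1 * Y1 n \<omega> + t $ 2 * Y2 n \<omega>) \<in> borel_measurable M" by simp
      show "\<forall>\<^sub>F n in sequentially. (\<lambda>\<omega>. A * WI n \<omega> + B * WS n \<omega> + C * WN n \<omega>) \<in> borel_measurable M"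
        using W_measurable by eventually_elim (intro borel_measurable_times borel_measurable_add borel_measurable_diff borel_measurable_const Y1m Y2m; assumption)
    qed
    then show "(\<lambda>n. expectation (\<lambda>\<omega>. iexp (t \<bullet> vector [Y1 n \<omega>, Y2 n \<omega>]))) \<longlonglongrightarrow>
      (\<integral>x. iexp (t \<bullet> x) \<partial>multi_normal 0 (vector [vector [d + w, w], vector [w, w]] :: real ^ 2 ^ 2))"
      unfolding inner char_multi_normal_shear[OF d0 w0] s2 .
  qed
qed

end

theorem corollary4p3:
  fixes M :: "'a measure" and X :: "nat \<Rightarrow> 'a \<Rightarrow> real" and \<theta> \<tau> p d_dj d_sl :: real
    and u :: "nat \<Rightarrow> real" and r l s :: "nat \<Rightarrow> nat" and \<pi> :: "nat pmf"
  assumes "prob_space M"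
    and "\<And>i. i \<ge> 1 \<Longrightarrow> X i \<in> borel_measurable M"
    and "strictly_stationary M X"
    and "has_extremal_index M X \<theta>"
    and "\<tau> > 0" and "(\<lambda>m. real m * tail M X (u m)) \<longlonglongrightarrow> \<tau>"
    and "\<And>n. n \<ge> 1 \<Longrightarrow> r n > 0" and "\<And>n. n \<ge> 1 \<Longrightarrow> l n > 0"
    and "(\<lambda>n. real (l n)) \<in> o(\<lambda>n. real (r n))"
    and "(\<lambda>n. real (r n)) \<in> o(\<lambda>n. real n)"
    and "(\<lambda>n. \<Sum>j=l n..n. max_corr M X n j (u (r n))) \<in> o(\<lambda>n. real (r n))"
    and "(\<lambda>n. \<Sum>j=1..n. max_corr M X n j (u (r n))) \<in> o(\<lambda>n. real (r n) powr (1/2))"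
    and "\<And>n. n \<ge> 1 \<Longrightarrow> s n > 0"
    and "set_pmf \<pi> \<subseteq> {1..}"
    and "(\<lambda>n. real (l n)) \<in> o(\<lambda>n. real (s n))"
    and "(\<lambda>n. real (s n)) \<in> o(\<lambda>n. real (r n))"
    and "(\<lambda>n. max_corr M X n (l n) (u (r n))) \<in> o(\<lambda>n. real (s n) / real n)"
    and "\<And>j. j \<ge> 1 \<Longrightarrow>
           (\<lambda>n. \<P>(\<omega> in M. exceedances X (s n) (u (r n)) \<omega> = j \<bar> block_max X 0 (s n) \<omega> > u (r n)))
             \<longlonglongrightarrow> pmf \<pi> j"
    and "(\<lambda>j. real j ^ 2 * pmf \<pi> j) summable_on {1..}"
    and "(\<lambda>n. cond_expect M (\<lambda>\<omega>. real (exceedances X (s n) (u (r n)) \<omega>) ^ 2)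
                 (\<lambda>\<omega>. block_max X 0 (s n) \<omega> > u (r n)))
           \<longlonglongrightarrow> (\<Sum>\<^sub>\<infinity>j\<in>{1..}. real j ^ 2 * pmf \<pi> j)"
    and "p > 1"
    and "(\<lambda>n. \<integral>\<omega>. real (exceedances X (r n) (u (r n)) \<omega>) powr (2 * p) \<partial>M) \<in> O(\<lambda>_. 1)"
    and "(\<lambda>n. theta_block M X (r n) (u (r n)) - \<theta>) \<in> o(\<lambda>n. 1 / sqrt (real (n div r n)))"
  shows "converges_in_distribution M
           (\<lambda>n \<omega>. sqrt (real (n div r n)) *\<^sub>R
              (vector [theta_dj d_dj X n (r n) (u (r n)) \<omega> - \<theta>,
                       theta_sl d_sl X n (r n) (u (r n)) \<omega> - \<theta>] :: real ^ 2))
           (multi_normal 0 (asymp_cov \<theta> (\<tau> * \<theta>) (sq_coeff_var \<pi>)))"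
proof -
  note a = assms
  interpret prob_space M by fact
  have lr: "(\<lambda>n. real (l n) / real (r n)) \<longlonglongrightarrow> 0" by (rule smalloD_tendsto[OF a(9)])
  have r: "filterlim r at_top sequentially" by (rule dominating_at_top[OF a(8) lr a(7)])
  obtain Cm where Cm: "\<forall>\<^sub>F n in sequentially. (\<integral>\<omega>. real (exceedances X (r n) (u (r n)) \<omega>) powr (2 * p) \<partial>M) \<le> Cm"
  proof -
    obtain c where "\<forall>\<^sub>F n in sequentially. norm (\<integral>\<omega>. real (exceedances X (r n) (u (r n)) \<omega>) powr (2 * p) \<partial>M) \<le> c * norm (1::real)"
      using a(22) by (elim landau_o.bigE)
    then have "\<forall>\<^sub>F n in sequentially. (\<integral>\<omega>. real (exceedances X (r n) (u (r n)) \<omega>) powr (2 * p) \<partial>M) \<le> c"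
      by eventually_elim simp
    then show ?thesis by (rule that)
  qed
  interpret exceedance_moments M X "\<lambda>n. u (r n)" r l s \<theta> \<tau> \<pi> p Cm
  proof unfold_locales
    show "(\<lambda>n. real (r n) * tail M X (u (r n))) \<longlonglongrightarrow> \<tau>"
      by (rule filterlim_compose[OF a(6) r])
    show "(\<lambda>n. (theta_block M X (r n) (u (r n)) - \<theta>) / (1 / sqrt (real (n div r n)))) \<longlonglongrightarrow> 0"
      by (rule smalloD_tendsto[OF a(23)])
    show "\<theta> > 0" using a(4) by (simp add: has_extremal_index_def)
  qed (use a Cm smalloD_tendsto[OF a(15)] smalloD_tendsto[OF a(16)] smalloD_tendsto[OF a(10)] smalloD_tendsto[OF a(17)] in auto)
  show ?thesis by (rule estimators_converge)
qed

end
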